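(* Let $\mathbb{D}=\mathbb{D}(I;\mathbb{R}^d)$ be endowed with a regular topology that is weaker than Jakubowski's $S$-topology and stronger than the Meyer-Zheng topology. Let $\mathcal{Q}$ be a family of quasimartingale measures on $\mathbb{D}$ satisfying the condition $$\text{(UB)}\qquad \sup_{Q\in\mathcal{Q}}\sup_{t\in I}\Big(E_Q[|X_t|]+\sup_{H\in\mathcal{E}(Q)}E_Q[(H\bullet X)_t]\Big)<\infty.$$ Then the sequential closure $[\mathcal{Q}]_{seq}$ of $\mathcal{Q}$ in the weak${}^*$ topology is a weak${}^*$ compact and sequentially weak${}^*$ compact set of quasimartingale measures.
   Context: Canonical space. $I$ is $[0,T]$ with $0<T\le\infty$, or $I=[0,\infty)$; $d\in\mathbb{N}$; $T:=\sup I$. $\mathbb{D}(I;\mathbb{R}^d)$ is the set of c\`adl\`ag functions $\omega=(\omega^1,\dots,\omega^d):I\to\mathbb{R}^d$; $\mathbb{D}([0,\infty];\mathbb{R}^d)$ is regarded as the product $\mathbb{D}([0,\infty);\mathbb{R}^d)\times\mathbb{R}^d$ (and topologies on it as product topologies with the Euclidean topology on $\mathbb{R}^d$). $X$ is the canonical process, $X_t(\omega)=\omega(t)$, with coordinates $X^i$. $|x|=|x_1|+\dots+|x_d|$ on $\mathbb{R}^d$. $\mathcal{F}^o_t=\sigma(X_s:s\le t)$, $\mathcal{F}_t=\bigcap_{\varepsilon>0}\mathcal{F}^o_{t+\varepsilon}$ is its right-continuous version, and $\mathcal{F}_T=\bigvee_{t\in I}\mathcal{F}^o_t$. A probability measure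 $Q$ on $(\mathbb{D},\mathcal{F}_T)$ is a quasimartingale measure (i.e. $X$ is an $(\mathcal{F}_t)_{t\in I}$-quasimartingale under $Q$) if and only if the singleton family $\{Q\}$ satisfies (UB). Elementary integrands. $\mathcal{E}(Q)$ is the family of $H=(H^1,\dots,H^d)$ with $H^i=H^i_0\mathbf{1}_{\{0\}}+\sum_{k=1}^n H^i_{t^i_{k-1}}\mathbf{1}_{(t^i_{k-1},t^i_k]}$, where $n\in\mathbb{N}$, $0=t^i_0\le t^i_1\le\dots\le t^i_n$ in $I$, and each $H^i_{t^i_k}$ is an $\mathcal{F}_{t^i_k}$-measurable random variable in $L^\infty(Q)$ with $|H^i_{t^i_k}|\le 1$. $(H\bullet X)_t=\sum_{i=1}^d\big(H^i_0X^i_0+\sum_{k=1}^n H^i_{t^i_{k-1}}(X^i_{t^i_k\wedge t}-X^i_{t^i_{k-1}\wedge t})\big)$. Topologies. "Weaker"/"stronger" are meant in the wide sense (equality allowed); regular means Hausdorff and $T_3$. $S$-topology: on $\mathbb{D}([0,T];\mathbb{R}^d)$, $T<\infty$, write $\omega_n\to_S\omega_0$ if for every $i\le d$ and $\varepsilon>0$ there are functions $(\nu_n^{i,\varepsilon})_{n\ge 0}$ of finite variation on $[0,T]$ with $\|\omega_n^i-\nu_n^{i,\varepsilon}\|_\infty\le\varepsilon$ for all $n\ge0$ and $\nu_n^{i,\varepsilon}\to\nu_0^{i,\varepsilon}$ in the weak${}^*$ topology obtained by identifying finite-variation functions on $[0,T]$ with the Banach dual of $C([0,T])$. On $\mathbb{D}([0,\infty);\mathbb{R}^d)$,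 write $\omega_n\to_S\omega_0$ if for every $i\le d$ there are positive reals $T^r\uparrow\infty$ such that the restrictions of $\omega^i_n$ to $[0,T^r]$ $S$-converge to the restriction of $\omega_0^i$ for every $r$. The $S$-topology is the sequential topology generated by subsequential $S$-convergence: a set is closed iff it contains the limit $\omega_0$ of every sequence of its elements such that each subsequence has a further subsequence $S$-converging to $\omega_0$. Meyer-Zheng topology: the topology of the convergence $\int_I f(t,\omega_n^i(t))e^{-t}dt\to\int_I f(t,\omega^i(t))e^{-t}dt$ for all bounded continuous $f$ on $I\times\mathbb{R}$ and all $i\le d$, together with $\omega_n(T)\to\omega(T)$ if $I=[0,T]$. Measures. When $\mathbb{D}$ is endowed with a regular topology that is weaker than the $S$-topology and stronger than the Meyer-Zheng topology, the Borel $\sigma$-algebra of $\mathbb{D}$ equals $\mathcal{F}_T$. $\mathbb{M}(\mathbb{D})$ is the space of countably additive (signed) Borel measures of finite total variation, $\mathbb{P}(\mathbb{D})$ the subset of probability measures. The weak${}^*$ topology on $\mathbb{M}(\mathbb{D})$ is generated by the seminorms $\mu\mapsto|\int f\,d\mu|$, $f$ bounded continuous on $\mathbb{D}$. The sequential closure $[Z]_{seq}$ of $Z$ is the set of all limits of weak${}^*$ convergent sequences of elements of $Z$. Sequentially compact: every sequence in the set has a subsequence converging to an element of the set. *)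

theory Defs
  imports "HOL-Probability.Probability"
begin

text \<open>
  Time is a set of extended reals, so that \<open>[0,T]\<close> with \<open>T < \<infinity>\<close>, \<open>[0,\<infinity>]\<close> and \<open>[0,\<infinity>)\<close> are
  treated uniformly. Paths are functions on \<open>I\<close>, \<open>undefined\<close> outside \<open>I\<close>.
\<close>

type_synonym 'd path = "ereal \<Rightarrow> real ^ 'd"

definition time_domain :: "ereal set \<Rightarrow> bool" where
  "time_domain I \<longleftrightarrow> (\<exists>T>0. I = {0..T}) \<or> I = {0..<\<infinity>}"

text \<open>
  No condition is imposed at \<open>t = \<infinity>\<close>: the space over \<open>[0,\<infinity>]\<close> is the product of the space over
  \<open>[0,\<infinity>)\<close> with \<open>\<real>\<^sup>d\<close>. At the end points of \<open>I\<close> one of the two filters is trivial.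
\<close>

definition skorokhod_space :: "ereal set \<Rightarrow> ('d::finite) path set" where
  "skorokhod_space I = {\<omega> \<in> extensional I. \<forall>t\<in>I. t < \<infinity> \<longrightarrow>
     (\<omega> \<longlongrightarrow> \<omega> t) (at t within (I \<inter> {t<..})) \<and>
     (\<exists>l. (\<omega> \<longlongrightarrow> l) (at t within (I \<inter> {..<t})))}"

definition l1norm :: "real ^ ('d::finite) \<Rightarrow> real" where
  "l1norm x = (\<Sum>i\<in>UNIV. \<bar>x $ i\<bar>)"

definition raw_filtration :: "ereal set \<Rightarrow> ereal \<Rightarrow> ('d::finite) path measure" where
  "raw_filtration I t = sigma (skorokhod_space I)
     {{\<omega> \<in> skorokhod_space I. \<omega> s \<in> A} | s A. s \<in> I \<and> s \<le> t \<and> A \<in> sets borel}"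

definition right_filtration :: "ereal set \<Rightarrow> ereal \<Rightarrow> ('d::finite) path measure" where
  "right_filtration I t = sigma (skorokhod_space I)
     (\<Inter>\<epsilon>\<in>{0<..}. sets (raw_filtration I (t + ereal \<epsilon>)))"

definition path_algebra :: "ereal set \<Rightarrow> ('d::finite) path measure" where
  "path_algebra I = sigma (skorokhod_space I) (\<Union>t\<in>I. sets (raw_filtration I t))"

text \<open>
  An elementary integrand is given by the number \<open>n\<close> of steps, the grid points \<open>\<tau> i k\<close>, and the
  random variables \<open>H i s\<close>, of which only those with \<open>s\<close> in the grid matter.
\<close>

type_synonym 'd integrand = "nat \<times> ('d \<Rightarrow> nat \<Rightarrow> ereal) \<times> ('d \<Rightarrow> ereal \<Rightarrow> 'd path \<Rightarrow> real)"

definition elementary_integrands ::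
    "ereal set \<Rightarrow> ('d::finite) path measure \<Rightarrow> 'd integrand set" where
  "elementary_integrands I Q = {(n, \<tau>, H). \<forall>i.
     \<tau> i 0 = 0 \<and> (\<forall>k<n. \<tau> i k \<le> \<tau> i (Suc k)) \<and> (\<forall>k\<le>n. \<tau> i k \<in> I) \<and>
     (\<forall>k\<le>n. H i (\<tau> i k) \<in> borel_measurable (right_filtration I (\<tau> i k)) \<and>
            (AE \<omega> in Q. \<bar>H i (\<tau> i k) \<omega>\<bar> \<le> 1))}"

fun elementary_integral :: "('d::finite) integrand \<Rightarrow> ereal \<Rightarrow> 'd path \<Rightarrow> real" where
  "elementary_integral (n, \<tau>, H) t \<omega> =
     (\<Sum>i\<in>UNIV. H i 0 \<omega> * \<omega> 0 $ i +
        (\<Sum>k=1..n. H i (\<tau> i (k - 1)) \<omega> *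
           (\<omega> (min (\<tau> i k) t) $ i - \<omega> (min (\<tau> i (k - 1)) t) $ i)))"

text \<open>
  If some \<open>E\<^sub>Q |X\<^sub>t|\<close> is infinite then the supremum is infinite because of the first summand;
  otherwise all elementary integrals are integrable and their Bochner integrals are the expectations.
\<close>

definition UB :: "ereal set \<Rightarrow> ('d::finite) path measure set \<Rightarrow> bool" where
  "UB I \<Q> \<longleftrightarrow> (SUP Q\<in>\<Q>. SUP t\<in>I.
      enn2ereal (\<integral>\<^sup>+\<omega>. ennreal (l1norm (\<omega> t)) \<partial>Q) +
      (SUP H\<in>elementary_integrands I Q. ereal (\<integral>\<omega>. elementary_integral H t \<omega> \<partial>Q))) < \<infinity>"

text \<open>
  The convention for quasimartingales under which \<open>sup\<^sub>t E\<^sub>Q |X\<^sub>t|\<close> is finite for every \<open>I\<close>: the canonical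
  process is a quasimartingale under \<open>Q\<close> iff the singleton family \<open>{Q}\<close> satisfies \<open>(UB)\<close>.
\<close>

definition quasimartingale_measure :: "ereal set \<Rightarrow> ('d::finite) path measure \<Rightarrow> bool" where
  "quasimartingale_measure I Q \<longleftrightarrow>
     prob_space Q \<and> sets Q = sets (path_algebra I) \<and> UB I {Q}"

text \<open>
  A signed measure is a real-valued set function, extended by \<open>0\<close> outside the \<open>\<sigma>\<close>-algebra of \<open>B\<close>
  (as \<^const>\<open>measure\<close> is); only the \<open>\<sigma>\<close>-algebra of \<open>B\<close> is relevant.
\<close>

definition signed_measures :: "'a measure \<Rightarrow> ('a set \<Rightarrow> real) set" where
  "signed_measures B = {\<mu>.
     (\<forall>A. A \<notin> sets B \<longrightarrow> \<mu> A = 0) \<and>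
     (\<forall>A::nat \<Rightarrow> 'a set. range A \<subseteq> sets B \<longrightarrow> disjoint_family A \<longrightarrow>
        (\<lambda>n. \<mu> (A n)) sums \<mu> (\<Union>n. A n)) \<and>
     bdd_above {(\<Sum>A\<in>P. \<bar>\<mu> A\<bar>) | P. finite P \<and> P \<subseteq> sets B \<and> disjoint P}}"

text \<open>
  The positive part of the Jordan decomposition, \<open>\<mu>\<^sup>+(A) = sup {\<mu>(C) | C \<subseteq> A}\<close>; \<^const>\<open>ennreal\<close> maps
  negative numbers to \<open>0\<close>. The negative part is the positive part of \<open>-\<mu>\<close>.
\<close>

definition positive_part :: "'a measure \<Rightarrow> ('a set \<Rightarrow> real) \<Rightarrow> 'a measure" where
  "positive_part B \<mu> = measure_of (space B) (sets B)
     (\<lambda>A. SUP C\<in>{C \<in> sets B. C \<subseteq> A}. ennreal (\<mu> C))"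

definition signed_integral :: "'a measure \<Rightarrow> ('a set \<Rightarrow> real) \<Rightarrow> ('a \<Rightarrow> real) \<Rightarrow> real" where
  "signed_integral B \<mu> f =
     (\<integral>x. f x \<partial>positive_part B \<mu>) - (\<integral>x. f x \<partial>positive_part B (\<lambda>A. - \<mu> A))"

definition borel_algebra :: "'a topology \<Rightarrow> 'a measure" where
  "borel_algebra X = sigma (topspace X) {U. openin X U}"

definition weak_star :: "'a topology \<Rightarrow> ('a set \<Rightarrow> real) topology" where
  "weak_star X = (let B = borel_algebra X; M = signed_measures B in
     topology_generated_by
       {{\<nu> \<in> M. \<bar>signed_integral B \<nu> f - signed_integral B \<mu> f\<bar> < e} | \<mu> f e.
          \<mu> \<in> M \<and> continuous_map X euclideanreal f \<and> bounded (f ` topspace X) \<and> 0 < e})"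

definition sequential_closure :: "'a topology \<Rightarrow> 'a set \<Rightarrow> 'a set" where
  "sequential_closure X Z = {x. \<exists>s. (\<forall>n. s n \<in> Z) \<and> limitin X s x sequentially}"

definition sequentially_compactin :: "'a topology \<Rightarrow> 'a set \<Rightarrow> bool" where
  "sequentially_compactin X K \<longleftrightarrow> K \<subseteq> topspace X \<and>
     (\<forall>s::nat \<Rightarrow> 'a. (\<forall>n. s n \<in> K) \<longrightarrow>
        (\<exists>x\<in>K. \<exists>r. strict_mono r \<and> limitin X (s \<circ> r) x sequentially))"

definition finite_variation :: "real \<Rightarrow> (real \<Rightarrow> real) \<Rightarrow> bool" where
  "finite_variation T v \<longleftrightarrow>
     (\<forall>t\<in>{0..T}. (v \<longlongrightarrow> v t) (at t within {t<..T})) \<and>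
     (\<exists>C. \<forall>n (p::nat \<Rightarrow> real).
        (\<forall>k\<le>n. p k \<in> {0..T}) \<and> (\<forall>k<n. p k \<le> p (Suc k)) \<longrightarrow>
        (\<Sum>k<n. \<bar>v (p (Suc k)) - v (p k)\<bar>) \<le> C)"

text \<open>
  A right-continuous function \<open>v\<close> of finite variation is identified with the unique signed measure
  \<open>dv\<close> on \<open>[0,T]\<close> such that \<open>dv([0,t]) = v(t)\<close> (so \<open>dv({0}) = v(0)\<close>), that is, with the functional
  \<open>f \<mapsto> \<integral> f dv\<close> in the dual of \<open>C([0,T])\<close>.
\<close>

definition stieltjes_measure :: "real \<Rightarrow> (real \<Rightarrow> real) \<Rightarrow> real set \<Rightarrow> real" where
  "stieltjes_measure T v = (THE \<mu>. \<mu> \<in> signed_measures (restrict_space borel {0..T}) \<and>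
     (\<forall>t\<in>{0..T}. \<mu> {0..t} = v t))"

definition stieltjes_integral :: "real \<Rightarrow> (real \<Rightarrow> real) \<Rightarrow> (real \<Rightarrow> real) \<Rightarrow> real" where
  "stieltjes_integral T v f =
     signed_integral (restrict_space borel {0..T}) (stieltjes_measure T v) f"

definition S_converges_real ::
    "real \<Rightarrow> (nat \<Rightarrow> real \<Rightarrow> real) \<Rightarrow> (real \<Rightarrow> real) \<Rightarrow> bool" where
  "S_converges_real T x x\<^sub>0 \<longleftrightarrow> (\<forall>\<epsilon>>0. \<exists>v v\<^sub>0.
     (\<forall>n. finite_variation T (v n)) \<and> finite_variation T v\<^sub>0 \<and>
     (\<forall>n. \<forall>t\<in>{0..T}. \<bar>x n t - v n t\<bar> \<le> \<epsilon>) \<and> (\<forall>t\<in>{0..T}. \<bar>x\<^sub>0 t - v\<^sub>0 t\<bar> \<le> \<epsilon>) \<and>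
     (\<forall>f. continuous_on {0..T} f \<longrightarrow>
        (\<lambda>n. stieltjes_integral T (v n) f) \<longlonglongrightarrow> stieltjes_integral T v\<^sub>0 f))"

text \<open>Used for \<open>I = [0,T]\<close> with \<open>T < \<infinity>\<close> and for \<open>I = [0,\<infinity>)\<close> only.\<close>

definition S_converges ::
    "ereal set \<Rightarrow> (nat \<Rightarrow> ('d::finite) path) \<Rightarrow> 'd path \<Rightarrow> bool" where
  "S_converges I w w\<^sub>0 \<longleftrightarrow> (\<forall>i.
     let x = (\<lambda>n t. w n (ereal t) $ i); x\<^sub>0 = (\<lambda>t. w\<^sub>0 (ereal t) $ i) in
     if I = {0..<\<infinity>}
     then \<exists>T::nat \<Rightarrow> real. (\<forall>r. 0 < T r) \<and> incseq T \<and> filterlim T at_top sequentially \<and>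
            (\<forall>r. S_converges_real (T r) x x\<^sub>0)
     else S_converges_real (real_of_ereal (Sup I)) x x\<^sub>0)"

definition subseq_closed :: "'a set \<Rightarrow> ((nat \<Rightarrow> 'a) \<Rightarrow> 'a \<Rightarrow> bool) \<Rightarrow> 'a set \<Rightarrow> bool" where
  "subseq_closed D conv C \<longleftrightarrow> C \<subseteq> D \<and> (\<forall>s x. (\<forall>n. s n \<in> C) \<longrightarrow> x \<in> D \<longrightarrow>
     (\<forall>r::nat \<Rightarrow> nat. strict_mono r \<longrightarrow> (\<exists>q::nat \<Rightarrow> nat. strict_mono q \<and> conv (s \<circ> r \<circ> q) x)) \<longrightarrow> x \<in> C)"

definition sequential_topology ::
    "'a set \<Rightarrow> ((nat \<Rightarrow> 'a) \<Rightarrow> 'a \<Rightarrow> bool) \<Rightarrow> 'a topology" where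
  "sequential_topology D conv = topology (\<lambda>U. U \<subseteq> D \<and> subseq_closed D conv (D - U))"

lemma subseq_closed_Un:
  assumes A: "subseq_closed D conv A" and B: "subseq_closed D conv B"
  shows "subseq_closed D conv (A \<union> B)"
  unfolding subseq_closed_def
proof (intro conjI allI impI)
  show "A \<union> B \<subseteq> D" using A B by (auto simp: subseq_closed_def)
next
  fix s :: "nat \<Rightarrow> 'a" and x
  assume s: "\<forall>n. s n \<in> A \<union> B" and x: "x \<in> D"
    and lim: "\<forall>r::nat \<Rightarrow> nat. strict_mono r \<longrightarrow> (\<exists>q::nat \<Rightarrow> nat. strict_mono q \<and> conv (s \<circ> r \<circ> q) x)"
  have key: "x \<in> C" if C: "subseq_closed D conv C" and inf: "infinite {n. s n \<in> C}" for C
  proof -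
    obtain p :: "nat \<Rightarrow> nat" where p: "strict_mono p" "\<And>n. p n \<in> {n. s n \<in> C}"
      using infinite_enumerate[OF inf] by blast
    have "\<exists>q::nat \<Rightarrow> nat. strict_mono q \<and> conv ((s \<circ> p) \<circ> r \<circ> q) x" if "strict_mono r" for r :: "nat \<Rightarrow> nat"
      using lim[rule_format, OF strict_mono_o[OF p(1) that]] by (simp add: comp_assoc)
    moreover have "\<forall>n. (s \<circ> p) n \<in> C" using p(2) by simp
    ultimately show ?thesis
      using C x unfolding subseq_closed_def by blast
  qed
  have "infinite ({n. s n \<in> A} \<union> {n. s n \<in> B})"
    using s by (simp add: Collect_disj_eq[symmetric])
  then show "x \<in> A \<union> B" using key[OF A] key[OF B] by auto
qed

lemma istopology_sequential:
  "istopology (\<lambda>U. U \<subseteq> D \<and> subseq_closed D conv (D - U))"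
  unfolding istopology_def
proof (intro conjI allI impI)
  fix S T assume ST: "S \<subseteq> D \<and> subseq_closed D conv (D - S)" "T \<subseteq> D \<and> subseq_closed D conv (D - T)"
  then show "S \<inter> T \<subseteq> D" by blast
  from ST have "subseq_closed D conv ((D - S) \<union> (D - T))"
    by (intro subseq_closed_Un) simp_all
  then show "subseq_closed D conv (D - S \<inter> T)" by (simp only: Diff_Int)
next
  fix K assume K: "\<forall>S\<in>K. S \<subseteq> D \<and> subseq_closed D conv (D - S)"
  then show "\<Union>K \<subseteq> D" by auto
  show "subseq_closed D conv (D - \<Union>K)"
    unfolding subseq_closed_def
  proof (intro conjI allI impI)
    fix s :: "nat \<Rightarrow> 'a" and x
    assume s: "\<forall>n. s n \<in> D - \<Union>K" and x: "x \<in> D"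
      and lim: "\<forall>r::nat \<Rightarrow> nat. strict_mono r \<longrightarrow> (\<exists>q::nat \<Rightarrow> nat. strict_mono q \<and> conv (s \<circ> r \<circ> q) x)"
    have "x \<in> D - S" if "S \<in> K" for S
    proof -
      have "subseq_closed D conv (D - S)" using K that by blast
      moreover have "\<forall>n. s n \<in> D - S" using s that by blast
      ultimately show ?thesis using x lim by (simp only: subseq_closed_def)
    qed
    then show "x \<in> D - \<Union>K" using x by blast
  qed blast
qed

lemma openin_sequential_topology:
  "openin (sequential_topology D conv) U \<longleftrightarrow> U \<subseteq> D \<and> subseq_closed D conv (D - U)"
  unfolding sequential_topology_def topology_inverse'[OF istopology_sequential] by (rule refl)

text \<open>Over \<open>[0,\<infinity>]\<close> this is the product topology on the space over \<open>[0,\<infinity>)\<close> times \<open>\<real>\<^sup>d\<close>.\<close>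

definition S_topology :: "ereal set \<Rightarrow> ('d::finite) path topology" where
  "S_topology I =
     (if \<infinity> \<in> I
      then pullback_topology (skorokhod_space I) (\<lambda>\<omega>. (restrict \<omega> {0..<\<infinity>}, \<omega> \<infinity>))
             (prod_topology (sequential_topology (skorokhod_space {0..<\<infinity>}) (S_converges {0..<\<infinity>}))
                euclidean)
      else sequential_topology (skorokhod_space I) (S_converges I))"

text \<open>
  The initial topology of the indicated functionals. For \<open>I = [0,\<infinity>]\<close> the integrals involve only
  finite times, so this is again the product topology.
\<close>

definition MZ_functional ::
    "ereal set \<Rightarrow> 'd \<Rightarrow> (real \<times> real \<Rightarrow> real) \<Rightarrow> ('d::finite) path \<Rightarrow> real" where
  "MZ_functional I i f \<omega> =
     (LINT t:{t. ereal t \<in> I}|lborel. f (t, \<omega> (ereal t) $ i) * exp (- t))"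

definition MZ_topology :: "ereal set \<Rightarrow> ('d::finite) path topology" where
  "MZ_topology I = topology_generated_by
     ({{\<omega> \<in> skorokhod_space I. MZ_functional I i f \<omega> \<in> U} | i f U.
         continuous_on ({t. ereal t \<in> I} \<times> UNIV) f \<and>
         bounded (f ` ({t. ereal t \<in> I} \<times> UNIV)) \<and> open U} \<union>
      {{\<omega> \<in> skorokhod_space I. \<omega> (Sup I) \<in> U} | U. Sup I \<in> I \<and> open U})"

end

theory Submission
  imports Defs "HOL-Library.Diagonal_Subsequence"
begin

text \<open>
  Condition \<open>(UB)\<close> controls both the maximum and the number of oscillations of the paths: the first is
  the maximal inequality, and for the second the truncated square of the path, sampled at the
  oscillation times, gains a fixed amount at each oscillation. Paths bounded by a constant with at most
  \<open>N\<^sub>m\<close> oscillations of size \<open>1/(m+1)\<close> form a sequentially compact set for the \<open>S\<close>-topology, so the family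
  is uniformly tight. Since countably many bounded continuous functions separate the paths and generate
  the \<open>\<sigma>\<close>-algebra, Skorokhod's representation for random sequences turns tightness into sequential
  compactness, and the weak* topology is itself separated by countably many functionals, so that
  compactness follows.

  In a limit, the bound for truncated paths passes through averages over short time intervals, which are
  continuous; the integrands are approximated in \<open>L\<^sup>1\<close> by continuous functions measurable with respect to
  the raw filtration a little later, and truncation is removed at the end. Truncating a quasimartingale
  costs only a constant factor in \<open>(UB)\<close>, since truncation is a difference of concave functions.
\<close>

section \<open>Topologies separated by countably many functions\<close>

text \<open>Path space carries no metric here, so neither Prokhorov's theorem nor Skorokhod's
  representation applies to it directly. Both are replaced by a passage through the space of real
  sequences: countably many continuous functions send a path to a sequence, probability is done
  there, and on each sequentially compact set the result is pulled back. The two bounds on the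
  topology enter at opposite ends. Being coarser than the S-topology preserves sequential limits,
  which yields the compact sets; being finer than the Meyer-Zheng topology preserves continuous
  functions, which yields the coordinates and the test functions. In a limit, neither evaluation at
  a fixed time nor an adapted weight need be continuous. Both are repaired by looking slightly to
  the right in time: before the right end of \<open>I\<close>, an average at t uses only times from
  t + \<delta> on, which leaves room for weights known by t + \<delta>. Constants may grow on the
  way, since a quasimartingale measure needs only some finite bound: 2 C for weighted increments, 14
  C after truncation, 15 C for each coordinate in the limit.\<close>

lemma diagonal_subsequence:
  fixes P :: "nat \<Rightarrow> (nat \<Rightarrow> nat) \<Rightarrow> bool"
  assumes ex: "\<And>k s. strict_mono (s :: nat \<Rightarrow> nat) \<Longrightarrow> \<exists>r :: nat \<Rightarrow> nat. strict_mono r \<and> P k (s \<circ> r)"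
    and sub: "\<And>k s r. P k s \<Longrightarrow> strict_mono r \<Longrightarrow> P k (s \<circ> r)"
    and tail: "\<And>k s N. P k (\<lambda>n. s (n + N)) \<Longrightarrow> P k s"
  shows "\<exists>r. strict_mono r \<and> (\<forall>k. P k r)"
proof -
  interpret subseqs P by standard (use ex in blast)
  have "P k (\<lambda>n. diagseq (n + Suc k))" for k
    using diagseq_holds[of k] sub by (simp add: comp_def add.commute)
  then have "P k diagseq" for k by (rule tail)
  then show ?thesis using subseq_diagseq by blast
qed

lemma tendsto_subsubseq:
  fixes x :: "nat \<Rightarrow> 'a::topological_space"
  assumes "\<And>r :: nat \<Rightarrow> nat. strict_mono r \<Longrightarrow> \<exists>q :: nat \<Rightarrow> nat. strict_mono q \<and> (x \<circ> r \<circ> q) \<longlonglongrightarrow> l"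
  shows "x \<longlonglongrightarrow> l"
proof (rule topological_tendstoI, rule ccontr)
  fix U assume U: "open U" "l \<in> U" "\<not> (\<forall>\<^sub>F n in sequentially. x n \<in> U)"
  then have "infinite {n. x n \<notin> U}"
    by (simp add: frequently_cofinite[symmetric] cofinite_eq_sequentially not_eventually)
  then obtain r :: "nat \<Rightarrow> nat" where r: "strict_mono r" "\<And>n. r n \<in> {n. x n \<notin> U}"
    using infinite_enumerate by blast
  obtain q where q: "strict_mono q" "(x \<circ> r \<circ> q) \<longlonglongrightarrow> l" using assms[OF r(1)] by blast
  then have "\<forall>\<^sub>F n in sequentially. (x \<circ> r \<circ> q) n \<in> U"
    using topological_tendstoD[OF q(2) U(1,2)] by simp
  then show False using r(2) by simp
qed

lemma tendsto_componentwise_iff_fun: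
  fixes f :: "'c \<Rightarrow> 'i \<Rightarrow> 'b::topological_space"
  shows "(f \<longlongrightarrow> l) F \<longleftrightarrow> (\<forall>k. ((\<lambda>n. f n k) \<longlongrightarrow> l k) F)"
  using limitin_componentwise[of "\<lambda>_. euclidean" UNIV f l F]
  by (simp add: euclidean_product_topology)

lemma continuous_map_real_limitin:
  assumes "continuous_map X euclideanreal f" "limitin X s x F"
  shows "((\<lambda>n. f (s n)) \<longlongrightarrow> f x) F"
  using continuous_map_limit[OF assms] by (simp add: comp_def)

text \<open>Countably many separating continuous functions do the work of a metric: limits of
  sequences become unique, and the map \<open>E\<close> to real sequences restricts to an embedding
  of every sequentially compact set. The locale serves for path space and again for signed measures
  with the weak* topology.\<close>

locale countably_separated =
  fixes X :: "'a topology" and e :: "nat \<Rightarrow> 'a \<Rightarrow> real"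
  assumes cont: "\<And>k. continuous_map X euclideanreal (e k)"
    and sep: "\<And>x y. x \<in> topspace X \<Longrightarrow> y \<in> topspace X \<Longrightarrow> (\<And>k. e k x = e k y) \<Longrightarrow> x = y"
begin

lemma limitin_eqI:
  assumes "limitin X s x sequentially" "y \<in> topspace X" "\<And>k. (\<lambda>n. e k (s n)) \<longlonglongrightarrow> e k y"
  shows "x = y"
proof (rule sep)
  show "x \<in> topspace X" using assms(1) by (rule limitin_topspace)
  show "e k x = e k y" for k
    using continuous_map_real_limitin[OF cont assms(1)] assms(3) LIMSEQ_unique by blast
qed fact

definition E :: "'a \<Rightarrow> nat \<Rightarrow> real" where
  "E x = (\<lambda>k. e k x)"

lemma E_eqD: "E x = E y \<Longrightarrow> x \<in> topspace X \<Longrightarrow> y \<in> topspace X \<Longrightarrow> x = y"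
  using sep[of x y] by (auto simp: E_def dest: fun_cong)

lemma tendsto_E: "limitin X s x sequentially \<Longrightarrow> (\<lambda>n. E (s n)) \<longlonglongrightarrow> E x"
  unfolding E_def
  by (subst tendsto_componentwise_iff_fun) (intro allI continuous_map_real_limitin[OF cont])

text \<open>A limit of points outside an open set lies outside it, so \<open>Z - U\<close> inherits
  convergent subsequences, and their images converge in a metrizable space, where sequential
  compactness is compactness. The removed set \<open>U\<close> is there for the cover argument that
  follows.\<close>

lemma compact_image_sequentially_compactin:
  assumes Z: "sequentially_compactin X Z" and U: "openin X U"
  shows "compact (E ` (Z - U))"
  unfolding compact_eq_seq_compact_metric
proof (rule seq_compactI)
  fix f :: "nat \<Rightarrow> nat \<Rightarrow> real" assume "\<forall>n. f n \<in> E ` (Z - U)"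
  then have "\<exists>s. \<forall>n. s n \<in> Z - U \<and> f n = E (s n)"
    by (intro choice) auto
  then obtain s where s: "\<And>n. s n \<in> Z - U" "\<And>n. f n = E (s n)" by blast
  obtain x r where x: "x \<in> Z" "strict_mono r" "limitin X (s \<circ> r) x sequentially"
    using Z s(1) unfolding sequentially_compactin_def by blast
  have "x \<notin> U"
  proof
    assume "x \<in> U"
    then have "\<forall>\<^sub>F n in sequentially. (s \<circ> r) n \<in> U" using limitinD[OF x(3) U] by blast
    then show False using s(1) by simp
  qed
  moreover have "(f \<circ> r) \<longlonglongrightarrow> E x" using tendsto_E[OF x(3)] s(2) by (simp add: comp_def)
  ultimately show "\<exists>l\<in>E ` (Z - U). \<exists>r. strict_mono r \<and> (f \<circ> r) \<longlonglongrightarrow> l" using x by blast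
qed

text \<open>The image of \<open>Z - U\<close> under \<open>E\<close> is compact, hence closed, and
  by injectivity its complement meets the image of \<open>Z\<close> exactly in the image of the
  points of \<open>Z\<close> in \<open>U\<close>. A cover of \<open>Z\<close> thus becomes an open
  cover of a compact set of sequences, and a finite subcover pulls back.\<close>

lemma compactin_if_sequentially_compactin:
  assumes Z: "sequentially_compactin X Z"
  shows "compactin X Z"
proof -
  have ZX: "Z \<subseteq> topspace X" using Z by (simp add: sequentially_compactin_def)
  note comp = compact_image_sequentially_compactin[OF Z]
  have cE: "compact (E ` Z)" using comp[of "{}"] by simp
  show ?thesis
    unfolding compactin_def
  proof (intro conjI allI impI)
    fix \<U> assume \<U>: "Ball \<U> (openin X) \<and> Z \<subseteq> \<Union> \<U>"
    have "\<exists>C'\<subseteq>\<U>. finite C' \<and> E ` Z \<subseteq> (\<Union>U\<in>C'. - E ` (Z - U))"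
    proof (rule compactE_image[OF cE, of \<U> "\<lambda>U. - E ` (Z - U)"])
      show "open (- E ` (Z - U))" if "U \<in> \<U>" for U
        using comp[of U] \<U> that by (simp add: compact_imp_closed open_Compl)
      show "E ` Z \<subseteq> (\<Union>U\<in>\<U>. - E ` (Z - U))"
      proof clarify
        fix z assume z: "z \<in> Z"
        then obtain U where U: "U \<in> \<U>" "z \<in> U" using \<U> by blast
        have "E z \<notin> E ` (Z - U)"
        proof
          assume "E z \<in> E ` (Z - U)"
          then obtain y where y: "y \<in> Z - U" "E z = E y" by blast
          have "z = y" using E_eqD y z ZX by blast
          then show False using y U by simp
        qed
        then show "E z \<in> (\<Union>U\<in>\<U>. - E ` (Z - U))" using U by blast
      qed
    qed blast
    then obtain C' where C': "C' \<subseteq> \<U>" "finite C'" "E ` Z \<subseteq> (\<Union>U\<in>C'. - E ` (Z - U))" by blast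
    have "Z \<subseteq> \<Union>C'" using C'(3) by blast
    then show "\<exists>\<F>. finite \<F> \<and> \<F> \<subseteq> \<U> \<and> Z \<subseteq> \<Union> \<F>" using C' by blast
  qed (rule ZX)
qed

text \<open>A convergent sequence in \<open>Z\<close> has a subsequence with a limit in
  \<open>T\<close>; the values of the separating functions identify the two limits.\<close>

lemma sequential_closure_subset:
  assumes T: "sequentially_compactin X T" and ZT: "Z \<subseteq> T"
  shows "sequential_closure X Z \<subseteq> T"
proof
  fix x assume "x \<in> sequential_closure X Z"
  then obtain s where s: "\<And>n. s n \<in> Z" "limitin X s x sequentially"
    unfolding sequential_closure_def by blast
  then obtain y r where y: "y \<in> T" "strict_mono r" "limitin X (s \<circ> r) y sequentially"
    using T ZT unfolding sequentially_compactin_def by (meson subsetD)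
  have "y = x"
    by (rule limitin_eqI[OF y(3) limitin_topspace[OF s(2)]])
      (rule continuous_map_real_limitin[OF cont limitin_subsequence[OF y(2) s(2)]])
  then show "x \<in> T" using y by simp
qed

text \<open>
  A sequence in the sequential closure is shadowed by a sequence in \<open>Z\<close> whose first \<open>n\<close> coordinates
  are \<open>1/n\<close>-close at step \<open>n\<close>; both have the same limit points.
\<close>

lemma sequentially_compactin_sequential_closure:
  assumes T: "sequentially_compactin X T" and ZT: "Z \<subseteq> T"
  shows "sequentially_compactin X (sequential_closure X Z)"
  unfolding sequentially_compactin_def
proof (intro conjI allI impI)
  show "sequential_closure X Z \<subseteq> topspace X"
    using sequential_closure_subset[OF T ZT] T by (auto simp: sequentially_compactin_def)
next
  fix z :: "nat \<Rightarrow> 'a" assume z: "\<forall>n. z n \<in> sequential_closure X Z"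
  then have "\<forall>n. z n \<in> T" using sequential_closure_subset[OF T ZT] by blast
  then obtain x r where x: "x \<in> T" "strict_mono r" "limitin X (z \<circ> r) x sequentially"
    using T unfolding sequentially_compactin_def by blast
  have "\<exists>y\<in>Z. \<forall>k\<le>n. \<bar>e k y - e k (z (r n))\<bar> < inverse (Suc n)" for n
  proof -
    obtain s where s: "\<And>n. s n \<in> Z" "limitin X s (z (r n)) sequentially"
      using z unfolding sequential_closure_def by blast
    have "\<forall>\<^sub>F m in sequentially. \<bar>e k (s m) - e k (z (r n))\<bar> < inverse (Suc n)" for k
      using tendstoD[OF continuous_map_real_limitin[OF cont s(2)], of "inverse (Suc n)" k]
      by (simp add: dist_real_def)
    then have "\<forall>\<^sub>F m in sequentially. \<forall>k\<in>{..n}. \<bar>e k (s m) - e k (z (r n))\<bar> < inverse (Suc n)"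
      by (intro eventually_ball_finite) auto
    then obtain m where "\<forall>k\<in>{..n}. \<bar>e k (s m) - e k (z (r n))\<bar> < inverse (Suc n)"
      using eventually_happens by fastforce
    then show ?thesis using s(1) by blast
  qed
  then obtain y where y: "\<And>n. y n \<in> Z" "\<And>n k. k \<le> n \<Longrightarrow> \<bar>e k (y n) - e k (z (r n))\<bar> < inverse (Suc n)"
    by metis
  then obtain x' q where x': "x' \<in> T" "strict_mono q" "limitin X (y \<circ> q) x' sequentially"
    using T ZT unfolding sequentially_compactin_def by (meson subsetD)
  have lim: "(\<lambda>n. e k (y n)) \<longlonglongrightarrow> e k x" for k
  proof -
    have "(\<lambda>n. e k (y n) - e k (z (r n))) \<longlonglongrightarrow> 0"
    proof (rule Lim_null_comparison[OF _ LIMSEQ_inverse_real_of_nat])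
      show "\<forall>\<^sub>F n in sequentially. norm (e k (y n) - e k (z (r n))) \<le> inverse (real (Suc n))"
        using y(2) by (intro eventually_sequentiallyI[of k]) (auto intro: less_imp_le)
    qed
    moreover have "(\<lambda>n. e k (z (r n))) \<longlonglongrightarrow> e k x"
      using continuous_map_real_limitin[OF cont x(3)] by (simp add: comp_def)
    ultimately show ?thesis using tendsto_add by fastforce
  qed
  have "x' = x"
  proof (rule limitin_eqI[OF x'(3)])
    show "x \<in> topspace X" using limitin_topspace[OF x(3)] .
    show "(\<lambda>n. e k ((y \<circ> q) n)) \<longlonglongrightarrow> e k x" for k
      using LIMSEQ_subseq_LIMSEQ[OF lim x'(2)] by (simp add: comp_def)
  qed
  then have "x \<in> sequential_closure X Z"
    using x'(3) y(1) unfolding sequential_closure_def by (auto intro!: exI[of _ "y \<circ> q"])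
  then show "\<exists>x\<in>sequential_closure X Z. \<exists>r. strict_mono r \<and> limitin X (z \<circ> r) x sequentially"
    using x by blast
qed

end

section \<open>Signed measures\<close>

lemma signed_measures_outside: "\<mu> \<in> signed_measures B \<Longrightarrow> A \<notin> sets B \<Longrightarrow> \<mu> A = 0"
  by (simp add: signed_measures_def)

lemma signed_measures_sums:
  "\<mu> \<in> signed_measures B \<Longrightarrow> range A \<subseteq> sets B \<Longrightarrow> disjoint_family A \<Longrightarrow> (\<lambda>n. \<mu> (A n)) sums \<mu> (\<Union>n. A n)"
  by (simp add: signed_measures_def)

lemma signed_measures_empty:
  assumes "\<mu> \<in> signed_measures B" shows "\<mu> {} = 0"
proof -
  have "(\<lambda>n::nat. \<mu> {}) sums \<mu> (\<Union>n::nat. {})"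
    using assms by (intro signed_measures_sums) (auto simp: disjoint_family_on_def)
  then have "summable (\<lambda>n::nat. \<mu> {})" by (rule sums_summable)
  then show ?thesis by (simp add: summable_const_iff)
qed

lemma signed_measures_Un:
  assumes \<mu>: "\<mu> \<in> signed_measures B" and AB: "A \<in> sets B" "A' \<in> sets B" "A \<inter> A' = {}"
  shows "\<mu> (A \<union> A') = \<mu> A + \<mu> A'"
proof -
  have "(\<lambda>n. \<mu> (binaryset A A' n)) sums \<mu> (\<Union>n. binaryset A A' n)"
    using AB by (intro signed_measures_sums[OF \<mu>])
      (auto simp: disjoint_family_on_def binaryset_def range_binaryset_eq)
  moreover have "(\<lambda>n. \<mu> (binaryset A A' n)) sums (\<mu> A + \<mu> A')"
    using signed_measures_empty[OF \<mu>] by (rule binaryset_sums)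
  ultimately show ?thesis by (simp add: UN_binaryset_eq sums_unique2)
qed

lemma signed_measures_Diff:
  assumes \<mu>: "\<mu> \<in> signed_measures B" and A: "A \<in> sets B" "C \<in> sets B" "C \<subseteq> A"
  shows "\<mu> (A - C) = \<mu> A - \<mu> C"
proof -
  have "(A - C) \<inter> C = {}" "A - C \<union> C = A" using A by blast+
  then show ?thesis using signed_measures_Un[OF \<mu>, of "A - C" C] A by simp
qed

lemma signed_measures_bounded:
  assumes "\<mu> \<in> signed_measures B"
  obtains K where "\<And>A. A \<in> sets B \<Longrightarrow> \<bar>\<mu> A\<bar> \<le> K"
proof -
  have "bdd_above {(\<Sum>A\<in>P. \<bar>\<mu> A\<bar>) | P. finite P \<and> P \<subseteq> sets B \<and> disjoint P}"
    using assms by (simp add: signed_measures_def)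
  then obtain K where "\<forall>x\<in>{(\<Sum>A\<in>P. \<bar>\<mu> A\<bar>) | P. finite P \<and> P \<subseteq> sets B \<and> disjoint P}. x \<le> K"
    unfolding bdd_above_def by (rule exE)
  then have K: "(\<Sum>A\<in>P. \<bar>\<mu> A\<bar>) \<le> K" if "finite P" "P \<subseteq> sets B" "disjoint P" for P
    using that by auto
  have "\<bar>\<mu> A\<bar> \<le> K" if "A \<in> sets B" for A
    using K[of "{A}"] that by simp
  then show ?thesis using that by blast
qed

lemma signed_measures_uminus:
  assumes "\<mu> \<in> signed_measures B" shows "(\<lambda>A. - \<mu> A) \<in> signed_measures B"
  using assms by (auto simp: signed_measures_def sums_minus)

lemma measure_signed_measures:
  assumes "finite_measure Q" "sets Q = sets B"
  shows "measure Q \<in> signed_measures B"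
proof -
  interpret finite_measure Q by fact
  have "(\<Sum>A\<in>P. \<bar>measure Q A\<bar>) \<le> measure Q (space Q)"
    if "finite P" "P \<subseteq> sets B" "disjoint P" for P
  proof -
    have "(\<Sum>A\<in>P. \<bar>measure Q A\<bar>) = measure Q (\<Union>A\<in>P. A)"
      using that assms(2)
      by (subst finite_measure_finite_Union) (auto simp: disjoint_def disjoint_family_on_def)
    also have "\<dots> \<le> measure Q (space Q)" by (rule bounded_measure)
    finally show ?thesis .
  qed
  then show ?thesis
    using assms(2) finite_measure_UNION
    by (auto simp: signed_measures_def measure_notin_sets intro!: bdd_aboveI)
qed

text \<open>Dynkin's argument. The whole space is a separate assumption because complements are
  evaluated by subtraction from it and \<open>G\<close> need not contain it.\<close>

lemma signed_measures_eqI: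
  assumes \<mu>: "\<mu> \<in> signed_measures B" and \<nu>: "\<nu> \<in> signed_measures B"
    and G: "sets B = sigma_sets (space B) G" "Int_stable G" "G \<subseteq> Pow (space B)"
    and eq: "\<And>A. A \<in> G \<Longrightarrow> \<mu> A = \<nu> A" "\<mu> (space B) = \<nu> (space B)"
  shows "\<mu> = \<nu>"
proof
  fix A
  show "\<mu> A = \<nu> A"
  proof (cases "A \<in> sets B")
    case True
    then have "A \<in> sigma_sets (space B) G" using G by simp
    with G(2,3) show ?thesis
    proof (induction rule: sigma_sets_induct_disjoint)
      case (compl A)
      then have A: "A \<in> sets B" "A \<subseteq> space B" using G(1) sets.sets_into_space by blast+
      show ?case
        using signed_measures_Diff[OF \<mu> sets.top A] signed_measures_Diff[OF \<nu> sets.top A] eq(2) compl.IH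
        by simp
    next
      case (union A)
      then have "range A \<subseteq> sets B" using G(1) by simp
      from signed_measures_sums[OF \<mu> this] signed_measures_sums[OF \<nu> this] union
      have "(\<lambda>n. \<nu> (A n)) sums \<mu> (\<Union>n. A n)" "(\<lambda>n. \<nu> (A n)) sums \<nu> (\<Union>n. A n)"
        by auto
      then show ?case by (rule sums_unique2)
    qed (use eq signed_measures_empty[OF \<mu>] signed_measures_empty[OF \<nu>] in auto)
  qed (simp add: signed_measures_outside[OF \<mu>] signed_measures_outside[OF \<nu>])
qed

section \<open>Jordan decomposition and integrals against signed measures\<close>

lemma ennreal_add_le: "ennreal (a + b) \<le> ennreal a + ennreal b"
proof (cases "0 \<le> a \<and> 0 \<le> b")
  case False
  then consider "a \<le> 0" | "b \<le> 0" by linarith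
  then show ?thesis
    by cases (auto simp: ennreal_neg intro: ennreal_leI)
qed simp

lemma ennreal_sum_le: "ennreal (\<Sum>i\<in>I. f i) \<le> (\<Sum>i\<in>I. ennreal (f i))"
proof (induction I rule: infinite_finite_induct)
  case (insert i I)
  have "ennreal (f i + sum f I) \<le> ennreal (f i) + ennreal (sum f I)"
    by (rule ennreal_add_le)
  with insert show ?case by (simp add: add_left_mono order_trans)
qed auto

lemma
  shows sets_positive_part [simp]: "sets (positive_part B \<mu>) = sets B"
    and space_positive_part [simp]: "space (positive_part B \<mu>) = space B"
  by (auto simp: positive_part_def sets.space_closed sets.sigma_sets_eq)

text \<open>The supremum is superadditive over disjoint sets because unions of test sets are test
  sets, and countably subadditive because a test set can be cut along the pieces. This gives
  countable additivity without a Hahn decomposition.\<close>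

lemma emeasure_positive_part:
  assumes \<mu>: "\<mu> \<in> signed_measures B" and A: "A \<in> sets B"
  shows "emeasure (positive_part B \<mu>) A = (SUP C\<in>{C \<in> sets B. C \<subseteq> A}. ennreal (\<mu> C))"
proof (rule emeasure_measure_of[OF positive_part_def])
  let ?F = "\<lambda>A. SUP C\<in>{C \<in> sets B. C \<subseteq> A}. ennreal (\<mu> C)"
  have ne: "{C \<in> sets B. C \<subseteq> A} \<noteq> {}" for A by auto
  show "positive (sets (positive_part B \<mu>)) ?F"
    by (auto simp: positive_def signed_measures_empty[OF \<mu>] intro!: SUP_eqI)
  have super: "?F A + ?F A' \<le> ?F (A \<union> A')" if "A \<inter> A' = {}" for A A'
  proof -
    have "ennreal (\<mu> C) + ennreal (\<mu> C') \<le> ?F (A \<union> A')"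
      if C: "C \<in> {C \<in> sets B. C \<subseteq> A}" "C' \<in> {C \<in> sets B. C \<subseteq> A'}" for C C'
    proof -
      have "C \<inter> C' = {}" using C \<open>A \<inter> A' = {}\<close> by auto
      then have "\<mu> (C \<union> C') = \<mu> C + \<mu> C'" using C by (intro signed_measures_Un[OF \<mu>]) auto
      \<comment> \<open>Where one of the two values is negative, \<open>ennreal\<close> maps it to 0
        and the other test set alone serves as witness; the union serves when both are
        nonnegative.\<close>
      moreover have "ennreal (\<mu> D) \<le> ?F (A \<union> A')" if "D \<in> {C, C', C \<union> C'}" for D
        using C that by (intro SUP_upper) auto
      ultimately show ?thesis
        by (cases "0 \<le> \<mu> C"; cases "0 \<le> \<mu> C'")
          (fastforce simp: ennreal_neg ennreal_plus[symmetric] simp del: ennreal_plus)+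
    qed
    then have "ennreal (\<mu> C) + ?F A' \<le> ?F (A \<union> A')" if "C \<in> {C \<in> sets B. C \<subseteq> A}" for C
      unfolding ennreal_SUP_add_right[OF ne] using that by (intro SUP_least) blast
    then show ?thesis
      unfolding ennreal_SUP_add_left[OF ne, symmetric] by (intro SUP_least) blast
  qed
  show "countably_additive (sets (positive_part B \<mu>)) ?F"
    unfolding sets_positive_part
  proof (rule countably_additiveI)
    fix D :: "nat \<Rightarrow> 'a set" assume D: "range D \<subseteq> sets B" "disjoint_family D" "(\<Union>n. D n) \<in> sets B"
    have "(\<Sum>n<N. ?F (D n)) \<le> ?F (\<Union>n. D n)" for N
    proof -
      have "(\<Sum>n<N. ?F (D n)) \<le> ?F (\<Union>n<N. D n)"
      proof (induction N)
        case (Suc N)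
        have "(\<Union>n<N. D n) \<inter> D N = {}"
        proof -
          have "D n \<inter> D N = {}" if "n < N" for n
            using disjoint_family_onD[OF D(2), of n N] that by simp
          then show ?thesis by blast
        qed
        then have "?F (\<Union>n<N. D n) + ?F (D N) \<le> ?F (\<Union>n<Suc N. D n)"
          using super[of "\<Union>n<N. D n" "D N"] by (simp add: lessThan_Suc Un_commute)
        from order_trans[OF add_right_mono[OF Suc] this] show ?case by (simp only: sum.lessThan_Suc)
      qed simp
      also have "\<dots> \<le> ?F (\<Union>n. D n)" by (rule SUP_subset_mono) auto
      finally show ?thesis .
    qed
    then have le: "(\<Sum>n. ?F (D n)) \<le> ?F (\<Union>n. D n)"
      by (intro suminf_le_const) auto
    have "ennreal (\<mu> C) \<le> (\<Sum>n. ?F (D n))" if C: "C \<in> sets B" "C \<subseteq> (\<Union>n. D n)" for C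
    proof -
      have "(\<lambda>n. \<mu> (C \<inter> D n)) sums \<mu> (\<Union>n. C \<inter> D n)"
        using C D(1) disjoint_family_on_bisimulation[OF D(2), of "\<lambda>n. C \<inter> D n"]
        by (intro signed_measures_sums[OF \<mu>]) auto
      also have "(\<Union>n. C \<inter> D n) = C" using C by blast
      finally have "(\<lambda>N. ennreal (\<Sum>n<N. \<mu> (C \<inter> D n))) \<longlonglongrightarrow> ennreal (\<mu> C)"
        unfolding sums_def by (rule tendsto_ennrealI)
      moreover have "ennreal (\<Sum>n<N. \<mu> (C \<inter> D n)) \<le> (\<Sum>n. ?F (D n))" for N
      proof -
        have "ennreal (\<Sum>n<N. \<mu> (C \<inter> D n)) \<le> (\<Sum>n<N. ennreal (\<mu> (C \<inter> D n)))"
          by (rule ennreal_sum_le)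
        also have "\<dots> \<le> (\<Sum>n<N. ?F (D n))"
          using C D(1) by (intro sum_mono SUP_upper) auto
        also have "\<dots> \<le> (\<Sum>n. ?F (D n))" by (rule sum_le_suminf) auto
        finally show ?thesis .
      qed
      ultimately show ?thesis by (intro LIMSEQ_le_const2) auto
    qed
    then have "?F (\<Union>n. D n) \<le> (\<Sum>n. ?F (D n))" by (intro SUP_least) auto
    with le show "(\<Sum>n. ?F (D n)) = ?F (\<Union>n. D n)" by (rule antisym)
  qed
qed (use A sets.space_closed in auto)

text \<open>For C inside A, \<mu>(C) = \<mu>(A) - \<mu>(A - C) is at most \<mu>(A) plus the negative
  part of A; the supremum over C gives one inequality, and the same argument for -\<mu> the other.
  Finiteness comes from the boundedness of \<mu>.\<close>

lemma
  assumes \<mu>: "\<mu> \<in> signed_measures B"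
  shows finite_measure_positive_part: "finite_measure (positive_part B \<mu>)"
    and jordan_decomposition: "A \<in> sets B \<Longrightarrow>
      \<mu> A = measure (positive_part B \<mu>) A - measure (positive_part B (\<lambda>A. - \<mu> A)) A"
proof -
  have fin: "emeasure (positive_part B \<mu>) A \<noteq> \<infinity>" if \<mu>: "\<mu> \<in> signed_measures B" "A \<in> sets B" for \<mu> A
  proof -
    obtain K where "\<And>A. A \<in> sets B \<Longrightarrow> \<bar>\<mu> A\<bar> \<le> K" by (rule signed_measures_bounded[OF \<mu>(1)]) blast
    then have "emeasure (positive_part B \<mu>) A \<le> ennreal K"
      unfolding emeasure_positive_part[OF \<mu>] by (intro SUP_least ennreal_leI) force
    then show ?thesis using ennreal_less_top[of K] by (auto simp: top_unique)
  qed
  show fm: "finite_measure (positive_part B \<mu>)"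
    using fin[OF \<mu>] by (intro finite_measureI) auto
  have m: "emeasure (positive_part B \<mu>) A = ennreal (measure (positive_part B \<mu>) A)"
    if "\<mu> \<in> signed_measures B" "A \<in> sets B" for \<mu> A
    using fin[OF that] by (intro emeasure_eq_ennreal_measure) auto
  have up: "\<mu> C \<le> measure (positive_part B \<mu>) A"
    if \<mu>: "\<mu> \<in> signed_measures B" and A: "A \<in> sets B" and C: "C \<in> sets B" "C \<subseteq> A" for \<mu> A C
  proof -
    have "ennreal (\<mu> C) \<le> ennreal (measure (positive_part B \<mu>) A)"
      unfolding m[OF \<mu> A, symmetric] emeasure_positive_part[OF \<mu> A] using C by (intro SUP_upper) auto
    then show ?thesis by (simp add: ennreal_le_iff)
  qed
  have least: "measure (positive_part B \<mu>) A \<le> x"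
    if \<mu>: "\<mu> \<in> signed_measures B" and A: "A \<in> sets B" and x: "\<And>C. C \<in> sets B \<Longrightarrow> C \<subseteq> A \<Longrightarrow> \<mu> C \<le> x" for \<mu> A x
  proof -
    have "0 \<le> x" using x[of "{}"] signed_measures_empty[OF \<mu>] by simp
    have "ennreal (measure (positive_part B \<mu>) A) \<le> ennreal x"
      unfolding m[OF \<mu> A, symmetric] emeasure_positive_part[OF \<mu> A]
      using x by (intro SUP_least ennreal_leI) auto
    then show ?thesis using \<open>0 \<le> x\<close> by (simp add: ennreal_le_iff)
  qed
  assume A: "A \<in> sets B"
  note \<mu>' = signed_measures_uminus[OF \<mu>]
  have "measure (positive_part B \<mu>) A \<le> \<mu> A + measure (positive_part B (\<lambda>A. - \<mu> A)) A"
  proof (rule least[OF \<mu> A])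
    fix C assume "C \<in> sets B" "C \<subseteq> A"
    then show "\<mu> C \<le> \<mu> A + measure (positive_part B (\<lambda>A. - \<mu> A)) A"
      using up[OF \<mu>' A, of "A - C"] signed_measures_Diff[OF \<mu> A] A by simp
  qed
  moreover have "measure (positive_part B (\<lambda>A. - \<mu> A)) A \<le> measure (positive_part B \<mu>) A - \<mu> A"
  proof (rule least[OF \<mu>' A])
    fix C assume "C \<in> sets B" "C \<subseteq> A"
    then show "- \<mu> C \<le> measure (positive_part B \<mu>) A - \<mu> A"
      using up[OF \<mu> A, of "A - C"] signed_measures_Diff[OF \<mu> A] A by simp
  qed
  ultimately show "\<mu> A = measure (positive_part B \<mu>) A - measure (positive_part B (\<lambda>A. - \<mu> A)) A"
    by simp
qed

lemma measurable_if_sets_eq: "f \<in> measurable B M' \<Longrightarrow> sets N = sets B \<Longrightarrow> f \<in> measurable N M'"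
  by (subst measurable_cong_sets[OF _ refl]) auto

text \<open>An identity between differences of measures, written with sums because nonnegative
  integrals may be infinite and cannot be subtracted. It is carried from sets to functions by the
  usual induction over nonnegative measurable functions.\<close>

lemma nn_integral_add_measures:
  assumes sets: "sets N1 = sets B" "sets N2 = sets B" "sets N3 = sets B" "sets N4 = sets B"
    and eq: "\<And>A. A \<in> sets B \<Longrightarrow> emeasure N1 A + emeasure N2 A = emeasure N3 A + emeasure N4 A"
    and f: "f \<in> borel_measurable B"
  shows "(\<integral>\<^sup>+x. f x \<partial>N1) + (\<integral>\<^sup>+x. f x \<partial>N2) = (\<integral>\<^sup>+x. f x \<partial>N3) + (\<integral>\<^sup>+x. f x \<partial>N4)"
proof -
  note mN = measurable_if_sets_eq
  show ?thesis using f
proof (induction rule: borel_measurable_induct)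
  case (cong f g)
  have "(\<integral>\<^sup>+x. f x \<partial>N) = (\<integral>\<^sup>+x. g x \<partial>N)" if "sets N = sets B" for N
    using cong(3) sets_eq_imp_space_eq[OF that] by (intro nn_integral_cong) simp
  with cong sets show ?case by simp
next
  case (set A)
  then show ?case using eq sets by simp
next
  case (mult u c)
  then show ?case
    using sets by (simp add: nn_integral_cmult[OF mN[OF mult(2)]] distrib_left[symmetric])
next
  case (add u v)
  then have "(\<integral>\<^sup>+x. v x + u x \<partial>N) = (\<integral>\<^sup>+x. v x \<partial>N) + (\<integral>\<^sup>+x. u x \<partial>N)" if "sets N = sets B" for N
    using that mN by (intro nn_integral_add) blast+
  then have "(\<integral>\<^sup>+x. v x + u x \<partial>N1) + (\<integral>\<^sup>+x. v x + u x \<partial>N2) =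
      ((\<integral>\<^sup>+x. v x \<partial>N1) + (\<integral>\<^sup>+x. v x \<partial>N2)) + ((\<integral>\<^sup>+x. u x \<partial>N1) + (\<integral>\<^sup>+x. u x \<partial>N2))"
    "(\<integral>\<^sup>+x. v x + u x \<partial>N3) + (\<integral>\<^sup>+x. v x + u x \<partial>N4) =
      ((\<integral>\<^sup>+x. v x \<partial>N3) + (\<integral>\<^sup>+x. v x \<partial>N4)) + ((\<integral>\<^sup>+x. u x \<partial>N3) + (\<integral>\<^sup>+x. u x \<partial>N4))"
    using sets by (simp_all add: ac_simps)
  then show ?case using add.IH by simp
next
  case (seq U)
  have conv: "(\<lambda>i. \<integral>\<^sup>+x. U i x \<partial>N) \<longlonglongrightarrow> (\<integral>\<^sup>+x. (SUP i. U i) x \<partial>N)" if "sets N = sets B" for N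
  proof -
    have "(\<integral>\<^sup>+x. (SUP i. U i) x \<partial>N) = (SUP i. \<integral>\<^sup>+x. U i x \<partial>N)"
      unfolding SUP_apply using seq(3) mN[OF seq(1) that]
      by (intro nn_integral_monotone_convergence_SUP) auto
    then show ?thesis
      using seq(3) by (auto simp: incseq_def le_fun_def intro!: LIMSEQ_SUP nn_integral_mono)
  qed
  have "(\<lambda>i. (\<integral>\<^sup>+x. U i x \<partial>N1) + (\<integral>\<^sup>+x. U i x \<partial>N2)) \<longlonglongrightarrow> (\<integral>\<^sup>+x. (SUP i. U i) x \<partial>N1) + (\<integral>\<^sup>+x. (SUP i. U i) x \<partial>N2)"
    "(\<lambda>i. (\<integral>\<^sup>+x. U i x \<partial>N3) + (\<integral>\<^sup>+x. U i x \<partial>N4)) \<longlonglongrightarrow> (\<integral>\<^sup>+x. (SUP i. U i) x \<partial>N3) + (\<integral>\<^sup>+x. (SUP i. U i) x \<partial>N4)"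
    using sets by (intro tendsto_add conv; simp)+
  then show ?case using seq.IH LIMSEQ_unique by simp
qed
qed

text \<open>Both the Jordan parts and \<open>N1\<close>, \<open>N2\<close> represent \<mu> as a
  difference, so the cross sums agree as measures. Adding the constant \<open>K\<close> makes
  \<open>f\<close> nonnegative, and the contributions of \<open>K\<close> cancel since the cross
  sums also agree on the whole space.\<close>

lemma signed_integral_eq_diff:
  assumes \<mu>: "\<mu> \<in> signed_measures B" and N: "finite_measure N1" "finite_measure N2"
    and sets: "sets N1 = sets B" "sets N2 = sets B"
    and eq: "\<And>A. A \<in> sets B \<Longrightarrow> \<mu> A = measure N1 A - measure N2 A"
    and f: "f \<in> borel_measurable B" and bd: "\<And>x. x \<in> space B \<Longrightarrow> \<bar>f x\<bar> \<le> K"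
  shows "signed_integral B \<mu> f = (\<integral>x. f x \<partial>N1) - (\<integral>x. f x \<partial>N2)"
proof -
  define P where "P = positive_part B \<mu>"
  define M where "M = positive_part B (\<lambda>A. - \<mu> A)"
  have fin: "finite_measure P" "finite_measure M"
    unfolding P_def M_def using \<mu> signed_measures_uminus finite_measure_positive_part by blast+
  have sets': "sets P = sets B" "sets M = sets B" by (simp_all add: P_def M_def)
  have int: "integrable N f" if "finite_measure N" "sets N = sets B" for N :: "'a measure"
  proof -
    interpret finite_measure N by fact
    show ?thesis
      using bd sets_eq_imp_space_eq[OF that(2)]
      by (intro integrable_const_bound[of _ K] AE_I2 measurable_if_sets_eq[OF f that(2)]) auto
  qed
  have nn: "(\<integral>\<^sup>+x. ennreal (f x + K) \<partial>N) = ennreal ((\<integral>x. f x \<partial>N) + K * measure N (space B))"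
    and nonneg: "0 \<le> (\<integral>x. f x \<partial>N) + K * measure N (space B)"
    if "finite_measure N" "sets N = sets B" for N :: "'a measure"
  proof -
    interpret finite_measure N by fact
    have "AE x in N. 0 \<le> f x + K"
      using bd sets_eq_imp_space_eq[OF that(2)] by (intro AE_I2) (force simp: abs_le_iff)
    then show "(\<integral>\<^sup>+x. ennreal (f x + K) \<partial>N) = ennreal ((\<integral>x. f x \<partial>N) + K * measure N (space B))"
      "0 \<le> (\<integral>x. f x \<partial>N) + K * measure N (space B)"
      using int[OF that] sets_eq_imp_space_eq[OF that(2)] integral_nonneg_AE[of "\<lambda>x. f x + K" N]
      by (simp_all add: nn_integral_eq_integral mult.commute)
  qed
  have meq: "measure P A + measure N2 A = measure N1 A + measure M A" if "A \<in> sets B" for A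
    using eq[OF that] jordan_decomposition[OF \<mu> that] by (simp add: P_def M_def)
  have "emeasure P A + emeasure N2 A = emeasure N1 A + emeasure M A" if "A \<in> sets B" for A
    using meq[OF that] N fin
    by (simp add: finite_measure.emeasure_eq_measure ennreal_plus[symmetric] del: ennreal_plus)
  from nn_integral_add_measures[OF sets'(1) sets(2) sets(1) sets'(2) this, of "\<lambda>x. ennreal (f x + K)"] f
  have "ennreal ((\<integral>x. f x \<partial>P) + K * measure P (space B)) + ennreal ((\<integral>x. f x \<partial>N2) + K * measure N2 (space B)) =
    ennreal ((\<integral>x. f x \<partial>N1) + K * measure N1 (space B)) + ennreal ((\<integral>x. f x \<partial>M) + K * measure M (space B))"
    using N fin sets sets' by (simp add: nn)
  then have "((\<integral>x. f x \<partial>P) + K * measure P (space B)) + ((\<integral>x. f x \<partial>N2) + K * measure N2 (space B)) =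
    ((\<integral>x. f x \<partial>N1) + K * measure N1 (space B)) + ((\<integral>x. f x \<partial>M) + K * measure M (space B))"
    using N fin sets sets' nonneg
    by (simp add: ennreal_plus[symmetric] add_nonneg_nonneg del: ennreal_plus)
  moreover have "K * measure P (space B) + K * measure N2 (space B) = K * measure N1 (space B) + K * measure M (space B)"
    using meq[of "space B"] by (simp add: distrib_left[symmetric])
  ultimately have "(\<integral>x. f x \<partial>P) + (\<integral>x. f x \<partial>N2) = (\<integral>x. f x \<partial>N1) + (\<integral>x. f x \<partial>M)" by linarith
  then show ?thesis by (simp add: signed_integral_def P_def M_def)
qed

lemma signed_integral_measure:
  assumes "finite_measure Q" "sets Q = sets B" "f \<in> borel_measurable B" "\<And>x. x \<in> space B \<Longrightarrow> \<bar>f x\<bar> \<le> K"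
  shows "signed_integral B (measure Q) f = (\<integral>x. f x \<partial>Q)"
proof -
  have "finite_measure (null_measure B)" by (intro finite_measureI) simp
  then have "signed_integral B (measure Q) f = (\<integral>x. f x \<partial>Q) - (\<integral>x. f x \<partial>null_measure B)"
    using assms by (intro signed_integral_eq_diff[of _ _ _ _ _ K] measure_signed_measures) auto
  also have "(\<integral>x. f x \<partial>null_measure B) = 0"
    by simp
  finally show ?thesis by simp
qed

section \<open>Skorokhod's representation for random sequences\<close>

lemma binary_expansion:
  fixes v :: real
  assumes "0 \<le> v" "v < 1"
  shows "(\<lambda>j. real_of_int (\<lfloor>2 ^ Suc j * v\<rfloor> mod 2) / 2 ^ Suc j) sums v"
proof -
  have part: "(\<Sum>j<N. real_of_int (\<lfloor>2 ^ Suc j * v\<rfloor> mod 2) / 2 ^ Suc j) = real_of_int \<lfloor>2 ^ N * v\<rfloor> / 2 ^ N" for N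
  proof (induction N)
    case 0
    have "\<lfloor>v\<rfloor> = 0" using assms by linarith
    then show ?case by simp
  next
    case (Suc N)
    have "\<lfloor>2 ^ Suc N * v\<rfloor> div 2 = \<lfloor>2 ^ N * v\<rfloor>"
      using floor_divide_real_eq_div[of 2 "2 ^ Suc N * v"] by simp
    then have "\<lfloor>2 ^ Suc N * v\<rfloor> = 2 * \<lfloor>2 ^ N * v\<rfloor> + \<lfloor>2 ^ Suc N * v\<rfloor> mod 2"
      by (metis mult_div_mod_eq)
    then have "real_of_int \<lfloor>2 ^ Suc N * v\<rfloor> = 2 * real_of_int \<lfloor>2 ^ N * v\<rfloor> + real_of_int (\<lfloor>2 ^ Suc N * v\<rfloor> mod 2)"
      by (metis of_int_add of_int_mult of_int_numeral)
    then show ?case using Suc by (simp add: field_simps)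
  qed
  have "(\<lambda>N. real_of_int \<lfloor>2 ^ N * v\<rfloor> / 2 ^ N) \<longlonglongrightarrow> v"
  proof (rule real_tendsto_sandwich)
    show "(\<lambda>N. v - (1 / 2) ^ N) \<longlonglongrightarrow> v" "(\<lambda>N. v) \<longlonglongrightarrow> v"
      using tendsto_diff[OF tendsto_const LIMSEQ_realpow_zero[of "1/2"], of v] by simp_all
    show "\<forall>\<^sub>F N in sequentially. v - (1 / 2) ^ N \<le> real_of_int \<lfloor>2 ^ N * v\<rfloor> / 2 ^ N"
    proof (intro always_eventually allI)
      fix N :: nat
      have "2 ^ N * v - 1 \<le> real_of_int \<lfloor>2 ^ N * v\<rfloor>" by linarith
      then have "(2 ^ N * v - 1) / 2 ^ N \<le> real_of_int \<lfloor>2 ^ N * v\<rfloor> / 2 ^ N"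
        by (intro divide_right_mono) auto
      then show "v - (1 / 2) ^ N \<le> real_of_int \<lfloor>2 ^ N * v\<rfloor> / 2 ^ N"
        by (simp add: diff_divide_distrib power_one_over)
    qed
    show "\<forall>\<^sub>F N in sequentially. real_of_int \<lfloor>2 ^ N * v\<rfloor> / 2 ^ N \<le> v"
      by (intro always_eventually allI) (simp add: field_simps)
  qed
  then show ?thesis unfolding sums_def part .
qed

text \<open>Bit sequences are coded in base \<open>4\<close> so that distinct prefixes have separated codes.\<close>

definition code4 :: "(nat \<Rightarrow> int) \<Rightarrow> real" where
  "code4 b = (\<Sum>j. real_of_int (b j) / 4 ^ Suc j)"

lemma code4_summable:
  assumes "\<And>j. b j \<in> {0, 1}"
  shows "summable (\<lambda>j. real_of_int (b j) / 4 ^ Suc j)"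
proof (rule summable_comparison_test')
  show "summable (\<lambda>j. (1 / 4 :: real) ^ Suc j)" by (simp add: summable_geometric)
  show "norm (real_of_int (b j) / 4 ^ Suc j) \<le> (1 / 4) ^ Suc j" for j
    using assms[of j] by (auto simp: field_simps)
qed

lemma code4_bounds:
  assumes b: "\<And>j. b j \<in> {0, 1}"
  shows "0 \<le> code4 b" "code4 b \<le> 1 / 3"
proof -
  have g: "(\<lambda>j. (1 / 4 :: real) ^ Suc j) sums (1 / 3)"
    using sums_mult[OF geometric_sums[of "1/4 :: real"], of "1/4"] by simp
  have "real_of_int (b j) / 4 ^ Suc j \<ge> 0" "real_of_int (b j) / 4 ^ Suc j \<le> (1 / 4) ^ Suc j" for j
    using b[of j] by (auto simp: field_simps)
  note le = this
  show "0 \<le> code4 b"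
    unfolding code4_def by (intro suminf_nonneg code4_summable b le)
  have "code4 b \<le> (\<Sum>j. (1 / 4) ^ Suc j)"
    unfolding code4_def by (intro suminf_le code4_summable b le sums_summable[OF g])
  then show "code4 b \<le> 1 / 3" using sums_unique[OF g] by simp
qed

text \<open>The integer with base-4 digits \<open>b 0\<close>, ..., \<open>b (N - 1)\<close>, which
  for digits 0 and 1 is the integer part of the code multiplied by the \<open>N\<close>-th power of
  4.\<close>

primrec prefix4 :: "(nat \<Rightarrow> int) \<Rightarrow> nat \<Rightarrow> int" where
  "prefix4 b 0 = 0"
| "prefix4 b (Suc N) = 4 * prefix4 b N + b N"

lemma code4_split:
  assumes b: "\<And>j. b j \<in> {0, 1}"
  shows "4 ^ N * code4 b = real_of_int (prefix4 b N) + code4 (\<lambda>j. b (j + N))"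
proof -
  have "4 ^ N * (\<Sum>j<N. real_of_int (b j) / 4 ^ Suc j) = real_of_int (prefix4 b N)"
    by (induction N) (simp_all add: field_simps)
  moreover have "4 ^ N * (\<Sum>j. real_of_int (b (j + N)) / 4 ^ Suc (j + N)) = code4 (\<lambda>j. b (j + N))"
    unfolding code4_def
  proof (subst suminf_mult[symmetric])
    show "summable (\<lambda>j. real_of_int (b (j + N)) / 4 ^ Suc (j + N))"
      using summable_ignore_initial_segment[OF code4_summable[of b, OF b], where k = N] by simp
    show "(\<Sum>j. 4 ^ N * (real_of_int (b (j + N)) / 4 ^ Suc (j + N))) = (\<Sum>j. real_of_int (b (j + N)) / 4 ^ Suc j)"
      by (simp add: power_add field_simps)
  qed
  ultimately show ?thesis
    unfolding code4_def[of b] suminf_split_initial_segment[OF code4_summable[of b, OF b], of N]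
    by (simp add: distrib_left)
qed

definition digit4 :: "nat \<Rightarrow> real \<Rightarrow> int" where
  "digit4 j y = \<lfloor>4 ^ Suc j * y\<rfloor> mod 4"

text \<open>Codes have this property because the digits 0 and 1 beyond any position contribute at
  most 1/4 + 1/16 + ... = 1/3. It leaves a gap of 2/3 below the next integer at every scale, and as
  a Borel condition it can be read off from a law.\<close>

definition separated4 :: "real \<Rightarrow> bool" where
  "separated4 y \<longleftrightarrow> (\<forall>j. 4 ^ Suc j * y - of_int \<lfloor>4 ^ Suc j * y\<rfloor> \<le> (1 / 3 :: real))"

lemma
  assumes b: "\<And>j. b j \<in> {0, 1}"
  shows digit4_code4: "digit4 j (code4 b) = b j"
    and separated4_code4: "separated4 (code4 b)"
proof -
  have "0 \<le> code4 (\<lambda>j. b (j + N))" "code4 (\<lambda>j. b (j + N)) \<le> 1 / 3" for N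
    using b by (intro code4_bounds; blast)+
  then have fl: "\<lfloor>4 ^ N * code4 b\<rfloor> = prefix4 b N" "4 ^ N * code4 b - of_int (prefix4 b N) \<le> 1 / 3" for N
    unfolding code4_split[of b N, OF b]
    using order_le_less_trans[OF \<open>code4 (\<lambda>j. b (j + N)) \<le> 1 / 3\<close>, of 1] by (auto simp: floor_eq_iff)
  show "digit4 j (code4 b) = b j"
    using b[of j] unfolding digit4_def fl(1) by auto
  show "separated4 (code4 b)"
    unfolding separated4_def fl(1) using fl(2) by blast
qed

text \<open>Once two scaled terms differ by less than 1/3, their integer parts agree: a fractional
  part of at most 1/3 plus a displacement below 1/3 does not reach the next integer.\<close>

lemma digit4_eventually_constant:
  assumes sep: "\<And>n. separated4 (y n)" and conv: "convergent y"
  shows "\<exists>n0. \<forall>n\<ge>n0. digit4 j (y n) = digit4 j (y n0)"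
proof -
  have "Cauchy (\<lambda>n. 4 ^ Suc j * y n)"
    using conv by (intro convergent_Cauchy convergent_mult convergent_const)
  then obtain n0 where n0: "\<And>m n. n0 \<le> m \<Longrightarrow> n0 \<le> n \<Longrightarrow> dist (4 ^ Suc j * y m) (4 ^ Suc j * y n) < 1 / 3"
    unfolding Cauchy_def by (metis zero_less_divide_1_iff zero_less_numeral)
  have le: "\<lfloor>4 ^ Suc j * y n\<rfloor> \<le> \<lfloor>4 ^ Suc j * y m\<rfloor>" if "n0 \<le> m" "n0 \<le> n" for m n
  proof -
    have "4 ^ Suc j * y m - of_int \<lfloor>4 ^ Suc j * y m\<rfloor> \<le> 1 / 3"
      using sep[of m] unfolding separated4_def by blast
    moreover have "\<bar>4 ^ Suc j * y m - 4 ^ Suc j * y n\<bar> < 1 / 3" using n0[OF that] by (simp add: dist_real_def)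
    moreover have "of_int \<lfloor>4 ^ Suc j * y n\<rfloor> \<le> 4 ^ Suc j * y n" by (rule of_int_floor_le)
    ultimately have "real_of_int \<lfloor>4 ^ Suc j * y n\<rfloor> < real_of_int \<lfloor>4 ^ Suc j * y m\<rfloor> + 1" by linarith
    then show ?thesis by linarith
  qed
  have "digit4 j (y n) = digit4 j (y n0)" if "n0 \<le> n" for n
    using le[of n n0] le[of n0 n] that by (simp add: digit4_def)
  then show ?thesis by blast
qed

text \<open>Digit \<open>prod_encode (k, j)\<close> of the code holds binary digit \<open>j\<close>
  of coordinate \<open>k\<close>. For an arbitrary real argument the digits may be 2 or 3, hence the
  bound 3 in the domination below.\<close>

definition decode4 :: "nat \<Rightarrow> real \<Rightarrow> real" where
  "decode4 k y = (\<Sum>j. real_of_int (digit4 (prod_encode (k, j)) y) / 2 ^ Suc j)"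

lemma digit4_range: "0 \<le> digit4 j y" "digit4 j y \<le> 3"
  using pos_mod_bound[of 4 "\<lfloor>4 ^ Suc j * y\<rfloor>"] by (auto simp: digit4_def)

lemma measurable_decode4 [measurable]: "decode4 k \<in> borel_measurable borel"
  unfolding decode4_def digit4_def by measurable

text \<open>Every digit is eventually constant along the sequence, and the series is dominated by a
  geometric one, so limit and sum may be exchanged.\<close>

lemma convergent_decode4:
  assumes "\<And>n. separated4 (y n)" "convergent y"
  shows "convergent (\<lambda>n. decode4 k (y n))"
proof -
  have "\<exists>d. \<forall>\<^sub>F n in sequentially. digit4 (prod_encode (k, j)) (y n) = d" for j
    using digit4_eventually_constant[OF assms] unfolding eventually_sequentially by blast
  then obtain d where d: "\<And>j. \<forall>\<^sub>F n in sequentially. digit4 (prod_encode (k, j)) (y n) = d j" by metis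
  have "(\<lambda>n. \<Sum>j. real_of_int (digit4 (prod_encode (k, j)) (y n)) / 2 ^ Suc j) \<longlonglongrightarrow> (\<Sum>j. real_of_int (d j) / 2 ^ Suc j)"
  proof (rule tannerys_theorem[THEN conjunct2, THEN conjunct2])
    show "(\<lambda>n. real_of_int (digit4 (prod_encode (k, j)) (y n)) / 2 ^ Suc j) \<longlonglongrightarrow> real_of_int (d j) / 2 ^ Suc j" for j
      by (intro tendsto_eventually eventually_mono[OF d[of j]]) simp
    show "\<forall>\<^sub>F (j, n) in at_top \<times>\<^sub>F sequentially. norm (real_of_int (digit4 (prod_encode (k, j)) (y n)) / 2 ^ Suc j) \<le> 3 * (1 / 2) ^ Suc j"
      using digit4_range by (intro always_eventually) (simp add: field_simps)
    show "summable (\<lambda>j. 3 * (1 / 2 :: real) ^ Suc j)" by (intro summable_mult) (simp add: summable_geometric)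
  qed simp
  then show ?thesis unfolding decode4_def convergent_def by blast
qed

text \<open>
  A version of Skorokhod's representation for random sequences: all coordinates are coded in one
  real number, to which Helly's selection theorem and Skorokhod's theorem on the line apply.
\<close>

proposition skorokhod_representation_sequences:
  fixes M :: "nat \<Rightarrow> 'a measure" and g :: "nat \<Rightarrow> 'a \<Rightarrow> real"
  assumes prob: "\<And>n. prob_space (M n)" and meas: "\<And>n k. g k \<in> borel_measurable (M n)"
    and range: "\<And>k x. 0 \<le> g k x" "\<And>k x. g k x < 1"
  obtains r :: "nat \<Rightarrow> nat" and P :: "real measure" and u :: "nat \<Rightarrow> nat \<Rightarrow> real \<Rightarrow> real"
  where "strict_mono r" "prob_space P" "\<And>n k. u n k \<in> borel_measurable P"
    "\<And>n. distr P (PiM UNIV (\<lambda>_. borel)) (\<lambda>\<omega> k. u n k \<omega>) =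
      distr (M (r n)) (PiM UNIV (\<lambda>_. borel)) (\<lambda>x k. g k x)"
    "AE \<omega> in P. \<forall>k. convergent (\<lambda>n. u n k \<omega>)"
proof -
  define b where "b x j = \<lfloor>2 ^ Suc (snd (prod_decode j)) * g (fst (prod_decode j)) x\<rfloor> mod 2" for x j
  define c where "c x = code4 (b x)" for x
  have b01: "b x j \<in> {0, 1}" for x j unfolding b_def by auto
  have dec: "decode4 k (c x) = g k x" for k x
  proof -
    have "decode4 k (c x) = (\<Sum>j. real_of_int (\<lfloor>2 ^ Suc j * g k x\<rfloor> mod 2) / 2 ^ Suc j)"
      unfolding decode4_def c_def digit4_code4[of "b x", OF b01] by (simp add: b_def)
    also have "\<dots> = g k x" using sums_unique[OF binary_expansion[OF range]] by simp
    finally show ?thesis .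
  qed
  have c_meas [measurable]: "c \<in> borel_measurable (M n)" for n
    using meas[of _ n] unfolding c_def code4_def b_def by measurable
  define \<mu> where "\<mu> n = distr (M n) borel c" for n
  have rd: "real_distribution (\<mu> n)" for n
    unfolding \<mu>_def by (intro c_meas prob_space.real_distribution_distr prob)
  have "tight \<mu>"
    unfolding tight_def
  proof (intro conjI allI impI rd)
    fix \<epsilon> :: real assume "\<epsilon> > 0"
    \<comment> \<open>Codes lie between 0 and 1/3, so all laws live on one bounded interval and
      tightness is automatic.\<close>
    have "measure (\<mu> n) {-1<..1} = 1" for n
    proof -
      interpret prob_space "M n" by (rule prob)
      have "c -` {-1<..1} \<inter> space (M n) = space (M n)"
      proof -
        have "- 1 < c x \<and> c x \<le> 1" for x
          using code4_bounds[of "b x", OF b01] unfolding c_def by linarith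
        then show ?thesis by auto
      qed
      then show ?thesis unfolding \<mu>_def by (simp add: measure_distr prob_space)
    qed
    then show "\<exists>a b. a < b \<and> (\<forall>n. 1 - \<epsilon> < measure (\<mu> n) {a<..b})"
      using \<open>\<epsilon> > 0\<close> by (intro exI[of _ "-1"] exI[of _ 1]) simp
  qed
  from tight_imp_convergent_subsubsequence[OF this strict_mono_id]
  obtain r N where r: "strict_mono r" and N: "real_distribution N" "weak_conv_m (\<lambda>n. \<mu> (r n)) N"
    by (auto simp: comp_def)
  from Skorohod[OF rd N] obtain P :: "real measure" and Y Y' where P: "prob_space P"
    and Y: "\<And>n. Y n \<in> borel_measurable P" "\<And>n. distr P borel (Y n) = \<mu> (r n)"
      "\<And>x. x \<in> space P \<Longrightarrow> (\<lambda>n. Y n x) \<longlonglongrightarrow> Y' x"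
    by blast
  note [measurable] = Y(1)
  show thesis
  proof (rule that[OF r P, of "\<lambda>n k \<omega>. decode4 k (Y n \<omega>)"])
    have dm: "(\<lambda>y k. decode4 k y) \<in> measurable borel (PiM UNIV (\<lambda>_. borel))"
      by (intro measurable_PiM_single') auto
    show "distr P (PiM UNIV (\<lambda>_. borel)) (\<lambda>\<omega> k. decode4 k (Y n \<omega>)) =
      distr (M (r n)) (PiM UNIV (\<lambda>_. borel)) (\<lambda>x k. g k x)" for n
    proof -
      have "distr P (PiM UNIV (\<lambda>_. borel)) (\<lambda>\<omega> k. decode4 k (Y n \<omega>)) =
        distr (\<mu> (r n)) (PiM UNIV (\<lambda>_. borel)) (\<lambda>y k. decode4 k y)"
        unfolding Y(2)[symmetric] by (subst distr_distr[OF dm Y(1)]) (simp add: comp_def)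
      also have "\<dots> = distr (M (r n)) (PiM UNIV (\<lambda>_. borel)) (\<lambda>x k. g k x)"
        unfolding \<mu>_def by (subst distr_distr[OF dm c_meas]) (simp add: comp_def dec)
      finally show ?thesis .
    qed
    have [measurable]: "Measurable.pred borel separated4"
      unfolding separated4_def by measurable
    \<comment> \<open>Only the law of \<open>Y n\<close> is known to be that of a code;
      \<open>separated4\<close> is a Borel condition and so carries over almost surely, which is
      what makes decoding continuous along the sequence.\<close>
    have "AE \<omega> in P. separated4 (Y n \<omega>)" for n
    proof -
      have "AE y in distr P borel (Y n). separated4 y"
        unfolding Y(2) \<mu>_def using separated4_code4[of "b x" for x, OF b01]
        by (subst AE_distr_iff) (auto simp: c_def)
      then show ?thesis by (subst (asm) AE_distr_iff) auto
    qed
    then have "AE \<omega> in P. \<forall>n. separated4 (Y n \<omega>)" by (simp add: AE_all_countable)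
    then show "AE \<omega> in P. \<forall>k. convergent (\<lambda>n. decode4 k (Y n \<omega>))"
    proof (rule AE_mp, intro AE_I2 impI allI)
      fix \<omega> k assume "\<omega> \<in> space P" "\<forall>n. separated4 (Y n \<omega>)"
      then show "convergent (\<lambda>n. decode4 k (Y n \<omega>))"
        using Y(3) by (intro convergent_decode4 convergentI) auto
    qed
  qed measurable
qed

section \<open>Weak* compactness of tight families\<close>

lemma limitin_topology_generated_by:
  assumes "x \<in> topspace (topology_generated_by S)"
    and "\<And>U. U \<in> S \<Longrightarrow> x \<in> U \<Longrightarrow> eventually (\<lambda>n. s n \<in> U) F"
  shows "limitin (topology_generated_by S) s x F"
  unfolding limitin_def
proof (intro conjI allI impI)
  fix U assume U: "openin (topology_generated_by S) U \<and> x \<in> U"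
  then have "generate_topology_on S U" by (simp add: openin_topology_generated_by_iff)
  then have "x \<in> U \<longrightarrow> eventually (\<lambda>n. s n \<in> U) F"
  proof induction
    case (Int a b)
    then show ?case by (auto intro: eventually_conj)
  next
    case (UN K)
    then show ?case
    proof (intro impI)
      assume "x \<in> \<Union>K"
      then obtain k where k: "k \<in> K" "x \<in> k" by blast
      then have "eventually (\<lambda>n. s n \<in> k) F" using UN.IH by blast
      then show "eventually (\<lambda>n. s n \<in> \<Union>K) F" by (rule eventually_mono) (use k in blast)
    qed
  qed (use assms in auto)
  then show "eventually (\<lambda>n. s n \<in> U) F" using U by blast
qed fact

lemma space_borel_algebra [simp]: "space (borel_algebra X) = topspace X"
  by (simp add: borel_algebra_def space_measure_of_conv)

lemma sets_borel_algebra: "sets (borel_algebra X) = sigma_sets (topspace X) {U. openin X U}"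
  unfolding borel_algebra_def by (intro sets_measure_of) (auto dest: openin_subset)

lemma borel_measurable_continuous_map:
  assumes "continuous_map X euclideanreal f"
  shows "f \<in> borel_measurable (borel_algebra X)"
proof (rule borel_measurableI)
  fix U :: "real set" assume "open U"
  then have "openin X {x \<in> topspace X. f x \<in> U}"
    using assms by (auto simp: continuous_map_def)
  also have "{x \<in> topspace X. f x \<in> U} = f -` U \<inter> space (borel_algebra X)" by auto
  finally show "f -` U \<inter> space (borel_algebra X) \<in> sets (borel_algebra X)"
    unfolding sets_borel_algebra by blast
qed

abbreviation bounded_continuous :: "'a topology \<Rightarrow> ('a \<Rightarrow> real) \<Rightarrow> bool" where
  "bounded_continuous X f \<equiv> continuous_map X euclideanreal f \<and> bounded (f ` topspace X)"

lemma bounded_continuousE: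
  assumes "bounded_continuous X f"
  obtains b where "0 \<le> b" "\<And>x. x \<in> topspace X \<Longrightarrow> \<bar>f x\<bar> \<le> b"
proof -
  obtain b where "\<forall>y\<in>f ` topspace X. norm y \<le> b" "0 < b" using assms unfolding bounded_pos by blast
  then show thesis by (intro that[of b]) auto
qed

lemma weak_star_subbase:
  "weak_star X = topology_generated_by
    {{\<nu> \<in> signed_measures (borel_algebra X).
      \<bar>signed_integral (borel_algebra X) \<nu> f - signed_integral (borel_algebra X) \<mu> f\<bar> < e} | \<mu> f e.
     \<mu> \<in> signed_measures (borel_algebra X) \<and> bounded_continuous X f \<and> 0 < e}"
  by (simp add: weak_star_def Let_def conj_assoc)

lemma topspace_weak_star: "topspace (weak_star X) = signed_measures (borel_algebra X)"
proof -
  let ?B = "borel_algebra X"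
  have "\<mu> \<in> topspace (weak_star X)" if "\<mu> \<in> signed_measures ?B" for \<mu>
    unfolding weak_star_subbase topology_generated_by_topspace
  proof (rule UnionI)
    show "\<mu> \<in> {\<nu> \<in> signed_measures ?B. \<bar>signed_integral ?B \<nu> (\<lambda>_. 0) - signed_integral ?B \<mu> (\<lambda>_. 0)\<bar> < 1}"
      using that by simp
  qed (rule CollectI, rule exI[of _ \<mu>], rule exI[of _ "\<lambda>_. 0"], rule exI[of _ 1],
      use that in \<open>auto simp: bounded_iff\<close>)
  then show ?thesis
    unfolding weak_star_subbase topology_generated_by_topspace by blast
qed

lemma continuous_map_signed_integral:
  assumes f: "bounded_continuous X f"
  shows "continuous_map (weak_star X) euclideanreal (\<lambda>\<nu>. signed_integral (borel_algebra X) \<nu> f)"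
  unfolding continuous_map_def
proof (intro conjI allI impI)
  let ?B = "borel_algebra X"
  fix U assume "openin euclideanreal U"
  then have U: "open U" by simp
  show "openin (weak_star X) {\<nu> \<in> topspace (weak_star X). signed_integral ?B \<nu> f \<in> U}"
  proof (subst openin_subopen, intro ballI)
    fix \<mu> assume \<mu>: "\<mu> \<in> {\<nu> \<in> topspace (weak_star X). signed_integral ?B \<nu> f \<in> U}"
    then obtain e where e: "e > 0" "ball (signed_integral ?B \<mu> f) e \<subseteq> U"
      using U by (auto simp: open_contains_ball)
    let ?V = "{\<nu> \<in> signed_measures ?B. \<bar>signed_integral ?B \<nu> f - signed_integral ?B \<mu> f\<bar> < e}"
    have "openin (weak_star X) ?V"
      unfolding weak_star_subbase
      by (rule topology_generated_by_Basis) (use \<mu> e f in \<open>auto simp: topspace_weak_star\<close>)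
    moreover have "\<mu> \<in> ?V" using \<mu> e by (simp add: topspace_weak_star)
    moreover have "?V \<subseteq> {\<nu> \<in> topspace (weak_star X). signed_integral ?B \<nu> f \<in> U}"
      using e(2) by (force simp: topspace_weak_star dist_real_def)
    ultimately show "\<exists>T. openin (weak_star X) T \<and> \<mu> \<in> T \<and> T \<subseteq> {\<nu> \<in> topspace (weak_star X). signed_integral ?B \<nu> f \<in> U}"
      by blast
  qed
qed simp

lemma limitin_weak_starI:
  assumes "\<And>n. s n \<in> signed_measures (borel_algebra X)" "\<mu> \<in> signed_measures (borel_algebra X)"
    and "\<And>f. bounded_continuous X f \<Longrightarrow>
      (\<lambda>n. signed_integral (borel_algebra X) (s n) f) \<longlonglongrightarrow> signed_integral (borel_algebra X) \<mu> f"
  shows "limitin (weak_star X) s \<mu> sequentially"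
  unfolding weak_star_subbase
proof (rule limitin_topology_generated_by)
  let ?B = "borel_algebra X"
  show "\<mu> \<in> topspace (topology_generated_by {{\<nu> \<in> signed_measures ?B. \<bar>signed_integral ?B \<nu> f - signed_integral ?B \<mu> f\<bar> < e} | \<mu> f e.
     \<mu> \<in> signed_measures ?B \<and> bounded_continuous X f \<and> 0 < e})"
    using assms(2) topspace_weak_star[of X] unfolding weak_star_subbase by simp
  fix U assume "U \<in> {{\<nu> \<in> signed_measures ?B. \<bar>signed_integral ?B \<nu> f - signed_integral ?B \<mu> f\<bar> < e} | \<mu> f e.
     \<mu> \<in> signed_measures ?B \<and> bounded_continuous X f \<and> 0 < e}" "\<mu> \<in> U"
  then obtain \<nu> f e where U: "U = {\<nu>' \<in> signed_measures ?B. \<bar>signed_integral ?B \<nu>' f - signed_integral ?B \<nu> f\<bar> < e}"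
    "bounded_continuous X f" "0 < e" and \<mu>: "\<bar>signed_integral ?B \<mu> f - signed_integral ?B \<nu> f\<bar> < e"
    by auto
  have "(\<lambda>n. \<bar>signed_integral ?B (s n) f - signed_integral ?B \<nu> f\<bar>) \<longlonglongrightarrow> \<bar>signed_integral ?B \<mu> f - signed_integral ?B \<nu> f\<bar>"
    by (intro tendsto_intros assms(3) U)
  then show "\<forall>\<^sub>F n in sequentially. s n \<in> U"
    using order_tendstoD(2)[OF _ \<mu>] U(1) assms(1) by simp
qed

text \<open>Values in \<open>[0, 1)\<close> are what the coding by binary digits asks for.
  \<open>sets_borel\<close> says that the coordinates generate the Borel \<sigma>-algebra, so
  measurability of a map into the space can be checked coordinate by coordinate.\<close>

locale borel_coordinates = countably_separated X g for X :: "'a topology" and g :: "nat \<Rightarrow> 'a \<Rightarrow> real" +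
  assumes g_range: "\<And>k x. 0 \<le> g k x" "\<And>k x. g k x < 1"
    and sets_borel: "sets (borel_algebra X) = sets (vimage_algebra (topspace X) (\<lambda>x k. g k x) (PiM UNIV (\<lambda>_. borel)))"
begin

abbreviation B :: "'a measure" where "B \<equiv> borel_algebra X"

lemma measurable_g [measurable]: "g k \<in> borel_measurable B"
  by (rule borel_measurable_continuous_map[OF cont])

lemma measurable_E [measurable]: "E \<in> measurable B (PiM UNIV (\<lambda>_. borel))"
  unfolding E_def by (intro measurable_PiM_single') auto

lemma measurable_into_B:
  assumes "Z \<in> space M \<rightarrow> topspace X" "\<And>k. (\<lambda>x. g k (Z x)) \<in> borel_measurable M"
  shows "Z \<in> measurable M B"
proof -
  have "(\<lambda>x k. g k (Z x)) \<in> measurable M (PiM UNIV (\<lambda>_. borel))"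
    using assms(2) by (intro measurable_PiM_single') auto
  then have "Z \<in> measurable M (vimage_algebra (topspace X) (\<lambda>x k. g k x) (PiM UNIV (\<lambda>_. borel)))"
    using assms(1) by (intro measurable_vimage_algebra2)
  then show ?thesis using measurable_cong_sets[OF refl sets_borel] by blast
qed

text \<open>Continuous functions decreasing in \<open>m\<close> to the indicator of an orthant cut
  out by finitely many bounds \<open>g k x \<le> of_rat q\<close>. Lists and rational thresholds
  keep the family countable, which is what makes the weak* topology countably separated.\<close>

definition test_function :: "(nat \<times> rat) list \<Rightarrow> nat \<Rightarrow> 'a \<Rightarrow> real" where
  "test_function l m x = (\<Prod>(k, q)\<in>set l. max 0 (min 1 (1 - real m * (g k x - of_rat q))))"

lemma test_function_range: "0 \<le> test_function l m x" "test_function l m x \<le> 1"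
  by (auto simp: test_function_def intro!: prod_nonneg prod_le_1)

lemma bounded_continuous_test_function: "bounded_continuous X (test_function l m)"
proof
  show "continuous_map X euclideanreal (test_function l m)"
    unfolding test_function_def case_prod_beta
    by (intro continuous_intros continuous_map_prod continuous_map_real_max continuous_map_real_min cont) auto
  show "bounded (test_function l m ` topspace X)"
    using test_function_range by (auto simp: bounded_iff intro!: exI[of _ 1])
qed

lemma tendsto_test_function:
  "(\<lambda>m. test_function l m x) \<longlonglongrightarrow> (if \<forall>(k, q)\<in>set l. g k x \<le> of_rat q then 1 else 0)"
proof -
  have *: "(\<lambda>m. max 0 (min 1 (1 - real m * d))) \<longlonglongrightarrow> (if d \<le> 0 then 1 else 0)" for d :: real
  proof (cases "d \<le> 0")
    case True
    then have "max 0 (min 1 (1 - real m * d)) = 1" for m by (simp add: mult_nonneg_nonpos min_def)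
    then show ?thesis using True by simp
  next
    case False
    then have "max 0 (min 1 (1 - real m * d)) = 0" if "m \<ge> nat \<lceil>1 / d\<rceil>" for m
      using that by (simp add: field_simps max_def min_def nat_le_iff ceiling_le_iff)
    then have "\<forall>\<^sub>F m in sequentially. max 0 (min 1 (1 - real m * d)) = 0"
      by (rule eventually_sequentiallyI)
    then show ?thesis using False by (simp add: tendsto_eventually)
  qed
  have "(\<lambda>m. test_function l m x) \<longlonglongrightarrow> (\<Prod>(k, q)\<in>set l. if g k x - of_rat q \<le> 0 then 1 else 0)"
    unfolding test_function_def case_prod_beta by (intro tendsto_prod *)
  also have "(\<Prod>(k, q)\<in>set l. if g k x - of_rat q \<le> 0 then 1 else (0::real)) = (if \<forall>(k, q)\<in>set l. g k x \<le> of_rat q then 1 else 0)"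
    by (auto intro!: prod.neutral simp: case_prod_beta split: if_splits)
  finally show ?thesis .
qed

definition orthants :: "'a set set" where
  "orthants = {{x \<in> topspace X. \<forall>(k, q)\<in>set l. g k x \<le> of_rat q} | l :: (nat \<times> rat) list. True}"

lemma sets_B_orthants: "sets B = sigma_sets (topspace X) orthants"
proof
  show "sigma_sets (topspace X) orthants \<subseteq> sets B"
  proof (rule sets.sigma_sets_subset'[of _ B, simplified])
    show "orthants \<subseteq> sets B"
    proof (clarsimp simp: orthants_def)
      fix l :: "(nat \<times> rat) list"
      have "{x \<in> space B. \<forall>p\<in>set l. g (fst p) x \<le> of_rat (snd p)} \<in> sets B" by measurable
      then show "{x \<in> topspace X. \<forall>(k, q)\<in>set l. g k x \<le> real_of_rat q} \<in> sets B"
        by (simp add: case_prod_beta)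
    qed
  qed (use sets.top[of B] in simp)
  define N where "N = sigma (topspace X) orthants"
  have N: "space N = topspace X" "sets N = sigma_sets (topspace X) orthants"
  proof -
    have "orthants \<subseteq> Pow (topspace X)" by (auto simp: orthants_def)
    then show "space N = topspace X" "sets N = sigma_sets (topspace X) orthants"
      unfolding N_def by (simp_all add: space_measure_of)
  qed
  have "g k \<in> borel_measurable N" for k
  proof (rule borel_measurableI_le)
    fix y :: real
    have "{x \<in> space N. g k x \<le> y} = (\<Inter>q\<in>{q. y \<le> of_rat q}. {x \<in> topspace X. g k x \<le> of_rat q})" (is "_ = ?R")
    proof
      show "?R \<subseteq> {x \<in> space N. g k x \<le> y}"
      proof
        fix x assume x: "x \<in> ?R"
        obtain q0 where "y < of_rat q0" using of_rat_dense[of y "y + 1"] by auto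
        then have "x \<in> topspace X" using x less_imp_le[of y] by blast
        moreover have "g k x \<le> y"
        proof (rule ccontr)
          assume "\<not> g k x \<le> y"
          then obtain q where "y < of_rat q" "of_rat q < g k x" using of_rat_dense[of y "g k x"] by auto
          then have "g k x \<le> of_rat q" using x less_imp_le[of y] by blast
          then show False using \<open>of_rat q < g k x\<close> by linarith
        qed
        ultimately show "x \<in> {x \<in> space N. g k x \<le> y}" by (simp add: N)
      qed
    qed (auto simp: N)
    also have "\<dots> \<in> sets N"
    proof (rule sets.countable_INT')
      show "{q. y \<le> real_of_rat q} \<noteq> {}" using of_rat_dense[of y "y + 1"] by (auto intro: less_imp_le)
      have "{x \<in> topspace X. g k x \<le> of_rat q} \<in> orthants" for q
        unfolding orthants_def by (intro CollectI exI[of _ "[(k, q)]"]) auto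
      then show "(\<lambda>q. {x \<in> topspace X. g k x \<le> of_rat q}) ` {q. y \<le> of_rat q} \<subseteq> sets N"
        unfolding N by blast
    qed (rule countableI_type)
    finally show "{x \<in> space N. g k x \<le> y} \<in> sets N" .
  qed
  then have "(\<lambda>x k. g k x) \<in> measurable N (PiM UNIV (\<lambda>_. borel))"
    by (intro measurable_PiM_single') auto
  note gN = this
  have "A \<in> sets N" if "A \<in> sets B" for A
  proof -
    have "A \<in> {(\<lambda>x k. g k x) -` S \<inter> topspace X | S. S \<in> sets (PiM UNIV (\<lambda>_::nat. borel :: real measure))}"
      using that unfolding sets_borel by (subst (asm) sets_vimage_algebra2) (auto simp: space_PiM)
    then obtain S where S: "S \<in> sets (PiM UNIV (\<lambda>_::nat. borel :: real measure))" "A = (\<lambda>x k. g k x) -` S \<inter> topspace X"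
      by blast
    then show ?thesis using measurable_sets[OF gN S(1)] N by simp
  qed
  then show "sets B \<subseteq> sigma_sets (topspace X) orthants" unfolding N by blast
qed

text \<open>Dominated convergence under both Jordan parts turns the integrals of test functions into
  the values on orthants, and orthants are stable under intersection and generate the Borel
  sets.\<close>

lemma signed_measure_eqI:
  assumes \<mu>: "\<mu> \<in> signed_measures B" and \<nu>: "\<nu> \<in> signed_measures B"
    and eq: "\<And>l m. signed_integral B \<mu> (test_function l m) = signed_integral B \<nu> (test_function l m)"
  shows "\<mu> = \<nu>"
proof -
  have lim: "(\<lambda>m. signed_integral B \<mu> (test_function l m)) \<longlonglongrightarrow> \<mu> {x \<in> topspace X. \<forall>(k, q)\<in>set l. g k x \<le> of_rat q}"
    if \<mu>: "\<mu> \<in> signed_measures B" for \<mu> l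
  proof -
    let ?A = "{x \<in> topspace X. \<forall>(k, q)\<in>set l. g k x \<le> of_rat q}"
    have A: "?A \<in> sets B" unfolding sets_B_orthants orthants_def by blast
    have "(\<lambda>m. \<integral>x. test_function l m x \<partial>N) \<longlonglongrightarrow> measure N ?A" if "finite_measure N" "sets N = sets B" for N
    proof -
      interpret finite_measure N by fact
      have sp: "space N = topspace X" using sets_eq_imp_space_eq[OF that(2)] by simp
      have "(\<lambda>m. \<integral>x. test_function l m x \<partial>N) \<longlonglongrightarrow> (\<integral>x. indicator ?A x \<partial>N)"
      proof (rule integral_dominated_convergence[where w="\<lambda>_. 1"])
        show "test_function l m \<in> borel_measurable N" for m
          using bounded_continuous_test_function that(2)
          by (intro measurable_if_sets_eq[OF borel_measurable_continuous_map]) auto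
        show "AE x in N. (\<lambda>m. test_function l m x) \<longlonglongrightarrow> indicator ?A x"
        proof (rule AE_I2)
          fix x assume "x \<in> space N"
          then have "indicator ?A x = (if \<forall>(k, q)\<in>set l. g k x \<le> of_rat q then 1 else (0 :: real))"
            using sp by (simp add: indicator_def)
          then show "(\<lambda>m. test_function l m x) \<longlonglongrightarrow> indicator ?A x"
            using tendsto_test_function[of l x] by (simp only:)
        qed
      qed (use A that(2) test_function_range in auto)
      then show ?thesis using A that(2) by simp
    qed
    from tendsto_diff[OF this this] show ?thesis
      unfolding signed_integral_def jordan_decomposition[OF \<mu> A]
      using finite_measure_positive_part[OF \<mu>] finite_measure_positive_part[OF signed_measures_uminus[OF \<mu>]] by simp
  qed
  have oreq: "\<mu> A = \<nu> A" if "A \<in> orthants" for A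
    using that lim[OF \<mu>] lim[OF \<nu>] LIMSEQ_unique unfolding eq orthants_def by blast
  show ?thesis
  proof (rule signed_measures_eqI[OF \<mu> \<nu>, of orthants])
    show "Int_stable orthants"
    proof (rule Int_stableI)
      fix a b assume "a \<in> orthants" "b \<in> orthants"
      then obtain l l' :: "(nat \<times> rat) list" where "a = {x \<in> topspace X. \<forall>(k, q)\<in>set l. g k x \<le> of_rat q}"
        "b = {x \<in> topspace X. \<forall>(k, q)\<in>set l'. g k x \<le> of_rat q}"
        unfolding orthants_def by blast
      then have "a \<inter> b = {x \<in> topspace X. \<forall>(k, q)\<in>set (l @ l'). g k x \<le> of_rat q}" by auto
      then show "a \<inter> b \<in> orthants" unfolding orthants_def by blast
    qed
    have "space B = {x \<in> topspace X. \<forall>(k, q)\<in>set []. g k x \<le> of_rat q}" by simp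
    then have "space B \<in> orthants" unfolding orthants_def by blast
    then show "\<mu> (space B) = \<nu> (space B)" by (rule oreq)
  qed (use sets_B_orthants oreq in \<open>auto simp: orthants_def\<close>)
qed

sublocale weak: countably_separated "weak_star X"
  "\<lambda>j \<mu>. signed_integral B \<mu> (case_prod test_function (from_nat j))"
proof
  show "continuous_map (weak_star X) euclideanreal (\<lambda>\<mu>. signed_integral B \<mu> (case_prod test_function (from_nat j)))" for j
    unfolding case_prod_beta by (intro continuous_map_signed_integral bounded_continuous_test_function)
  fix \<mu> \<nu>
  assume \<mu>\<nu>: "\<mu> \<in> topspace (weak_star X)" "\<nu> \<in> topspace (weak_star X)"
    and eq: "\<And>j. signed_integral B \<mu> (case_prod test_function (from_nat j)) =
      signed_integral B \<nu> (case_prod test_function (from_nat j))"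
  show "\<mu> = \<nu>"
    using \<mu>\<nu> eq[of "to_nat (l :: (nat \<times> rat) list, m :: nat)" for l m] by (intro signed_measure_eqI) (auto simp: topspace_weak_star)
qed

end

section \<open>Tight families on a space with separating coordinates\<close>

lemma sequentially_compactinE:
  assumes "sequentially_compactin X K" "\<And>n. s n \<in> K"
  obtains x r where "x \<in> K" "strict_mono (r :: nat \<Rightarrow> nat)" "limitin X (s \<circ> r) x sequentially"
  using assms unfolding sequentially_compactin_def by meson

text \<open>The reverse form of Fatou's lemma for events: the tails \<open>U N\<close> decrease to
  the event that infinitely many \<open>A n\<close> occur, and each has probability at least
  \<open>c\<close>.\<close>

lemma (in prob_space) prob_limsup_ge:
  fixes A :: "nat \<Rightarrow> 'a set"
  assumes A: "\<And>n. A n \<in> events" and ge: "\<And>n. c \<le> prob (A n)"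
    and S: "S \<in> events" and sub: "AE x in M. (\<forall>N. \<exists>n\<ge>N. x \<in> A n) \<longrightarrow> x \<in> S"
  shows "c \<le> prob S"
proof -
  define U where "U N = (\<Union>n\<in>{N..}. A n)" for N :: nat
  have U: "U N \<in> events" for N using A by (auto simp: U_def)
  have "(\<lambda>N. prob (U N)) \<longlonglongrightarrow> prob (\<Inter>N. U N)"
  proof (rule finite_Lim_measure_decseq)
    show "range U \<subseteq> events" using U by blast
    show "decseq U" unfolding U_def decseq_def by (intro allI impI UN_mono) auto
  qed
  moreover have "c \<le> prob (U N)" for N
    using ge[of N] finite_measure_mono[of "A N" "U N"] U A by (force simp: U_def)
  ultimately have "c \<le> prob (\<Inter>N. U N)" by (intro LIMSEQ_le_const) auto
  also have "\<dots> \<le> prob S"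
    using sub by (intro finite_measure_mono_AE S) (auto simp: U_def)
  finally show ?thesis .
qed

text \<open>\<open>\<delta> m\<close> bounds the mass outside \<open>K m\<close>. Compactness of
  \<open>K m\<close> is asked in the sequential sense, the form in which it can be obtained from
  convergence of paths.\<close>

locale tight_family = borel_coordinates X g for X :: "'a topology" and g :: "nat \<Rightarrow> 'a \<Rightarrow> real" +
  fixes K :: "nat \<Rightarrow> 'a set" and \<delta> :: "nat \<Rightarrow> real"
  assumes K: "\<And>m. sequentially_compactin X (K m)" and \<delta>: "\<delta> \<longlonglongrightarrow> 0"
begin

lemma K_subset: "K m \<subseteq> topspace X"
  using K[of m] by (simp add: sequentially_compactin_def)

lemma closed_E_K: "closed (E ` K m)"
  using compact_image_sequentially_compactin[OF K openin_empty, of m] by (simp add: compact_imp_closed)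

lemma sets_PiM_borel: "sets (PiM UNIV (\<lambda>_::nat. borel :: real measure)) = sets borel"
  by (rule sets_PiM_equal_borel)

lemma E_K_sets [measurable]: "E ` K m \<in> sets (PiM UNIV (\<lambda>_. borel))"
  unfolding sets_PiM_borel using closed_E_K by (rule borel_closed)

lemma E_in_K_iff: "x \<in> topspace X \<Longrightarrow> E x \<in> E ` K m \<longleftrightarrow> x \<in> K m"
  using E_eqD K_subset by blast

lemma K_eq: "K m = E -` (E ` K m) \<inter> space B"
proof (rule set_eqI)
  fix x show "x \<in> K m \<longleftrightarrow> x \<in> E -` (E ` K m) \<inter> space B"
    using K_subset[of m] E_in_K_iff[of x m] by auto
qed

lemma K_sets [measurable]: "K m \<in> sets B"
  using measurable_sets[OF measurable_E E_K_sets] K_eq by metis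

definition tight_probabilities :: "'a measure set" where
  "tight_probabilities = {Q. prob_space Q \<and> sets Q = sets B \<and> (\<forall>m. 1 - \<delta> m \<le> measure Q (K m))}"

text \<open>A measurable inverse of \<open>E\<close> on the union of the compact images. The default
  \<open>x0\<close> is taken off this union, where the laws to be decoded have no mass.\<close>

definition decode :: "'a \<Rightarrow> (nat \<Rightarrow> real) \<Rightarrow> 'a" where
  "decode x0 y = (if y \<in> (\<Union>m. E ` K m) then SOME x. x \<in> (\<Union>m. K m) \<and> E x = y else x0)"

lemma decode_E:
  assumes "x \<in> K m" shows "decode x0 (E x) = x"
proof -
  have "(SOME x'. x' \<in> (\<Union>m. K m) \<and> E x' = E x) = x"
    using assms E_eqD K_subset by (intro some_equality) blast+
  then show ?thesis using assms by (auto simp: decode_def)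
qed

lemma decode_in_topspace:
  assumes "x0 \<in> topspace X" shows "decode x0 y \<in> topspace X"
proof (cases "y \<in> (\<Union>m. E ` K m)")
  case True
  then obtain m x where "x \<in> K m" "y = E x" by blast
  then show ?thesis using decode_E[of x m x0] K_subset[of m] by auto
qed (use assms in \<open>simp add: decode_def\<close>)

text \<open>On the images of the compact sets, coordinate \<open>k\<close> of the decoded point is
  the entry \<open>y k\<close> itself, so the coordinates of \<open>decode x0\<close> are measurable
  although the map is defined by choice.\<close>

lemma measurable_decode:
  assumes x0: "x0 \<in> topspace X"
  shows "decode x0 \<in> measurable (PiM UNIV (\<lambda>_. borel)) B"
proof (rule measurable_into_B)
  show "decode x0 \<in> space (PiM UNIV (\<lambda>_. borel)) \<rightarrow> topspace X"
    using decode_in_topspace[OF x0] by simp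
  fix k
  have "g k (decode x0 y) = (if y \<in> (\<Union>m. E ` K m) then y k else g k x0)" for y
  proof (cases "y \<in> (\<Union>m. E ` K m)")
    case True
    then obtain m x where "x \<in> K m" "y = E x" by blast
    then show ?thesis using decode_E[of x m x0] by (auto simp: E_def)
  qed (simp add: decode_def)
  then show "(\<lambda>y. g k (decode x0 y)) \<in> borel_measurable (PiM UNIV (\<lambda>_. borel))"
    by simp
qed

text \<open>An injective continuous map on a sequentially compact set has a continuous inverse:
  every subsequence of decoded points has a further one with some limit \<open>z\<close>, and
  \<open>E z = l\<close> determines \<open>z\<close>.\<close>

lemma decode_tendsto:
  assumes y: "y \<longlonglongrightarrow> l" and inK: "\<And>n. y n \<in> E ` K m" and f: "continuous_map X euclideanreal f"
  shows "l \<in> E ` K m" "(\<lambda>n. f (decode x0 (y n))) \<longlonglongrightarrow> f (decode x0 l)"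
proof -
  show l: "l \<in> E ` K m"
    using closed_sequentially[OF closed_E_K, of y m l] y inK by blast
  show "(\<lambda>n. f (decode x0 (y n))) \<longlonglongrightarrow> f (decode x0 l)"
  proof (rule tendsto_subsubseq)
    fix r :: "nat \<Rightarrow> nat" assume r: "strict_mono r"
    have dK: "decode x0 (y n) \<in> K m \<and> E (decode x0 (y n)) = y n" for n
      using inK[of n] decode_E by auto
    then have "decode x0 (y (r n)) \<in> K m" for n by blast
    from sequentially_compactinE[OF K this]
    obtain z q where z: "z \<in> K m" "strict_mono q" "limitin X ((\<lambda>n. decode x0 (y (r n))) \<circ> q) z sequentially" .
    have "(\<lambda>n. y (r (q n))) \<longlonglongrightarrow> E z" using tendsto_E[OF z(3)] dK by (simp add: comp_def)
    moreover have "(\<lambda>n. y (r (q n))) \<longlonglongrightarrow> l"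
      using LIMSEQ_subseq_LIMSEQ[OF y strict_mono_o[OF r z(2)]] by (simp add: comp_def)
    ultimately have "E z = l" by (rule LIMSEQ_unique)
    then have "decode x0 l = z" using decode_E[OF z(1)] by blast
    then show "\<exists>q. strict_mono q \<and> ((\<lambda>n. f (decode x0 (y n))) \<circ> r \<circ> q) \<longlonglongrightarrow> f (decode x0 l)"
      using z(2) continuous_map_real_limitin[OF f z(3)] by (auto simp: comp_def)
  qed
qed

text \<open>A random sequence need not stay in one \<open>K m\<close>. The terms outside are
  switched off by an indicator here; in the application each of them is outside with probability at
  most \<open>\<delta> m\<close>.\<close>

lemma decode_tendsto_frequently:
  assumes y: "y \<longlonglongrightarrow> l" and f: "continuous_map X euclideanreal f"
  shows "\<forall>N. \<exists>n\<ge>N. y n \<in> E ` K m \<Longrightarrow> l \<in> E ` K m"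
    and "(\<lambda>n. (f (decode x0 (y n)) - f (decode x0 l)) * indicator (E ` K m) (y n)) \<longlonglongrightarrow> 0"
proof -
  have enum: "\<exists>q :: nat \<Rightarrow> nat. strict_mono q \<and> (\<forall>n. y (r (q n)) \<in> E ` K m)"
    if "\<forall>N. \<exists>n\<ge>N. y (r n) \<in> E ` K m" for r :: "nat \<Rightarrow> nat"
  proof -
    have "infinite {n. y (r n) \<in> E ` K m}"
      using that by (auto simp: infinite_nat_iff_unbounded_le)
    from infinite_enumerate[OF this] show ?thesis by simp
  qed
  show "l \<in> E ` K m" if hyp: "\<forall>N. \<exists>n\<ge>N. y n \<in> E ` K m"
  proof -
    obtain q :: "nat \<Rightarrow> nat" where q: "strict_mono q" "\<And>n. y (q n) \<in> E ` K m"
      using enum[of "\<lambda>n. n", OF hyp] by blast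
    then show ?thesis using decode_tendsto(1)[OF LIMSEQ_subseq_LIMSEQ[OF y q(1)], of m f] f by simp
  qed
  show "(\<lambda>n. (f (decode x0 (y n)) - f (decode x0 l)) * indicator (E ` K m) (y n)) \<longlonglongrightarrow> 0"
  proof (rule tendsto_subsubseq)
    fix r :: "nat \<Rightarrow> nat" assume r: "strict_mono r"
    show "\<exists>q. strict_mono q \<and> ((\<lambda>n. (f (decode x0 (y n)) - f (decode x0 l)) * indicator (E ` K m) (y n)) \<circ> r \<circ> q) \<longlonglongrightarrow> 0"
    proof (cases "\<forall>N. \<exists>n\<ge>N. y (r n) \<in> E ` K m")
      case True
      then obtain q :: "nat \<Rightarrow> nat" where q: "strict_mono q" "\<And>n. y (r (q n)) \<in> E ` K m" using enum by blast
      have "(\<lambda>n. f (decode x0 (y (r (q n)))) - f (decode x0 l)) \<longlonglongrightarrow> 0"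
        using decode_tendsto(2)[OF LIMSEQ_subseq_LIMSEQ[OF y strict_mono_o[OF r q(1)]], of m f x0] q(2) f
        by (intro LIM_zero) (simp add: comp_def)
      then have "((\<lambda>n. (f (decode x0 (y n)) - f (decode x0 l)) * indicator (E ` K m) (y n)) \<circ> r \<circ> q) \<longlonglongrightarrow> 0"
        using q(2) by (simp add: comp_def)
      then show ?thesis using q(1) by blast
    next
      case False
      then obtain N where "\<And>n. n \<ge> N \<Longrightarrow> y (r n) \<notin> E ` K m" by blast
      then have "((\<lambda>n. (f (decode x0 (y n)) - f (decode x0 l)) * indicator (E ` K m) (y n)) \<circ> r \<circ> id) \<longlonglongrightarrow> 0"
        by (intro tendsto_eventually eventually_sequentiallyI[of N]) simp
      then show ?thesis using strict_mono_id by blast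
    qed
  qed
qed

text \<open>The laws of \<open>E\<close> are realised by almost surely convergent random sequences,
  and the limit is decoded. No mass is lost since the image of \<open>K m\<close> is closed: a
  convergent sequence that visits it infinitely often ends in it. For convergence of integrals,
  \<open>m\<close> is fixed first; on the image of \<open>K m\<close> dominated convergence applies,
  and off it the error is at most \<open>2 * b * \<delta> m\<close>.\<close>

proposition prokhorov:
  assumes Q: "\<And>n. Q n \<in> tight_probabilities"
  obtains r :: "nat \<Rightarrow> nat" and Q' where "strict_mono r" "Q' \<in> tight_probabilities"
    "\<And>f. bounded_continuous X f \<Longrightarrow> (\<lambda>n. \<integral>x. f x \<partial>Q (r n)) \<longlonglongrightarrow> (\<integral>x. f x \<partial>Q')"
proof -
  let ?\<Pi> = "PiM UNIV (\<lambda>_::nat. borel :: real measure)"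
  have Qp: "prob_space (Q n)" and Qs: "sets (Q n) = sets B" and QK: "1 - \<delta> m \<le> measure (Q n) (K m)" for n m
    using Q[of n] by (auto simp: tight_probabilities_def)
  have sp: "space (Q n) = topspace X" for n using sets_eq_imp_space_eq[OF Qs[of n]] by simp
  have EQ: "E \<in> measurable (Q n) ?\<Pi>" for n by (rule measurable_if_sets_eq[OF measurable_E Qs])
  have "topspace X \<noteq> {}" using prob_space.not_empty[OF Qp] sp by blast
  then obtain x0 where x0: "x0 \<in> topspace X" by blast
  note [measurable] = measurable_decode[OF x0]
  obtain r :: "nat \<Rightarrow> nat" and P :: "real measure" and u :: "nat \<Rightarrow> nat \<Rightarrow> real \<Rightarrow> real"
    where r: "strict_mono r" and P: "prob_space P" and u [measurable]: "\<And>n k. u n k \<in> borel_measurable P"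
    and law: "\<And>n. distr P ?\<Pi> (\<lambda>\<omega> k. u n k \<omega>) = distr (Q (r n)) ?\<Pi> (\<lambda>x k. g k x)"
    and conv: "AE \<omega> in P. \<forall>k. convergent (\<lambda>n. u n k \<omega>)"
    using skorokhod_representation_sequences[of Q g, OF Qp measurable_if_sets_eq[OF measurable_g Qs] g_range]
    by blast
  interpret P: prob_space P by (rule P)
  define V where "V n \<omega> = (\<lambda>k. u n k \<omega>)" for n \<omega>
  define V' where "V' \<omega> = (\<lambda>k. lim (\<lambda>n. u n k \<omega>))" for \<omega>
  have V [measurable]: "V n \<in> measurable P ?\<Pi>" for n
    unfolding V_def by (intro measurable_PiM_single') auto
  have V' [measurable]: "V' \<in> measurable P ?\<Pi>"
    unfolding V'_def by (intro measurable_PiM_single') auto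
  have lawE: "distr P ?\<Pi> (V n) = distr (Q (r n)) ?\<Pi> E" for n
    using law[of n] by (simp add: V_def[abs_def] E_def[abs_def])
  have convV: "AE \<omega> in P. (\<lambda>n. V n \<omega>) \<longlonglongrightarrow> V' \<omega>"
    using conv by (rule AE_mp)
      (auto simp: tendsto_componentwise_iff_fun V_def V'_def convergent_LIMSEQ_iff)
  have PV: "P.prob (V n -` (E ` K m) \<inter> space P) \<ge> 1 - \<delta> m" for n m
  proof -
    have "P.prob (V n -` (E ` K m) \<inter> space P) = measure (distr P ?\<Pi> (V n)) (E ` K m)"
      by (simp add: measure_distr)
    also have "\<dots> = measure (Q (r n)) (E -` (E ` K m) \<inter> space (Q (r n)))"
      unfolding lawE by (simp add: measure_distr[OF EQ])
    also have "E -` (E ` K m) \<inter> space (Q (r n)) = K m" using K_eq sp by auto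
    finally show ?thesis using QK by simp
  qed
  have PV': "P.prob (V' -` (E ` K m) \<inter> space P) \<ge> 1 - \<delta> m" for m
  proof (rule P.prob_limsup_ge[OF _ PV])
    show "AE \<omega> in P. (\<forall>N. \<exists>n\<ge>N. \<omega> \<in> V n -` (E ` K m) \<inter> space P) \<longrightarrow> \<omega> \<in> V' -` (E ` K m) \<inter> space P"
      using convV
    proof (rule AE_mp, intro AE_I2 impI)
      fix \<omega> assume "\<omega> \<in> space P" "(\<lambda>n. V n \<omega>) \<longlonglongrightarrow> V' \<omega>" "\<forall>N. \<exists>n\<ge>N. \<omega> \<in> V n -` (E ` K m) \<inter> space P"
      then show "\<omega> \<in> V' -` (E ` K m) \<inter> space P"
        using decode_tendsto_frequently(1)[of "\<lambda>n. V n \<omega>" "V' \<omega>" "\<lambda>_. 0" m] by auto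
    qed
  qed (simp_all add: measurable_sets)
  define Q' where "Q' = distr P B (\<lambda>\<omega>. decode x0 (V' \<omega>))"
  have Q': "Q' \<in> tight_probabilities"
    unfolding tight_probabilities_def
  proof (intro CollectI conjI allI)
    show "prob_space Q'" unfolding Q'_def by (rule P.prob_space_distr) measurable
    fix m
    have "1 - \<delta> m \<le> P.prob (V' -` (E ` K m) \<inter> space P)" by (rule PV')
    also have "\<dots> \<le> P.prob ((\<lambda>\<omega>. decode x0 (V' \<omega>)) -` K m \<inter> space P)"
      using decode_E by (intro P.finite_measure_mono measurable_sets[of _ _ B] K_sets) auto
    also have "\<dots> = measure Q' (K m)" by (simp add: Q'_def measure_distr)
    finally show "1 - \<delta> m \<le> measure Q' (K m)" .
  qed (simp add: Q'_def)
  show thesis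
  proof (rule that[OF r Q'])
    fix f assume f: "bounded_continuous X f"
    then obtain b where b: "0 \<le> b" "\<And>x. x \<in> topspace X \<Longrightarrow> \<bar>f x\<bar> \<le> b"       using bounded_continuousE by blast
    have fm [measurable]: "f \<in> borel_measurable B" using f by (intro borel_measurable_continuous_map) simp
    have fd: "\<bar>f (decode x0 y)\<bar> \<le> b" for y using b(2) decode_in_topspace[OF x0] by blast
    have int: "(\<integral>x. f x \<partial>Q (r n)) = (\<integral>\<omega>. f (decode x0 (V n \<omega>)) \<partial>P)" for n
    proof -
      interpret Qn: prob_space "Q (r n)" by (rule Qp)
      have "AE x in Q (r n). x \<in> (\<Union>m. K m)"
      proof (rule Qn.AE_prob_1, rule antisym)
        have "(\<lambda>m. 1 - \<delta> m) \<longlonglongrightarrow> 1 - 0" by (intro tendsto_intros \<delta>)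
        moreover have "1 - \<delta> m \<le> Qn.prob (\<Union>m. K m)" for m
          using QK[of m "r n"] Qn.finite_measure_mono[of "K m" "\<Union>m. K m"] Qs[of "r n"] by force
        ultimately show "1 \<le> Qn.prob (\<Union>m. K m)" by (intro LIMSEQ_le_const2) auto
      qed simp
      then have "(\<integral>x. f x \<partial>Q (r n)) = (\<integral>x. f (decode x0 (E x)) \<partial>Q (r n))"
        using decode_E EQ fm measurable_if_sets_eq[OF fm Qs]
        by (intro integral_cong_AE) (auto intro!: measurable_compose[OF EQ])
      also have "\<dots> = (\<integral>y. f (decode x0 y) \<partial>distr (Q (r n)) ?\<Pi> E)"
        using EQ by (subst integral_distr) auto
      also have "\<dots> = (\<integral>\<omega>. f (decode x0 (V n \<omega>)) \<partial>P)"
        unfolding lawE[symmetric] by (subst integral_distr) auto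
      finally show ?thesis .
    qed
    have int': "(\<integral>x. f x \<partial>Q') = (\<integral>\<omega>. f (decode x0 (V' \<omega>)) \<partial>P)"
      unfolding Q'_def by (subst integral_distr) auto
    have intV: "integrable P (\<lambda>\<omega>. f (decode x0 (V n \<omega>)))" and intV': "integrable P (\<lambda>\<omega>. f (decode x0 (V' \<omega>)))" for n
      using fd by (auto intro!: P.integrable_const_bound[of _ b])
    show "(\<lambda>n. \<integral>x. f x \<partial>Q (r n)) \<longlonglongrightarrow> (\<integral>x. f x \<partial>Q')"
      unfolding int int'
    proof (rule tendstoI)
      fix e :: real assume e: "e > 0"
      have "(\<lambda>m. 2 * b * \<delta> m) \<longlonglongrightarrow> 2 * b * 0" by (intro tendsto_intros \<delta>)
      then have "\<forall>\<^sub>F m in sequentially. 2 * b * \<delta> m < e / 2" using e by (intro order_tendstoD) auto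
      then obtain m where m: "2 * b * \<delta> m < e / 2" by (meson eventually_sequentially order_refl)
      let ?D = "\<lambda>n \<omega>. f (decode x0 (V n \<omega>)) - f (decode x0 (V' \<omega>))"
      let ?I = "\<lambda>n \<omega>. indicator (E ` K m) (V n \<omega>) :: real"
      have Dle: "\<bar>?D n \<omega>\<bar> \<le> 2 * b" for n \<omega>
        using fd[of "V n \<omega>"] fd[of "V' \<omega>"] by linarith
      have Im [measurable]: "?I n \<in> borel_measurable P" for n by measurable
      have intDI: "integrable P (\<lambda>\<omega>. ?D n \<omega> * ?I n \<omega>)" for n
        using Dle[of n] b(1) by (intro P.integrable_const_bound[of _ "2 * b"]) (auto simp: abs_mult indicator_def)
      have "(\<lambda>n. \<integral>\<omega>. ?D n \<omega> * ?I n \<omega> \<partial>P) \<longlonglongrightarrow> (\<integral>\<omega>. 0 \<partial>P)"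
      proof (rule integral_dominated_convergence[where w="\<lambda>_. 2 * b"])
        show "AE \<omega> in P. (\<lambda>n. ?D n \<omega> * ?I n \<omega>) \<longlonglongrightarrow> 0"
          using convV by (rule AE_mp) (use decode_tendsto_frequently(2) f in \<open>auto intro!: AE_I2\<close>)
        show "AE \<omega> in P. norm (?D n \<omega> * ?I n \<omega>) \<le> 2 * b" for n
          using Dle[of n] b(1) by (intro AE_I2) (auto simp: abs_mult indicator_def)
      qed auto
      then have "\<forall>\<^sub>F n in sequentially. \<bar>\<integral>\<omega>. ?D n \<omega> * ?I n \<omega> \<partial>P\<bar> < e / 2"
        using e tendstoD[of "\<lambda>n. \<integral>\<omega>. ?D n \<omega> * ?I n \<omega> \<partial>P" 0 sequentially "e / 2"] by (simp add: dist_real_def)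
      then show "\<forall>\<^sub>F n in sequentially. dist (\<integral>\<omega>. f (decode x0 (V n \<omega>)) \<partial>P) (\<integral>\<omega>. f (decode x0 (V' \<omega>)) \<partial>P) < e"
      proof (rule eventually_mono)
        fix n assume n: "\<bar>\<integral>\<omega>. ?D n \<omega> * ?I n \<omega> \<partial>P\<bar> < e / 2"
        have "(\<integral>\<omega>. ?D n \<omega> \<partial>P) = (\<integral>\<omega>. ?D n \<omega> * ?I n \<omega> + ?D n \<omega> * (1 - ?I n \<omega>) \<partial>P)"
          by (intro Bochner_Integration.integral_cong) (auto simp: algebra_simps)
        also have "\<dots> = (\<integral>\<omega>. ?D n \<omega> * ?I n \<omega> \<partial>P) + (\<integral>\<omega>. ?D n \<omega> * (1 - ?I n \<omega>) \<partial>P)"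
          using Dle[of n] b(1) by (intro Bochner_Integration.integral_add intDI P.integrable_const_bound[of _ "2 * b"])
            (auto simp: abs_mult indicator_def)
        finally have split: "(\<integral>\<omega>. ?D n \<omega> \<partial>P) = (\<integral>\<omega>. ?D n \<omega> * ?I n \<omega> \<partial>P) + (\<integral>\<omega>. ?D n \<omega> * (1 - ?I n \<omega>) \<partial>P)" .
        have "\<bar>\<integral>\<omega>. ?D n \<omega> * (1 - ?I n \<omega>) \<partial>P\<bar> \<le> (\<integral>\<omega>. 2 * b * (1 - ?I n \<omega>) \<partial>P)"
          using Dle[of n] b(1)
          by (intro integral_abs_bound_integral P.integrable_const_bound[of _ "2 * b"])
            (auto simp: abs_mult indicator_def)
        also have "\<dots> = 2 * b * (1 - P.prob (V n -` (E ` K m) \<inter> space P))"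
        proof -
          have "(\<integral>\<omega>. ?I n \<omega> \<partial>P) = (\<integral>\<omega>. indicator (V n -` (E ` K m) \<inter> space P) \<omega> \<partial>P)"
            by (intro Bochner_Integration.integral_cong) (auto simp: indicator_def)
          also have "\<dots> = P.prob (V n -` (E ` K m) \<inter> space P)" by simp
          finally have I: "(\<integral>\<omega>. ?I n \<omega> \<partial>P) = P.prob (V n -` (E ` K m) \<inter> space P)" .
          have "integrable P (?I n)" by (intro P.integrable_const_bound[of _ 1]) auto
          then show ?thesis using I by (simp add: P.prob_space)
        qed
        also have "\<dots> \<le> 2 * b * \<delta> m" using PV[of m n] b(1) by (intro mult_left_mono) auto
        finally have "\<bar>\<integral>\<omega>. ?D n \<omega> \<partial>P\<bar> < e" using n m split by linarith
        then show "dist (\<integral>\<omega>. f (decode x0 (V n \<omega>)) \<partial>P) (\<integral>\<omega>. f (decode x0 (V' \<omega>)) \<partial>P) < e"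
          using intV[of n] intV' by (simp add: dist_real_def)
      qed
    qed
  qed
qed

lemma signed_integral_tight:
  assumes "Q \<in> tight_probabilities" "bounded_continuous X f"
  shows "signed_integral B (measure Q) f = (\<integral>x. f x \<partial>Q)"
proof -
  obtain b where "0 \<le> b" "\<And>x. x \<in> topspace X \<Longrightarrow> \<bar>f x\<bar> \<le> b" using bounded_continuousE[OF assms(2)] by blast
  then show ?thesis
    using assms by (intro signed_integral_measure[of _ _ _ b] borel_measurable_continuous_map)
      (auto simp: tight_probabilities_def prob_space_def)
qed

lemma measure_tight: "Q \<in> tight_probabilities \<Longrightarrow> measure Q \<in> signed_measures B"
  by (auto simp: tight_probabilities_def prob_space_def intro!: measure_signed_measures)

lemma sequentially_compactin_tight: "sequentially_compactin (weak_star X) (measure ` tight_probabilities)"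
  unfolding sequentially_compactin_def
proof (intro conjI allI impI)
  show "measure ` tight_probabilities \<subseteq> topspace (weak_star X)"
    using measure_tight by (auto simp: topspace_weak_star)
  fix s :: "nat \<Rightarrow> 'a set \<Rightarrow> real" assume "\<forall>n. s n \<in> measure ` tight_probabilities"
  then have "\<exists>Q. \<forall>n. Q n \<in> tight_probabilities \<and> s n = measure (Q n)" by (intro choice) auto
  then obtain Q where Q: "\<And>n. Q n \<in> tight_probabilities" "\<And>n. s n = measure (Q n)" by blast
  obtain r :: "nat \<Rightarrow> nat" and Q' where r: "strict_mono r" "Q' \<in> tight_probabilities"
    "\<And>f. bounded_continuous X f \<Longrightarrow> (\<lambda>n. \<integral>x. f x \<partial>Q (r n)) \<longlonglongrightarrow> (\<integral>x. f x \<partial>Q')"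
    by (rule prokhorov[of Q, OF Q(1)]) blast
  have "limitin (weak_star X) (s \<circ> r) (measure Q') sequentially"
    using Q r measure_tight signed_integral_tight by (intro limitin_weak_starI) auto
  then show "\<exists>x\<in>measure ` tight_probabilities. \<exists>r. strict_mono r \<and> limitin (weak_star X) (s \<circ> r) x sequentially"
    using r by blast
qed

text \<open>Membership in the closure is unfolded into convergence of integrals along a sequence
  from the family, the form in which a limit law is examined later. That a limit is again a
  probability measure comes from the sequential compactness of the whole tight set, rather than from
  a representation theorem for functionals.\<close>

theorem weak_star_compactness:
  assumes \<Q>: "\<Q> \<subseteq> tight_probabilities"
  shows "compactin (weak_star X) (sequential_closure (weak_star X) (measure ` \<Q>))"
    and "sequentially_compactin (weak_star X) (sequential_closure (weak_star X) (measure ` \<Q>))"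
    and "\<mu> \<in> sequential_closure (weak_star X) (measure ` \<Q>) \<Longrightarrow>
      \<exists>Q Qs. prob_space Q \<and> sets Q = sets B \<and> \<mu> = measure Q \<and> (\<forall>n. Qs n \<in> \<Q>) \<and>
        (\<forall>f. bounded_continuous X f \<longrightarrow> (\<lambda>n. \<integral>x. f x \<partial>Qs n) \<longlonglongrightarrow> (\<integral>x. f x \<partial>Q))"
proof -
  have sub: "measure ` \<Q> \<subseteq> measure ` tight_probabilities" using \<Q> by blast
  show seq: "sequentially_compactin (weak_star X) (sequential_closure (weak_star X) (measure ` \<Q>))"
    using sequentially_compactin_tight sub by (rule weak.sequentially_compactin_sequential_closure)
  then show "compactin (weak_star X) (sequential_closure (weak_star X) (measure ` \<Q>))"
    by (rule weak.compactin_if_sequentially_compactin)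
  assume \<mu>: "\<mu> \<in> sequential_closure (weak_star X) (measure ` \<Q>)"
  then obtain s where s: "\<And>n. s n \<in> measure ` \<Q>" "limitin (weak_star X) s \<mu> sequentially"
    unfolding sequential_closure_def by blast
  from s(1) have "\<exists>Q. \<forall>n. Q n \<in> \<Q> \<and> s n = measure (Q n)" by (intro choice) blast
  then obtain Qs where Qs: "\<And>n. Qs n \<in> \<Q>" "\<And>n. s n = measure (Qs n)" by blast
  obtain Q where Q: "Q \<in> tight_probabilities" "\<mu> = measure Q"
    using weak.sequential_closure_subset[OF sequentially_compactin_tight sub] \<mu> by blast
  have "(\<lambda>n. \<integral>x. f x \<partial>Qs n) \<longlonglongrightarrow> (\<integral>x. f x \<partial>Q)" if f: "bounded_continuous X f" for f
  proof -
    have "signed_integral B (s n) f = (\<integral>x. f x \<partial>Qs n)" for n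
      using signed_integral_tight[OF _ f, of "Qs n"] Qs \<Q> by auto
    then show ?thesis
      using continuous_map_real_limitin[OF continuous_map_signed_integral[OF f] s(2)]
        signed_integral_tight[OF Q(1) f] Q(2) by simp
  qed
  then show "\<exists>Q Qs. prob_space Q \<and> sets Q = sets B \<and> \<mu> = measure Q \<and> (\<forall>n. Qs n \<in> \<Q>) \<and>
        (\<forall>f. bounded_continuous X f \<longrightarrow> (\<lambda>n. \<integral>x. f x \<partial>Qs n) \<longlonglongrightarrow> (\<integral>x. f x \<partial>Q))"
    using Q Qs(1) by (intro exI[of _ Q] exI[of _ Qs]) (auto simp: tight_probabilities_def)
qed

end

section \<open>Paths with few oscillations\<close>

text \<open>Jump heights \<open>c k\<close> at times \<open>\<tau> k\<close>, which may repeat and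
  come in any order. Times are extended reals so that a jump may move off to infinity along a
  sequence.\<close>

definition step_function :: "nat \<Rightarrow> (nat \<Rightarrow> real) \<Rightarrow> (nat \<Rightarrow> ereal) \<Rightarrow> real \<Rightarrow> real" where
  "step_function N c \<tau> t = (\<Sum>k<N. if \<tau> k \<le> ereal t then c k else 0)"

lemma step_function_right_continuous:
  "(step_function N c \<tau> \<longlongrightarrow> step_function N c \<tau> t) (at_right t)"
  unfolding step_function_def
proof (rule tendsto_sum)
  fix k
  show "((\<lambda>s. if \<tau> k \<le> ereal s then c k else 0) \<longlongrightarrow> (if \<tau> k \<le> ereal t then c k else 0)) (at_right t)"
  proof (cases "\<tau> k \<le> ereal t")
    case True
    then have "\<tau> k \<le> ereal s" if "s > t" for s
      using that by (meson ereal_less_eq(3) less_imp_le order_trans)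
    then show ?thesis using True
      by (intro tendsto_eventually) (auto simp: eventually_at_filter)
  next
    case False
    then have "ereal t < \<tau> k" by simp
    then obtain b where b: "t < b" "ereal b < \<tau> k" using ereal_dense2 by fastforce
    then have "\<forall>\<^sub>F s in at_right t. \<not> \<tau> k \<le> ereal s"
      unfolding eventually_at_right_field by (intro exI[of _ b]) (auto simp: not_le intro: order.strict_trans[of "ereal _" "ereal b"])
    then show ?thesis using False by (auto intro!: tendsto_eventually elim: eventually_mono)
  qed
qed

lemma step_function_left_limit:
  "(step_function N c \<tau> \<longlongrightarrow> (\<Sum>k<N. if \<tau> k < ereal t then c k else 0)) (at_left t)"
  unfolding step_function_def
proof (rule tendsto_sum)
  fix k
  show "((\<lambda>s. if \<tau> k \<le> ereal s then c k else 0) \<longlongrightarrow> (if \<tau> k < ereal t then c k else 0)) (at_left t)"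
  proof (cases "\<tau> k < ereal t")
    case True
    then obtain b where b: "b < t" "\<tau> k < ereal b" using ereal_dense2[of "\<tau> k" "ereal t"] by auto
    then have "\<forall>\<^sub>F s in at_left t. \<tau> k \<le> ereal s"
      unfolding eventually_at_left_field
      by (intro exI[of _ b]) (auto intro!: less_imp_le intro: less_trans)
    then show ?thesis using True by (auto intro!: tendsto_eventually elim: eventually_mono)
  next
    case False
    then have "\<not> \<tau> k \<le> ereal s" if "s < t" for s
      using that by (meson ereal_less(2) less_ereal.simps(1) not_le order_le_less_trans)
    then show ?thesis using False
      by (intro tendsto_eventually) (auto simp: eventually_at_filter)
  qed
qed

text \<open>Each jump indicator is nondecreasing in time and varies by at most 1, so the sum of the
  absolute heights bounds the variation.\<close>

lemma finite_variation_step_function: "finite_variation T (step_function N c \<tau>)"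
  unfolding finite_variation_def
proof (intro conjI ballI exI allI impI)
  fix t
  show "(step_function N c \<tau> \<longlongrightarrow> step_function N c \<tau> t) (at t within {t<..T})"
    by (rule tendsto_within_subset[OF step_function_right_continuous]) auto
next
  fix n and p :: "nat \<Rightarrow> real"
  assume p: "(\<forall>k\<le>n. p k \<in> {0..T}) \<and> (\<forall>k<n. p k \<le> p (Suc k))"
  define I :: "nat \<Rightarrow> nat \<Rightarrow> real" where "I k j = (if \<tau> k \<le> ereal (p j) then 1 else 0)" for k j
  have sf: "step_function N c \<tau> (p j) = (\<Sum>k<N. c k * I k j)" for j
    unfolding step_function_def I_def by (intro sum.cong) auto
  have I: "I k j \<le> I k (Suc j)" if "j < n" for k j
  proof -
    have "ereal (p j) \<le> ereal (p (Suc j))" using p that by simp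
    then show ?thesis unfolding I_def using order_trans by fastforce
  qed
  have "(\<Sum>j<n. \<bar>step_function N c \<tau> (p (Suc j)) - step_function N c \<tau> (p j)\<bar>) \<le> (\<Sum>j<n. \<Sum>k<N. \<bar>c k\<bar> * (I k (Suc j) - I k j))"
  proof (rule sum_mono)
    fix j assume "j \<in> {..<n}"
    then have "\<bar>\<Sum>k<N. c k * (I k (Suc j) - I k j)\<bar> \<le> (\<Sum>k<N. \<bar>c k\<bar> * (I k (Suc j) - I k j))"
      using I[of j] by (intro order_trans[OF sum_abs] sum_mono) (simp add: abs_mult)
    then show "\<bar>step_function N c \<tau> (p (Suc j)) - step_function N c \<tau> (p j)\<bar> \<le> (\<Sum>k<N. \<bar>c k\<bar> * (I k (Suc j) - I k j))"
      by (simp add: sf sum_subtractf[symmetric] right_diff_distrib)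
  qed
  also have "\<dots> = (\<Sum>k<N. \<bar>c k\<bar> * (\<Sum>j<n. I k (Suc j) - I k j))"
    by (subst sum.swap) (simp add: sum_distrib_left)
  also have "\<dots> \<le> (\<Sum>k<N. \<bar>c k\<bar>)"
  proof (rule sum_mono)
    fix k
    have "(\<Sum>j<n. I k (Suc j) - I k j) = I k n - I k 0" by (rule sum_lessThan_telescope)
    also have "\<dots> \<le> 1" by (simp add: I_def)
    finally have "(\<Sum>j<n. I k (Suc j) - I k j) \<le> 1" .
    then show "\<bar>c k\<bar> * (\<Sum>j<n. I k (Suc j) - I k j) \<le> \<bar>c k\<bar>" by (simp add: mult_left_le)
  qed
  finally show "(\<Sum>j<n. \<bar>step_function N c \<tau> (p (Suc j)) - step_function N c \<tau> (p j)\<bar>) \<le> (\<Sum>k<N. \<bar>c k\<bar>)" .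
qed

lemma sets_restrict_borel_initial:
  fixes T :: real
  shows "sets (restrict_space borel {0..T}) = sigma_sets {0..T} (range (\<lambda>a. {0..T} \<inter> {..a}))"
proof -
  have "sets (restrict_space borel {0..T}) = (\<inter>) {0..T} ` sigma_sets UNIV (range atMost)"
    by (simp add: sets_restrict_space borel_eq_atMost)
  also have "\<dots> = sigma_sets {0..T} ((\<inter>) {0..T} ` range atMost)"
  proof (rule sigma_sets_Int)
    have "sets borel = sigma_sets UNIV (range (atMost :: real \<Rightarrow> _))" by (simp add: borel_eq_atMost)
    then show "{0..T} \<in> sigma_sets UNIV (range atMost)" using closed_atLeastAtMost borel_closed by metis
  qed simp
  finally show ?thesis by (simp add: image_image)
qed

lemma signed_measures_diff:
  assumes \<mu>: "\<mu> \<in> signed_measures B" and \<nu>: "\<nu> \<in> signed_measures B"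
  shows "(\<lambda>A. \<mu> A - \<nu> A) \<in> signed_measures B"
proof -
  let ?S = "\<lambda>\<mu>. {(\<Sum>A\<in>P. \<bar>\<mu> A\<bar>) | P. finite P \<and> P \<subseteq> sets B \<and> disjoint P}"
  have "bdd_above (?S \<mu>)" "bdd_above (?S \<nu>)" using \<mu> \<nu> by (simp_all add: signed_measures_def)
  obtain a where "\<forall>x\<in>?S \<mu>. x \<le> a" using \<open>bdd_above (?S \<mu>)\<close> unfolding bdd_above_def by (rule exE)
  then have a: "x \<le> a" if "x \<in> ?S \<mu>" for x using that by (rule bspec)
  obtain b where "\<forall>x\<in>?S \<nu>. x \<le> b" using \<open>bdd_above (?S \<nu>)\<close> unfolding bdd_above_def by (rule exE)
  then have b: "x \<le> b" if "x \<in> ?S \<nu>" for x using that by (rule bspec)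
  have "bdd_above (?S (\<lambda>A. \<mu> A - \<nu> A))"
  proof (rule bdd_aboveI)
    fix x assume "x \<in> ?S (\<lambda>A. \<mu> A - \<nu> A)"
    then obtain P where P: "finite P" "P \<subseteq> sets B" "disjoint P" "x = (\<Sum>A\<in>P. \<bar>\<mu> A - \<nu> A\<bar>)" by blast
    have "x \<le> (\<Sum>A\<in>P. \<bar>\<mu> A\<bar>) + (\<Sum>A\<in>P. \<bar>\<nu> A\<bar>)"
      unfolding P(4) sum.distrib[symmetric] by (intro sum_mono) linarith
    also have "\<dots> \<le> a + b" using P by (intro add_mono a b) auto
    finally show "x \<le> a + b" .
  qed
  then show ?thesis using \<mu> \<nu> by (simp add: signed_measures_def sums_diff)
qed

text \<open>\<open>stieltjes_measure\<close> is a definite description, so existence and uniqueness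
  both have to be supplied. The measure is a sum of point masses \<open>c k\<close> at
  \<open>\<tau> k\<close>, with positive heights in \<open>P 1\<close> and negative ones in
  \<open>P (- 1)\<close>; uniqueness holds because initial intervals are stable under intersection
  and generate the Borel sets of \<open>{0..T}\<close>.\<close>

lemma stieltjes_integral_step_function:
  assumes T: "T > 0" and \<tau>: "\<And>k. k < N \<Longrightarrow> 0 \<le> \<tau> k" and f: "continuous_on {0..T} f"
  shows "stieltjes_integral T (step_function N c \<tau>) f =
    (\<Sum>k<N. if \<tau> k \<le> ereal T then c k * f (real_of_ereal (\<tau> k)) else 0)"
proof -
  let ?B = "restrict_space borel {0..T}"
  define J where "J = {k. k < N \<and> \<tau> k \<le> ereal T}"
  define \<theta> where "\<theta> k = real_of_ereal (\<tau> k)" for k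
  define P where "P s = distr (point_measure J (\<lambda>k. ennreal (max 0 (s * c k)))) ?B \<theta>" for s :: real
  have J: "finite J" by (simp add: J_def)
  have \<theta>: "\<tau> k = ereal (\<theta> k) \<and> 0 \<le> \<theta> k \<and> \<theta> k \<le> T" if "k \<in> J" for k
    using that \<tau>[of k] unfolding J_def \<theta>_def by (cases "\<tau> k") auto
  have spB: "space ?B = {0..T}" by (simp add: space_restrict_space)
  have \<theta>m: "\<theta> \<in> measurable (point_measure J (\<lambda>k. ennreal (max 0 (s * c k)))) ?B" for s
    using \<theta> spB by (simp add: measurable_point_measure_eq1)
  have sP: "sets (P s) = sets ?B" for s by (simp add: P_def)
  have fP: "finite_measure (P s)" for s
  proof -
    have "finite_measure (point_measure J (\<lambda>k. ennreal (max 0 (s * c k))))"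
      using J by (intro finite_measureI) (simp add: space_point_measure emeasure_point_measure_finite)
    then show ?thesis unfolding P_def by (rule finite_measure.finite_measure_distr) (rule \<theta>m)
  qed
  have intP: "(\<integral>t. h t \<partial>P s) = (\<Sum>k\<in>J. max 0 (s * c k) * h (\<theta> k))" if "h \<in> borel_measurable ?B" for h :: "real \<Rightarrow> real" and s
    unfolding P_def integral_distr[OF \<theta>m that] by (subst lebesgue_integral_point_measure_finite[OF J]) auto
  have mP: "measure (P s) A = (\<Sum>k\<in>J. max 0 (s * c k) * indicator A (\<theta> k))" if A: "A \<in> sets ?B" for A s
  proof -
    have "measure (P s) A = (\<integral>t. indicator A t \<partial>P s)"
      using A sP by simp
    then show ?thesis using A by (subst (asm) intP) auto
  qed
  have mx: "max 0 (1 * c k) - max 0 (- 1 * c k) = c k" for k by (simp add: max_def)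
  define \<mu> where "\<mu> A = measure (P 1) A - measure (P (- 1)) A" for A
  have \<mu>S: "\<mu> \<in> signed_measures ?B"
    unfolding \<mu>_def by (intro signed_measures_diff measure_signed_measures fP sP)
  have atM: "{0..T} \<inter> {..a} = {0..min a T}" for a by auto
  have \<mu>v: "\<mu> {0..t} = step_function N c \<tau> t" if t: "t \<in> {0..T}" for t
  proof -
    have "{0..t} \<in> sets ?B" using t by (auto simp: sets_restrict_space_iff)
    then have "\<mu> {0..t} = (\<Sum>k\<in>J. c k * indicator {0..t} (\<theta> k))"
      unfolding \<mu>_def by (simp add: mP sum_subtractf[symmetric] left_diff_distrib[symmetric] mx del: mult_1 mult_minus1)
        (simp add: max_def algebra_simps if_distrib cong: if_cong)
    also have "\<dots> = (\<Sum>k\<in>J. if \<tau> k \<le> ereal t then c k else 0)"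
      using \<theta> by (intro sum.cong) (auto simp: indicator_def)
    also have "\<dots> = step_function N c \<tau> t"
      unfolding step_function_def J_def using t
      by (intro sum.mono_neutral_cong_left) (auto intro: order_trans)
    finally show ?thesis .
  qed
  have "stieltjes_measure T (step_function N c \<tau>) = \<mu>"
    unfolding stieltjes_measure_def
  proof (rule the_equality)
    show "\<mu> \<in> signed_measures ?B \<and> (\<forall>t\<in>{0..T}. \<mu> {0..t} = step_function N c \<tau> t)"
      using \<mu>S \<mu>v by blast
    fix \<nu> assume \<nu>: "\<nu> \<in> signed_measures ?B \<and> (\<forall>t\<in>{0..T}. \<nu> {0..t} = step_function N c \<tau> t)"
    show "\<nu> = \<mu>"
    proof (rule signed_measures_eqI[where B = ?B and G = "range (\<lambda>a. {0..T} \<inter> {..a})"])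
      show "sets ?B = sigma_sets (space ?B) (range (\<lambda>a. {0..T} \<inter> {..a}))"
        unfolding spB by (rule sets_restrict_borel_initial)
      show "Int_stable (range (\<lambda>a. {0..T} \<inter> {..a}))"
      proof (rule Int_stableI)
        fix a b assume "a \<in> range (\<lambda>a. {0..T} \<inter> {..a})" "b \<in> range (\<lambda>a. {0..T} \<inter> {..a})"
        then obtain a' b' where "a = {0..T} \<inter> {..a'}" "b = {0..T} \<inter> {..b'}" by blast
        then have "a \<inter> b = {0..T} \<inter> {..min a' b'}" by auto
        then show "a \<inter> b \<in> range (\<lambda>a. {0..T} \<inter> {..a})" by blast
      qed
      have init: "\<nu> {0..t} = \<mu> {0..t}" if "t \<le> T" for t
      proof (cases "0 \<le> t")
        case True
        then show ?thesis using \<nu> \<mu>v that by simp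
      next
        case False
        then have "{0..t} = {}" by simp
        then show ?thesis using signed_measures_empty[OF \<mu>S] signed_measures_empty[of \<nu> ?B] \<nu> by simp
      qed
      then show "\<nu> A = \<mu> A" if "A \<in> range (\<lambda>a. {0..T} \<inter> {..a})" for A
        using that unfolding atM by auto
      show "\<nu> (space ?B) = \<mu> (space ?B)" unfolding spB using init by simp
    qed (use \<nu> \<mu>S spB in auto)
  qed
  moreover have fm: "f \<in> borel_measurable ?B"
    using f by (rule borel_measurable_continuous_on_restrict)
  moreover obtain K where K: "\<And>t. t \<in> {0..T} \<Longrightarrow> \<bar>f t\<bar> \<le> K"
  proof -
    have "bounded (f ` {0..T})" using f by (intro compact_imp_bounded compact_continuous_image) auto
    then obtain a where "\<forall>y\<in>f ` {0..T}. norm y \<le> a" unfolding bounded_iff by (rule exE)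
    then show thesis by (intro that[of a]) simp
  qed
  ultimately have "stieltjes_integral T (step_function N c \<tau>) f = (\<integral>t. f t \<partial>P 1) - (\<integral>t. f t \<partial>P (- 1))"
    unfolding stieltjes_integral_def
    by (simp, intro signed_integral_eq_diff[where K = K] \<mu>S fP sP) (auto simp: \<mu>_def spB)
  also have "\<dots> = (\<Sum>k\<in>J. c k * f (\<theta> k))"
    unfolding intP[OF fm] sum_subtractf[symmetric] left_diff_distrib[symmetric] mx ..
  also have "\<dots> = (\<Sum>k<N. if \<tau> k \<le> ereal T then c k * f (real_of_ereal (\<tau> k)) else 0)"
    unfolding J_def \<theta>_def by (intro sum.mono_neutral_cong_left) auto
  finally show ?thesis .
qed

text \<open>The starting time is a parameter so that a chain of increments can be extended at its
  front in the induction for step functions, and shifted when a limit is taken.\<close>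

definition oscillates :: "(real \<Rightarrow> real) \<Rightarrow> real \<Rightarrow> nat \<Rightarrow> real \<Rightarrow> bool" where
  "oscillates x a N \<epsilon> \<longleftrightarrow> (\<exists>s :: nat \<Rightarrow> real. s 0 = a \<and> (\<forall>j<N. s j \<le> s (Suc j)) \<and>
     (\<forall>j<N. \<epsilon> < \<bar>x (s (Suc j)) - x (s j)\<bar>))"

lemma oscillates_cons:
  assumes "oscillates x b N \<epsilon>" "a \<le> b" "\<epsilon> < \<bar>x b - x a\<bar>"
  shows "oscillates x a (Suc N) \<epsilon>"
proof -
  obtain s where s: "s 0 = b" "\<forall>j<N. s j \<le> s (Suc j)" "\<forall>j<N. \<epsilon> < \<bar>x (s (Suc j)) - x (s j)\<bar>"
    using assms(1) unfolding oscillates_def by blast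
  show ?thesis
    unfolding oscillates_def
    by (rule exI[of _ "\<lambda>j. case j of 0 \<Rightarrow> a | Suc i \<Rightarrow> s i"])
      (use s assms in \<open>auto split: nat.split simp: less_Suc_eq_0_disj\<close>)
qed

lemma step_function_Suc_Suc:
  "step_function (Suc (Suc N)) (\<lambda>k. if k = 0 then u else if k = 1 then v else c (k - 2))
     (\<lambda>k. if k = 0 then ereal a else if k = 1 then ereal b else ereal (\<tau> (k - 2))) t =
   (if a \<le> t then u else 0) + (if b \<le> t then v else 0) + step_function N c (\<lambda>k. ereal (\<tau> k)) t"
  by (simp add: step_function_def sum.lessThan_Suc_shift del: sum.lessThan_Suc cong: if_cong)

text \<open>Greedy construction: \<open>\<sigma>\<close> is the infimum of the times where
  \<open>x\<close> is further than \<open>\<epsilon>\<close> from \<open>x a\<close>.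
  Right-continuity gives a displacement of at least \<open>\<epsilon>\<close> at
  \<open>\<sigma>\<close>, hence above \<open>\<epsilon> / 2\<close>, so one oscillation fewer is
  left from \<open>\<sigma>\<close> on. Each stage spends two jumps, \<open>x a\<close> at
  \<open>a\<close> and \<open>- x a\<close> at \<open>\<sigma>\<close>, whence \<open>2 * N\<close>.
  Controlling the jump times of functions that become constant is what later lets the fixed end of a
  bounded interval be used.\<close>

lemma step_approximation:
  fixes x :: "real \<Rightarrow> real"
  assumes rc: "\<And>t. 0 \<le> t \<Longrightarrow> (x \<longlongrightarrow> x t) (at_right t)" and C: "\<And>t. 0 \<le> t \<Longrightarrow> \<bar>x t\<bar> \<le> C" and \<epsilon>: "0 < \<epsilon>"
  shows "0 \<le> a \<Longrightarrow> \<not> oscillates x a N (\<epsilon> / 2) \<Longrightarrow>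
    \<exists>c \<tau>. (\<forall>t\<ge>a. \<bar>x t - step_function (2 * N) c (\<lambda>k. ereal (\<tau> k)) t\<bar> \<le> \<epsilon>) \<and>
      (\<forall>k. a \<le> \<tau> k) \<and> (\<forall>k. \<bar>c k\<bar> \<le> C) \<and> (\<forall>T\<ge>a. (\<forall>t\<ge>T. x t = x T) \<longrightarrow> (\<forall>k. \<tau> k \<le> T))"
proof (induction N arbitrary: a)
  case 0
  have "oscillates x a 0 (\<epsilon> / 2)" unfolding oscillates_def by (rule exI[of _ "\<lambda>_. a"]) simp
  then show ?case using 0 by simp
next
  case (Suc N)
  have C0: "0 \<le> C" using C[of 0] by linarith
  show ?case
  proof (cases "\<exists>t\<ge>a. \<epsilon> < \<bar>x t - x a\<bar>")
    case False
    then have F: "\<bar>x t - x a\<bar> \<le> \<epsilon>" if "t \<ge> a" for t using that by force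
    have "step_function (2 * Suc N) (\<lambda>k. if k = 0 then x a else 0) (\<lambda>k. ereal a) t = x a" if "t \<ge> a" for t
      using that by (simp add: step_function_def sum.lessThan_Suc_shift del: sum.lessThan_Suc cong: if_cong)
    then show ?thesis using F C[of a] C0 Suc.prems(1)
      by (intro exI[of _ "\<lambda>k. if k = 0 then x a else 0"] exI[of _ "\<lambda>k. a"]) auto
  next
    case True
    define A where "A = {t. a \<le> t \<and> \<epsilon> < \<bar>x t - x a\<bar>}"
    define \<sigma> where "\<sigma> = Inf A"
    have A: "A \<noteq> {}" "bdd_below A" using True by (auto simp: A_def intro!: bdd_belowI[of _ a])
    have a\<sigma>: "a \<le> \<sigma>" unfolding \<sigma>_def using A by (intro cInf_greatest) (auto simp: A_def)
    have before: "\<bar>x t - x a\<bar> \<le> \<epsilon>" if "a \<le> t" "t < \<sigma>" for t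
      using that cInf_lower[OF _ A(2), of t] unfolding \<sigma>_def A_def by force
    have at: "\<epsilon> \<le> \<bar>x \<sigma> - x a\<bar>"
    proof (rule ccontr)
      assume n: "\<not> \<epsilon> \<le> \<bar>x \<sigma> - x a\<bar>"
      have "((\<lambda>s. \<bar>x s - x a\<bar>) \<longlongrightarrow> \<bar>x \<sigma> - x a\<bar>) (at_right \<sigma>)"
        using a\<sigma> Suc.prems(1) by (intro tendsto_intros rc) auto
      then have "\<forall>\<^sub>F s in at_right \<sigma>. \<bar>x s - x a\<bar> < \<epsilon>" using n by (intro order_tendstoD) auto
      then obtain b where b: "b > \<sigma>" "\<And>s. \<sigma> < s \<Longrightarrow> s < b \<Longrightarrow> \<bar>x s - x a\<bar> < \<epsilon>"
        unfolding eventually_at_right_field by blast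
      obtain t where t: "t \<in> A" "t < b" using b(1) A cInf_less_iff[of A b] unfolding \<sigma>_def by auto
      have "\<sigma> \<le> t" unfolding \<sigma>_def using t(1) A(2) by (rule cInf_lower)
      then show False using b(2)[of t] t n unfolding A_def by (cases "t = \<sigma>") auto
    qed
    have "\<not> oscillates x \<sigma> N (\<epsilon> / 2)"
      using oscillates_cons[OF _ a\<sigma>, of x N "\<epsilon> / 2"] at \<epsilon> Suc.prems(2) by auto
    then obtain c \<tau> where c: "\<forall>t\<ge>\<sigma>. \<bar>x t - step_function (2 * N) c (\<lambda>k. ereal (\<tau> k)) t\<bar> \<le> \<epsilon>"
      "\<forall>k. \<sigma> \<le> \<tau> k" "\<forall>k. \<bar>c k\<bar> \<le> C" "\<forall>T\<ge>\<sigma>. (\<forall>t\<ge>T. x t = x T) \<longrightarrow> (\<forall>k. \<tau> k \<le> T)"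
      using Suc.IH[of \<sigma>] order_trans[OF Suc.prems(1) a\<sigma>] by blast
    define c' where "c' k = (if k = 0 then x a else if k = 1 then - x a else c (k - 2))" for k :: nat
    define \<tau>' where "\<tau>' k = (if k = 0 then a else if k = 1 then \<sigma> else \<tau> (k - 2))" for k :: nat
    have sf: "step_function (2 * Suc N) c' (\<lambda>k. ereal (\<tau>' k)) t =
      (if a \<le> t then x a else 0) + (if \<sigma> \<le> t then - x a else 0) + step_function (2 * N) c (\<lambda>k. ereal (\<tau> k)) t" for t
      using step_function_Suc_Suc[of "2 * N" "x a" "- x a" c a \<sigma> \<tau> t]
      by (simp add: c'_def[abs_def] \<tau>'_def if_distrib[of ereal] cong: if_cong)
    show ?thesis
    proof (intro exI conjI allI impI)
      fix t assume t: "a \<le> t"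
      show "\<bar>x t - step_function (2 * Suc N) c' (\<lambda>k. ereal (\<tau>' k)) t\<bar> \<le> \<epsilon>"
      proof (cases "\<sigma> \<le> t")
        case True
        then show ?thesis using c(1) t unfolding sf by simp
      next
        case False
        then have "step_function (2 * N) c (\<lambda>k. ereal (\<tau> k)) t = 0"
        proof -
          have "\<not> \<tau> k \<le> t" for k using c(2)[rule_format, of k] False by linarith
          then show ?thesis by (simp add: step_function_def)
        qed
        then show ?thesis using before[of t] False t unfolding sf by simp
      qed
    next
      fix k
      show "a \<le> \<tau>' k" using a\<sigma> c(2)[rule_format, of "k - 2"] by (auto simp: \<tau>'_def)
      show "\<bar>c' k\<bar> \<le> C" using C[of a] Suc.prems(1) c(3) by (auto simp: c'_def)
    next
      fix T k assume T: "a \<le> T" "\<forall>t\<ge>T. x t = x T"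
      have "\<sigma> \<le> T"
      proof -
        obtain t where t: "t \<in> A" using A by blast
        have "T \<in> A" if "T \<le> t"
        proof -
          have "x t = x T" using T(2) that by blast
          then show ?thesis using t T(1) unfolding A_def by simp
        qed
        then show ?thesis using cInf_lower[OF _ A(2), of t] cInf_lower[OF _ A(2), of T] t unfolding \<sigma>_def by linarith
      qed
      moreover from this have "\<tau> (k - 2) \<le> T" using c(4) T(2) by blast
      ultimately show "\<tau>' k \<le> T" using T(1) by (simp add: \<tau>'_def)
    qed
  qed
qed

text \<open>A countable set of exceptional times does not matter for right-continuous functions.\<close>

lemma right_limit_le:
  fixes f :: "real \<Rightarrow> real"
  assumes f: "(f \<longlongrightarrow> l) (at_right t)" and A: "countable A" and le: "\<And>s. t < s \<Longrightarrow> s \<notin> A \<Longrightarrow> f s \<le> K"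
  shows "l \<le> K"
proof (rule ccontr)
  assume "\<not> l \<le> K"
  then have "\<forall>\<^sub>F s in at_right t. K < f s" using f by (intro order_tendstoD) auto
  then obtain b where b: "t < b" "\<And>s. t < s \<Longrightarrow> s < b \<Longrightarrow> K < f s"
    unfolding eventually_at_right_field by blast
  have "\<not> {t<..<b} \<subseteq> A"
    using uncountable_open_interval[of t b] b(1) countable_subset[OF _ A] by blast
  then obtain s where "s \<in> {t<..<b}" "s \<notin> A" by blast
  then show False using b(2)[of s] le[of s] by auto
qed

text \<open>Near a limiting jump time the approximating jumps may fall on either side of
  \<open>t\<close>, so convergence is claimed only away from these times.\<close>

lemma step_function_tendsto:
  assumes c: "\<And>k. k < N \<Longrightarrow> (\<lambda>n. c n k) \<longlonglongrightarrow> c0 k" and \<tau>: "\<And>k. k < N \<Longrightarrow> (\<lambda>n. \<tau> n k) \<longlonglongrightarrow> \<tau>0 k"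
    and t: "\<And>k. k < N \<Longrightarrow> \<tau>0 k \<noteq> ereal t"
  shows "(\<lambda>n. step_function N (c n) (\<tau> n) t) \<longlonglongrightarrow> step_function N c0 \<tau>0 t"
  unfolding step_function_def
proof (rule tendsto_sum)
  fix k assume "k \<in> {..<N}"
  then have k: "k < N" by simp
  show "(\<lambda>n. if \<tau> n k \<le> ereal t then c n k else 0) \<longlonglongrightarrow> (if \<tau>0 k \<le> ereal t then c0 k else 0)"
  proof (cases "\<tau>0 k \<le> ereal t")
    case True
    then have "\<forall>\<^sub>F n in sequentially. \<tau> n k < ereal t" using order_tendstoD(2)[OF \<tau>[OF k]] t[OF k] by simp
    then have "\<forall>\<^sub>F n in sequentially. c n k = (if \<tau> n k \<le> ereal t then c n k else 0)"
      by (rule eventually_mono) auto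
    then show ?thesis using True c[OF k] by (auto intro: Lim_transform_eventually)
  next
    case False
    then have "\<forall>\<^sub>F n in sequentially. ereal t < \<tau> n k" using order_tendstoD(1)[OF \<tau>[OF k]] by simp
    then have "\<forall>\<^sub>F n in sequentially. (if \<tau> n k \<le> ereal t then c n k else 0) = 0"
      by (rule eventually_mono) auto
    then show ?thesis using False by (auto intro: tendsto_eventually)
  qed
qed

text \<open>The condition at \<open>T\<close> keeps every jump eventually on the same side of
  \<open>T\<close> as its limit; a point mass crossing the end of \<open>[0, T]\<close> would change
  the integral abruptly.\<close>

lemma stieltjes_step_function_tendsto:
  assumes c: "\<And>k. k < N \<Longrightarrow> (\<lambda>n. c n k) \<longlonglongrightarrow> c0 k" and \<tau>: "\<And>k. k < N \<Longrightarrow> (\<lambda>n. \<tau> n k) \<longlonglongrightarrow> \<tau>0 k"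
    and nonneg: "\<And>n k. 0 \<le> \<tau> n k"
    and T: "0 < T" "\<And>k. k < N \<Longrightarrow> \<forall>\<^sub>F n in sequentially. \<tau> n k \<le> ereal T \<longleftrightarrow> \<tau>0 k \<le> ereal T"
    and f: "continuous_on {0..T} f"
  shows "(\<lambda>n. stieltjes_integral T (step_function N (c n) (\<tau> n)) f) \<longlonglongrightarrow> stieltjes_integral T (step_function N c0 \<tau>0) f"
proof -
  have nonneg0: "0 \<le> \<tau>0 k" if "k < N" for k
    using LIMSEQ_le_const[OF \<tau>[OF that]] nonneg by blast
  have S0: "stieltjes_integral T (step_function N c0 \<tau>0) f =
      (\<Sum>k<N. if \<tau>0 k \<le> ereal T then c0 k * f (real_of_ereal (\<tau>0 k)) else 0)"
    by (rule stieltjes_integral_step_function[OF T(1) nonneg0 f])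
  show ?thesis
    unfolding stieltjes_integral_step_function[OF T(1) nonneg f] S0
  proof (rule tendsto_sum)
    fix k assume "k \<in> {..<N}"
    then have k: "k < N" by simp
    let ?g = "\<lambda>n. if \<tau> n k \<le> ereal T then c n k * f (real_of_ereal (\<tau> n k)) else 0"
    show "?g \<longlonglongrightarrow> (if \<tau>0 k \<le> ereal T then c0 k * f (real_of_ereal (\<tau>0 k)) else 0)"
    proof (cases "\<tau>0 k \<le> ereal T")
      case True
      have fin: "\<bar>\<tau>0 k\<bar> \<noteq> \<infinity>" using True nonneg0[OF k] by (cases "\<tau>0 k") auto
      have in0: "real_of_ereal (\<tau>0 k) \<in> {0..T}" using True nonneg0[OF k] by (cases "\<tau>0 k") auto
      have ev: "\<forall>\<^sub>F n in sequentially. \<tau> n k \<le> ereal T" using T(2)[OF k] True by (auto elim: eventually_mono)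
      have "\<forall>\<^sub>F n in sequentially. real_of_ereal (\<tau> n k) \<in> {0..T}"
        using ev
      proof (rule eventually_mono)
        fix n assume "\<tau> n k \<le> ereal T"
        then show "real_of_ereal (\<tau> n k) \<in> {0..T}" using nonneg[of n k] by (cases "\<tau> n k") auto
      qed
      moreover have "(\<lambda>n. real_of_ereal (\<tau> n k)) \<longlonglongrightarrow> real_of_ereal (\<tau>0 k)"
        using lim_real_of_ereal[of "\<lambda>n. \<tau> n k" "real_of_ereal (\<tau>0 k)"] \<tau>[OF k] fin by (simp add: ereal_real')
      ultimately have "(\<lambda>n. c n k * f (real_of_ereal (\<tau> n k))) \<longlonglongrightarrow> c0 k * f (real_of_ereal (\<tau>0 k))"
        using continuous_on_tendsto_compose[OF f _ in0] by (intro tendsto_mult c k) auto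
      moreover have "\<forall>\<^sub>F n in sequentially. c n k * f (real_of_ereal (\<tau> n k)) = ?g n"
        using ev by (rule eventually_mono) simp
      ultimately show ?thesis using True by (auto intro: Lim_transform_eventually)
    next
      case False
      then have "\<forall>\<^sub>F n in sequentially. ?g n = 0" using T(2)[OF k] by (auto elim: eventually_mono)
      then show ?thesis using False by (auto intro: tendsto_eventually)
    qed
  qed
qed

lemma tendsto_le_eps:
  fixes a :: "nat \<Rightarrow> real"
  assumes "a \<longlonglongrightarrow> l" "\<And>n. \<bar>a n - b\<bar> \<le> K" shows "\<bar>l - b\<bar> \<le> K"
proof (rule LIMSEQ_le_const2)
  show "(\<lambda>n. \<bar>a n - b\<bar>) \<longlonglongrightarrow> \<bar>l - b\<bar>" by (intro tendsto_intros assms(1))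
qed (use assms(2) in auto)

text \<open>
  Along a subsequence for which, at every accuracy, the jump times and heights of the approximating
  step functions converge, the limits of the step functions are uniformly Cauchy, and their uniform
  limit is the limit of the given functions.
\<close>

lemma S_limit_exists:
  fixes x :: "nat \<Rightarrow> real \<Rightarrow> real" and c :: "nat \<Rightarrow> nat \<Rightarrow> nat \<Rightarrow> real" and \<tau> :: "nat \<Rightarrow> nat \<Rightarrow> nat \<Rightarrow> ereal"
  assumes approx: "\<And>n m t. 0 \<le> t \<Longrightarrow> \<bar>x n t - step_function (N m) (c n m) (\<tau> n m) t\<bar> \<le> inverse (real (Suc m))"
    and nonneg: "\<And>n m k. 0 \<le> \<tau> n m k"
    and c: "\<And>m k. k < N m \<Longrightarrow> (\<lambda>n. c n m k) \<longlonglongrightarrow> c0 m k"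
    and \<tau>: "\<And>m k. k < N m \<Longrightarrow> (\<lambda>n. \<tau> n m k) \<longlonglongrightarrow> \<tau>0 m k"
  obtains x0 where
    "\<And>t. 0 \<le> t \<Longrightarrow> (x0 \<longlongrightarrow> x0 t) (at_right t)"
    "\<And>t. 0 < t \<Longrightarrow> \<exists>l. (x0 \<longlongrightarrow> l) (at_left t)"
    "\<And>t. 0 \<le> t \<Longrightarrow> (\<And>m k. k < N m \<Longrightarrow> \<tau>0 m k \<noteq> ereal t) \<Longrightarrow> (\<lambda>n. x n t) \<longlonglongrightarrow> x0 t"
    "\<And>T. 0 < T \<Longrightarrow> (\<And>m k. k < N m \<Longrightarrow> \<forall>\<^sub>F n in sequentially. \<tau> n m k \<le> ereal T \<longleftrightarrow> \<tau>0 m k \<le> ereal T) \<Longrightarrow>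
      S_converges_real T x x0"
proof -
  define e where "e m = inverse (real (Suc m))" for m
  have e0: "e \<longlonglongrightarrow> 0" unfolding e_def by (rule LIMSEQ_inverse_real_of_nat)
  define v where "v m = step_function (N m) (c0 m) (\<tau>0 m)" for m
  define A where "A = real_of_ereal ` (\<Union>m. (\<lambda>k. \<tau>0 m k) ` {..<N m})"
  have A: "countable A" unfolding A_def by (intro countable_image countable_UN) auto
  have notA: "\<tau>0 m k \<noteq> ereal t" if "t \<notin> A" "k < N m" for t m k
    using that unfolding A_def by force
  have vlim: "(\<lambda>n. step_function (N m) (c n m) (\<tau> n m) t) \<longlonglongrightarrow> v m t"
    if "\<And>k. k < N m \<Longrightarrow> \<tau>0 m k \<noteq> ereal t" for m t
    unfolding v_def by (intro step_function_tendsto c \<tau> that)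
  \<comment> \<open>Both step functions stay close to the same \<open>x n\<close>. Off the countable
    set of limiting jump times this comparison passes to the limit, and right-continuity fills in
    the rest.\<close>
  have cauchy: "\<bar>v m t - v m' t\<bar> \<le> e m + e m'" if t: "0 \<le> t" for m m' t
  proof (rule right_limit_le[OF _ A])
    show "((\<lambda>s. \<bar>v m s - v m' s\<bar>) \<longlongrightarrow> \<bar>v m t - v m' t\<bar>) (at_right t)"
      unfolding v_def by (intro tendsto_intros step_function_right_continuous)
    fix s assume s: "t < s" "s \<notin> A"
    have "(\<lambda>n. step_function (N m) (c n m) (\<tau> n m) s - step_function (N m') (c n m') (\<tau> n m') s) \<longlonglongrightarrow> v m s - v m' s"
      by (intro tendsto_diff vlim notA s)
    moreover have "\<bar>step_function (N m) (c n m) (\<tau> n m) s - step_function (N m') (c n m') (\<tau> n m') s - 0\<bar> \<le> e m + e m'" for n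
      using approx[of s n m] approx[of s n m'] s t unfolding e_def by linarith
    ultimately show "\<bar>v m s - v m' s\<bar> \<le> e m + e m'"
      using tendsto_le_eps[of _ "v m s - v m' s" 0] by fastforce
  qed
  have CauchyI': "convergent a" if a: "\<And>m m'. \<bar>a m - a m'\<bar> \<le> e m + e m'" for a :: "nat \<Rightarrow> real"
  proof (rule Cauchy_convergent, rule metric_CauchyI)
    fix \<epsilon> :: real assume "\<epsilon> > 0"
    then have "\<forall>\<^sub>F m in sequentially. e m < \<epsilon> / 2" using e0 by (intro order_tendstoD) auto
    then obtain M where M: "\<And>m. M \<le> m \<Longrightarrow> e m < \<epsilon> / 2" unfolding eventually_sequentially by blast
    show "\<exists>M. \<forall>m\<ge>M. \<forall>n\<ge>M. dist (a m) (a n) < \<epsilon>"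
    proof (intro exI allI impI)
      fix m n assume "M \<le> m" "M \<le> n"
      then show "dist (a m) (a n) < \<epsilon>" using M[of m] M[of n] a[of m n] by (simp add: dist_real_def)
    qed
  qed
  define x0 where "x0 t = lim (\<lambda>m. v m t)" for t
  have x0: "(\<lambda>m. v m t) \<longlonglongrightarrow> x0 t" if "0 \<le> t" for t
    unfolding x0_def using CauchyI'[OF cauchy[OF that]] by (simp add: convergent_LIMSEQ_iff)
  have close: "\<bar>x0 t - v m t\<bar> \<le> e m" if t: "0 \<le> t" for m t
  proof (rule LIMSEQ_le)
    show "(\<lambda>m'. \<bar>v m' t - v m t\<bar>) \<longlonglongrightarrow> \<bar>x0 t - v m t\<bar>" by (intro tendsto_intros x0 t)
    have "(\<lambda>m'. e m' + e m) \<longlonglongrightarrow> 0 + e m" by (intro tendsto_intros e0)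
    then show "(\<lambda>m'. e m' + e m) \<longlonglongrightarrow> e m" by simp
  qed (use cauchy[OF t] in auto)
  have unif: "uniform_limit {0..} v x0 sequentially"
  proof (rule uniform_limitI)
    fix \<epsilon> :: real assume "\<epsilon> > 0"
    then have "\<forall>\<^sub>F m in sequentially. e m < \<epsilon>" using e0 by (intro order_tendstoD) auto
    then show "\<forall>\<^sub>F m in sequentially. \<forall>t\<in>{0..}. dist (v m t) (x0 t) < \<epsilon>"
    proof (rule eventually_mono, intro ballI)
      fix m t assume "e m < \<epsilon>" "t \<in> {0::real..}"
      then show "dist (v m t) (x0 t) < \<epsilon>" using close[of t m] by (simp add: dist_real_def abs_minus_commute)
    qed
  qed
  show thesis
  proof (rule that[of x0])
    fix t :: real assume t: "0 \<le> t"
    show "(x0 \<longlongrightarrow> x0 t) (at_right t)"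
    proof (rule swap_uniform_limit)
      show "\<forall>\<^sub>F m in sequentially. (v m \<longlongrightarrow> v m t) (at_right t)"
        unfolding v_def by (intro always_eventually allI step_function_right_continuous)
      show "(\<lambda>m. v m t) \<longlonglongrightarrow> x0 t" by (rule x0[OF t])
      show "uniform_limit {t<..} v x0 sequentially"
        by (rule uniform_limit_on_subset[OF unif]) (use t in auto)
    qed auto
    show "(\<lambda>n. x n t) \<longlonglongrightarrow> x0 t" if good: "\<And>m k. k < N m \<Longrightarrow> \<tau>0 m k \<noteq> ereal t"
    proof (rule LIMSEQ_I)
      fix \<epsilon> :: real assume \<epsilon>: "\<epsilon> > 0"
      then have "\<forall>\<^sub>F m in sequentially. e m < \<epsilon> / 3" using e0 by (intro order_tendstoD) auto
      then obtain m where m: "e m < \<epsilon> / 3" unfolding eventually_sequentially by blast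
      obtain n0 where n0: "\<And>n. n0 \<le> n \<Longrightarrow> \<bar>step_function (N m) (c n m) (\<tau> n m) t - v m t\<bar> < \<epsilon> / 3"
        using LIMSEQ_D[OF vlim[of m t], of "\<epsilon> / 3"] good \<epsilon> by auto
      have "norm (x n t - x0 t) < \<epsilon>" if "n0 \<le> n" for n
        using n0[OF that] approx[OF t, of n m] close[OF t, of m] m unfolding e_def[symmetric] real_norm_def by linarith
      then show "\<exists>n0. \<forall>n\<ge>n0. norm (x n t - x0 t) < \<epsilon>" by blast
    qed
  next
    fix t :: real assume t: "0 < t"
    define L where "L m = (\<Sum>k<N m. if \<tau>0 m k < ereal t then c0 m k else 0)" for m
    have L: "(v m \<longlongrightarrow> L m) (at_left t)" for m
      unfolding v_def L_def by (rule step_function_left_limit)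
    have "\<bar>L m - L m'\<bar> \<le> e m + e m'" for m m'
    proof (rule tendsto_upperbound)
      show "((\<lambda>s. \<bar>v m s - v m' s\<bar>) \<longlongrightarrow> \<bar>L m - L m'\<bar>) (at_left t)" by (intro tendsto_intros L)
      show "\<forall>\<^sub>F s in at_left t. \<bar>v m s - v m' s\<bar> \<le> e m + e m'"
        unfolding eventually_at_left_field using t cauchy by (intro exI[of _ 0]) auto
    qed simp
    then obtain l where l: "L \<longlonglongrightarrow> l" using CauchyI'[of L] by (auto simp: convergent_def)
    have "(x0 \<longlongrightarrow> l) (at t within {0..<t})"
    proof (rule swap_uniform_limit[OF _ l])
      show "\<forall>\<^sub>F m in sequentially. (v m \<longlongrightarrow> L m) (at t within {0..<t})"
        by (intro always_eventually allI tendsto_within_subset[OF L]) auto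
      show "uniform_limit {0..<t} v x0 sequentially"
        by (rule uniform_limit_on_subset[OF unif]) auto
    qed auto
    moreover have "at t within {0..<t} = at_left t"
      using t by (intro at_within_nhd[of t "{0<..}"]) auto
    ultimately show "\<exists>l. (x0 \<longlongrightarrow> l) (at_left t)" by auto
  next
    fix T :: real assume T: "0 < T" "\<And>m k. k < N m \<Longrightarrow> \<forall>\<^sub>F n in sequentially. \<tau> n m k \<le> ereal T \<longleftrightarrow> \<tau>0 m k \<le> ereal T"
    show "S_converges_real T x x0"
      unfolding S_converges_real_def
    proof (intro allI impI)
      fix \<epsilon> :: real assume "0 < \<epsilon>"
      then have "\<forall>\<^sub>F m in sequentially. e m < \<epsilon>" using e0 by (intro order_tendstoD) auto
      then obtain m where m: "e m < \<epsilon>" unfolding eventually_sequentially by blast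
      have "(\<lambda>n. stieltjes_integral T (step_function (N m) (c n m) (\<tau> n m)) f) \<longlonglongrightarrow> stieltjes_integral T (v m) f"
        if "continuous_on {0..T} f" for f
        unfolding v_def by (intro stieltjes_step_function_tendsto c \<tau> nonneg T that)
      moreover have "\<bar>x n t - step_function (N m) (c n m) (\<tau> n m) t\<bar> \<le> \<epsilon>" if "t \<in> {0..T}" for n t
        using approx[of t n m] that m unfolding e_def by simp
      moreover have "\<bar>x0 t - v m t\<bar> \<le> \<epsilon>" if "t \<in> {0..T}" for t using close[of t m] that m by simp
      ultimately show "\<exists>v v\<^sub>0. (\<forall>n. finite_variation T (v n)) \<and> finite_variation T v\<^sub>0 \<and>
        (\<forall>n. \<forall>t\<in>{0..T}. \<bar>x n t - v n t\<bar> \<le> \<epsilon>) \<and> (\<forall>t\<in>{0..T}. \<bar>x0 t - v\<^sub>0 t\<bar> \<le> \<epsilon>) \<and>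
        (\<forall>f. continuous_on {0..T} f \<longrightarrow> (\<lambda>n. stieltjes_integral T (v n) f) \<longlonglongrightarrow> stieltjes_integral T v\<^sub>0 f)"
        using finite_variation_step_function
        by (intro exI[of _ "\<lambda>n. step_function (N m) (c n m) (\<tau> n m)"] exI[of _ "v m"]) (auto simp: v_def)
    qed
  qed
qed

section \<open>Extraction of S-convergent subsequences\<close>

lemma ex_limit_subseq:
  assumes "\<exists>l. (\<lambda>n. h (s n)) \<longlonglongrightarrow> l" "strict_mono (r :: nat \<Rightarrow> nat)"
  shows "\<exists>l. (\<lambda>n. h ((s \<circ> r) n)) \<longlonglongrightarrow> l"
proof -
  obtain l where "(\<lambda>n. h (s n)) \<longlonglongrightarrow> l" using assms(1) by blast
  from LIMSEQ_subseq_LIMSEQ[OF this assms(2)] show ?thesis by (auto simp: comp_def)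
qed

lemma ex_limit_offset: "\<exists>l. (\<lambda>n. h (s (n + M))) \<longlonglongrightarrow> l \<Longrightarrow> \<exists>l. (\<lambda>n. h (s n)) \<longlonglongrightarrow> l"
  using LIMSEQ_offset[of "\<lambda>n. h (s n)" M] by blast

lemma bounded_real_subsequence:
  fixes a :: "nat \<Rightarrow> real"
  assumes "\<And>n. \<bar>a n\<bar> \<le> C"
  shows "\<exists>r l. strict_mono (r :: nat \<Rightarrow> nat) \<and> (\<lambda>n. a (r n)) \<longlonglongrightarrow> l"
proof -
  have "seq_compact {-C..C}" using compact_imp_seq_compact[of "{-C..C}"] by simp
  moreover have "\<forall>n. a n \<in> {-C..C}" using assms by (auto simp: abs_le_iff minus_le_iff)
  ultimately obtain l r where "strict_mono r" "(a \<circ> r) \<longlonglongrightarrow> l" unfolding seq_compact_def by metis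
  then show ?thesis by (auto simp: comp_def)
qed

text \<open>Heights are bounded and times lie in the compact extended half-line, so one diagonal
  subsequence serves all coordinates, accuracies and jumps. The exceptional set collects the
  limiting jump times. An end time in it is still allowed if all functions are constant afterwards:
  then no jump time exceeds it, before or in the limit.\<close>

proposition S_extraction:
  fixes x :: "nat \<Rightarrow> 'd::finite \<Rightarrow> real \<Rightarrow> real"
  assumes rc: "\<And>n i t. 0 \<le> t \<Longrightarrow> (x n i \<longlongrightarrow> x n i t) (at_right t)"
    and C: "\<And>n i t. 0 \<le> t \<Longrightarrow> \<bar>x n i t\<bar> \<le> C"
    and osc: "\<And>n i m. \<not> oscillates (x n i) 0 (N m) (inverse (real (Suc m)) / 2)"
  obtains r :: "nat \<Rightarrow> nat" and x0 :: "'d \<Rightarrow> real \<Rightarrow> real" and A :: "real set" where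
    "strict_mono r" "countable A"
    "\<And>i t. 0 \<le> t \<Longrightarrow> (x0 i \<longlongrightarrow> x0 i t) (at_right t)"
    "\<And>i t. 0 < t \<Longrightarrow> \<exists>l. (x0 i \<longlongrightarrow> l) (at_left t)"
    "\<And>i t. 0 \<le> t \<Longrightarrow> t \<notin> A \<Longrightarrow> (\<lambda>n. x (r n) i t) \<longlonglongrightarrow> x0 i t"
    "\<And>i T. 0 < T \<Longrightarrow> T \<notin> A \<or> (\<forall>n. \<forall>t\<ge>T. x n i t = x n i T) \<Longrightarrow>
      S_converges_real T (\<lambda>n. x (r n) i) (x0 i)"
proof -
  define e where "e m = inverse (real (Suc m))" for m
  have "\<exists>c \<tau>. (\<forall>t\<ge>0. \<bar>x n i t - step_function (2 * N m) c (\<lambda>k. ereal (\<tau> k)) t\<bar> \<le> e m) \<and>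
      (\<forall>k. 0 \<le> \<tau> k) \<and> (\<forall>k. \<bar>c k\<bar> \<le> C) \<and> (\<forall>T\<ge>0. (\<forall>t\<ge>T. x n i t = x n i T) \<longrightarrow> (\<forall>k. \<tau> k \<le> T))" for n i m
    using osc[of n i m] by (intro step_approximation[OF rc C]) (auto simp: e_def)
  then obtain c \<tau> where approx: "\<And>n i m t. 0 \<le> t \<Longrightarrow> \<bar>x n i t - step_function (2 * N m) (c n i m) (\<lambda>k. ereal (\<tau> n i m k)) t\<bar> \<le> e m"
    and \<tau>0: "\<And>n i m k. 0 \<le> \<tau> n i m k" and cC: "\<And>n i m k. \<bar>c n i m k\<bar> \<le> C"
    and stop: "\<And>n i m T k. 0 \<le> T \<Longrightarrow> (\<forall>t\<ge>T. x n i t = x n i T) \<Longrightarrow> \<tau> n i m k \<le> T"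
    by metis
  define P where "P j r \<longleftrightarrow> (case from_nat j :: 'd \<times> nat \<times> nat of (i, m, k) \<Rightarrow>
    (\<exists>l. (\<lambda>n. c (r n) i m k) \<longlonglongrightarrow> l) \<and> (\<exists>l. (\<lambda>n. ereal (\<tau> (r n) i m k)) \<longlonglongrightarrow> l))" for j and r :: "nat \<Rightarrow> nat"
  have "\<exists>r. strict_mono r \<and> (\<forall>j. P j r)"
  proof (rule diagonal_subsequence)
    fix j and s :: "nat \<Rightarrow> nat" assume s: "strict_mono s"
    obtain i m k where j: "from_nat j = (i :: 'd, m :: nat, k :: nat)" by (metis prod_cases3)
    obtain r l where r: "strict_mono (r :: nat \<Rightarrow> nat)" "(\<lambda>n. c (s (r n)) i m k) \<longlonglongrightarrow> l"
      using bounded_real_subsequence[of "\<lambda>n. c (s n) i m k" C] cC by blast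
    obtain q l' where q: "strict_mono (q :: nat \<Rightarrow> nat)" "(\<lambda>n. ereal (\<tau> (s (r (q n))) i m k)) \<longlonglongrightarrow> l'"
      using compact_complete_linorder[of "\<lambda>n. ereal (\<tau> (s (r n)) i m k)"] by (auto simp: comp_def)
    have "P j (s \<circ> (r \<circ> q))"
      using q(2) LIMSEQ_subseq_LIMSEQ[OF r(2) q(1)] by (auto simp: P_def j comp_def)
    then show "\<exists>r. strict_mono r \<and> P j (s \<circ> r)" using strict_mono_o[OF r(1) q(1)] by blast
  next
    fix j and s r :: "nat \<Rightarrow> nat" assume P: "P j s" and r: "strict_mono r"
    obtain i m k where j: "from_nat j = (i :: 'd, m :: nat, k :: nat)" by (metis prod_cases3)
    show "P j (s \<circ> r)"
      using P ex_limit_subseq[OF _ r, of "\<lambda>n. c n i m k" s] ex_limit_subseq[OF _ r, of "\<lambda>n. ereal (\<tau> n i m k)" s]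
      unfolding P_def j prod.case by blast
  next
    fix j M and s :: "nat \<Rightarrow> nat" assume P: "P j (\<lambda>n. s (n + M))"
    obtain i m k where j: "from_nat j = (i :: 'd, m :: nat, k :: nat)" by (metis prod_cases3)
    show "P j s"
      using P ex_limit_offset[of "\<lambda>n. c n i m k" s M] ex_limit_offset[of "\<lambda>n. ereal (\<tau> n i m k)" s M]
      unfolding P_def j prod.case by blast
  qed
  then obtain r where r: "strict_mono r" "\<And>j. P j r" by blast
  have "\<exists>l. (\<lambda>n. c (r n) i m k) \<longlonglongrightarrow> l" "\<exists>l. (\<lambda>n. ereal (\<tau> (r n) i m k)) \<longlonglongrightarrow> l" for i m k
    using r(2)[of "to_nat (i, m, k)"] by (simp_all add: P_def)
  then obtain c0 \<tau>' where c0: "\<And>i m k. (\<lambda>n. c (r n) i m k) \<longlonglongrightarrow> c0 i m k"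
    and \<tau>': "\<And>i m k. (\<lambda>n. ereal (\<tau> (r n) i m k)) \<longlonglongrightarrow> \<tau>' i m k"
    by metis
  define A where "A = real_of_ereal ` range (\<lambda>(i, m, k). \<tau>' i m k)"
  have A: "countable A" unfolding A_def by auto
  have notA: "\<tau>' i m k \<noteq> ereal t" if "t \<notin> A" for t i m k
  proof
    assume "\<tau>' i m k = ereal t"
    then have "t = real_of_ereal ((\<lambda>(i, m, k). \<tau>' i m k) (i, m, k))" by simp
    then show False using that unfolding A_def by blast
  qed
  have "\<exists>x0. (\<forall>t\<ge>0. (x0 \<longlongrightarrow> x0 t) (at_right t)) \<and> (\<forall>t>0. \<exists>l. (x0 \<longlongrightarrow> l) (at_left t)) \<and>
    (\<forall>t\<ge>0. t \<notin> A \<longrightarrow> (\<lambda>n. x (r n) i t) \<longlonglongrightarrow> x0 t) \<and>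
    (\<forall>T>0. T \<notin> A \<or> (\<forall>n. \<forall>t\<ge>T. x n i t = x n i T) \<longrightarrow> S_converges_real T (\<lambda>n. x (r n) i) x0)" for i
  proof -
    obtain x0 where x0: "\<And>t. 0 \<le> t \<Longrightarrow> (x0 \<longlongrightarrow> x0 t) (at_right t)"
      "\<And>t. 0 < t \<Longrightarrow> \<exists>l. (x0 \<longlongrightarrow> l) (at_left t)"
      "\<And>t. 0 \<le> t \<Longrightarrow> (\<And>m k. k < 2 * N m \<Longrightarrow> \<tau>' i m k \<noteq> ereal t) \<Longrightarrow> (\<lambda>n. x (r n) i t) \<longlonglongrightarrow> x0 t"
      "\<And>T. 0 < T \<Longrightarrow> (\<And>m k. k < 2 * N m \<Longrightarrow> \<forall>\<^sub>F n in sequentially. ereal (\<tau> (r n) i m k) \<le> ereal T \<longleftrightarrow> \<tau>' i m k \<le> ereal T) \<Longrightarrow>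
        S_converges_real T (\<lambda>n. x (r n) i) x0"
    proof (rule S_limit_exists[of "\<lambda>n. x (r n) i" "\<lambda>m. 2 * N m" "\<lambda>n m. c (r n) i m" "\<lambda>n m k. ereal (\<tau> (r n) i m k)" "c0 i" "\<tau>' i"])
      show "\<bar>x (r n) i t - step_function (2 * N m) (c (r n) i m) (\<lambda>k. ereal (\<tau> (r n) i m k)) t\<bar> \<le> inverse (real (Suc m))"
        if "0 \<le> t" for n m t using approx[OF that] by (simp add: e_def)
    qed (use \<tau>0 c0 \<tau>' in auto)
    have "S_converges_real T (\<lambda>n. x (r n) i) x0"
      if T: "0 < T" and or: "T \<notin> A \<or> (\<forall>n. \<forall>t\<ge>T. x n i t = x n i T)" for T
    proof (rule x0(4)[OF T])
      fix m k
      show "\<forall>\<^sub>F n in sequentially. ereal (\<tau> (r n) i m k) \<le> ereal T \<longleftrightarrow> \<tau>' i m k \<le> ereal T"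
      proof (cases "T \<in> A")
        case True
        then have const: "\<forall>t\<ge>T. x (r n) i t = x (r n) i T" for n using or by blast
        have le: "\<tau> (r n) i m k \<le> T" for n by (rule stop[OF less_imp_le[OF T] const])
        then have "\<tau>' i m k \<le> ereal T" by (intro LIMSEQ_le_const2[OF \<tau>']) auto
        then show ?thesis using le by simp
      next
        case False
        then have "\<tau>' i m k < ereal T \<or> ereal T < \<tau>' i m k" using notA[of T i m k] by (simp add: neq_iff)
        then show ?thesis
        proof
          assume "\<tau>' i m k < ereal T"
          then show ?thesis
            by (intro eventually_mono[OF order_tendstoD(2)[OF \<tau>' \<open>\<tau>' i m k < ereal T\<close>]]) simp
        next
          assume "ereal T < \<tau>' i m k"
          then show ?thesis
            by (intro eventually_mono[OF order_tendstoD(1)[OF \<tau>' \<open>ereal T < \<tau>' i m k\<close>]]) (simp add: not_le)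
        qed
      qed
    qed
    note S = this
    show ?thesis
      by (intro exI[of _ x0] conjI allI impI x0(1) x0(2) x0(3)[OF _ notA] S)
  qed
  then obtain x0 where "\<And>i. (\<forall>t\<ge>0. (x0 i \<longlongrightarrow> x0 i t) (at_right t)) \<and> (\<forall>t>0. \<exists>l. (x0 i \<longlongrightarrow> l) (at_left t)) \<and>
    (\<forall>t\<ge>0. t \<notin> A \<longrightarrow> (\<lambda>n. x (r n) i t) \<longlonglongrightarrow> x0 i t) \<and>
    (\<forall>T>0. T \<notin> A \<or> (\<forall>n. \<forall>t\<ge>T. x n i t = x n i T) \<longrightarrow> S_converges_real T (\<lambda>n. x (r n) i) (x0 i))"
    by metis
  then show thesis using that[OF r(1) A, of x0] by blast
qed

section \<open>Paths as functions on the half-line\<close>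

lemma time_domain_cases:
  assumes "time_domain I"
  obtains T where "0 < T" "T < \<infinity>" "I = {0..ereal T}" "Sup I = ereal T"
  | "I = {0..\<infinity>}" "Sup I = \<infinity>" | "I = {0..<\<infinity>}" "Sup I = \<infinity>"
proof (cases "I = {0..<\<infinity>}")
  case True
  moreover have "Sup {0..<\<infinity>::ereal} = \<infinity>" by (rule Sup_atLeastLessThan) simp
  ultimately show ?thesis using that(3) by simp
next
  case False
  then obtain T where T: "T > 0" "I = {0..T}" using assms unfolding time_domain_def by blast
  then have S: "Sup I = T" by simp
  show ?thesis
  proof (cases T)
    case (real r)
    then show ?thesis using that(1)[of r] T S by simp
  next
    case PInf
    then show ?thesis using that(2) T S by simp
  qed (use T in simp)
qed

context
  fixes I :: "ereal set"
  assumes I: "time_domain I"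
begin

lemma time_domain_nonneg: "t \<in> I \<Longrightarrow> 0 \<le> t"
  using I by (auto simp: time_domain_def)

lemma time_domain_le_Sup: "t \<in> I \<Longrightarrow> t \<le> Sup I"
  by (rule Sup_upper)

lemma time_domain_zero: "0 \<in> I"
  using I by (auto simp: time_domain_def less_imp_le)

lemma time_domain_less: "0 \<le> t \<Longrightarrow> t < Sup I \<Longrightarrow> t \<in> I"
  using I by (rule time_domain_cases) auto

lemma time_domain_min: "0 \<le> t \<Longrightarrow> t < \<infinity> \<Longrightarrow> min t (Sup I) \<in> I"
  using I by (rule time_domain_cases) (auto simp: min_def)

end

text \<open>Freezing the path at the right end turns it into a function on the whole half-line, so
  that bounded and unbounded \<open>I\<close> share one notion of oscillation. A value at infinity
  is not seen and is carried separately.\<close>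

definition stopped_path :: "ereal set \<Rightarrow> ('d::finite) path \<Rightarrow> 'd \<Rightarrow> real \<Rightarrow> real" where
  "stopped_path I \<omega> i t = \<omega> (min (ereal t) (Sup I)) $ i"

lemma stopped_path_eq: "ereal t \<in> I \<Longrightarrow> stopped_path I \<omega> i t = \<omega> (ereal t) $ i"
  using Sup_upper[of "ereal t" I] by (simp add: stopped_path_def min_def)

lemma filterlim_ereal_at_right_within:
  assumes I: "time_domain I" and t: "0 \<le> t" "ereal t < Sup I"
  shows "filterlim ereal (at (ereal t) within (I \<inter> {ereal t<..})) (at_right t)"
proof -
  obtain b where b: "t < b" "ereal b < Sup I" using ereal_dense2[OF t(2)] by (auto simp: less_ereal.simps)
  have "\<forall>\<^sub>F s in at_right t. ereal s \<in> I \<inter> {ereal t<..} \<and> ereal s \<noteq> ereal t"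
    unfolding eventually_at_right_field
  proof (intro exI[of _ b] conjI allI impI)
    fix s assume s: "t < s" "s < b"
    then have "0 \<le> ereal s" using t by simp
    moreover have "ereal s < Sup I" using s b(2) by (meson less_ereal.simps(1) less_trans)
    ultimately show "ereal s \<in> I \<inter> {ereal t<..}" using s time_domain_less[OF I] by simp
  qed (use b in auto)
  then show ?thesis
    unfolding filterlim_at by (auto intro!: tendsto_ident_at)
qed

lemma stopped_path_right_continuous:
  assumes I: "time_domain I" and \<omega>: "\<omega> \<in> skorokhod_space I" and t: "0 \<le> t"
  shows "(stopped_path I \<omega> i \<longlongrightarrow> stopped_path I \<omega> i t) (at_right t)"
proof (cases "ereal t < Sup I")
  case True
  then have tI: "ereal t \<in> I" using t by (intro time_domain_less[OF I]) auto
  then have "(\<omega> \<longlongrightarrow> \<omega> (ereal t)) (at (ereal t) within (I \<inter> {ereal t<..}))"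
    using \<omega> by (auto simp: skorokhod_space_def)
  from filterlim_compose[OF this filterlim_ereal_at_right_within[OF I t True]]
  have "((\<lambda>s. \<omega> (ereal s) $ i) \<longlongrightarrow> \<omega> (ereal t) $ i) (at_right t)" by (rule tendsto_vec_nth)
  moreover obtain b where b: "t < b" "ereal b < Sup I" using ereal_dense2[OF True] by (auto simp: less_ereal.simps)
  have "\<forall>\<^sub>F s in at_right t. \<omega> (ereal s) $ i = stopped_path I \<omega> i s"
    unfolding eventually_at_right_field
  proof (intro exI[of _ b] conjI allI impI b(1))
    fix s assume "t < s" "s < b"
    then have "ereal s < Sup I" using b(2) by (meson less_ereal.simps(1) less_trans)
    then show "\<omega> (ereal s) $ i = stopped_path I \<omega> i s" by (simp add: stopped_path_def min_def less_imp_le)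
  qed
  ultimately show ?thesis unfolding stopped_path_eq[OF tI] by (rule Lim_transform_eventually)
next
  case False
  have "stopped_path I \<omega> i s = stopped_path I \<omega> i t" if "t < s" for s
  proof -
    have "Sup I \<le> ereal t" "Sup I \<le> ereal s" using False that by (auto simp: not_less intro: order_trans)
    then show ?thesis by (simp add: stopped_path_def min_absorb2)
  qed
  then show ?thesis by (intro tendsto_eventually eventually_mono[OF eventually_at_right_less])
qed

text \<open>The way back from functions on the half-line to a path; \<open>y\<close> supplies the
  value at infinity when \<infinity> belongs to \<open>I\<close>.\<close>

definition glue_path :: "ereal set \<Rightarrow> real ^ 'd \<Rightarrow> ('d::finite \<Rightarrow> real \<Rightarrow> real) \<Rightarrow> 'd path" where
  "glue_path I y x t = (if t \<in> I then if t = \<infinity> then y else (\<chi> i. x i (real_of_ereal t)) else undefined)"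

lemma glue_path_in_skorokhod_space:
  assumes I: "time_domain I"
    and rc: "\<And>i t. 0 \<le> t \<Longrightarrow> (x i \<longlongrightarrow> x i t) (at_right t)"
    and ll: "\<And>i t. 0 < t \<Longrightarrow> \<exists>l. (x i \<longlongrightarrow> l) (at_left t)"
  shows "glue_path I y x \<in> skorokhod_space I"
  unfolding skorokhod_space_def
proof (intro CollectI conjI ballI impI)
  show "glue_path I y x \<in> extensional I" by (simp add: glue_path_def extensional_def)
  fix t assume t: "t \<in> I" "t < \<infinity>"
  then obtain r where r: "t = ereal r" "0 \<le> r" using time_domain_nonneg[OF I t(1)] by (cases t) auto
  have fin: "\<forall>\<^sub>F s in at t within A. s \<in> A \<and> \<bar>s\<bar> \<noteq> \<infinity> \<and> s \<noteq> t" for A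
  proof -
    have "\<forall>\<^sub>F s in at t within A. s \<in> {ereal (r - 1)<..<ereal (r + 1)}"
      using r by (intro topological_tendstoD[OF tendsto_ident_at]) auto
    moreover have "\<forall>\<^sub>F s in at t within A. s \<in> A \<and> s \<noteq> t" by (simp add: eventually_at_filter)
    ultimately show ?thesis by eventually_elim auto
  qed
  have re: "(real_of_ereal \<longlongrightarrow> r) (at t within A)" for A
    using lim_real_of_ereal[of "\<lambda>s. s" r "at t within A"] r by simp
  have comp: "(glue_path I y x \<longlongrightarrow> (\<chi> i. l i)) (at t within A)"
    if A: "A \<subseteq> I" and fl: "filterlim real_of_ereal F (at t within A)" and l: "\<And>i. (x i \<longlongrightarrow> l i) F" for A F l
  proof (rule vec_tendstoI)
    fix i
    have "((\<lambda>s. x i (real_of_ereal s)) \<longlongrightarrow> l i) (at t within A)" by (rule filterlim_compose[OF l fl])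
    moreover have "\<forall>\<^sub>F s in at t within A. x i (real_of_ereal s) = glue_path I y x s $ i"
      using fin[of A] by eventually_elim (use A in \<open>auto simp: glue_path_def\<close>)
    ultimately show "((\<lambda>s. glue_path I y x s $ i) \<longlongrightarrow> (\<chi> i. l i) $ i) (at t within A)"
      by (auto intro: Lim_transform_eventually)
  qed
  have "filterlim real_of_ereal (at_right r) (at t within (I \<inter> {t<..}))"
    unfolding filterlim_at
  proof (rule conjI[OF _ re])
    show "\<forall>\<^sub>F s in at t within (I \<inter> {t<..}). real_of_ereal s \<in> {r<..} \<and> real_of_ereal s \<noteq> r"
      using fin[of "I \<inter> {t<..}"]
    proof eventually_elim
      case (elim s)
      then show ?case using r by (cases s) auto
    qed
  qed
  from comp[OF _ this rc[OF r(2)]] show "(glue_path I y x \<longlongrightarrow> glue_path I y x t) (at t within (I \<inter> {t<..}))"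
    using t r by (simp add: glue_path_def)
  show "\<exists>l. (glue_path I y x \<longlongrightarrow> l) (at t within (I \<inter> {..<t}))"
  proof (cases "r = 0")
    case True
    then have "I \<inter> {..<t} = {}" using time_domain_nonneg[OF I] r by (auto simp: zero_ereal_def[symmetric] leD)
    then show ?thesis by simp
  next
    case False
    have "filterlim real_of_ereal (at_left r) (at t within (I \<inter> {..<t}))"
      unfolding filterlim_at
    proof (rule conjI[OF _ re])
      show "\<forall>\<^sub>F s in at t within (I \<inter> {..<t}). real_of_ereal s \<in> {..<r} \<and> real_of_ereal s \<noteq> r"
        using fin[of "I \<inter> {..<t}"]
      proof eventually_elim
        case (elim s)
        then show ?case using r by (cases s) auto
      qed
    qed
    moreover obtain l where "\<And>i. (x i \<longlongrightarrow> l i) (at_left r)" using ll[of r] False r(2) by (metis order_le_less)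
    ultimately show ?thesis using comp[of "I \<inter> {..<t}"] by blast
  qed
qed

lemma skorokhod_space_restrict:
  assumes "\<omega> \<in> skorokhod_space {0..\<infinity>}"
  shows "restrict \<omega> {0..<\<infinity>} \<in> skorokhod_space {0..<\<infinity>}"
  unfolding skorokhod_space_def
proof (intro CollectI conjI ballI impI)
  fix t :: ereal assume t: "t \<in> {0..<\<infinity>}"
  have tr: "(restrict \<omega> {0..<\<infinity>} \<longlongrightarrow> l) (at t within ({0..<\<infinity>} \<inter> A))"
    if "(\<omega> \<longlongrightarrow> l) (at t within ({0..\<infinity>} \<inter> A))" for l A
  proof (rule Lim_transform_eventually)
    show "(\<omega> \<longlongrightarrow> l) (at t within ({0..<\<infinity>} \<inter> A))"
      by (rule tendsto_within_subset[OF that]) auto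
    show "\<forall>\<^sub>F s in at t within ({0..<\<infinity>} \<inter> A). \<omega> s = restrict \<omega> {0..<\<infinity>} s"
      by (simp add: eventually_at_filter)
  qed
  have \<omega>: "(\<omega> \<longlongrightarrow> \<omega> t) (at t within ({0..\<infinity>} \<inter> {t<..}))" "\<exists>l. (\<omega> \<longlongrightarrow> l) (at t within ({0..\<infinity>} \<inter> {..<t}))"
    using assms t unfolding skorokhod_space_def by auto
  show "(restrict \<omega> {0..<\<infinity>} \<longlongrightarrow> restrict \<omega> {0..<\<infinity>} t) (at t within ({0..<\<infinity>} \<inter> {t<..}))"
    using tr[OF \<omega>(1)] t by simp
  show "\<exists>l. (restrict \<omega> {0..<\<infinity>} \<longlongrightarrow> l) (at t within ({0..<\<infinity>} \<inter> {..<t}))"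
    using \<omega>(2) tr by blast
qed simp

text \<open>Each time of the chain is moved to the right by so little that the value changes by less
  than half the excess over \<open>\<epsilon>\<close> of either adjacent increment, and the next
  time is not reached. The increments are nonzero, so the original times are strictly increasing and
  there is room for the move.\<close>

lemma oscillates_dense:
  fixes x :: "real \<Rightarrow> real"
  assumes rc: "\<And>t. 0 \<le> t \<Longrightarrow> (x \<longlongrightarrow> x t) (at_right t)" and D: "\<And>t b. 0 \<le> t \<Longrightarrow> t < b \<Longrightarrow> \<exists>s\<in>D. t < s \<and> s < b"
    and osc: "oscillates x a N \<epsilon>" and a: "0 \<le> a" and \<epsilon>: "0 \<le> \<epsilon>"
  obtains s :: "nat \<Rightarrow> real" where "\<And>j. j \<le> N \<Longrightarrow> s j \<in> D \<and> 0 \<le> s j" "\<And>j. j < N \<Longrightarrow> s j \<le> s (Suc j)"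
    "\<And>j. j < N \<Longrightarrow> \<epsilon> < \<bar>x (s (Suc j)) - x (s j)\<bar>"
proof -
  obtain s where s: "s 0 = a" "\<And>j. j < N \<Longrightarrow> s j \<le> s (Suc j)" "\<And>j. j < N \<Longrightarrow> \<epsilon> < \<bar>x (s (Suc j)) - x (s j)\<bar>"
    using osc unfolding oscillates_def by blast
  have s0: "0 \<le> s j" if "j \<le> N" for j
    using that
  proof (induction j)
    case (Suc j)
    then show ?case using s(2)[of j] by simp
  qed (use s(1) a in simp)
  have less: "s j < s (Suc j)" if "j < N" for j
    using s(2,3)[OF that] \<epsilon> by (cases "s j = s (Suc j)") auto
  define d where "d j = (\<bar>x (s (Suc j)) - x (s j)\<bar> - \<epsilon>) / 2" for j
  have d: "0 < d j" if "j < N" for j using s(3)[OF that] by (simp add: d_def)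
  have "\<exists>q\<in>D. s j < q \<and> (j < N \<longrightarrow> q < s (Suc j) \<and> \<bar>x q - x (s j)\<bar> < d j) \<and> (0 < j \<longrightarrow> \<bar>x q - x (s j)\<bar> < d (j - 1))"
    if j: "j \<le> N" for j
  proof -
    have ev: "\<forall>\<^sub>F q in at_right (s j). \<bar>x q - x (s j)\<bar> < \<eta>" if "0 < \<eta>" for \<eta>
      using tendstoD[OF rc[OF s0[OF j]] that] by (simp add: dist_real_def)
    have "\<forall>\<^sub>F q in at_right (s j). (j < N \<longrightarrow> q < s (Suc j) \<and> \<bar>x q - x (s j)\<bar> < d j) \<and> (0 < j \<longrightarrow> \<bar>x q - x (s j)\<bar> < d (j - 1))"
    proof (rule eventually_conj)
      show "\<forall>\<^sub>F q in at_right (s j). j < N \<longrightarrow> q < s (Suc j) \<and> \<bar>x q - x (s j)\<bar> < d j"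
      proof (cases "j < N")
        case True
        have "\<forall>\<^sub>F q in at_right (s j). q < s (Suc j)"
          unfolding eventually_at_right_field using less[OF True] by (intro exI[of _ "s (Suc j)"]) auto
        then show ?thesis using ev[OF d[OF True]] by eventually_elim simp
      qed simp
      show "\<forall>\<^sub>F q in at_right (s j). 0 < j \<longrightarrow> \<bar>x q - x (s j)\<bar> < d (j - 1)"
      proof (cases "0 < j")
        case True
        then have "0 < d (j - 1)" using j by (intro d) simp
        then show ?thesis using ev by simp
      qed simp
    qed
    then obtain b where b: "s j < b" "\<And>q. s j < q \<Longrightarrow> q < b \<Longrightarrow>
      (j < N \<longrightarrow> q < s (Suc j) \<and> \<bar>x q - x (s j)\<bar> < d j) \<and> (0 < j \<longrightarrow> \<bar>x q - x (s j)\<bar> < d (j - 1))"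
      unfolding eventually_at_right_field by blast
    then show ?thesis using D[OF s0[OF j] b(1)] by blast
  qed
  then obtain q where q: "\<And>j. j \<le> N \<Longrightarrow> q j \<in> D" "\<And>j. j \<le> N \<Longrightarrow> s j < q j"
    "\<And>j. j < N \<Longrightarrow> q j < s (Suc j)" "\<And>j. j < N \<Longrightarrow> \<bar>x (q j) - x (s j)\<bar> < d j"
    "\<And>j. j \<le> N \<Longrightarrow> 0 < j \<Longrightarrow> \<bar>x (q j) - x (s j)\<bar> < d (j - 1)"
    by (metis less_imp_le)
  show thesis
  proof (rule that[of q])
    show "q j \<in> D \<and> 0 \<le> q j" if "j \<le> N" for j using q(1,2)[OF that] s0[OF that] by simp
    show "q j \<le> q (Suc j)" if "j < N" for j using q(3)[OF that] q(2)[of "Suc j"] that by simp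
    show "\<epsilon> < \<bar>x (q (Suc j)) - x (q j)\<bar>" if "j < N" for j
    proof -
      have "\<bar>x (s (Suc j)) - x (s j)\<bar> \<le> \<bar>x (q (Suc j)) - x (s (Suc j))\<bar> + \<bar>x (q (Suc j)) - x (q j)\<bar> + \<bar>x (q j) - x (s j)\<bar>"
        by linarith
      moreover have "\<bar>x (q (Suc j)) - x (s (Suc j))\<bar> < d j" using q(5)[of "Suc j"] that by simp
      moreover have "\<bar>x (s (Suc j)) - x (s j)\<bar> = 2 * d j + \<epsilon>"
      proof -
        have "z = 2 * ((z - \<epsilon>) / 2) + \<epsilon>" for z by (simp add: field_simps)
        then show ?thesis unfolding d_def .
      qed
      ultimately show ?thesis using q(4)[OF that] by linarith
    qed
  qed
qed

text \<open>Finitely many strict inequalities at times where the functions converge hold for some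
  \<open>x n\<close> too. The move to such times changes the starting time, so a bound has to be
  known for all starting times to be inherited by the limit.\<close>

lemma oscillates_limit:
  fixes x :: "nat \<Rightarrow> real \<Rightarrow> real"
  assumes rc: "\<And>t. 0 \<le> t \<Longrightarrow> (x0 \<longlongrightarrow> x0 t) (at_right t)" and A: "countable A"
    and lim: "\<And>t. 0 \<le> t \<Longrightarrow> t \<notin> A \<Longrightarrow> (\<lambda>n. x n t) \<longlonglongrightarrow> x0 t"
    and osc: "oscillates x0 a N \<epsilon>" "0 \<le> a" "0 \<le> \<epsilon>"
  shows "\<exists>n b. 0 \<le> b \<and> oscillates (x n) b N \<epsilon>"
proof -
  have "\<exists>s\<in>-A. t < s \<and> s < b" if "0 \<le> t" "t < b" for t b
  proof -
    have "\<not> {t<..<b} \<subseteq> A"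
      using uncountable_open_interval[of t b] that(2) countable_subset[OF _ A] by blast
    then show ?thesis by auto
  qed
  from oscillates_dense[OF rc this osc] obtain s where s: "\<And>j. j \<le> N \<Longrightarrow> s j \<in> -A \<and> 0 \<le> s j"
    "\<And>j. j < N \<Longrightarrow> s j \<le> s (Suc j)" "\<And>j. j < N \<Longrightarrow> \<epsilon> < \<bar>x0 (s (Suc j)) - x0 (s j)\<bar>" by blast
  have "\<forall>\<^sub>F n in sequentially. \<forall>j\<in>{..<N}. \<epsilon> < \<bar>x n (s (Suc j)) - x n (s j)\<bar>"
  proof (intro eventually_ball_finite ballI)
    fix j assume "j \<in> {..<N}"
    then have "(\<lambda>n. \<bar>x n (s (Suc j)) - x n (s j)\<bar>) \<longlonglongrightarrow> \<bar>x0 (s (Suc j)) - x0 (s j)\<bar>"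
      using s(1)[of j] s(1)[of "Suc j"] by (intro tendsto_intros lim) auto
    then show "\<forall>\<^sub>F n in sequentially. \<epsilon> < \<bar>x n (s (Suc j)) - x n (s j)\<bar>"
      using s(3) \<open>j \<in> {..<N}\<close> by (intro order_tendstoD(1)) auto
  qed simp
  then obtain n where "\<forall>j\<in>{..<N}. \<epsilon> < \<bar>x n (s (Suc j)) - x n (s j)\<bar>"
    using eventually_happens'[OF sequentially_bot] by blast
  then have "oscillates (x n) (s 0) N \<epsilon>"
    unfolding oscillates_def using s(2) by (intro exI[of _ s]) auto
  then show ?thesis using s(1)[of 0] by blast
qed

section \<open>Tame paths and their limits in the S-topology\<close>

lemma countable_gap:
  fixes a b :: real
  assumes "countable A" "a < b"
  obtains s where "a < s" "s < b" "s \<notin> A"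
proof -
  have "\<not> {a<..<b} \<subseteq> A"
    using uncountable_open_interval[of a b] assms(2) countable_subset[OF _ assms(1)] by blast
  then obtain s where "s \<in> {a<..<b}" "s \<notin> A" by blast
  then show thesis by (intro that[of s]) auto
qed

text \<open>The threshold is half the accuracy \<open>inverse (real (Suc m))\<close> of the step
  approximation. Quantifying over all starting times \<open>a\<close> makes the set closed under
  limits.\<close>

definition tame_paths :: "ereal set \<Rightarrow> real \<Rightarrow> (nat \<Rightarrow> nat) \<Rightarrow> ('d::finite) path set" where
  "tame_paths I C N = {\<omega> \<in> skorokhod_space I. (\<forall>t\<in>I. \<forall>i. \<bar>\<omega> t $ i\<bar> \<le> C) \<and>
     (\<forall>i m a. 0 \<le> a \<longrightarrow> \<not> oscillates (stopped_path I \<omega> i) a (N m) (inverse (real (Suc m)) / 2))}"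

lemma S_converges_real_cong:
  assumes "S_converges_real T x x0" "\<And>n t. t \<in> {0..T} \<Longrightarrow> x' n t = x n t" "\<And>t. t \<in> {0..T} \<Longrightarrow> x0' t = x0 t"
  shows "S_converges_real T x' x0'"
proof -
  have "(\<forall>n. \<forall>t\<in>{0..T}. \<bar>x' n t - v n t\<bar> \<le> \<epsilon>) = (\<forall>n. \<forall>t\<in>{0..T}. \<bar>x n t - v n t\<bar> \<le> \<epsilon>)"
    "(\<forall>t\<in>{0..T}. \<bar>x0' t - v0 t\<bar> \<le> \<epsilon>) = (\<forall>t\<in>{0..T}. \<bar>x0 t - v0 t\<bar> \<le> \<epsilon>)" for v v0 \<epsilon>
    using assms(2,3) by (metis (no_types, lifting))+
  then show ?thesis using assms(1) unfolding S_converges_real_def by (simp only:)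
qed

lemma S_converges_real_subseq:
  assumes S: "S_converges_real T x x0" and r: "strict_mono (r :: nat \<Rightarrow> nat)"
  shows "S_converges_real T (\<lambda>n. x (r n)) x0"
  unfolding S_converges_real_def
proof (intro allI impI)
  fix \<epsilon> :: real assume "0 < \<epsilon>"
  then obtain v v0 where v: "\<forall>n. finite_variation T (v n)" "finite_variation T v0"
    "\<forall>n. \<forall>t\<in>{0..T}. \<bar>x n t - v n t\<bar> \<le> \<epsilon>" "\<forall>t\<in>{0..T}. \<bar>x0 t - v0 t\<bar> \<le> \<epsilon>"
    "\<forall>f. continuous_on {0..T} f \<longrightarrow> (\<lambda>n. stieltjes_integral T (v n) f) \<longlonglongrightarrow> stieltjes_integral T v0 f"
    using S[unfolded S_converges_real_def, THEN spec, THEN mp, OF \<open>0 < \<epsilon>\<close>] by (elim exE conjE) (rule that)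
  have "(\<lambda>n. stieltjes_integral T (v (r n)) f) \<longlonglongrightarrow> stieltjes_integral T v0 f" if "continuous_on {0..T} f" for f
  proof -
    have "((\<lambda>n. stieltjes_integral T (v n) f) \<circ> r) \<longlonglongrightarrow> stieltjes_integral T v0 f"
      using v(5) that by (intro LIMSEQ_subseq_LIMSEQ[OF _ r]) blast
    then show ?thesis by (simp only: comp_def)
  qed
  note conv = this
  show "\<exists>v v\<^sub>0. (\<forall>n. finite_variation T (v n)) \<and> finite_variation T v\<^sub>0 \<and>
     (\<forall>n. \<forall>t\<in>{0..T}. \<bar>x (r n) t - v n t\<bar> \<le> \<epsilon>) \<and> (\<forall>t\<in>{0..T}. \<bar>x0 t - v\<^sub>0 t\<bar> \<le> \<epsilon>) \<and>
     (\<forall>f. continuous_on {0..T} f \<longrightarrow> (\<lambda>n. stieltjes_integral T (v n) f) \<longlonglongrightarrow> stieltjes_integral T v\<^sub>0 f)"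
    by (rule exI[of _ "\<lambda>n. v (r n)"], rule exI[of _ v0], intro conjI allI impI conv v(2,4) v(1,3)[THEN spec])
qed

lemma S_converges_subseq:
  assumes S: "S_converges I w w0" and r: "strict_mono (r :: nat \<Rightarrow> nat)"
  shows "S_converges I (w \<circ> r) w0"
proof (cases "I = {0..<\<infinity>}")
  case True
  show ?thesis
    unfolding S_converges_def Let_def if_P[OF True]
  proof
    fix i
    obtain T :: "nat \<Rightarrow> real" where T: "\<forall>r. 0 < T r" "incseq T" "filterlim T at_top sequentially"
      "\<forall>r. S_converges_real (T r) (\<lambda>n t. w n (ereal t) $ i) (\<lambda>t. w0 (ereal t) $ i)"
      using S[unfolded S_converges_def Let_def if_P[OF True], rule_format, of i] by blast
    have "S_converges_real (T j) (\<lambda>n t. (w \<circ> r) n (ereal t) $ i) (\<lambda>t. w0 (ereal t) $ i)" for j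
      using S_converges_real_subseq[OF T(4)[rule_format] r] by simp
    with T show "\<exists>T::nat \<Rightarrow> real. (\<forall>r. 0 < T r) \<and> incseq T \<and> filterlim T at_top sequentially \<and>
      (\<forall>j. S_converges_real (T j) (\<lambda>n t. (w \<circ> r) n (ereal t) $ i) (\<lambda>t. w0 (ereal t) $ i))"
      by (intro exI[of _ T]) simp
  qed
next
  case False
  have "S_converges_real (real_of_ereal (Sup I)) (\<lambda>n t. (w \<circ> r) n (ereal t) $ i) (\<lambda>t. w0 (ereal t) $ i)" for i
  proof -
    have "S_converges_real (real_of_ereal (Sup I)) (\<lambda>n t. w n (ereal t) $ i) (\<lambda>t. w0 (ereal t) $ i)"
      by (rule S[unfolded S_converges_def Let_def if_not_P[OF False], THEN spec])
    from S_converges_real_subseq[OF this r] show ?thesis by simp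
  qed
  then show ?thesis unfolding S_converges_def Let_def if_not_P[OF False] by (rule allI)
qed

lemma topspace_sequential_topology: "topspace (sequential_topology D conv) = D"
proof
  show "topspace (sequential_topology D conv) \<subseteq> D"
    by (auto simp: topspace_def openin_sequential_topology)
  have "openin (sequential_topology D conv) D"
    by (simp add: openin_sequential_topology subseq_closed_def)
  then show "D \<subseteq> topspace (sequential_topology D conv)" by (rule openin_subset)
qed

text \<open>If infinitely many terms missed an open neighbourhood \<open>U\<close> of
  \<open>x\<close>, they would form a subsequence in the complement of \<open>U\<close> all of whose
  subsequences converge to \<open>x\<close>, so the closed complement would contain
  \<open>x\<close>.\<close>

lemma limitin_sequential_topology:
  assumes s: "\<And>n. s n \<in> D" and x: "x \<in> D" and conv: "conv s x"
    and sub: "\<And>s x r. conv s x \<Longrightarrow> strict_mono (r :: nat \<Rightarrow> nat) \<Longrightarrow> conv (s \<circ> r) x"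
  shows "limitin (sequential_topology D conv) s x sequentially"
  unfolding limitin_def
proof (intro conjI allI impI)
  show "x \<in> topspace (sequential_topology D conv)" using x by (simp add: topspace_sequential_topology)
  fix U assume U: "openin (sequential_topology D conv) U \<and> x \<in> U"
  show "\<forall>\<^sub>F n in sequentially. s n \<in> U"
  proof (rule ccontr)
    assume "\<not> (\<forall>\<^sub>F n in sequentially. s n \<in> U)"
    then have "infinite {n. s n \<notin> U}"
      by (simp add: frequently_cofinite[symmetric] cofinite_eq_sequentially not_eventually)
    then obtain p :: "nat \<Rightarrow> nat" where p: "strict_mono p" "\<And>n. p n \<in> {n. s n \<notin> U}"
      using infinite_enumerate by blast
    have "subseq_closed D conv (D - U)" using U by (simp add: openin_sequential_topology)
    moreover have "\<forall>n. (s \<circ> p) n \<in> D - U" using p s by simp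
    moreover have "\<exists>q::nat \<Rightarrow> nat. strict_mono q \<and> conv (s \<circ> p \<circ> r \<circ> q) x" if "strict_mono r" for r :: "nat \<Rightarrow> nat"
      using sub[OF sub[OF sub[OF conv p(1)] that] strict_mono_id] strict_mono_id by blast
    ultimately have "x \<in> D - U" unfolding subseq_closed_def using x by blast
    then show False using U by blast
  qed
qed

text \<open>The limit is glued from the coordinate limits. On \<open>[0, T]\<close> the end time is
  allowed since stopped paths are constant beyond it; on \<open>[0, \<infinity>)\<close> end times
  are picked outside the exceptional set; if \<infinity> belongs to \<open>I\<close>, a further
  subsequence takes care of the values there.\<close>

lemma tame_paths_limit:
  fixes \<omega> :: "nat \<Rightarrow> ('d::finite) path"
  assumes I: "time_domain I" and \<omega>: "\<And>n. \<omega> n \<in> tame_paths I C N"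
  obtains r :: "nat \<Rightarrow> nat" and \<omega>0 where "strict_mono r" "\<omega>0 \<in> tame_paths I C N" "limitin (S_topology I) (\<omega> \<circ> r) \<omega>0 sequentially"
proof -
  have sk: "\<omega> n \<in> skorokhod_space I" and bd: "\<And>t i. t \<in> I \<Longrightarrow> \<bar>\<omega> n t $ i\<bar> \<le> C"
    and osc: "\<And>i m a. 0 \<le> a \<Longrightarrow> \<not> oscillates (stopped_path I (\<omega> n) i) a (N m) (inverse (real (Suc m)) / 2)" for n
    using \<omega>[of n] by (auto simp: tame_paths_def)
  define x where "x n = stopped_path I (\<omega> n)" for n
  have xC: "\<bar>x n i t\<bar> \<le> C" if "0 \<le> t" for n i t
    using bd[OF time_domain_min[OF I, of "ereal t"]] that by (simp add: x_def stopped_path_def)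
  have xrc: "(x n i \<longlongrightarrow> x n i t) (at_right t)" if "0 \<le> t" for n i t
    unfolding x_def by (rule stopped_path_right_continuous[OF I sk that])
  obtain r :: "nat \<Rightarrow> nat" and x0 :: "'d \<Rightarrow> real \<Rightarrow> real" and A :: "real set" where
    r: "strict_mono r" and A: "countable A"
    and rc: "\<And>i t. 0 \<le> t \<Longrightarrow> (x0 i \<longlongrightarrow> x0 i t) (at_right t)"
    and ll: "\<And>i t. 0 < t \<Longrightarrow> \<exists>l. (x0 i \<longlongrightarrow> l) (at_left t)"
    and lim: "\<And>i t. 0 \<le> t \<Longrightarrow> t \<notin> A \<Longrightarrow> (\<lambda>n. x (r n) i t) \<longlonglongrightarrow> x0 i t"
    and S: "\<And>i T. 0 < T \<Longrightarrow> T \<notin> A \<or> (\<forall>n. \<forall>t\<ge>T. x n i t = x n i T) \<Longrightarrow>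
      S_converges_real T (\<lambda>n. x (r n) i) (x0 i)"
  proof -
    have osc0: "\<not> oscillates (x n i) 0 (N m) (inverse (real (Suc m)) / 2)" for n i m
      unfolding x_def by (rule osc) simp
    show thesis
      by (rule S_extraction[where x = x and C = C and N = N, OF xrc xC osc0]) (assumption+, rule that)
  qed
  have "\<exists>q y. strict_mono (q :: nat \<Rightarrow> nat) \<and> (\<infinity> \<in> I \<longrightarrow> (\<lambda>n. \<omega> (r (q n)) \<infinity>) \<longlonglongrightarrow> y \<and> (\<forall>i. \<bar>y $ i\<bar> \<le> C))"
  proof (cases "\<infinity> \<in> I")
    case True
    have "bounded (range (\<lambda>n. \<omega> (r n) \<infinity>))"
    proof -
      have "norm (\<omega> (r n) \<infinity>) \<le> (\<Sum>i\<in>(UNIV::'d set). C)" for n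
        using bd[OF True] by (intro order_trans[OF norm_le_l1_cart] sum_mono) auto
      then show ?thesis unfolding bounded_iff by blast
    qed
    then obtain y and q :: "nat \<Rightarrow> nat" where q: "strict_mono q" "((\<lambda>n. \<omega> (r n) \<infinity>) \<circ> q) \<longlonglongrightarrow> y"
      using bounded_imp_convergent_subsequence by blast
    have "\<bar>y $ i\<bar> \<le> C" for i
    proof (rule LIMSEQ_le_const2)
      show "(\<lambda>n. \<bar>\<omega> (r (q n)) \<infinity> $ i\<bar>) \<longlonglongrightarrow> \<bar>y $ i\<bar>" using q(2) by (intro tendsto_intros) (simp add: comp_def)
    qed (use bd[OF True] in auto)
    then show ?thesis using q by (auto simp: comp_def)
  qed (use strict_mono_id in blast)
  then obtain q y where q: "strict_mono (q :: nat \<Rightarrow> nat)"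
    and y: "\<infinity> \<in> I \<Longrightarrow> (\<lambda>n. \<omega> (r (q n)) \<infinity>) \<longlonglongrightarrow> y" "\<And>i. \<infinity> \<in> I \<Longrightarrow> \<bar>y $ i\<bar> \<le> C" by blast
  define p where "p = r \<circ> q"
  have p: "strict_mono p" unfolding p_def by (rule strict_mono_o[OF r q])
  have limp: "(\<lambda>n. x (p n) i t) \<longlonglongrightarrow> x0 i t" if "0 \<le> t" "t \<notin> A" for i t
    using LIMSEQ_subseq_LIMSEQ[OF lim[OF that] q] by (simp add: p_def comp_def)
  have Sp: "S_converges_real T (\<lambda>n. x (p n) i) (x0 i)" if "0 < T" "T \<notin> A \<or> (\<forall>n. \<forall>t\<ge>T. x n i t = x n i T)" for i T
    using S_converges_real_subseq[OF S[OF that] q] by (simp add: p_def)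
  have x0C: "\<bar>x0 i t\<bar> \<le> C" if t: "0 \<le> t" for i t
  proof (rule right_limit_le[OF _ A])
    show "((\<lambda>s. \<bar>x0 i s\<bar>) \<longlongrightarrow> \<bar>x0 i t\<bar>) (at_right t)" by (intro tendsto_intros rc t)
    fix s assume "t < s" "s \<notin> A"
    then show "\<bar>x0 i s\<bar> \<le> C"
      using tendsto_le_eps[OF limp[of s i], of 0 C] xC[of s] t by simp
  qed
  define \<omega>0 where "\<omega>0 = glue_path I y x0"
  have sk0: "\<omega>0 \<in> skorokhod_space I"
    unfolding \<omega>0_def by (rule glue_path_in_skorokhod_space[OF I rc ll])
  \<comment> \<open>Being constant after \<open>T\<close> passes to the limit first at times of
    convergence, then to all times by right-continuity. It makes the glued path, stopped again,
    agree with \<open>x0\<close> beyond the end of a bounded interval.\<close>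
  have const: "x0 i t = x0 i T" if T: "0 \<le> T" "T \<le> t" "\<forall>n. \<forall>t\<ge>T. x n i t = x n i T" for i t T
  proof -
    obtain s0 where s0: "T < s0" "s0 < T + 1" "s0 \<notin> A" by (rule countable_gap[OF A, of T "T + 1"]) auto
    have *: "x0 i s = x0 i s0" if "s > T" "s \<notin> A" for s
    proof -
      have "x n i s = x n i s0" for n
        using T(3)[rule_format, of s n] T(3)[rule_format, of s0 n] that(1) s0(1) by simp
      then have "(\<lambda>n. x (p n) i s) \<longlonglongrightarrow> x0 i s0" using limp[of s0 i] s0 T(1) by simp
      moreover have "(\<lambda>n. x (p n) i s) \<longlonglongrightarrow> x0 i s" using that T(1) by (intro limp) auto
      ultimately show ?thesis using LIMSEQ_unique by blast
    qed
    have "\<bar>x0 i s - x0 i s0\<bar> \<le> 0" if "s \<ge> T" for s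
    proof (rule right_limit_le[OF _ A])
      show "((\<lambda>u. \<bar>x0 i u - x0 i s0\<bar>) \<longlongrightarrow> \<bar>x0 i s - x0 i s0\<bar>) (at_right s)"
        using that T by (intro tendsto_intros rc) auto
    qed (use * that in auto)
    from this[of t] this[of T] show ?thesis using T(2) by simp
  qed
  have ext0: "stopped_path I \<omega>0 i t = x0 i t" if t: "0 \<le> t" for i t
    using I
  proof (cases rule: time_domain_cases)
    case (1 T)
    show ?thesis
    proof (cases "t \<le> T")
      case True
      then show ?thesis using t 1 by (simp add: stopped_path_def \<omega>0_def glue_path_def min_def)
    next
      case False
      have "x n i s = x n i T" if "s \<ge> T" for n s
        using that 1 by (simp add: x_def stopped_path_def min_absorb2)
      then have c: "\<forall>n. \<forall>s\<ge>T. x n i s = x n i T" by blast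
      have "x0 i t = x0 i T" by (rule const[OF _ _ c]) (use False 1 in auto)
      then show ?thesis using False 1 by (simp add: stopped_path_def \<omega>0_def glue_path_def min_def)
    qed
  qed (use t in \<open>simp_all add: stopped_path_def \<omega>0_def glue_path_def\<close>)
  have tame: "\<omega>0 \<in> tame_paths I C N"
    unfolding tame_paths_def
  proof (intro CollectI conjI ballI allI impI sk0 notI)
    fix t i assume t: "t \<in> I"
    show "\<bar>\<omega>0 t $ i\<bar> \<le> C"
    proof (cases "t = \<infinity>")
      case False
      then obtain s where "t = ereal s" "0 \<le> s" using time_domain_nonneg[OF I t] by (cases t) auto
      then show ?thesis using x0C[of s i] t by (simp add: \<omega>0_def glue_path_def)
    qed (use y(2) t in \<open>simp add: \<omega>0_def glue_path_def\<close>)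
  next
    fix i m a assume a: "0 \<le> a" "oscillates (stopped_path I \<omega>0 i) a (N m) (inverse (real (Suc m)) / 2)"
    have rc': "(stopped_path I \<omega>0 i \<longlongrightarrow> stopped_path I \<omega>0 i t) (at_right t)" if "0 \<le> t" for t
      by (rule stopped_path_right_continuous[OF I sk0 that])
    obtain n b where "0 \<le> b" "oscillates (x (p n) i) b (N m) (inverse (real (Suc m)) / 2)"
      using oscillates_limit[OF rc' A _ a(2,1), of "\<lambda>n. x (p n) i"] limp ext0 by auto
    then show False using osc[of b "p n" i m] by (simp add: x_def)
  qed
  have Tseq: "\<exists>T::nat \<Rightarrow> real. (\<forall>j. 0 < T j \<and> T j \<notin> A) \<and> incseq T \<and> filterlim T at_top sequentially"
  proof -
    have "\<exists>T. real j + 1 < T \<and> T < real j + 2 \<and> T \<notin> A" for j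
    proof -
      obtain s where "real j + 1 < s" "s < real j + 2" "s \<notin> A"
        by (rule countable_gap[OF A, of "real j + 1" "real j + 2"]) auto
      then show ?thesis by blast
    qed
    then obtain T where T: "\<And>j. real j + 1 < T j" "\<And>j. T j < real j + 2" "\<And>j. T j \<notin> A" by metis
    have "incseq T"
    proof (rule incseq_SucI)
      fix j show "T j \<le> T (Suc j)" using T(2)[of j] T(1)[of "Suc j"] by simp
    qed
    moreover have "filterlim T at_top sequentially"
    proof (rule filterlim_at_top_mono[OF filterlim_real_sequentially])
      have "real j \<le> T j" for j using T(1)[of j] by linarith
      then show "\<forall>\<^sub>F j in sequentially. real j \<le> T j" by simp
    qed
    moreover have "0 < T j" for j using T(1)[of j] by linarith
    ultimately show ?thesis using T(3) by blast
  qed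
  have unb: "limitin (sequential_topology (skorokhod_space {0..<\<infinity>}) (S_converges {0..<\<infinity>})) w w0 sequentially"
    if w: "\<And>n. w n \<in> skorokhod_space {0..<\<infinity>}" "w0 \<in> skorokhod_space {0..<\<infinity>}"
      and eq: "\<And>n t i. 0 \<le> t \<Longrightarrow> w n (ereal t) $ i = x (p n) i t" "\<And>t i. 0 \<le> t \<Longrightarrow> w0 (ereal t) $ i = x0 i t"
    for w and w0 :: "'d path"
  proof (rule limitin_sequential_topology[where conv = "S_converges {0..<\<infinity>}", OF w])
    show "S_converges {0..<\<infinity>} (s \<circ> r) z"
      if "S_converges {0..<\<infinity>} s z" "strict_mono r" for s :: "nat \<Rightarrow> 'd path" and z and r :: "nat \<Rightarrow> nat"
      by (rule S_converges_subseq[OF that])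
    obtain T :: "nat \<Rightarrow> real" where T: "\<forall>j. 0 < T j \<and> T j \<notin> A" "incseq T" "filterlim T at_top sequentially"
      using Tseq by blast
    have "S_converges_real (T j) (\<lambda>n t. w n (ereal t) $ i) (\<lambda>t. w0 (ereal t) $ i)" for i j
      by (rule S_converges_real_cong[OF Sp[of "T j" i]]) (use T(1) eq in auto)
    then show "S_converges {0..<\<infinity>} w w0"
      unfolding S_converges_def Let_def using T by auto
  qed
  have "limitin (S_topology I) (\<omega> \<circ> p) \<omega>0 sequentially"
    using I
  proof (cases rule: time_domain_cases)
    case (1 T)
    have "limitin (sequential_topology (skorokhod_space I) (S_converges I)) (\<omega> \<circ> p) \<omega>0 sequentially"
    proof (rule limitin_sequential_topology[where conv = "S_converges I", OF _ sk0])
      show "S_converges I (s \<circ> r) z"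
        if "S_converges I s z" "strict_mono r" for s :: "nat \<Rightarrow> 'd path" and z and r :: "nat \<Rightarrow> nat"
        by (rule S_converges_subseq[OF that])
      have cst: "x n i s = x n i T" if "s \<ge> T" for n s i
        using that 1 by (simp add: x_def stopped_path_def min_absorb2)
      have "S_converges_real T (\<lambda>n t. (\<omega> \<circ> p) n (ereal t) $ i) (\<lambda>t. \<omega>0 (ereal t) $ i)" for i
      proof (rule S_converges_real_cong[OF Sp[of T i]])
        show "T \<notin> A \<or> (\<forall>n. \<forall>t\<ge>T. x n i t = x n i T)" using cst by blast
        fix t assume t: "t \<in> {0..T}"
        then have tI: "ereal t \<in> I" using 1 by simp
        show "(\<omega> \<circ> p) n (ereal t) $ i = x (p n) i t" for n
          by (simp add: x_def stopped_path_eq[OF tI])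
        show "\<omega>0 (ereal t) $ i = x0 i t" using stopped_path_eq[OF tI, of \<omega>0 i] ext0[of t i] t by simp
      qed (use 1 in simp)
      moreover have "I \<noteq> {0..<\<infinity>}"
      proof
        assume eq: "I = {0..<\<infinity>}"
        have "ereal (T + 1) \<in> I" unfolding eq using 1(1) by simp
        then show False using 1(3) by simp
      qed
      ultimately show "S_converges I (\<omega> \<circ> p) \<omega>0" using 1 by (simp add: S_converges_def)
    qed (use sk in simp_all)
    moreover have "\<infinity> \<notin> I" using 1 by simp
    ultimately show ?thesis by (simp add: S_topology_def)
  next
    case 2
    let ?f = "\<lambda>\<omega> :: 'd path. (restrict \<omega> {0..<\<infinity>}, \<omega> \<infinity>)"
    let ?X = "sequential_topology (skorokhod_space {0..<\<infinity>}) (S_converges {0..<\<infinity>}) :: 'd path topology"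
    have f: "limitin (prod_topology ?X euclidean) (?f \<circ> (\<omega> \<circ> p)) (?f \<omega>0) sequentially"
      unfolding limitin_pairwise
    proof
      have "limitin ?X (\<lambda>n. restrict (\<omega> (p n)) {0..<\<infinity>}) (restrict \<omega>0 {0..<\<infinity>}) sequentially"
      proof (rule unb)
        show "restrict (\<omega> (p n)) {0..<\<infinity>} \<in> skorokhod_space {0..<\<infinity>}" for n
          using skorokhod_space_restrict sk 2 by auto
        show "restrict \<omega>0 {0..<\<infinity>} \<in> skorokhod_space {0..<\<infinity>}" using skorokhod_space_restrict sk0 2 by auto
        show "restrict (\<omega> (p n)) {0..<\<infinity>} (ereal t) $ i = x (p n) i t" if "0 \<le> t" for n t i
          using that 2 by (simp add: x_def stopped_path_def)
        show "restrict \<omega>0 {0..<\<infinity>} (ereal t) $ i = x0 i t" if "0 \<le> t" for t i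
          using ext0[OF that, of i] that 2 by (simp add: stopped_path_def)
      qed
      then show "limitin ?X (fst \<circ> (?f \<circ> (\<omega> \<circ> p))) (fst (?f \<omega>0)) sequentially" by (simp add: comp_def)
      have "\<omega>0 \<infinity> = y" using 2 by (simp add: \<omega>0_def glue_path_def)
      then show "limitin euclidean (snd \<circ> (?f \<circ> (\<omega> \<circ> p))) (snd (?f \<omega>0)) sequentially"
        using y(1) 2 by (simp add: comp_def p_def)
    qed
    have "limitin (pullback_topology (skorokhod_space I) ?f (prod_topology ?X euclidean)) (\<omega> \<circ> p) \<omega>0 sequentially"
      unfolding limitin_def
    proof (intro conjI allI impI)
      show "\<omega>0 \<in> topspace (pullback_topology (skorokhod_space I) ?f (prod_topology ?X euclidean))"
        using limitin_topspace[OF f] sk0 by (simp add: topspace_pullback_topology)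
      fix U assume "openin (pullback_topology (skorokhod_space I) ?f (prod_topology ?X euclidean)) U \<and> \<omega>0 \<in> U"
      then obtain V where V: "openin (prod_topology ?X euclidean) V" "U = ?f -` V \<inter> skorokhod_space I" "?f \<omega>0 \<in> V"
        unfolding openin_pullback_topology by blast
      have "\<forall>\<^sub>F n in sequentially. (?f \<circ> (\<omega> \<circ> p)) n \<in> V" using limitinD[OF f V(1,3)] .
      then show "\<forall>\<^sub>F n in sequentially. (\<omega> \<circ> p) n \<in> U"
        by (rule eventually_mono) (use V(2) sk in simp)
    qed
    then show ?thesis using 2 by (simp add: S_topology_def)
  next
    case 3
    have "limitin (sequential_topology (skorokhod_space {0..<\<infinity>}) (S_converges {0..<\<infinity>})) (\<omega> \<circ> p) \<omega>0 sequentially"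
    proof (rule unb)
      show "(\<omega> \<circ> p) n (ereal t) $ i = x (p n) i t" if "0 \<le> t" for n t i
        using that 3 by (simp add: x_def stopped_path_def)
      show "\<omega>0 (ereal t) $ i = x0 i t" if "0 \<le> t" for t i
        using ext0[OF that, of i] that 3 by (simp add: stopped_path_def)
    qed (use sk sk0 3 in auto)
    then show ?thesis using 3 by (simp add: S_topology_def)
  qed
  then show thesis using that[OF p tame] by blast
qed

lemma sequentially_compactin_tame_paths:
  assumes I: "time_domain I" and top: "topspace X = skorokhod_space I"
    and weaker: "\<And>U. openin X U \<Longrightarrow> openin (S_topology I) U"
  shows "sequentially_compactin X (tame_paths I C N)"
  unfolding sequentially_compactin_def
proof (intro conjI allI impI)
  show "tame_paths I C N \<subseteq> topspace X" unfolding top by (auto simp: tame_paths_def)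
  fix s :: "nat \<Rightarrow> 'a path" assume "\<forall>n. s n \<in> tame_paths I C N"
  then obtain r :: "nat \<Rightarrow> nat" and w where r: "strict_mono r" "w \<in> tame_paths I C N" "limitin (S_topology I) (s \<circ> r) w sequentially"
    using tame_paths_limit[OF I] by blast
  have "limitin X (s \<circ> r) w sequentially"
    using r(2,3) weaker unfolding limitin_def top by (auto simp: tame_paths_def)
  then show "\<exists>x\<in>tame_paths I C N. \<exists>r. strict_mono r \<and> limitin X (s \<circ> r) x sequentially"
    using r by blast
qed

section \<open>Bounded quasimartingales\<close>

lemma measurable_sub_sigma_algebra:
  assumes "f \<in> measurable M N" "space M' = space M" "sets M \<subseteq> sets M'"
  shows "f \<in> measurable M' N"
proof (rule measurableI)
  show "f x \<in> space N" if "x \<in> space M'" for x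
    using that assms(2) measurable_space[OF assms(1)] by simp
  show "f -` A \<inter> space M' \<in> sets M'" if "A \<in> sets N" for A
    using measurable_sets[OF assms(1) that] assms(2,3) by (simp only: subsetD)
qed

lemma sets_sigma_generated: "G \<subseteq> Pow D \<Longrightarrow> sets (sigma D G) = sigma_sets D G"
  by (rule sets_measure_of)

lemma space_raw_filtration [simp]: "space (raw_filtration I t) = skorokhod_space I"
  and space_right_filtration [simp]: "space (right_filtration I t) = skorokhod_space I"
  and space_path_algebra [simp]: "space (path_algebra I) = skorokhod_space I"
  by (simp_all add: raw_filtration_def right_filtration_def path_algebra_def space_measure_of_conv)

lemma sets_raw_filtration: "sets (raw_filtration I t) = sigma_sets (skorokhod_space I)
     {{\<omega> \<in> skorokhod_space I. \<omega> s \<in> A} | s A. s \<in> I \<and> s \<le> t \<and> A \<in> sets borel}"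
  unfolding raw_filtration_def by (rule sets_sigma_generated) auto

lemma raw_filtration_subset_Pow: "sets (raw_filtration I t) \<subseteq> Pow (skorokhod_space I)"
  using sets.space_closed[of "raw_filtration I t"] by simp

lemma sets_path_algebra: "sets (path_algebra I) = sigma_sets (skorokhod_space I) (\<Union>t\<in>I. sets (raw_filtration I t))"
  unfolding path_algebra_def by (rule sets_sigma_generated) (intro UN_least raw_filtration_subset_Pow)

lemma sets_right_filtration: "sets (right_filtration I t) =
    sigma_sets (skorokhod_space I) (\<Inter>\<epsilon>\<in>{0<..}. sets (raw_filtration I (t + ereal \<epsilon>)))"
  unfolding right_filtration_def
proof (rule sets_sigma_generated)
  show "(\<Inter>\<epsilon>\<in>{0<..}. sets (raw_filtration I (t + ereal \<epsilon>))) \<subseteq> Pow (skorokhod_space I)"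
    by (rule order_trans[OF INT_lower[of 1] raw_filtration_subset_Pow]) simp
qed

lemma raw_filtration_mono:
  assumes "s \<le> t" shows "sets (raw_filtration I s) \<subseteq> sets (raw_filtration I t)"
  unfolding sets_raw_filtration
proof (rule sigma_sets_mono', clarify)
  fix u and A :: "(real ^ 'a) set"
  assume "u \<in> I" "u \<le> s" "A \<in> sets borel"
  then show "\<exists>u' A'. {\<omega> \<in> skorokhod_space I. \<omega> u \<in> A} = {\<omega> \<in> skorokhod_space I. \<omega> u' \<in> A'} \<and> u' \<in> I \<and> u' \<le> t \<and> A' \<in> sets borel"
    using order_trans[OF _ assms, of u] by blast
qed

lemma raw_le_right_filtration: "sets (raw_filtration I t) \<subseteq> sets (right_filtration I t)"
proof
  fix A assume A: "A \<in> sets (raw_filtration I t)"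
  have "A \<in> sets (raw_filtration I (t + ereal \<epsilon>))" if "\<epsilon> > 0" for \<epsilon>
  proof -
    have "t \<le> t + ereal \<epsilon>" using that by (cases t) auto
    then show ?thesis using raw_filtration_mono A by blast
  qed
  then show "A \<in> sets (right_filtration I t)" unfolding sets_right_filtration by auto
qed

lemma right_le_raw_filtration:
  assumes "0 < \<epsilon>" shows "sets (right_filtration I t) \<subseteq> sets (raw_filtration I (t + ereal \<epsilon>))"
  unfolding sets_right_filtration
proof -
  have "(\<Inter>\<epsilon>\<in>{0<..}. sets (raw_filtration I (t + ereal \<epsilon>))) \<subseteq> sets (raw_filtration I (t + ereal \<epsilon>))"
    using assms by (intro INT_lower) simp
  from sets.sigma_sets_subset[OF this]
  show "sigma_sets (skorokhod_space I) (\<Inter>\<epsilon>\<in>{0<..}. sets (raw_filtration I (t + ereal \<epsilon>))) \<subseteq>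
      sets (raw_filtration I (t + ereal \<epsilon>))"
    unfolding space_raw_filtration .
qed

lemma raw_le_path_algebra: "sets (raw_filtration I t :: ('d::finite) path measure) \<subseteq> sets (path_algebra I)"
  unfolding sets_raw_filtration
proof (rule sets.sigma_sets_subset[of _ "path_algebra I", unfolded space_path_algebra])
  show "{{\<omega> \<in> skorokhod_space I. \<omega> s \<in> A} | s A. s \<in> I \<and> s \<le> t \<and> A \<in> sets borel} \<subseteq> sets (path_algebra I :: 'd path measure)"
  proof clarify
    fix s and A :: "(real ^ 'd) set" assume "s \<in> I" "A \<in> sets borel"
    then have "{\<omega> \<in> skorokhod_space I. \<omega> s \<in> A} \<in> sets (raw_filtration I s)"
      unfolding sets_raw_filtration by blast
    then show "{\<omega> \<in> skorokhod_space I. \<omega> s \<in> A} \<in> sets (path_algebra I)"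
      unfolding sets_path_algebra using \<open>s \<in> I\<close> by blast
  qed
qed

lemma right_le_path_algebra: "sets (right_filtration I t) \<subseteq> sets (path_algebra I)"
  by (rule order_trans[OF right_le_raw_filtration[OF zero_less_one] raw_le_path_algebra])

lemma measurable_coordinate_vec:
  assumes "s \<in> I" "s \<le> t" shows "(\<lambda>\<omega> :: ('d::finite) path. \<omega> s) \<in> borel_measurable (raw_filtration I t)"
proof (rule measurableI)
  fix A :: "(real ^ 'd) set" assume "A \<in> sets borel"
  then have "{\<omega> \<in> skorokhod_space I. \<omega> s \<in> A} \<in> sets (raw_filtration I t)"
    unfolding sets_raw_filtration using assms by blast
  also have "{\<omega> \<in> skorokhod_space I. \<omega> s \<in> A} = (\<lambda>\<omega>. \<omega> s) -` A \<inter> space (raw_filtration I t)" by auto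
  finally show "(\<lambda>\<omega>. \<omega> s) -` A \<inter> space (raw_filtration I t) \<in> sets (raw_filtration I t)" .
qed simp

lemma measurable_coordinate:
  assumes "s \<in> I" "s \<le> t" shows "(\<lambda>\<omega> :: ('d::finite) path. \<omega> s $ i) \<in> borel_measurable (raw_filtration I t)"
  by (rule measurable_compose[OF measurable_coordinate_vec[OF assms]]) simp

lemma measurable_coordinate_path:
  assumes "s \<in> I" shows "(\<lambda>\<omega> :: ('d::finite) path. \<omega> s $ i) \<in> borel_measurable (path_algebra I)"
proof (rule measurable_sub_sigma_algebra)
  show "(\<lambda>\<omega> :: 'd path. \<omega> s $ i) \<in> borel_measurable (raw_filtration I s)"
    by (rule measurable_coordinate[OF assms order_refl])
qed (simp, rule raw_le_path_algebra)

text \<open>Splits (UB) into separate bounds by one real constant, which avoids extended-real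
  suprema in all later estimates. A family satisfying (UB) shares one such constant.\<close>

definition UB_constant :: "ereal set \<Rightarrow> ('d::finite) path measure \<Rightarrow> real \<Rightarrow> bool" where
  "UB_constant I Q C \<longleftrightarrow> 0 \<le> C \<and> (\<forall>t\<in>I. (\<integral>\<^sup>+\<omega>. ennreal (l1norm (\<omega> t)) \<partial>Q) \<le> ennreal C) \<and>
     (\<forall>t\<in>I. \<forall>H\<in>elementary_integrands I Q. (\<integral>\<omega>. elementary_integral H t \<omega> \<partial>Q) \<le> C)"

lemma UB_constant_imp_UB:
  assumes "UB_constant I Q C" shows "UB I {Q}"
proof -
  have "enn2ereal (\<integral>\<^sup>+\<omega>. ennreal (l1norm (\<omega> t)) \<partial>Q) +
      (SUP H\<in>elementary_integrands I Q. ereal (\<integral>\<omega>. elementary_integral H t \<omega> \<partial>Q)) \<le> ereal C + ereal C" if "t \<in> I" for t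
  proof (rule add_mono)
    have "enn2ereal (\<integral>\<^sup>+\<omega>. ennreal (l1norm (\<omega> t)) \<partial>Q) \<le> enn2ereal (ennreal C)"
      using assms that unfolding UB_constant_def less_eq_ennreal.rep_eq[symmetric] by blast
    then show "enn2ereal (\<integral>\<^sup>+\<omega>. ennreal (l1norm (\<omega> t)) \<partial>Q) \<le> ereal C"
      using assms unfolding UB_constant_def by (simp add: enn2ereal_ennreal)
    show "(SUP H\<in>elementary_integrands I Q. ereal (\<integral>\<omega>. elementary_integral H t \<omega> \<partial>Q)) \<le> ereal C"
      using assms that unfolding UB_constant_def by (intro SUP_least) auto
  qed
  then have "(SUP t\<in>I. enn2ereal (\<integral>\<^sup>+\<omega>. ennreal (l1norm (\<omega> t)) \<partial>Q) +
      (SUP H\<in>elementary_integrands I Q. ereal (\<integral>\<omega>. elementary_integral H t \<omega> \<partial>Q))) \<le> ereal C + ereal C"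
    by (rule SUP_least)
  also have "\<dots> < \<infinity>" by simp
  finally show ?thesis by (simp add: UB_def)
qed

lemma zero_integrand:
  assumes "time_domain I" shows "(0, \<lambda>_ _. 0, \<lambda>_ _ _. 0) \<in> elementary_integrands I Q"
  using time_domain_zero[OF assms] by (simp add: elementary_integrands_def)

lemma UB_imp_UB_constant:
  assumes I: "time_domain I" and UB: "UB I \<Q>"
  obtains C where "\<And>Q. Q \<in> \<Q> \<Longrightarrow> UB_constant I Q C"
proof -
  let ?e = "\<lambda>Q t. enn2ereal (\<integral>\<^sup>+\<omega>. ennreal (l1norm (\<omega> t)) \<partial>Q)"
  let ?s = "\<lambda>Q t. SUP H\<in>elementary_integrands I Q. ereal (\<integral>\<omega>. elementary_integral H t \<omega> \<partial>Q)"
  define S where "S = (SUP Q\<in>\<Q>. SUP t\<in>I. ?e Q t + ?s Q t)"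
  have "S < \<infinity>" using UB by (simp add: S_def UB_def)
  then obtain C where C: "S \<le> ereal C" "0 \<le> C"
  proof (cases S)
    case (real r)
    then show thesis by (intro that[of "max 0 r"]) auto
  next
    case MInf
    then show thesis by (intro that[of 0]) auto
  qed (use \<open>S < \<infinity>\<close> in simp)
  have "UB_constant I Q C" if Q: "Q \<in> \<Q>" for Q
    unfolding UB_constant_def
  proof (intro conjI ballI C(2))
    fix t assume t: "t \<in> I"
    have "?e Q t + ?s Q t \<le> S"
      unfolding S_def using Q t by (intro SUP_upper2[OF Q] SUP_upper2[OF t]) auto
    then have le: "?e Q t + ?s Q t \<le> ereal C" using C(1) by (rule order_trans)
    \<comment> \<open>The zero integrand makes the supremum nonnegative, so each of the two summands
      is bounded by their sum.\<close>
    have s0: "0 \<le> ?s Q t"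
      using SUP_upper[OF zero_integrand[OF I], of "\<lambda>H. ereal (\<integral>\<omega>. elementary_integral H t \<omega> \<partial>Q)"]
      by (simp add: zero_ereal_def)
    have "?e Q t \<le> ?e Q t + ?s Q t" using s0 by (simp add: add_increasing2)
    then have "?e Q t \<le> ereal C" using le by (rule order_trans)
    then show "(\<integral>\<^sup>+\<omega>. ennreal (l1norm (\<omega> t)) \<partial>Q) \<le> ennreal C"
      using C(2) by (simp add: less_eq_ennreal.rep_eq enn2ereal_ennreal)
    fix H assume "H \<in> elementary_integrands I Q"
    then have "ereal (\<integral>\<omega>. elementary_integral H t \<omega> \<partial>Q) \<le> ?s Q t" by (rule SUP_upper)
    also have "\<dots> \<le> ?e Q t + ?s Q t" by (simp add: add_increasing enn2ereal_nonneg)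
    finally have "ereal (\<integral>\<omega>. elementary_integral H t \<omega> \<partial>Q) \<le> ereal C" using le by (rule order_trans)
    then show "(\<integral>\<omega>. elementary_integral H t \<omega> \<partial>Q) \<le> C" by simp
  qed
  then show thesis by (rule that)
qed

lemma abs_le_l1norm: "\<bar>x $ i\<bar> \<le> l1norm x"
  unfolding l1norm_def by (rule member_le_sum) auto

locale bounded_quasimartingale = prob_space Q for Q :: "('d::finite) path measure" +
  fixes I :: "ereal set" and C :: real
  assumes time_domain: "time_domain I" and sets_Q: "sets Q = sets (path_algebra I)"
    and UB_constant: "UB_constant I Q C"
begin

lemma space_Q: "space Q = skorokhod_space I"
  using sets_eq_imp_space_eq[OF sets_Q] by simp

lemma C_nonneg: "0 \<le> C"
  using UB_constant by (simp add: UB_constant_def)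

lemma coordinate_measurable: "t \<in> I \<Longrightarrow> (\<lambda>\<omega>. \<omega> t $ i) \<in> borel_measurable Q"
  by (rule measurable_if_sets_eq[OF measurable_coordinate_path sets_Q])

lemma right_filtration_measurable:
  "f \<in> measurable (right_filtration I t) M \<Longrightarrow> f \<in> measurable Q M"
  by (erule measurable_sub_sigma_algebra) (simp add: space_Q, unfold sets_Q, rule right_le_path_algebra)

lemma
  assumes t: "t \<in> I"
  shows coordinate_integrable: "integrable Q (\<lambda>\<omega>. \<omega> t $ i)"
    and coordinate_L1: "(\<integral>\<omega>. \<bar>\<omega> t $ i\<bar> \<partial>Q) \<le> C"
proof -
  have le: "(\<integral>\<^sup>+\<omega>. ennreal (norm (\<omega> t $ i)) \<partial>Q) \<le> ennreal C"
  proof -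
    have "(\<integral>\<^sup>+\<omega>. ennreal (norm (\<omega> t $ i)) \<partial>Q) \<le> (\<integral>\<^sup>+\<omega>. ennreal (l1norm (\<omega> t)) \<partial>Q)"
      using abs_le_l1norm by (intro nn_integral_mono ennreal_leI) auto
    also have "\<dots> \<le> ennreal C" using UB_constant t unfolding UB_constant_def by blast
    finally show ?thesis .
  qed
  show int: "integrable Q (\<lambda>\<omega>. \<omega> t $ i)"
    using le coordinate_measurable[OF t] by (intro integrableI_bounded) (auto intro: le_less_trans)
  have "ennreal (\<integral>\<omega>. \<bar>\<omega> t $ i\<bar> \<partial>Q) \<le> ennreal C"
    using le int by (simp add: nn_integral_eq_integral integrable_abs)
  then show "(\<integral>\<omega>. \<bar>\<omega> t $ i\<bar> \<partial>Q) \<le> C" using C_nonneg by simp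
qed

lemma integrable_mult_bounded:
  assumes "integrable Q X" "h \<in> borel_measurable Q" "\<And>\<omega>. \<bar>h \<omega>\<bar> \<le> K"
  shows "integrable Q (\<lambda>\<omega>. h \<omega> * X \<omega> :: real)"
proof (rule Bochner_Integration.integrable_bound[of Q "\<lambda>\<omega>. K * X \<omega>"])
  show "AE \<omega> in Q. norm (h \<omega> * X \<omega>) \<le> norm (K * X \<omega>)"
    using assms(3) by (intro AE_I2) (metis abs_ge_zero abs_mult abs_of_nonneg mult_right_mono order_trans real_norm_def abs_ge_self)
qed (use assms in auto)

end

section \<open>Elementary integrals on a finite grid\<close>

definition time_grid :: "ereal set \<Rightarrow> nat \<Rightarrow> (nat \<Rightarrow> ereal) \<Rightarrow> bool" where
  "time_grid I n s \<longleftrightarrow> (\<forall>k\<le>n. s k \<in> I) \<and> (\<forall>k<n. s k \<le> s (Suc k))"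

lemma time_grid_mono:
  assumes "time_grid I n s" "j \<le> k" "k \<le> n" shows "s j \<le> s k"
  using assms(2,3)
proof (induction k rule: dec_induct)
  case (step k)
  have "s k \<le> s (Suc k)" using step assms(1) by (simp add: time_grid_def)
  then show ?case using step order_trans by simp
qed simp

text \<open>
  The weights of an elementary integrand are indexed by times rather than by grid positions; where a
  grid repeats a time, the weight of its last occurrence is the only one that matters.
\<close>

lemma (in bounded_quasimartingale) elementary_bound:
  assumes s: "time_grid I n s" and h: "\<And>k. k < n \<Longrightarrow> h k \<in> borel_measurable (right_filtration I (s k))"
    and h1: "\<And>k \<omega>. \<bar>h k \<omega>\<bar> \<le> 1"
  shows "(\<integral>\<omega>. (\<Sum>k<n. h k \<omega> * (\<omega> (s (Suc k)) $ i - \<omega> (s k) $ i)) \<partial>Q) \<le> 2 * C"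
proof -
  have sI: "s k \<in> I" if "k \<le> n" for k using s that by (simp add: time_grid_def)
  define h' where "h' t = (if \<exists>k<n. s k = t then h (Max {k. k < n \<and> s k = t}) else (\<lambda>_. 0))" for t
  have h'm: "h' t \<in> borel_measurable (right_filtration I t)" for t
  proof (cases "\<exists>k<n. s k = t")
    case True
    then have "Max {k. k < n \<and> s k = t} \<in> {k. k < n \<and> s k = t}" by (intro Max_in) auto
    then show ?thesis using True h[of "Max {k. k < n \<and> s k = t}"] by (auto simp: h'_def)
  next
    case False
    then have "h' t = (\<lambda>_. 0)" unfolding h'_def by (rule if_not_P)
    then show ?thesis by simp
  qed
  have h'1: "\<bar>h' t \<omega>\<bar> \<le> 1" for t \<omega>
    by (cases "\<exists>k<n. s k = t") (simp_all only: h'_def if_True if_False h1 abs_zero zero_le_one)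
  have h's: "h' (s k) = h k" if k: "k < n" "s k \<noteq> s (Suc k)" for k
  proof -
    have "Max {j. j < n \<and> s j = s k} = k"
    proof (rule Max_eqI)
      fix j assume "j \<in> {j. j < n \<and> s j = s k}"
      moreover have "s (Suc k) \<le> s j" if "Suc k \<le> j" "j < n" using time_grid_mono[OF s] that by simp
      moreover have "s k < s (Suc k)" using k s by (simp add: time_grid_def order_less_le)
      ultimately show "j \<le> k" by (cases "j \<le> k") auto
    qed (use k in auto)
    then show ?thesis using k by (auto simp: h'_def)
  qed
  \<comment> \<open>Elementary integrands start at time 0, so 0 is put in front of the grid, which
    adds one step; coordinates other than \<open>i\<close> get weight zero.\<close>
  define \<tau> :: "'d \<Rightarrow> nat \<Rightarrow> ereal" where "\<tau> j k = (if k = 0 then 0 else s (k - 1))" for j k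
  define H where "H j t = (if j = i then h' t else (\<lambda>_. 0))" for j t
  have E: "(Suc n, \<tau>, H) \<in> elementary_integrands I Q"
    unfolding elementary_integrands_def
  proof (clarify, intro conjI allI impI)
    fix j k
    show "\<tau> j 0 = 0" by (simp add: \<tau>_def)
    show "\<tau> j k \<le> \<tau> j (Suc k)" if "k < Suc n"
    proof (cases k)
      case 0
      then show ?thesis using time_domain_nonneg[OF time_domain sI[of 0]] by (simp add: \<tau>_def)
    next
      case (Suc l)
      then show ?thesis using s that by (simp add: \<tau>_def time_grid_def)
    qed
    show "\<tau> j k \<in> I" if "k \<le> Suc n"
      using that sI[of "k - 1"] time_domain_zero[OF time_domain] by (simp add: \<tau>_def)
    show "H j (\<tau> j k) \<in> borel_measurable (right_filtration I (\<tau> j k))" using h'm by (simp add: H_def)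
    show "AE \<omega> in Q. \<bar>H j (\<tau> j k) \<omega>\<bar> \<le> 1" using h'1 by (simp add: H_def)
  qed
  \<comment> \<open>The initial term and the step from 0 to \<open>s 0\<close> carry the same weight
    \<open>h' 0\<close> and combine to \<open>h' 0\<close> times the value at \<open>s 0\<close>.
    Removing it costs one more C, whence 2 C.\<close>
  have eq: "elementary_integral (Suc n, \<tau>, H) (s n) \<omega> =
    h' 0 \<omega> * \<omega> (s 0) $ i + (\<Sum>k<n. h k \<omega> * (\<omega> (s (Suc k)) $ i - \<omega> (s k) $ i))" for \<omega>
  proof -
    have "elementary_integral (Suc n, \<tau>, H) (s n) \<omega> = h' 0 \<omega> * \<omega> 0 $ i +
      (\<Sum>k=1..Suc n. h' (\<tau> i (k - 1)) \<omega> * (\<omega> (min (\<tau> i k) (s n)) $ i - \<omega> (min (\<tau> i (k - 1)) (s n)) $ i))"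
      unfolding elementary_integral.simps
      by (subst sum.remove[of _ i]) (auto simp: H_def intro!: sum.neutral)
    also have "(\<Sum>k=1..Suc n. h' (\<tau> i (k - 1)) \<omega> * (\<omega> (min (\<tau> i k) (s n)) $ i - \<omega> (min (\<tau> i (k - 1)) (s n)) $ i)) =
      (\<Sum>k<Suc n. h' (\<tau> i k) \<omega> * (\<omega> (min (\<tau> i (Suc k)) (s n)) $ i - \<omega> (min (\<tau> i k) (s n)) $ i))"
      by (rule sum.reindex_bij_witness[of _ Suc "\<lambda>k. k - 1"]) auto
    also have "\<dots> = h' 0 \<omega> * (\<omega> (s 0) $ i - \<omega> 0 $ i) +
      (\<Sum>k<n. h' (s k) \<omega> * (\<omega> (min (s (Suc k)) (s n)) $ i - \<omega> (min (s k) (s n)) $ i))"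
      using time_grid_mono[OF s, of 0 n] time_domain_nonneg[OF time_domain sI[of n]]
      by (simp add: sum.lessThan_Suc_shift \<tau>_def min_absorb1 del: sum.lessThan_Suc)
    also have "(\<Sum>k<n. h' (s k) \<omega> * (\<omega> (min (s (Suc k)) (s n)) $ i - \<omega> (min (s k) (s n)) $ i)) =
      (\<Sum>k<n. h k \<omega> * (\<omega> (s (Suc k)) $ i - \<omega> (s k) $ i))"
    proof (rule sum.cong[OF refl])
      fix k assume "k \<in> {..<n}"
      then have k: "k < n" by simp
      then have "min (s (Suc k)) (s n) = s (Suc k)" "min (s k) (s n) = s k"
        using time_grid_mono[OF s] by (auto simp: min_absorb1)
      then show "h' (s k) \<omega> * (\<omega> (min (s (Suc k)) (s n)) $ i - \<omega> (min (s k) (s n)) $ i) = h k \<omega> * (\<omega> (s (Suc k)) $ i - \<omega> (s k) $ i)"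
        using h's[OF k] by (cases "s k = s (Suc k)") auto
    qed
    finally show ?thesis by (simp add: algebra_simps)
  qed
  have int0: "integrable Q (\<lambda>\<omega>. h' 0 \<omega> * \<omega> (s 0) $ i)"
    using h'1 by (intro integrable_mult_bounded[where K = 1] coordinate_integrable sI right_filtration_measurable[OF h'm]) auto
  have intS: "integrable Q (\<lambda>\<omega>. \<Sum>k<n. h k \<omega> * (\<omega> (s (Suc k)) $ i - \<omega> (s k) $ i))"
    using h1 by (intro Bochner_Integration.integrable_sum integrable_mult_bounded[where K = 1] Bochner_Integration.integrable_diff
      coordinate_integrable sI right_filtration_measurable[OF h]) auto
  have "(\<integral>\<omega>. elementary_integral (Suc n, \<tau>, H) (s n) \<omega> \<partial>Q) \<le> C"
    using UB_constant E sI[of n] unfolding UB_constant_def by blast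
  then have "(\<integral>\<omega>. h' 0 \<omega> * \<omega> (s 0) $ i \<partial>Q) + (\<integral>\<omega>. (\<Sum>k<n. h k \<omega> * (\<omega> (s (Suc k)) $ i - \<omega> (s k) $ i)) \<partial>Q) \<le> C"
    unfolding eq using int0 intS by simp
  moreover have "- (\<integral>\<omega>. h' 0 \<omega> * \<omega> (s 0) $ i \<partial>Q) \<le> C"
  proof -
    have "- (\<integral>\<omega>. h' 0 \<omega> * \<omega> (s 0) $ i \<partial>Q) \<le> (\<integral>\<omega>. \<bar>h' 0 \<omega> * \<omega> (s 0) $ i\<bar> \<partial>Q)"
      using integral_abs_bound[of Q "\<lambda>\<omega>. h' 0 \<omega> * \<omega> (s 0) $ i"] by linarith
    also have "\<dots> \<le> (\<integral>\<omega>. \<bar>\<omega> (s 0) $ i\<bar> \<partial>Q)"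
    proof (rule integral_mono)
      show "\<bar>h' 0 \<omega> * \<omega> (s 0) $ i\<bar> \<le> \<bar>\<omega> (s 0) $ i\<bar>" for \<omega>
        using h'1[of 0 \<omega>] by (simp add: abs_mult mult_left_le_one_le)
    qed (intro integrable_abs int0 coordinate_integrable sI; simp)+
    also have "\<dots> \<le> C" by (rule coordinate_L1[OF sI]) simp
    finally show ?thesis .
  qed
  ultimately show ?thesis by linarith
qed

section \<open>Discrete weights for maximal and oscillation estimates\<close>

definition clip :: "real \<Rightarrow> real \<Rightarrow> real" where
  "clip c x = max (- c) (min c x)"

lemma abs_clip_le: "0 \<le> c \<Longrightarrow> \<bar>clip c x\<bar> \<le> c"
  by (auto simp: clip_def)

lemma measurable_clip [measurable]: "clip c \<in> borel_measurable borel"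
  unfolding clip_def by measurable

text \<open>A weight that is zero until the modulus of \<open>y\<close> exceeds \<open>l\<close> and
  afterwards stays frozen at the sign of the exceeding value. It depends on the past only, hence is
  adapted.\<close>

primrec first_exceedance :: "real \<Rightarrow> (nat \<Rightarrow> real) \<Rightarrow> nat \<Rightarrow> real" where
  "first_exceedance l y 0 = (if l < \<bar>y 0\<bar> then sgn (y 0) else 0)"
| "first_exceedance l y (Suc k) = (if first_exceedance l y k \<noteq> 0 then first_exceedance l y k
     else if l < \<bar>y (Suc k)\<bar> then sgn (y (Suc k)) else 0)"

lemma abs_first_exceedance: "\<bar>first_exceedance l y k\<bar> \<le> 1"
  by (induction k) (auto simp: sgn_if)

lemma first_exceedance_nonzero:
  assumes "0 \<le> l" "j \<le> k" "l < \<bar>y j\<bar>" shows "\<bar>first_exceedance l y k\<bar> = 1"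
  using assms(2)
proof (induction k rule: dec_induct)
  case base
  then show ?case
  proof (cases j)
    case (Suc j')
    have "first_exceedance l y j' \<noteq> 0 \<Longrightarrow> \<bar>first_exceedance l y j'\<bar> = 1" for j'
      by (induction j') (auto simp: sgn_if split: if_splits)
    then show ?thesis using assms(1,3) Suc by (auto simp: sgn_if)
  qed (use assms in \<open>auto simp: sgn_if\<close>)
next
  case (step k)
  then show ?case by auto
qed

text \<open>Once the weight is nonzero it is constant, so the sum telescopes and the right side
  equals the modulus of \<open>y\<close> at the first exceedance, or 0 if there is none.\<close>

lemma first_exceedance_gain:
  assumes l: "0 \<le> l"
  shows "l * \<bar>first_exceedance l y n\<bar> \<le> first_exceedance l y n * y n - (\<Sum>k<n. first_exceedance l y k * (y (Suc k) - y k))"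
proof (induction n)
  case 0
  then show ?case using l by (auto simp: sgn_if)
next
  case (Suc n)
  show ?case
  proof (cases "first_exceedance l y n = 0")
    case True
    then have "0 \<le> - (\<Sum>k<n. first_exceedance l y k * (y (Suc k) - y k))" using Suc by simp
    moreover have "l * \<bar>first_exceedance l y (Suc n)\<bar> \<le> first_exceedance l y (Suc n) * y (Suc n)"
      using True l by (auto simp: sgn_if)
    ultimately show ?thesis using True by simp
  next
    case False
    then show ?thesis using Suc by (simp add: algebra_simps)
  qed
qed

text \<open>A lagging copy of \<open>y\<close> that moves to the current value whenever the distance
  exceeds \<open>\<epsilon>\<close>; \<open>updates\<close> counts the moves. Being computed from
  the past, it can serve as an adapted weight.\<close>

primrec reference :: "real \<Rightarrow> (nat \<Rightarrow> real) \<Rightarrow> nat \<Rightarrow> real" where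
  "reference \<epsilon> y 0 = y 0"
| "reference \<epsilon> y (Suc k) = (if \<epsilon> < \<bar>y (Suc k) - reference \<epsilon> y k\<bar> then y (Suc k) else reference \<epsilon> y k)"

primrec updates :: "real \<Rightarrow> (nat \<Rightarrow> real) \<Rightarrow> nat \<Rightarrow> nat" where
  "updates \<epsilon> y 0 = 0"
| "updates \<epsilon> y (Suc k) = (if \<epsilon> < \<bar>y (Suc k) - reference \<epsilon> y k\<bar> then Suc (updates \<epsilon> y k) else updates \<epsilon> y k)"

lemma reference_close: "0 \<le> \<epsilon> \<Longrightarrow> \<bar>y k - reference \<epsilon> y k\<bar> \<le> \<epsilon>"
  by (cases k) auto

lemma reference_bounded: "(\<And>j. j \<le> k \<Longrightarrow> \<bar>y j\<bar> \<le> c) \<Longrightarrow> \<bar>reference \<epsilon> y k\<bar> \<le> c"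
  by (induction k) auto

lemma updates_mono: "k \<le> k' \<Longrightarrow> updates \<epsilon> y k \<le> updates \<epsilon> y k'"
  by (rule lift_Suc_mono_le[of "updates \<epsilon> y"]) auto

lemma reference_unchanged:
  assumes "k \<le> k'" "updates \<epsilon> y k' = updates \<epsilon> y k" shows "reference \<epsilon> y k' = reference \<epsilon> y k"
  using assms
proof (induction k' rule: dec_induct)
  case (step j)
  have "updates \<epsilon> y k \<le> updates \<epsilon> y j" using step.hyps by (intro updates_mono) simp
  moreover have "updates \<epsilon> y j \<le> updates \<epsilon> y (Suc j)" by (rule updates_mono) simp
  ultimately have "updates \<epsilon> y j = updates \<epsilon> y k" "updates \<epsilon> y (Suc j) = updates \<epsilon> y j" using step.prems by linarith+
  then show ?case using step.IH by (auto split: if_splits)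
qed simp

text \<open>While the reference value stays unchanged, \<open>y\<close> remains within
  \<open>\<epsilon>\<close> of it, so two values differ by at most \<open>2 * \<epsilon>\<close>.
  Every larger increment therefore forces an update.\<close>

lemma updates_ge_oscillations:
  assumes \<epsilon>: "0 \<le> \<epsilon>" and \<kappa>: "\<And>j. j < N \<Longrightarrow> \<kappa> j \<le> \<kappa> (Suc j)"
    and osc: "\<And>j. j < N \<Longrightarrow> 2 * \<epsilon> < \<bar>y (\<kappa> (Suc j)) - y (\<kappa> j)\<bar>"
  shows "j \<le> N \<Longrightarrow> j \<le> updates \<epsilon> y (\<kappa> j)"
proof (induction j)
  case (Suc j)
  then have j: "j < N" by simp
  have "updates \<epsilon> y (\<kappa> (Suc j)) \<noteq> updates \<epsilon> y (\<kappa> j)"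
  proof
    assume "updates \<epsilon> y (\<kappa> (Suc j)) = updates \<epsilon> y (\<kappa> j)"
    then have "reference \<epsilon> y (\<kappa> (Suc j)) = reference \<epsilon> y (\<kappa> j)" by (rule reference_unchanged[OF \<kappa>[OF j]])
    then show False
      using reference_close[OF \<epsilon>, of y "\<kappa> (Suc j)"] reference_close[OF \<epsilon>, of y "\<kappa> j"] osc[OF j] by linarith
  qed
  then show ?case using updates_mono[OF \<kappa>[OF j], of \<epsilon> y] Suc by simp
qed simp

text \<open>
  For \<open>p = clip c a\<close>, the tangent \<open>b \<mapsto> 2 p b - p\<^sup>2\<close> touches at \<open>a\<close> the convex function
  \<open>b \<mapsto> sup {2 p b - p\<^sup>2 | \<bar>p\<bar> \<le> c}\<close>, a square continued linearly outside \<open>[-c,c]\<close>. Each update of the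
  reference value moves to the tangent at the new value and gains the square of the displacement.
\<close>

lemma clip_tangent_le:
  assumes p: "\<bar>p\<bar> \<le> c"
  shows "2 * p * b - p\<^sup>2 \<le> 2 * clip c b * b - (clip c b)\<^sup>2"
proof -
  have "\<bar>b - clip c b\<bar> \<le> \<bar>b - p\<bar>" using p by (auto simp: clip_def)
  then have "(b - clip c b)\<^sup>2 \<le> (b - p)\<^sup>2" by (simp add: abs_le_square_iff)
  then show ?thesis by (simp add: power2_diff algebra_simps)
qed

lemma reference_gain:
  assumes c: "0 \<le> c" and \<epsilon>: "0 \<le> \<epsilon>"
  shows "(if \<forall>k\<le>n. \<bar>y k\<bar> \<le> c then \<epsilon>\<^sup>2 * real (updates \<epsilon> y n) else 0) \<le>
    2 * clip c (reference \<epsilon> y n) * y n - (clip c (reference \<epsilon> y n))\<^sup>2 -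
    (\<Sum>k<n. 2 * clip c (reference \<epsilon> y k) * (y (Suc k) - y k))"
proof (induction n)
  case 0
  have "2 * 0 * y 0 - 0\<^sup>2 \<le> 2 * clip c (y 0) * y 0 - (clip c (y 0))\<^sup>2" using c by (intro clip_tangent_le) simp
  then show ?case by simp
next
  case (Suc n)
  let ?p = "clip c (reference \<epsilon> y n)" and ?b = "y (Suc n)"
  let ?S = "\<Sum>k<n. 2 * clip c (reference \<epsilon> y k) * (y (Suc k) - y k)"
  have eq: "2 * ?p * y n - ?p\<^sup>2 - ?S = 2 * ?p * ?b - ?p\<^sup>2 - (\<Sum>k<Suc n. 2 * clip c (reference \<epsilon> y k) * (y (Suc k) - y k))"
    by (simp add: algebra_simps)
  show ?case
  proof (cases "\<epsilon> < \<bar>?b - reference \<epsilon> y n\<bar>")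
    case False
    have "(if \<forall>k\<le>Suc n. \<bar>y k\<bar> \<le> c then \<epsilon>\<^sup>2 * real (updates \<epsilon> y n) else 0) \<le>
      (if \<forall>k\<le>n. \<bar>y k\<bar> \<le> c then \<epsilon>\<^sup>2 * real (updates \<epsilon> y n) else 0)" by (auto simp: le_Suc_eq)
    from order_trans[OF this Suc] have "(if \<forall>k\<le>Suc n. \<bar>y k\<bar> \<le> c then \<epsilon>\<^sup>2 * real (updates \<epsilon> y n) else 0) \<le>
      2 * ?p * ?b - ?p\<^sup>2 - (\<Sum>k<Suc n. 2 * clip c (reference \<epsilon> y k) * (y (Suc k) - y k))"
      unfolding eq .
    moreover have "reference \<epsilon> y (Suc n) = reference \<epsilon> y n" "updates \<epsilon> y (Suc n) = updates \<epsilon> y n"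
      using False by simp_all
    ultimately show ?thesis by (simp only:)
  next
    case True
    have "(if \<forall>k\<le>Suc n. \<bar>y k\<bar> \<le> c then \<epsilon>\<^sup>2 else 0) \<le> (2 * clip c ?b * ?b - (clip c ?b)\<^sup>2) - (2 * ?p * ?b - ?p\<^sup>2)"
    proof (cases "\<forall>k\<le>Suc n. \<bar>y k\<bar> \<le> c")
      case bounded: True
      then have "\<bar>?b\<bar> \<le> c" "\<bar>reference \<epsilon> y n\<bar> \<le> c" by (auto intro: reference_bounded)
      then have "clip c ?b = ?b" "?p = reference \<epsilon> y n" by (auto simp: clip_def)
      moreover have "\<epsilon>\<^sup>2 \<le> (?b - reference \<epsilon> y n)\<^sup>2" using True \<epsilon> by (simp add: abs_le_square_iff[symmetric])
      ultimately show ?thesis using bounded by (simp add: power2_eq_square algebra_simps)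
    next
      case False
      have "2 * ?p * ?b - ?p\<^sup>2 \<le> 2 * clip c ?b * ?b - (clip c ?b)\<^sup>2" by (rule clip_tangent_le[OF abs_clip_le[OF c]])
      then show ?thesis unfolding if_not_P[OF False] by simp
    qed
    moreover have "(if \<forall>k\<le>Suc n. \<bar>y k\<bar> \<le> c then \<epsilon>\<^sup>2 * real (updates \<epsilon> y (Suc n)) else 0) \<le>
      (if \<forall>k\<le>n. \<bar>y k\<bar> \<le> c then \<epsilon>\<^sup>2 * real (updates \<epsilon> y n) else 0) + (if \<forall>k\<le>Suc n. \<bar>y k\<bar> \<le> c then \<epsilon>\<^sup>2 else 0)"
      using True by (auto simp: algebra_simps le_Suc_eq)
    moreover have ref: "reference \<epsilon> y (Suc n) = ?b" using True by simp
    ultimately show ?thesis using Suc eq unfolding ref by linarith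
  qed
qed

section \<open>Probability estimates for a bounded quasimartingale on a grid\<close>

context bounded_quasimartingale
begin

lemma measurable_grid_coordinate:
  assumes s: "time_grid I n s" and k: "j \<le> k" "k \<le> n"
  shows "(\<lambda>\<omega>. \<omega> (s j) $ i) \<in> borel_measurable (right_filtration I (s k))"
proof (rule measurable_sub_sigma_algebra)
  show "(\<lambda>\<omega>. \<omega> (s j) $ i) \<in> borel_measurable (raw_filtration I (s k))"
    using s k time_grid_mono[OF s k] by (intro measurable_coordinate) (auto simp: time_grid_def)
qed (use raw_le_right_filtration in auto)

lemma measurable_first_exceedance:
  assumes s: "time_grid I n s" and k: "k \<le> n"
  shows "(\<lambda>\<omega>. first_exceedance l (\<lambda>k. \<omega> (s k) $ i) k) \<in> borel_measurable (right_filtration I (s k))"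
proof -
  have "(\<lambda>\<omega>. first_exceedance l (\<lambda>k. \<omega> (s k) $ i) j) \<in> borel_measurable (right_filtration I (s k))" if "j \<le> k" for j
    using that
  proof (induction j)
    case 0
    note [measurable] = measurable_grid_coordinate[OF s 0 k, of i]
    show ?case by simp
  next
    case (Suc j)
    note [measurable] = measurable_grid_coordinate[OF s Suc.prems k, of i] Suc.IH[OF Suc_leD[OF Suc.prems]]
    show ?case by simp
  qed
  then show ?thesis by simp
qed

lemma measurable_reference_updates:
  assumes s: "time_grid I n s" and k: "k \<le> n"
  shows "(\<lambda>\<omega>. reference \<epsilon> (\<lambda>k. \<omega> (s k) $ i) k) \<in> borel_measurable (right_filtration I (s k))"
    and "(\<lambda>\<omega>. updates \<epsilon> (\<lambda>k. \<omega> (s k) $ i) k) \<in> measurable (right_filtration I (s k)) (count_space UNIV)"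
proof -
  have "(\<lambda>\<omega>. reference \<epsilon> (\<lambda>k. \<omega> (s k) $ i) j) \<in> borel_measurable (right_filtration I (s k)) \<and>
    (\<lambda>\<omega>. updates \<epsilon> (\<lambda>k. \<omega> (s k) $ i) j) \<in> measurable (right_filtration I (s k)) (count_space UNIV)" if "j \<le> k" for j
    using that
  proof (induction j)
    case 0
    note [measurable] = measurable_grid_coordinate[OF s 0 k, of i]
    show ?case by simp
  next
    case (Suc j)
    note [measurable] = measurable_grid_coordinate[OF s Suc.prems k, of i]
      Suc.IH[OF Suc_leD[OF Suc.prems], THEN conjunct1] Suc.IH[OF Suc_leD[OF Suc.prems], THEN conjunct2]
    show ?case by simp
  qed
  then show "(\<lambda>\<omega>. reference \<epsilon> (\<lambda>k. \<omega> (s k) $ i) k) \<in> borel_measurable (right_filtration I (s k))"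
    "(\<lambda>\<omega>. updates \<epsilon> (\<lambda>k. \<omega> (s k) $ i) k) \<in> measurable (right_filtration I (s k)) (count_space UNIV)" by simp_all
qed

lemma integrable_grid_sum:
  assumes s: "time_grid I n s" and h: "\<And>k. k < n \<Longrightarrow> h k \<in> borel_measurable (right_filtration I (s k))"
    and h1: "\<And>k \<omega>. \<bar>h k \<omega>\<bar> \<le> K"
  shows "integrable Q (\<lambda>\<omega>. \<Sum>k<n. h k \<omega> * (\<omega> (s (Suc k)) $ i - \<omega> (s k) $ i))"
  using s h1 by (intro Bochner_Integration.integrable_sum integrable_mult_bounded[where K = K] Bochner_Integration.integrable_diff
    coordinate_integrable right_filtration_measurable[OF h]) (auto simp: time_grid_def)

text \<open>The gain of the first-exceedance weight bounds \<open>l\<close> times the indicator of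
  the event by the modulus at the last grid time plus an elementary sum. Their expectations are at
  most C and 2 C, independently of the grid.\<close>

lemma maximal_inequality:
  assumes s: "time_grid I n s" and l: "0 < l"
  shows "prob {\<omega> \<in> space Q. \<exists>k\<le>n. l < \<bar>\<omega> (s k) $ i\<bar>} \<le> 3 * C / l"
proof -
  define \<rho> where "\<rho> k \<omega> = first_exceedance l (\<lambda>k. \<omega> (s k) $ i) k" for k and \<omega> :: "'d path"
  have \<rho>m: "\<rho> k \<in> borel_measurable (right_filtration I (s k))" if "k \<le> n" for k
    unfolding \<rho>_def by (rule measurable_first_exceedance[OF s that])
  have \<rho>1: "\<bar>\<rho> k \<omega>\<bar> \<le> 1" for k \<omega> unfolding \<rho>_def by (rule abs_first_exceedance)
  have sn: "s n \<in> I" using s by (simp add: time_grid_def)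
  define A where "A = {\<omega> \<in> space Q. \<exists>k\<le>n. l < \<bar>\<omega> (s k) $ i\<bar>}"
  have [measurable]: "(\<lambda>\<omega>. \<omega> (s k) $ i) \<in> borel_measurable Q" if "k \<in> {..n}" for k
    using s that by (intro coordinate_measurable) (simp add: time_grid_def)
  have "A = {\<omega> \<in> space Q. \<exists>k\<in>{..n}. l < \<bar>\<omega> (s k) $ i\<bar>}" by (auto simp: A_def)
  also have "\<dots> \<in> events" by measurable
  finally have A: "A \<in> events" .
  define S where "S \<omega> = (\<Sum>k<n. - \<rho> k \<omega> * (\<omega> (s (Suc k)) $ i - \<omega> (s k) $ i))" for \<omega>
  have mS: "- \<rho> k \<in> borel_measurable (right_filtration I (s k))" if "k < n" for k
    using \<rho>m[of k] that unfolding fun_Compl_def by simp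
  have intS: "integrable Q S"
    unfolding S_def using \<rho>1 \<rho>m by (intro integrable_grid_sum[OF s, of "\<lambda>k \<omega>. - \<rho> k \<omega>" 1]) auto
  have ES: "(\<integral>\<omega>. S \<omega> \<partial>Q) \<le> 2 * C"
    unfolding S_def using \<rho>1 \<rho>m by (intro elementary_bound[OF s, of "\<lambda>k \<omega>. - \<rho> k \<omega>"]) auto
  have le: "l * indicator A \<omega> \<le> \<bar>\<omega> (s n) $ i\<bar> + S \<omega>" for \<omega>
  proof -
    have g: "l * \<bar>\<rho> n \<omega>\<bar> \<le> \<rho> n \<omega> * \<omega> (s n) $ i + S \<omega>"
      using first_exceedance_gain[of l "\<lambda>k. \<omega> (s k) $ i" n] l unfolding \<rho>_def S_def by (simp add: sum_negf)
    have "\<rho> n \<omega> * \<omega> (s n) $ i \<le> \<bar>\<rho> n \<omega>\<bar> * \<bar>\<omega> (s n) $ i\<bar>" by (metis abs_ge_self abs_mult)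
    also have "\<dots> \<le> \<bar>\<omega> (s n) $ i\<bar>" using \<rho>1[of n \<omega>] by (simp add: mult_left_le_one_le)
    finally have up: "\<rho> n \<omega> * \<omega> (s n) $ i \<le> \<bar>\<omega> (s n) $ i\<bar>" .
    have "l * indicator A \<omega> \<le> l * \<bar>\<rho> n \<omega>\<bar>"
    proof (cases "\<omega> \<in> A")
      case True
      then have "\<bar>\<rho> n \<omega>\<bar> = 1" unfolding A_def \<rho>_def using first_exceedance_nonzero[of l] l by auto
      then show ?thesis using True by simp
    qed (use l in simp)
    then show ?thesis using g up by linarith
  qed
  have "l * prob A = (\<integral>\<omega>. l * indicator A \<omega> \<partial>Q)" using A by simp
  also have "\<dots> \<le> (\<integral>\<omega>. \<bar>\<omega> (s n) $ i\<bar> + S \<omega> \<partial>Q)"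
    using le coordinate_integrable[OF sn] intS integrable_real_indicator[OF A] by (intro integral_mono) (auto simp: emeasure_eq_measure)
  also have "\<dots> = (\<integral>\<omega>. \<bar>\<omega> (s n) $ i\<bar> \<partial>Q) + (\<integral>\<omega>. S \<omega> \<partial>Q)"
    using coordinate_integrable[OF sn] intS by (intro Bochner_Integration.integral_add) auto
  also have "\<dots> \<le> 3 * C" using coordinate_L1[OF sn, of i] ES by linarith
  finally show ?thesis using l by (simp add: A_def field_simps)
qed

text \<open>The weight is minus the clipped reference value divided by \<open>c\<close>, which
  brings it into \<open>[- 1, 1]\<close>. The final tangent term contributes at most 2 c C and the
  elementary sum, rescaled by 2 c, at most 4 c C. The number of grid points does not enter, so the
  estimate survives refinement.\<close>

lemma oscillation_inequality:
  assumes s: "time_grid I n s" and c: "0 < c" and \<epsilon>: "0 < \<epsilon>" and N: "0 < N"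
  shows "{\<omega> \<in> space Q. (\<forall>k\<le>n. \<bar>\<omega> (s k) $ i\<bar> \<le> c) \<and> N \<le> updates \<epsilon> (\<lambda>k. \<omega> (s k) $ i) n} \<in> events"
    and "prob {\<omega> \<in> space Q. (\<forall>k\<le>n. \<bar>\<omega> (s k) $ i\<bar> \<le> c) \<and> N \<le> updates \<epsilon> (\<lambda>k. \<omega> (s k) $ i) n} \<le> 6 * c * C / (\<epsilon>\<^sup>2 * real N)"
proof -
  define p where "p k \<omega> = clip c (reference \<epsilon> (\<lambda>k. \<omega> (s k) $ i) k)" for k and \<omega> :: "'d path"
  have pm: "p k \<in> borel_measurable (right_filtration I (s k))" if "k \<le> n" for k
    unfolding p_def by (rule measurable_compose[OF measurable_reference_updates(1)[OF s that] measurable_clip])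
  have pc: "\<bar>p k \<omega>\<bar> \<le> c" for k \<omega> unfolding p_def using c by (intro abs_clip_le) simp
  have sn: "s n \<in> I" using s by (simp add: time_grid_def)
  define A where "A = {\<omega> \<in> space Q. (\<forall>k\<le>n. \<bar>\<omega> (s k) $ i\<bar> \<le> c) \<and> N \<le> updates \<epsilon> (\<lambda>k. \<omega> (s k) $ i) n}"
  have [measurable]: "(\<lambda>\<omega>. \<omega> (s k) $ i) \<in> borel_measurable Q" if "k \<in> {..n}" for k
    using s that by (intro coordinate_measurable) (simp add: time_grid_def)
  have [measurable]: "(\<lambda>\<omega>. updates \<epsilon> (\<lambda>k. \<omega> (s k) $ i) n) \<in> measurable Q (count_space UNIV)"
    by (rule measurable_sub_sigma_algebra[OF measurable_reference_updates(2)[OF s order_refl]])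
      (use right_le_path_algebra sets_Q space_Q in auto)
  have "A = {\<omega> \<in> space Q. (\<forall>k\<in>{..n}. \<bar>\<omega> (s k) $ i\<bar> \<le> c) \<and> N \<le> updates \<epsilon> (\<lambda>k. \<omega> (s k) $ i) n}" by (auto simp: A_def)
  also have "\<dots> \<in> events" by measurable
  finally show A: "A \<in> events" .
  define S where "S \<omega> = (\<Sum>k<n. (- p k \<omega> / c) * (\<omega> (s (Suc k)) $ i - \<omega> (s k) $ i))" for \<omega>
  have p1: "\<bar>- p k \<omega> / c\<bar> \<le> 1" for k \<omega> using pc[of k \<omega>] c by (simp add: divide_le_eq)
  have pcm: "(\<lambda>\<omega>. - p k \<omega> / c) \<in> borel_measurable (right_filtration I (s k))" if "k < n" for k
    using pm[of k] that by simp
  have intS: "integrable Q S"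
    unfolding S_def by (rule integrable_grid_sum[OF s pcm p1])
  have ES: "(\<integral>\<omega>. S \<omega> \<partial>Q) \<le> 2 * C"
    unfolding S_def by (rule elementary_bound[OF s pcm p1])
  have le: "\<epsilon>\<^sup>2 * real N * indicator A \<omega> \<le> 2 * c * \<bar>\<omega> (s n) $ i\<bar> + 2 * c * S \<omega>" for \<omega>
  proof -
    let ?y = "\<lambda>k. \<omega> (s k) $ i"
    have cS: "2 * c * S \<omega> = - (\<Sum>k<n. 2 * p k \<omega> * (?y (Suc k) - ?y k))"
      unfolding S_def sum_distrib_left sum_negf[symmetric] using c by (intro sum.cong) (auto simp: field_simps)
    have "(if \<forall>k\<le>n. \<bar>?y k\<bar> \<le> c then \<epsilon>\<^sup>2 * real (updates \<epsilon> ?y n) else 0) \<le> 2 * p n \<omega> * ?y n - (p n \<omega>)\<^sup>2 + 2 * c * S \<omega>"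
      using reference_gain[of c \<epsilon> n ?y] c \<epsilon> unfolding cS p_def by simp
    moreover have "\<epsilon>\<^sup>2 * real N * indicator A \<omega> \<le> (if \<forall>k\<le>n. \<bar>?y k\<bar> \<le> c then \<epsilon>\<^sup>2 * real (updates \<epsilon> ?y n) else 0)"
      using \<epsilon> by (auto simp: A_def indicator_def intro!: mult_left_mono)
    moreover have "p n \<omega> * ?y n \<le> c * \<bar>?y n\<bar>"
    proof -
      have "p n \<omega> * ?y n \<le> \<bar>p n \<omega>\<bar> * \<bar>?y n\<bar>" by (metis abs_ge_self abs_mult)
      also have "\<dots> \<le> c * \<bar>?y n\<bar>" using pc by (intro mult_right_mono) auto
      finally show ?thesis .
    qed
    moreover have "0 \<le> (p n \<omega>)\<^sup>2" by simp
    ultimately show ?thesis by linarith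
  qed
  have "\<epsilon>\<^sup>2 * real N * prob A = (\<integral>\<omega>. \<epsilon>\<^sup>2 * real N * indicator A \<omega> \<partial>Q)" using A by simp
  also have "\<dots> \<le> (\<integral>\<omega>. 2 * c * \<bar>\<omega> (s n) $ i\<bar> + 2 * c * S \<omega> \<partial>Q)"
    using le coordinate_integrable[OF sn] intS integrable_real_indicator[OF A] by (intro integral_mono) (auto simp: emeasure_eq_measure)
  also have "\<dots> = 2 * c * (\<integral>\<omega>. \<bar>\<omega> (s n) $ i\<bar> \<partial>Q) + 2 * c * (\<integral>\<omega>. S \<omega> \<partial>Q)"
    using coordinate_integrable[OF sn] intS by (subst Bochner_Integration.integral_add) auto
  also have "\<dots> \<le> 2 * c * C + 2 * c * (2 * C)"
    using coordinate_L1[OF sn, of i] ES c by (intro add_mono mult_left_mono) auto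
  also have "\<dots> = 6 * c * C" by simp
  finally have "\<epsilon>\<^sup>2 * real N * prob A \<le> 6 * c * C" .
  then show "prob A \<le> 6 * c * C / (\<epsilon>\<^sup>2 * real N)" using \<epsilon> N by (simp add: field_simps)
qed

text \<open>
  For concave \<open>\<phi>\<close> with derivative \<open>\<phi>'\<close>, the increments of \<open>\<phi>(X)\<close> are those of the elementary integral of
  \<open>\<phi>'(X)\<close> minus nonnegative remainders, whose sum is controlled by applying the same identity again.
\<close>

lemma concave_bound:
  assumes s: "time_grid I n s" and h: "\<And>k. k < n \<Longrightarrow> h k \<in> borel_measurable (right_filtration I (s k))"
    and h1: "\<And>k \<omega>. \<bar>h k \<omega>\<bar> \<le> 1"
    and \<phi>: "\<phi> \<in> borel_measurable borel" "\<phi>' \<in> borel_measurable borel" "\<And>x. \<bar>\<phi> x\<bar> \<le> \<bar>x\<bar>" "\<And>x. \<bar>\<phi>' x\<bar> \<le> 1"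
    and concave: "\<And>x y. \<phi> y - \<phi> x \<le> \<phi>' x * (y - x)"
  shows "(\<integral>\<omega>. (\<Sum>k<n. h k \<omega> * (\<phi> (\<omega> (s (Suc k)) $ i) - \<phi> (\<omega> (s k) $ i))) \<partial>Q) \<le> 6 * C"
proof -
  define X where "X k \<omega> = \<omega> (s k) $ i" for k and \<omega> :: "'d path"
  have sI: "s k \<in> I" if "k \<le> n" for k using s that by (simp add: time_grid_def)
  have Xm: "X k \<in> borel_measurable (right_filtration I (s k))" if "k < n" for k
    unfolding X_def using that by (intro measurable_grid_coordinate[OF s]) auto
  have d: "(\<lambda>\<omega>. \<phi>' (X k \<omega>)) \<in> borel_measurable (right_filtration I (s k))" if "k < n" for k
    by (rule measurable_compose[OF Xm[OF that] \<phi>(2)])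
  have hd: "(\<lambda>\<omega>. h k \<omega> * \<phi>' (X k \<omega>)) \<in> borel_measurable (right_filtration I (s k))" if "k < n" for k
    using h[OF that] d[OF that] by simp
  have hd1: "\<bar>h k \<omega> * \<phi>' (X k \<omega>)\<bar> \<le> 1" for k \<omega>
    using h1[of k \<omega>] \<phi>(4)[of "X k \<omega>"] by (simp add: abs_mult mult_le_one)
  have X: "integrable Q (X k)" if "k \<le> n" for k unfolding X_def by (rule coordinate_integrable[OF sI[OF that]])
  have \<phi>X: "integrable Q (\<lambda>\<omega>. \<phi> (X k \<omega>))" if "k \<le> n" for k
    by (rule Bochner_Integration.integrable_bound[OF X[OF that]])
      (use \<phi>(1,3) borel_measurable_integrable[OF X[OF that]] in auto)
  define S1 where "S1 \<omega> = (\<Sum>k<n. (h k \<omega> * \<phi>' (X k \<omega>)) * (X (Suc k) \<omega> - X k \<omega>))" for \<omega>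
  define S2 where "S2 \<omega> = (\<Sum>k<n. \<phi>' (X k \<omega>) * (X (Suc k) \<omega> - X k \<omega>))" for \<omega>
  have S1: "integrable Q S1" "(\<integral>\<omega>. S1 \<omega> \<partial>Q) \<le> 2 * C"
    unfolding S1_def X_def
    using integrable_grid_sum[OF s hd hd1, of i] elementary_bound[OF s hd hd1, of i] by (simp_all add: X_def)
  have S2: "integrable Q S2" "(\<integral>\<omega>. S2 \<omega> \<partial>Q) \<le> 2 * C"
    unfolding S2_def X_def
    using integrable_grid_sum[OF s d \<phi>(4), of i] elementary_bound[OF s d \<phi>(4), of i] by (simp_all add: X_def)
  have le: "(\<Sum>k<n. h k \<omega> * (\<phi> (X (Suc k) \<omega>) - \<phi> (X k \<omega>))) \<le> S1 \<omega> + S2 \<omega> + \<bar>X n \<omega>\<bar> + \<bar>X 0 \<omega>\<bar>" for \<omega>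
  proof -
    have "h k \<omega> * (\<phi> (X (Suc k) \<omega>) - \<phi> (X k \<omega>)) \<le>
      (h k \<omega> * \<phi>' (X k \<omega>)) * (X (Suc k) \<omega> - X k \<omega>) + \<phi>' (X k \<omega>) * (X (Suc k) \<omega> - X k \<omega>) - (\<phi> (X (Suc k) \<omega>) - \<phi> (X k \<omega>))" for k
    proof -
      let ?R = "\<phi>' (X k \<omega>) * (X (Suc k) \<omega> - X k \<omega>) - (\<phi> (X (Suc k) \<omega>) - \<phi> (X k \<omega>))"
      have R: "0 \<le> ?R" using concave[of "X (Suc k) \<omega>" "X k \<omega>"] by simp
      \<comment> \<open>\<open>?R\<close> is the defect in the concavity inequality. Since the
        weight is at least -1, the weighted defect can be replaced by \<open>?R\<close> itself,
        whose sum is again an elementary integral plus a telescoping term.\<close>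
      have "0 \<le> (1 + h k \<omega>) * ?R" using h1[of k \<omega>] R by (intro mult_nonneg_nonneg) auto
      then show ?thesis by (simp add: algebra_simps)
    qed
    then have "(\<Sum>k<n. h k \<omega> * (\<phi> (X (Suc k) \<omega>) - \<phi> (X k \<omega>))) \<le>
      (\<Sum>k<n. (h k \<omega> * \<phi>' (X k \<omega>)) * (X (Suc k) \<omega> - X k \<omega>) + \<phi>' (X k \<omega>) * (X (Suc k) \<omega> - X k \<omega>) - (\<phi> (X (Suc k) \<omega>) - \<phi> (X k \<omega>)))"
      by (intro sum_mono)
    also have "\<dots> = S1 \<omega> + S2 \<omega> - (\<Sum>k<n. \<phi> (X (Suc k) \<omega>) - \<phi> (X k \<omega>))"
      by (simp add: S1_def S2_def sum.distrib sum_subtractf)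
    also have "(\<Sum>k<n. \<phi> (X (Suc k) \<omega>) - \<phi> (X k \<omega>)) = \<phi> (X n \<omega>) - \<phi> (X 0 \<omega>)"
      by (rule sum_lessThan_telescope)
    finally show ?thesis using \<phi>(3)[of "X n \<omega>"] \<phi>(3)[of "X 0 \<omega>"] by linarith
  qed
  have "(\<integral>\<omega>. (\<Sum>k<n. h k \<omega> * (\<phi> (X (Suc k) \<omega>) - \<phi> (X k \<omega>))) \<partial>Q) \<le> (\<integral>\<omega>. S1 \<omega> + S2 \<omega> + \<bar>X n \<omega>\<bar> + \<bar>X 0 \<omega>\<bar> \<partial>Q)"
  proof (rule integral_mono)
    show "integrable Q (\<lambda>\<omega>. \<Sum>k<n. h k \<omega> * (\<phi> (X (Suc k) \<omega>) - \<phi> (X k \<omega>)))"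
      using h1 by (intro Bochner_Integration.integrable_sum integrable_mult_bounded[where K = 1] Bochner_Integration.integrable_diff
        \<phi>X right_filtration_measurable[OF h]) auto
    show "integrable Q (\<lambda>\<omega>. S1 \<omega> + S2 \<omega> + \<bar>X n \<omega>\<bar> + \<bar>X 0 \<omega>\<bar>)" using S1 S2 X[of n] X[of 0] by simp
  qed (rule le)
  also have "\<dots> = (\<integral>\<omega>. S1 \<omega> \<partial>Q) + (\<integral>\<omega>. S2 \<omega> \<partial>Q) + (\<integral>\<omega>. \<bar>X n \<omega>\<bar> \<partial>Q) + (\<integral>\<omega>. \<bar>X 0 \<omega>\<bar> \<partial>Q)"
    using S1 S2 X[of n] X[of 0] by simp
  \<comment> \<open>Two elementary sums at 2 C each and two absolute moments at C each.\<close>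
  also have "\<dots> \<le> 6 * C"
    using S1(2) S2(2) coordinate_L1[OF sI[of n], of i] coordinate_L1[OF sI[of 0], of i] unfolding X_def by simp
  finally show ?thesis by (simp add: X_def)
qed

text \<open>For nonnegative \<open>c\<close>, \<open>clip c x = min x c - min (- x) c - x\<close>.
  The two concave functions cost 6 C each and the linear one 2 C.\<close>

lemma clip_bound:
  assumes s: "time_grid I n s" and h: "\<And>k. k < n \<Longrightarrow> h k \<in> borel_measurable (right_filtration I (s k))"
    and h1: "\<And>k \<omega>. \<bar>h k \<omega>\<bar> \<le> 1" and c: "0 \<le> c"
  shows "(\<integral>\<omega>. (\<Sum>k<n. h k \<omega> * (clip c (\<omega> (s (Suc k)) $ i) - clip c (\<omega> (s k) $ i))) \<partial>Q) \<le> 14 * C"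
proof -
  let ?S = "\<lambda>\<phi> h \<omega>. \<Sum>k<n. h k \<omega> * (\<phi> (\<omega> (s (Suc k)) $ i) - \<phi> (\<omega> (s k) $ i) :: real)"
  have sI: "s k \<in> I" if "k \<le> n" for k using s that by (simp add: time_grid_def)
  have hn: "(\<lambda>\<omega>. - h k \<omega>) \<in> borel_measurable (right_filtration I (s k))" if "k < n" for k
    using h[OF that] by simp
  have a: "(\<integral>\<omega>. ?S (\<lambda>x. min x c) h \<omega> \<partial>Q) \<le> 6 * C"
    using c by (intro concave_bound[OF s h h1, where \<phi>' = "\<lambda>x. if x < c then 1 else 0"]) (auto simp: min_def)
  have b: "(\<integral>\<omega>. ?S (\<lambda>x. min (- x) c) (\<lambda>k \<omega>. - h k \<omega>) \<omega> \<partial>Q) \<le> 6 * C"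
    using c h1 by (intro concave_bound[OF s hn, where \<phi>' = "\<lambda>x. if - x < c then - 1 else 0"]) (auto simp: min_def)
  have d: "(\<integral>\<omega>. ?S (\<lambda>x. x) (\<lambda>k \<omega>. - h k \<omega>) \<omega> \<partial>Q) \<le> 2 * C"
    using h1 by (intro elementary_bound[OF s hn]) auto
  have int: "integrable Q (?S \<phi> g)" if "\<phi> \<in> borel_measurable borel" "\<And>x. \<bar>\<phi> x\<bar> \<le> \<bar>x\<bar>"
    "\<And>k. k < n \<Longrightarrow> g k \<in> borel_measurable (right_filtration I (s k))" "\<And>k \<omega>. \<bar>g k \<omega>\<bar> \<le> 1" for \<phi> and g :: "nat \<Rightarrow> 'd path \<Rightarrow> real"
  proof -
    have "integrable Q (\<lambda>\<omega>. \<phi> (\<omega> (s k) $ i))" if k: "k \<le> n" for k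
      by (rule Bochner_Integration.integrable_bound[OF coordinate_integrable[OF sI[OF k], of i]])
        (use \<open>\<phi> \<in> borel_measurable borel\<close> \<open>\<And>x. \<bar>\<phi> x\<bar> \<le> \<bar>x\<bar>\<close> coordinate_measurable[OF sI[OF k], of i] in auto)
    then show ?thesis
      using that by (intro Bochner_Integration.integrable_sum integrable_mult_bounded[where K = 1] Bochner_Integration.integrable_diff
        right_filtration_measurable[OF that(3)]) auto
  qed
  have split: "clip c x = min x c - min (- x) c - x" for x using c by (auto simp: clip_def min_def max_def)
  have "?S (clip c) h \<omega> = ?S (\<lambda>x. min x c) h \<omega> + ?S (\<lambda>x. min (- x) c) (\<lambda>k \<omega>. - h k \<omega>) \<omega> + ?S (\<lambda>x. x) (\<lambda>k \<omega>. - h k \<omega>) \<omega>" for \<omega>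
    unfolding sum.distrib[symmetric] split by (intro sum.cong) (auto simp: algebra_simps)
  then have "(\<integral>\<omega>. ?S (clip c) h \<omega> \<partial>Q) = (\<integral>\<omega>. ?S (\<lambda>x. min x c) h \<omega> + ?S (\<lambda>x. min (- x) c) (\<lambda>k \<omega>. - h k \<omega>) \<omega> + ?S (\<lambda>x. x) (\<lambda>k \<omega>. - h k \<omega>) \<omega> \<partial>Q)"
    by simp
  also have "\<dots> = (\<integral>\<omega>. ?S (\<lambda>x. min x c) h \<omega> \<partial>Q) + (\<integral>\<omega>. ?S (\<lambda>x. min (- x) c) (\<lambda>k \<omega>. - h k \<omega>) \<omega> \<partial>Q) + (\<integral>\<omega>. ?S (\<lambda>x. x) (\<lambda>k \<omega>. - h k \<omega>) \<omega> \<partial>Q)"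
    using int[of "\<lambda>x. min x c" h] int[of "\<lambda>x. min (- x) c" "\<lambda>k \<omega>. - h k \<omega>"] int[of "\<lambda>x. x" "\<lambda>k \<omega>. - h k \<omega>"] h hn h1 c
    by (subst Bochner_Integration.integral_add Bochner_Integration.integrable_add; (auto simp: min_def)?)+
  also have "\<dots> \<le> 14 * C" using a b d by linarith
  finally show ?thesis .
qed

end

section \<open>From finite grids to all times\<close>

lemma (in prob_space) prob_incseq_le:
  assumes "range A \<subseteq> events" "incseq A" "\<And>n::nat. prob (A n) \<le> c" shows "prob (\<Union>n. A n) \<le> c"
  using finite_Lim_measure_incseq[OF assms(1,2)] assms(3) by (intro LIMSEQ_le_const2) auto

lemma (in prob_space) prob_liminf_le:
  assumes A: "\<And>n::nat. A n \<in> events" and c: "\<And>n. prob (A n) \<le> c"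
  shows "(\<Union>n. \<Inter>m\<in>{n..}. A m) \<in> events" "prob (\<Union>n. \<Inter>m\<in>{n..}. A m) \<le> c"
proof -
  have B: "(\<Inter>m\<in>{n..}. A m) \<in> events" for n using A by (intro sets.countable_INT') auto
  then show "(\<Union>n. \<Inter>m\<in>{n..}. A m) \<in> events" by (intro sets.countable_UN) auto
  show "prob (\<Union>n. \<Inter>m\<in>{n..}. A m) \<le> c"
  proof (rule prob_incseq_le)
    show "incseq (\<lambda>n. \<Inter>m\<in>{n..}. A m)" unfolding incseq_def by (intro allI impI INF_superset_mono) auto
    fix n
    have "prob (\<Inter>m\<in>{n..}. A m) \<le> prob (A n)" using A by (intro finite_measure_mono) auto
    then show "prob (\<Inter>m\<in>{n..}. A m) \<le> c" using c by (rule order_trans)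
  qed (use B in auto)
qed

text \<open>The stopped rational times enumerate a countable set of times that determines all paths.\<close>

definition dense_times :: "ereal set \<Rightarrow> nat \<Rightarrow> ereal" where
  "dense_times I = from_nat_into ((\<lambda>q. min (ereal (of_rat q)) (Sup I)) ` {0..} \<union> {\<infinity>} \<inter> I)"

lemma range_dense_times: "range (dense_times I) = (\<lambda>q. min (ereal (of_rat q)) (Sup I)) ` {0..} \<union> {\<infinity>} \<inter> I"
  unfolding dense_times_def by (rule range_from_nat_into) auto

lemma dense_times_in: "time_domain I \<Longrightarrow> dense_times I n \<in> I"
proof -
  assume I: "time_domain I"
  have "dense_times I n \<in> range (dense_times I)" by simp
  then show ?thesis unfolding range_dense_times using time_domain_min[OF I] by (auto simp: zero_ereal_def)
qed

lemma sorted_grid: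
  fixes F :: "ereal set"
  assumes "finite F" "F \<noteq> {}" "F \<subseteq> I"
  obtains n s where "time_grid I n s" "s ` {..n} = F"
proof -
  let ?l = "sorted_list_of_set F"
  have l: "set ?l = F" "sorted ?l" "?l \<noteq> []" using assms by auto
  have n: "k < length ?l" if "k \<le> length ?l - 1" for k using that l(3) by (cases ?l) auto
  show thesis
  proof (rule that[of "length ?l - 1" "\<lambda>k. ?l ! k"])
    show "time_grid I (length ?l - 1) ((!) ?l)"
      unfolding time_grid_def
    proof (intro conjI allI impI)
      show "?l ! k \<in> I" if "k \<le> length ?l - 1" for k using n[OF that] l(1) assms(3) nth_mem[of k ?l] by blast
      show "?l ! k \<le> ?l ! Suc k" if "k < length ?l - 1" for k
        using l(2) that by (intro sorted_nth_mono) auto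
    qed
    have "{..length ?l - 1} = {..<length ?l}" using n by (auto simp: less_Suc_eq_le)
    then show "(!) ?l ` {..length ?l - 1} = F" using l(1) by (auto simp: set_conv_nth)
  qed
qed

text \<open>Grid indices chosen for the times \<open>\<sigma> j\<close> are automatically
  nondecreasing: a decrease would make two consecutive times equal and the increment zero.\<close>

lemma updates_ge_on_grid:
  assumes s: "time_grid I n s" and F: "s ` {..n} = F" and \<epsilon>: "0 \<le> \<epsilon>"
    and \<sigma>: "\<And>j. j \<le> N \<Longrightarrow> \<sigma> j \<in> F" "\<And>j. j < N \<Longrightarrow> \<sigma> j \<le> \<sigma> (Suc j)"
    and osc: "\<And>j. j < N \<Longrightarrow> 2 * \<epsilon> < \<bar>x (\<sigma> (Suc j)) - x (\<sigma> j)\<bar>"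
  shows "N \<le> updates \<epsilon> (\<lambda>k. x (s k)) n"
proof -
  have "\<forall>j\<in>{..N}. \<exists>k. k \<le> n \<and> s k = \<sigma> j" using \<sigma>(1) F by force
  then obtain \<kappa> where \<kappa>: "\<And>j. j \<le> N \<Longrightarrow> \<kappa> j \<le> n" "\<And>j. j \<le> N \<Longrightarrow> s (\<kappa> j) = \<sigma> j" by (metis atMost_iff)
  have "\<kappa> j \<le> \<kappa> (Suc j)" if j: "j < N" for j
  proof (rule ccontr)
    assume "\<not> \<kappa> j \<le> \<kappa> (Suc j)"
    then have "s (\<kappa> (Suc j)) \<le> s (\<kappa> j)" using \<kappa>(1)[of j] j by (intro time_grid_mono[OF s]) auto
    then have "\<sigma> (Suc j) = \<sigma> j" using \<kappa>(2)[of j] \<kappa>(2)[of "Suc j"] \<sigma>(2)[OF j] j by auto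
    then show False using osc[OF j] \<epsilon> by simp
  qed
  moreover have "2 * \<epsilon> < \<bar>x (s (\<kappa> (Suc j))) - x (s (\<kappa> j))\<bar>" if "j < N" for j
    using osc[OF that] \<kappa>(2)[of j] \<kappa>(2)[of "Suc j"] that by simp
  ultimately have "N \<le> updates \<epsilon> (\<lambda>k. x (s k)) (\<kappa> N)"
    by (intro updates_ge_oscillations[OF \<epsilon>, where N = N]) auto
  also have "\<dots> \<le> updates \<epsilon> (\<lambda>k. x (s k)) n" by (intro updates_mono \<kappa>) simp
  finally show ?thesis .
qed

text \<open>Rationals approaching \<open>t\<close> from the right are used, stopped at the right
  end; infinity, if in \<open>I\<close>, is itself among the dense times. The indices do not depend
  on the path, so every coordinate map is a pointwise limit of countably many of them.\<close>

lemma dense_times_limit: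
  assumes I: "time_domain I" and t: "t \<in> I"
  obtains k :: "nat \<Rightarrow> nat" where
    "\<And>\<omega> i. \<omega> \<in> skorokhod_space I \<Longrightarrow> (\<lambda>n. \<omega> (dense_times I (k n)) $ i) \<longlonglongrightarrow> \<omega> t $ i"
proof (cases "t = \<infinity>")
  case True
  then have "t \<in> range (dense_times I)" unfolding range_dense_times using t by auto
  then obtain k where "t = dense_times I k" by blast
  then show thesis by (intro that[of "\<lambda>_. k"]) simp
next
  case False
  then obtain r where r: "t = ereal r" "0 \<le> r" using time_domain_nonneg[OF I t] by (cases t) auto
  have "\<exists>k q. dense_times I k = min (ereal q) (Sup I) \<and> r < q \<and> q < r + inverse (real (Suc n))" for n
  proof -
    obtain q where q: "r < of_rat q" "of_rat q < r + inverse (real (Suc n))"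
      using of_rat_dense[of r "r + inverse (real (Suc n))"] by auto
    then have "0 \<le> q" using r(2) by (metis less_eq_real_def of_rat_less_0_iff not_less order_less_trans)
    then have "min (ereal (of_rat q)) (Sup I) \<in> range (dense_times I)" unfolding range_dense_times by auto
    then show ?thesis using q by (metis imageE)
  qed
  then obtain k q where k: "\<And>n. dense_times I (k n) = min (ereal (q n)) (Sup I)"
    and q: "\<And>n. r < q n" "\<And>n. q n < r + inverse (real (Suc n))" by metis
  have "q \<longlonglongrightarrow> r"
  proof (rule tendsto_sandwich[of "\<lambda>_. r"])
    show "(\<lambda>n. r + inverse (real (Suc n))) \<longlonglongrightarrow> r"
      using tendsto_add[OF tendsto_const LIMSEQ_inverse_real_of_nat, of r] by simp
  qed (use q in \<open>auto intro!: always_eventually less_imp_le\<close>)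
  then have q': "filterlim q (at_right r) sequentially" using q(1) by (auto simp: filterlim_at less_imp_neq[symmetric] intro!: always_eventually)
  show thesis
  proof (rule that)
    fix \<omega> i assume \<omega>: "\<omega> \<in> skorokhod_space I"
    have "(\<lambda>n. stopped_path I \<omega> i (q n)) \<longlonglongrightarrow> stopped_path I \<omega> i r"
      by (rule filterlim_compose[OF stopped_path_right_continuous[OF I \<omega> r(2)] q'])
    then show "(\<lambda>n. \<omega> (dense_times I (k n)) $ i) \<longlonglongrightarrow> \<omega> t $ i"
      using t r stopped_path_eq[of r I \<omega> i] by (simp add: k stopped_path_def)
  qed
qed

lemma bounded_at_dense_times:
  assumes I: "time_domain I" and \<omega>: "\<omega> \<in> skorokhod_space I"
    and bd: "\<And>n. \<bar>\<omega> (dense_times I n) $ i\<bar> \<le> c" and t: "t \<in> I"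
  shows "\<bar>\<omega> t $ i\<bar> \<le> c"
proof -
  obtain k :: "nat \<Rightarrow> nat" where k: "(\<lambda>n. \<omega> (dense_times I (k n)) $ i) \<longlonglongrightarrow> \<omega> t $ i"
    using dense_times_limit[OF I t] \<omega> by metis
  show ?thesis by (rule LIMSEQ_le_const2[OF tendsto_rabs[OF k]]) (use bd in auto)
qed

context bounded_quasimartingale
begin

text \<open>Finite sets of dense times are sorted into grids; the maximal inequality is uniform over
  grids, and the events increase with the finite set.\<close>

lemma prob_unbounded_le:
  assumes c: "0 < c"
  shows "{\<omega> \<in> space Q. \<exists>n. c < \<bar>\<omega> (dense_times I n) $ i\<bar>} \<in> events"
    and "prob {\<omega> \<in> space Q. \<exists>n. c < \<bar>\<omega> (dense_times I n) $ i\<bar>} \<le> 3 * C / c"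
proof -
  define A where "A n = {\<omega> \<in> space Q. \<exists>k\<in>{..n}. c < \<bar>\<omega> (dense_times I k) $ i\<bar>}" for n
  have [measurable]: "(\<lambda>\<omega>. \<omega> (dense_times I k) $ i) \<in> borel_measurable Q" for k
    by (intro coordinate_measurable dense_times_in time_domain)
  have A: "A n \<in> events" for n unfolding A_def by measurable
  have eq: "{\<omega> \<in> space Q. \<exists>n. c < \<bar>\<omega> (dense_times I n) $ i\<bar>} = (\<Union>n. A n)" by (auto simp: A_def)
  show "{\<omega> \<in> space Q. \<exists>n. c < \<bar>\<omega> (dense_times I n) $ i\<bar>} \<in> events" unfolding eq using A by blast
  show "prob {\<omega> \<in> space Q. \<exists>n. c < \<bar>\<omega> (dense_times I n) $ i\<bar>} \<le> 3 * C / c"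
    unfolding eq
  proof (rule prob_incseq_le)
    show "incseq A" unfolding incseq_def A_def by force
    fix n
    have "dense_times I ` {..n} \<subseteq> I" using dense_times_in[OF time_domain] by auto
    from sorted_grid[OF _ _ this] obtain m s where s: "time_grid I m s" "s ` {..m} = dense_times I ` {..n}" by auto
    have "A n = {\<omega> \<in> space Q. \<exists>t\<in>dense_times I ` {..n}. c < \<bar>\<omega> t $ i\<bar>}" by (auto simp: A_def)
    also have "\<dots> = {\<omega> \<in> space Q. \<exists>k\<le>m. c < \<bar>\<omega> (s k) $ i\<bar>}" unfolding s(2)[symmetric] by auto
    finally show "prob (A n) \<le> 3 * C / c" using maximal_inequality[OF s(1) c, of i] by simp
  qed (use A in auto)
qed

text \<open>Instead of showing that the paths with many oscillations form an event, they are
  enclosed in one. Rational times suffice to detect \<open>N\<close> oscillations, so such a path is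
  detected by all sufficiently large grids, and the limit inferior of the grid events keeps their
  common probability bound.\<close>

lemma oscillating_event:
  assumes c: "0 < c" and \<epsilon>: "0 < \<epsilon>" and N: "0 < N"
  obtains V where "V \<in> events" "prob V \<le> 6 * c * C / (\<epsilon>\<^sup>2 * real N)"
    "\<And>\<omega> a. \<omega> \<in> space Q \<Longrightarrow> (\<And>n. \<bar>\<omega> (dense_times I n) $ i\<bar> \<le> c) \<Longrightarrow> 0 \<le> a \<Longrightarrow>
      oscillates (stopped_path I \<omega> i) a N (2 * \<epsilon>) \<Longrightarrow> \<omega> \<in> V"
proof -
  have "\<exists>m s. time_grid I m s \<and> s ` {..m} = dense_times I ` {..n}" for n
  proof -
    have "dense_times I ` {..n} \<subseteq> I" using dense_times_in[OF time_domain] by auto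
    from sorted_grid[OF _ _ this] obtain m s where "time_grid I m s" "s ` {..m} = dense_times I ` {..n}" by auto
    then show ?thesis by blast
  qed
  then obtain m s where s: "\<And>n. time_grid I (m n) (s n)" "\<And>n. s n ` {..m n} = dense_times I ` {..n}" by metis
  define A where "A n = {\<omega> \<in> space Q. (\<forall>k\<le>m n. \<bar>\<omega> (s n k) $ i\<bar> \<le> c) \<and> N \<le> updates \<epsilon> (\<lambda>k. \<omega> (s n k) $ i) (m n)}" for n
  have A: "A n \<in> events" "prob (A n) \<le> 6 * c * C / (\<epsilon>\<^sup>2 * real N)" for n
    unfolding A_def by (rule oscillation_inequality[OF s(1) c \<epsilon> N])+
  show thesis
  proof (rule that[OF prob_liminf_le[OF A]])
    fix \<omega> a assume \<omega>: "\<omega> \<in> space Q" and bd: "\<And>n. \<bar>\<omega> (dense_times I n) $ i\<bar> \<le> c" and a: "0 \<le> a"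
      and osc: "oscillates (stopped_path I \<omega> i) a N (2 * \<epsilon>)"
    have rc: "(stopped_path I \<omega> i \<longlongrightarrow> stopped_path I \<omega> i t) (at_right t)" if "0 \<le> t" for t
      using stopped_path_right_continuous[OF time_domain _ that] \<omega> space_Q by simp
    have "\<exists>q\<in>range of_rat. t < q \<and> q < b" if "0 \<le> t" "t < b" for t b :: real
      using of_rat_dense[OF that(2)] by blast
    from oscillates_dense[OF rc this osc a less_imp_le[OF mult_pos_pos[OF zero_less_numeral \<epsilon>]]] obtain q where q: "\<And>j. j \<le> N \<Longrightarrow> q j \<in> range of_rat \<and> 0 \<le> q j"
      "\<And>j. j < N \<Longrightarrow> q j \<le> q (Suc j)" "\<And>j. j < N \<Longrightarrow> 2 * \<epsilon> < \<bar>stopped_path I \<omega> i (q (Suc j)) - stopped_path I \<omega> i (q j)\<bar>"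
      by blast
    define \<sigma> where "\<sigma> j = min (ereal (q j)) (Sup I)" for j
    have "\<exists>n. \<sigma> j = dense_times I n" if j: "j \<le> N" for j
    proof -
      obtain p :: rat where p: "q j = of_rat p" using q(1)[OF j] by blast
      have "0 \<le> p" using q(1)[OF j] p by simp
      then have "\<sigma> j \<in> range (dense_times I)" unfolding range_dense_times \<sigma>_def p by auto
      then show ?thesis by blast
    qed
    then obtain \<nu> where \<nu>: "\<And>j. j \<le> N \<Longrightarrow> \<sigma> j = dense_times I (\<nu> j)" by metis
    define M where "M = Max (\<nu> ` {..N})"
    have M: "\<nu> j \<le> M" if "j \<le> N" for j unfolding M_def using that by (intro Max_ge) auto
    have "\<omega> \<in> A n" if n: "M \<le> n" for n
    proof -
      have "\<bar>\<omega> (s n k) $ i\<bar> \<le> c" if "k \<le> m n" for k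
      proof -
        have "s n k \<in> dense_times I ` {..n}" using that s(2)[of n] by blast
        then show ?thesis using bd by auto
      qed
      moreover have "N \<le> updates \<epsilon> (\<lambda>k. (\<lambda>t. \<omega> t $ i) (s n k)) (m n)"
      proof (rule updates_ge_on_grid[OF s(1,2)])
        show "\<sigma> j \<in> dense_times I ` {..n}" if "j \<le> N" for j
          unfolding \<nu>[OF that] using M[OF that] n by auto
        show "\<sigma> j \<le> \<sigma> (Suc j)" if "j < N" for j
          unfolding \<sigma>_def using q(2)[OF that] by (intro min.mono) auto
        show "2 * \<epsilon> < \<bar>\<omega> (\<sigma> (Suc j)) $ i - \<omega> (\<sigma> j) $ i\<bar>" if "j < N" for j
          using q(3)[OF that] by (simp add: stopped_path_def \<sigma>_def)
      qed (use \<epsilon> in simp)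
      ultimately show ?thesis using \<omega> by (simp add: A_def)
    qed
    then show "\<omega> \<in> (\<Union>n. \<Inter>m\<in>{n..}. A m)" by blast
  qed
qed

end

text \<open>
  For each \<open>j\<close> the bound on the paths and, at every accuracy \<open>1/(m+1)\<close>, the number of oscillations are
  chosen so large that the exceptional events have total probability at most \<open>1/(j+1)\<close>.
\<close>

lemma uniform_tightness:
  fixes C :: real
  obtains c :: "nat \<Rightarrow> real" and N :: "nat \<Rightarrow> nat \<Rightarrow> nat" where
    "\<And>Q :: ('d::finite) path measure. \<And>I j. bounded_quasimartingale Q I C \<Longrightarrow>
      tame_paths I (c j) (N j) \<in> sets Q \<Longrightarrow> 1 - inverse (real (Suc j)) \<le> measure Q (tame_paths I (c j) (N j))"
proof -
  define d where "d = real CARD('d)"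
  have d: "1 \<le> d" by (simp add: d_def Suc_leI)
  \<comment> \<open>Makes the bound 3 C / c of the maximal inequality at most 1 / (2 d (j + 1)),
    half of the share of one coordinate. Adding 1 to the absolute value of C keeps \<open>c\<close>
    positive.\<close>
  define c where "c j = 6 * (\<bar>C\<bar> + 1) * d * real (Suc j)" for j
  have c: "0 < c j" for j using d by (simp add: c_def)
  \<comment> \<open>The oscillation estimate is for increments above twice its parameter, and tame
    paths use the threshold 1 / (2 (m + 1)), so the parameter is a quarter of the accuracy.\<close>
  define \<epsilon> where "\<epsilon> m = inverse (real (Suc m)) / 4" for m
  have \<epsilon>: "0 < \<epsilon> m" for m by (simp add: \<epsilon>_def)
  \<comment> \<open>Large enough that accuracy \<open>m\<close> fails with probability at most
    \<open>(1 / 2) ^ Suc m\<close> times 1 / (2 d (j + 1)); summed over \<open>m\<close> this is the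
    other half of the share.\<close>
  define N where "N j m = Suc (nat \<lceil>6 * c j * \<bar>C\<bar> * (2 * d * real (Suc j) * 2 ^ Suc m) / (\<epsilon> m)\<^sup>2\<rceil>)" for j m
  have N: "6 * c j * \<bar>C\<bar> / ((\<epsilon> m)\<^sup>2 * real (N j m)) \<le> (1 / 2) ^ Suc m / (2 * d * real (Suc j))" for j m
  proof -
    let ?D = "2 * d * real (Suc j) * 2 ^ Suc m"
    have D: "0 < ?D" using d by simp
    have "6 * c j * \<bar>C\<bar> * ?D / (\<epsilon> m)\<^sup>2 \<le> real (N j m)" unfolding N_def by linarith
    then have "6 * c j * \<bar>C\<bar> * ?D \<le> (\<epsilon> m)\<^sup>2 * real (N j m)" using \<epsilon>[of m] by (simp add: divide_le_eq mult.commute)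
    moreover have "0 < (\<epsilon> m)\<^sup>2 * real (N j m)" using \<epsilon>[of m] by (simp add: N_def)
    ultimately have "6 * c j * \<bar>C\<bar> / ((\<epsilon> m)\<^sup>2 * real (N j m)) \<le> 1 / ?D"
      using D by (simp add: divide_le_eq le_divide_eq mult.commute)
    also have "\<dots> = (1 / 2) ^ Suc m / (2 * d * real (Suc j))" by (simp add: power_one_over field_simps)
    finally show ?thesis .
  qed
  show thesis
  proof (rule that[of c N])
    fix Q :: "'d path measure" and I j
    assume "bounded_quasimartingale Q I C" and K: "tame_paths I (c j) (N j) \<in> sets Q"
    then interpret bounded_quasimartingale Q I C by simp
    let ?b = "1 / (2 * d * real (Suc j))"
    have b: "0 < ?b" using d by simp
    define S where "S i = {\<omega> \<in> space Q. \<exists>n. c j < \<bar>\<omega> (dense_times I n) $ i\<bar>}" for i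
    have S: "S i \<in> events" "prob (S i) \<le> ?b" for i
    proof -
      show "S i \<in> events" unfolding S_def by (rule prob_unbounded_le[OF c])
      have "prob (S i) \<le> 3 * C / c j" unfolding S_def by (rule prob_unbounded_le[OF c])
      also have "\<dots> \<le> 3 * (\<bar>C\<bar> + 1) / c j" using c[of j] by (intro divide_right_mono) auto
      also have "\<dots> = ?b"
      proof -
        have "3 * z / (6 * z * d * w) = 1 / (2 * d * w)" if "z \<noteq> 0" for z w :: real using that by simp
        from this[of "\<bar>C\<bar> + 1" "real (Suc j)"] show ?thesis
          unfolding c_def by (metis abs_ge_zero add_nonneg_eq_0_iff zero_le_one zero_neq_one)
      qed
      finally show "prob (S i) \<le> ?b" .
    qed
    define R where "R i m V \<longleftrightarrow> V \<in> events \<and> prob V \<le> ?b * (1 / 2) ^ Suc m \<and>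
      (\<forall>\<omega> a. \<omega> \<in> space Q \<longrightarrow> (\<forall>n. \<bar>\<omega> (dense_times I n) $ i\<bar> \<le> c j) \<longrightarrow> 0 \<le> a \<longrightarrow>
        oscillates (stopped_path I \<omega> i) a (N j m) (2 * \<epsilon> m) \<longrightarrow> \<omega> \<in> V)" for i m V
    have "\<exists>V. R i m V" for i m
    proof -
      have "0 < N j m" by (simp add: N_def)
      from oscillating_event[OF c[of j] \<epsilon>[of m] this, of i] obtain V where V: "V \<in> events"
        "prob V \<le> 6 * c j * C / ((\<epsilon> m)\<^sup>2 * real (N j m))"
        "\<And>\<omega> a. \<omega> \<in> space Q \<Longrightarrow> (\<And>n. \<bar>\<omega> (dense_times I n) $ i\<bar> \<le> c j) \<Longrightarrow> 0 \<le> a \<Longrightarrow>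
          oscillates (stopped_path I \<omega> i) a (N j m) (2 * \<epsilon> m) \<Longrightarrow> \<omega> \<in> V" by blast
      have "prob V \<le> ?b * (1 / 2) ^ Suc m" using V(2) N[of j m] C_nonneg by simp
      then have "R i m V" unfolding R_def using V(1,3) by blast
      then show ?thesis by blast
    qed
    then have R: "R i m (SOME V. R i m V)" for i m by (rule someI_ex)
    define V where "V i m = (SOME V. R i m V)" for i m
    have V: "V i m \<in> events" "prob (V i m) \<le> ?b * (1 / 2) ^ Suc m"
      "\<And>\<omega> a. \<omega> \<in> space Q \<Longrightarrow> (\<forall>n. \<bar>\<omega> (dense_times I n) $ i\<bar> \<le> c j) \<Longrightarrow> 0 \<le> a \<Longrightarrow>
        oscillates (stopped_path I \<omega> i) a (N j m) (2 * \<epsilon> m) \<Longrightarrow> \<omega> \<in> V i m" for i m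
      using R[of i m] unfolding R_def V_def by blast+
    have sum: "(\<lambda>m. ?b * (1 / 2) ^ Suc m) sums ?b"
      using sums_mult[OF power_half_series, of ?b] by simp
    have Ui: "prob (\<Union>m. V i m) \<le> ?b" for i
    proof -
      have su: "summable (\<lambda>m. prob (V i m))"
        using V(2) by (intro summable_comparison_test'[OF sums_summable[OF sum]]) auto
      have "prob (\<Union>m. V i m) \<le> (\<Sum>m. prob (V i m))"
        using V(1) by (intro finite_measure_subadditive_countably su) auto
      also have "\<dots> \<le> (\<Sum>m. ?b * (1 / 2) ^ Suc m)" by (intro suminf_le V(2) su sums_summable[OF sum])
      also have "\<dots> = ?b" by (rule sums_unique[OF sum, symmetric])
      finally show ?thesis .
    qed
    let ?U = "\<Union>i\<in>UNIV. S i \<union> (\<Union>m. V i m)"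
    have Uev: "S i \<union> (\<Union>m. V i m) \<in> events" for i using S V(1) by (intro sets.Un sets.countable_UN) auto
    have "space Q - tame_paths I (c j) (N j) \<subseteq> ?U"
    proof
      fix \<omega> assume \<omega>: "\<omega> \<in> space Q - tame_paths I (c j) (N j)"
      show "\<omega> \<in> ?U"
      proof (rule ccontr)
        assume nU: "\<omega> \<notin> ?U"
        then have bd: "\<bar>\<omega> (dense_times I n) $ i\<bar> \<le> c j" for i n
          using \<omega> by (auto simp: S_def not_less)
        have "\<omega> \<in> tame_paths I (c j) (N j)"
          unfolding tame_paths_def
        proof (intro CollectI conjI ballI allI impI notI)
          show sk: "\<omega> \<in> skorokhod_space I" using \<omega> space_Q by simp
          show "\<bar>\<omega> t $ i\<bar> \<le> c j" if "t \<in> I" for t i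
            by (rule bounded_at_dense_times[OF time_domain sk bd that])
          fix i m a assume "0 \<le> a" "oscillates (stopped_path I \<omega> i) a (N j m) (inverse (real (Suc m)) / 2)"
          moreover have "2 * \<epsilon> m = inverse (real (Suc m)) / 2" by (simp add: \<epsilon>_def)
          moreover have "\<forall>n. \<bar>\<omega> (dense_times I n) $ i\<bar> \<le> c j" using bd by blast
          moreover have "\<omega> \<in> space Q" using \<omega> by blast
          ultimately have "\<omega> \<in> V i m" using V(3)[of \<omega> i] by metis
          then show False using nU by blast
        qed
        then show False using \<omega> by simp
      qed
    qed
    then have "prob (space Q - tame_paths I (c j) (N j)) \<le> prob ?U"
      using Uev by (intro finite_measure_mono sets.finite_UN) auto
    also have "\<dots> \<le> (\<Sum>i\<in>UNIV. prob (S i \<union> (\<Union>m. V i m)))"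
      using Uev by (intro finite_measure_subadditive_finite) auto
    also have "\<dots> \<le> (\<Sum>i\<in>(UNIV::'d set). 2 * ?b)"
    proof (rule sum_mono)
      fix i
      have "prob (S i \<union> (\<Union>m. V i m)) \<le> prob (S i) + prob (\<Union>m. V i m)"
        using S V(1) by (intro measure_Un_le sets.countable_UN) auto
      then show "prob (S i \<union> (\<Union>m. V i m)) \<le> 2 * ?b" using S(2)[of i] Ui[of i] by linarith
    qed
    also have "\<dots> = inverse (real (Suc j))"
    proof -
      have "z * (2 * (1 / (2 * z * w))) = inverse w" if "z \<noteq> 0" for z w :: real using that by (simp add: field_simps)
      from this[of d "real (Suc j)"] d show ?thesis by (simp add: d_def)
    qed
    finally show "1 - inverse (real (Suc j)) \<le> prob (tame_paths I (c j) (N j))"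
      using prob_compl[OF K] by simp
  qed
qed

section \<open>Limits of quasimartingale measures\<close>

text \<open>The time argument is rounded up to a strictly later multiple of
  \<open>1 / (m + 1)\<close> and capped at \<open>b\<close>, which leaves countably many values;
  right-continuity gives the limit. Only \<open>Y u\<close> with \<open>u \<le> b\<close> enter, so
  measurability with respect to the past up to \<open>b\<close> is preserved.\<close>

lemma measurable_right_continuous_process:
  fixes Y :: "real \<Rightarrow> 'a \<Rightarrow> real"
  assumes Y: "\<And>u. 0 \<le> u \<Longrightarrow> u \<le> b \<Longrightarrow> Y u \<in> borel_measurable N" and b: "0 \<le> b"
    and rc: "\<And>x u. x \<in> space N \<Longrightarrow> 0 \<le> u \<Longrightarrow> u < b \<Longrightarrow> ((\<lambda>u. Y u x) \<longlongrightarrow> Y u x) (at_right u)"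
  shows "(\<lambda>(x, u). Y (max 0 (min u b)) x) \<in> borel_measurable (N \<Otimes>\<^sub>M borel)"
proof -
  define a where "a m u = max 0 (min (real_of_int (\<lfloor>real (Suc m) * max 0 u\<rfloor> + 1) / real (Suc m)) b)" for m u
  show ?thesis
  proof (rule borel_measurable_LIMSEQ_real)
    fix m
    define c where "c k = max 0 (min (real_of_int (k + 1) / real (Suc m)) b)" for k :: int
    have c: "0 \<le> c k" "c k \<le> b" for k using b by (auto simp: c_def)
    have "(\<lambda>p. Y (c \<lfloor>real (Suc m) * max 0 (snd p)\<rfloor>) (fst p)) \<in> borel_measurable (N \<Otimes>\<^sub>M borel)"
    proof (rule measurable_compose_countable[where f = "\<lambda>k p. Y (c k) (fst p)"])
      show "(\<lambda>p. Y (c k) (fst p)) \<in> borel_measurable (N \<Otimes>\<^sub>M borel)" for k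
        by (rule measurable_compose[OF measurable_fst Y[OF c]])
    qed measurable
    then show "(\<lambda>(x, u). Y (a m u) x) \<in> borel_measurable (N \<Otimes>\<^sub>M borel)"
      by (simp add: a_def c_def case_prod_beta)
  next
    fix p assume p: "p \<in> space (N \<Otimes>\<^sub>M (borel :: real measure))"
    obtain x u where xu: "p = (x, u)" by (cases p)
    have x: "x \<in> space N" using p xu by (simp add: space_pair_measure)
    let ?u = "max 0 u"
    have lo: "?u < real_of_int (\<lfloor>real (Suc m) * ?u\<rfloor> + 1) / real (Suc m)" for m
    proof -
      have "?u * real (Suc m) < real_of_int (\<lfloor>real (Suc m) * ?u\<rfloor> + 1)" by (subst mult.commute) linarith
      then show ?thesis by (subst pos_less_divide_eq) auto
    qed
    have hi: "real_of_int (\<lfloor>real (Suc m) * ?u\<rfloor> + 1) / real (Suc m) \<le> ?u + inverse (real (Suc m))" for m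
    proof -
      have "real_of_int (\<lfloor>real (Suc m) * ?u\<rfloor> + 1) / real (Suc m) \<le> (real (Suc m) * ?u + 1) / real (Suc m)"
        by (intro divide_right_mono) (auto simp del: of_nat_Suc)
      also have "\<dots> = ?u + inverse (real (Suc m))" by (simp add: add_divide_distrib inverse_eq_divide del: of_nat_Suc)
      finally show ?thesis .
    qed
    have "(\<lambda>m. Y (a m u) x) \<longlonglongrightarrow> Y (max 0 (min u b)) x"
    proof (cases "?u < b")
      case False
      then have "b \<le> real_of_int (\<lfloor>real (Suc m) * ?u\<rfloor> + 1) / real (Suc m)" for m using lo[of m] by linarith
      then have "a m u = max 0 b" for m by (simp add: a_def min_absorb2 del: of_nat_Suc)
      moreover have "max 0 (min u b) = max 0 b" using False b by auto
      ultimately show ?thesis by simp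
    next
      case True
      have gt: "?u < a m u" for m using lo[of m] True unfolding a_def by simp
      have le: "a m u \<le> ?u + inverse (real (Suc m))" for m
        using hi[of m] unfolding a_def by (auto simp: max_def min_def simp del: of_nat_Suc)
      have "(\<lambda>m. a m u) \<longlonglongrightarrow> ?u"
      proof (rule tendsto_sandwich[of "\<lambda>_. ?u"])
        show "(\<lambda>m. ?u + inverse (real (Suc m))) \<longlonglongrightarrow> ?u"
          using tendsto_add[OF tendsto_const LIMSEQ_inverse_real_of_nat, of ?u] by simp
      qed (use gt le in \<open>auto intro!: always_eventually less_imp_le simp del: of_nat_Suc\<close>)
      then have "filterlim (\<lambda>m. a m u) (at_right ?u) sequentially"
        using gt by (auto simp: filterlim_at less_imp_neq[symmetric] intro!: always_eventually)
      from filterlim_compose[OF rc[OF x _ True] this]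
      have "(\<lambda>m. Y (a m u) x) \<longlonglongrightarrow> Y ?u x" by simp
      moreover have "max 0 (min u b) = ?u" using True by auto
      ultimately show ?thesis by simp
    qed
    then show "(\<lambda>m. case p of (x, u) \<Rightarrow> Y (a m u) x) \<longlonglongrightarrow> (case p of (x, u) \<Rightarrow> Y (max 0 (min u b)) x)"
      by (simp add: xu)
  qed
qed

text \<open>A continuous density on \<open>[1, 2]\<close>, normalised by 6 because the parabola
  \<open>(v - 1) * (2 - v)\<close> integrates to 1/6 there. Its support stays away from 0, so an
  average started at \<open>t\<close> begins only at \<open>t + \<delta>\<close>; the delay leaves
  room for weights that are known slightly after \<open>t\<close>.\<close>

definition bump :: "real \<Rightarrow> real" where
  "bump v = max 0 (6 * (v - 1) * (2 - v))"

lemma bump_nonneg: "0 \<le> bump v"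
  by (simp add: bump_def)

lemma continuous_bump: "continuous_on UNIV bump"
  unfolding bump_def by (intro continuous_intros)

lemma measurable_bump [measurable]: "bump \<in> borel_measurable borel"
  by (rule borel_measurable_continuous_onI[OF continuous_bump])

lemma bump_eq: "bump v = 6 * (v - 1) * (2 - v) * indicator {1..2} v"
proof (cases "1 \<le> v \<and> v \<le> 2")
  case True
  then have "0 \<le> (v - 1) * (2 - v)" by (intro mult_nonneg_nonneg) auto
  then show ?thesis using True by (simp add: bump_def)
next
  case False
  then have "(v - 1) * (2 - v) \<le> 0" by (auto intro: mult_nonpos_nonneg mult_nonneg_nonpos)
  then have "6 * (v - 1) * (2 - v) \<le> 0" by (simp only: mult.assoc)
  then show ?thesis using False by (auto simp: bump_def)
qed

lemma bump_zero: "v \<le> 1 \<or> 2 \<le> v \<Longrightarrow> bump v = 0"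
  unfolding bump_eq by (auto simp: indicator_def)

lemma bump_le: "bump v \<le> 6"
proof (cases "1 \<le> v \<and> v \<le> 2")
  case True
  then have "(v - 1) * (2 - v) \<le> 1 * 1" by (intro mult_mono) auto
  then have "6 * (v - 1) * (2 - v) \<le> 6" unfolding mult.assoc by simp
  then show ?thesis using True unfolding bump_eq by simp
qed (auto simp: bump_eq indicator_def)

lemma
  shows integrable_bump: "integrable lborel bump" and integral_bump: "(\<integral>v. bump v \<partial>lborel) = 1"
proof -
  have "has_bochner_integral lborel (\<lambda>v. (6 * (v - 1) * (2 - v)) * indicator {1..2} v)
      ((9 * 2\<^sup>2 - 2 * 2 ^ 3 - 12 * 2) - (9 * 1\<^sup>2 - 2 * 1 ^ 3 - 12 * (1::real)))"
  proof (rule has_bochner_integral_FTC_Icc_real)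
    fix v :: real
    show "((\<lambda>v. 9 * v\<^sup>2 - 2 * v ^ 3 - 12 * v) has_real_derivative 6 * (v - 1) * (2 - v)) (at v)"
      by (auto intro!: derivative_eq_intros) (simp add: algebra_simps power2_eq_square)
    show "isCont (\<lambda>v. 6 * (v - 1) * (2 - v)) v" by (intro continuous_intros)
  qed simp
  then have "has_bochner_integral lborel bump 1" unfolding bump_eq[abs_def] by simp
  then show "integrable lborel bump" "(\<integral>v. bump v \<partial>lborel) = 1"
    by (auto simp: has_bochner_integral_iff)
qed

lemma integral_bump_le:
  assumes "\<And>v. 1 \<le> v \<Longrightarrow> v \<le> 2 \<Longrightarrow> f v \<le> B" "0 \<le> B"
  shows "(\<integral>v. bump v * f v \<partial>lborel) \<le> B"
proof -
  have "(\<integral>v. bump v * f v \<partial>lborel) \<le> (\<integral>v. B * bump v \<partial>lborel)"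
  proof (rule integral_mono')
    show "integrable lborel (\<lambda>v. B * bump v)" using integrable_bump by simp
    show "bump v * f v \<le> B * bump v" for v
    proof (cases "1 \<le> v \<and> v \<le> 2")
      case True
      then show ?thesis using mult_left_mono[OF assms(1)[of v] bump_nonneg[of v]] by (simp add: mult.commute)
    qed (auto simp: bump_zero)
    show "0 \<le> B * bump v" for v using assms(2) by (simp add: bump_nonneg)
  qed
  then show ?thesis by (simp add: integral_bump)
qed

text \<open>
  Single coordinates of a path are not Meyer-Zheng continuous, but averages over a short time
  interval to the right of \<open>t\<close> are, unless that interval reaches the end of \<open>I\<close>.
\<close>

definition average :: "ereal set \<Rightarrow> 'd \<Rightarrow> (real \<Rightarrow> real) \<Rightarrow> real \<Rightarrow> ereal \<Rightarrow> ('d::finite) path \<Rightarrow> real" where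
  "average I i \<phi> \<delta> t \<omega> = (\<integral>v. bump v * \<phi> (\<omega> (min (t + ereal (\<delta> * v)) (Sup I)) $ i) \<partial>lborel)"

text \<open>The two cases in which the average is Meyer-Zheng continuous: at a right end belonging
  to \<open>I\<close> it is an evaluation there, which the topology controls, and otherwise the
  window \<open>[t + \<delta>, t + 2 \<delta>]\<close> lies strictly before the end.\<close>

definition admissible :: "ereal set \<Rightarrow> real \<Rightarrow> ereal \<Rightarrow> bool" where
  "admissible I \<delta> t \<longleftrightarrow> 0 < \<delta> \<and> 0 \<le> t \<and> (t = Sup I \<and> Sup I \<in> I \<or> t + ereal (2 * \<delta>) < Sup I)"

lemma shifted_time:
  assumes I: "time_domain I" and t: "t \<in> I" "0 \<le> d"
  shows "min (t + ereal d) (Sup I) \<in> I"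
proof (cases "t = \<infinity>")
  case True
  then show ?thesis using t time_domain_le_Sup[OF I t(1)] by simp
next
  case False
  then show ?thesis using time_domain_nonneg[OF I t(1)] t(2) by (intro time_domain_min[OF I]) (cases t; simp)+
qed

lemma average_Sup:
  assumes "0 < \<delta>" shows "average I i \<phi> \<delta> (Sup I) \<omega> = \<phi> (\<omega> (Sup I) $ i)"
proof -
  have "bump v * \<phi> (\<omega> (min (Sup I + ereal (\<delta> * v)) (Sup I)) $ i) = bump v * \<phi> (\<omega> (Sup I) $ i)" for v
  proof (cases "0 \<le> v")
    case True
    then have "Sup I + 0 \<le> Sup I + ereal (\<delta> * v)" using assms by (intro add_left_mono) auto
    then show ?thesis by (simp add: min_absorb2)
  qed (simp add: bump_zero)
  then show ?thesis unfolding average_def by (simp only: integral_mult_left_zero integral_bump mult_1)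
qed

context
  fixes I :: "ereal set" and N :: "('d::finite) path measure" and \<phi> :: "real \<Rightarrow> real" and B :: real
  assumes I: "time_domain I" and N: "space N = skorokhod_space I"
    and \<phi>: "continuous_on UNIV \<phi>" and B: "\<And>x. \<bar>\<phi> x\<bar> \<le> B"
begin

lemma measurable_phi [measurable]: "\<phi> \<in> borel_measurable borel"
  by (rule borel_measurable_continuous_onI[OF \<phi>])

lemma measurable_average_integrand:
  assumes \<delta>: "0 < \<delta>" and t: "t \<in> I"
    and m: "\<And>s. s \<in> I \<Longrightarrow> s \<le> t + ereal (2 * \<delta>) \<Longrightarrow> (\<lambda>\<omega>. \<omega> s $ i) \<in> borel_measurable N"
  shows "(\<lambda>(\<omega>, v). bump v * \<phi> (\<omega> (min (t + ereal (\<delta> * v)) (Sup I)) $ i)) \<in> borel_measurable (N \<Otimes>\<^sub>M borel)"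
proof (cases "t = \<infinity>")
  case True
  then have "Sup I = \<infinity>" using time_domain_le_Sup[OF I t] by simp
  moreover have "(\<lambda>\<omega>. \<omega> t $ i) \<in> borel_measurable N" using m[OF t] True by simp
  ultimately have "min (t + ereal (\<delta> * v)) (Sup I) = t" for v using True by simp
  moreover have "(\<lambda>(\<omega>, v). bump v * \<phi> (\<omega> t $ i)) \<in> borel_measurable (N \<Otimes>\<^sub>M borel)"
    using \<open>(\<lambda>\<omega>. \<omega> t $ i) \<in> borel_measurable N\<close> by measurable
  ultimately show ?thesis by simp
next
  case False
  then obtain r where r: "t = ereal r" "0 \<le> r" using time_domain_nonneg[OF I t] by (cases t) auto
  define b where "b = r + 2 * \<delta>"
  have "(\<lambda>(\<omega>, u). stopped_path I \<omega> i (max 0 (min u b))) \<in> borel_measurable (N \<Otimes>\<^sub>M borel)"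
  proof (rule measurable_right_continuous_process)
    show "(\<lambda>\<omega>. stopped_path I \<omega> i u) \<in> borel_measurable N" if "0 \<le> u" "u \<le> b" for u
      unfolding stopped_path_def
    proof (rule m)
      show "min (ereal u) (Sup I) \<in> I" using that by (intro time_domain_min[OF I]) auto
      show "min (ereal u) (Sup I) \<le> t + ereal (2 * \<delta>)" using that by (intro min.coboundedI1) (simp add: b_def r)
    qed
  qed (use r \<delta> stopped_path_right_continuous[OF I] N in \<open>auto simp: b_def\<close>)
  from measurable_compose[OF _ this, of "\<lambda>p. (fst p, r + \<delta> * snd p)" "N \<Otimes>\<^sub>M borel"]
  have [measurable]: "(\<lambda>p. stopped_path I (fst p) i (max 0 (min (r + \<delta> * snd p) b))) \<in> borel_measurable (N \<Otimes>\<^sub>M borel)"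
    by simp
  have "(\<lambda>p. bump (snd p) * \<phi> (stopped_path I (fst p) i (max 0 (min (r + \<delta> * snd p) b)))) \<in> borel_measurable (N \<Otimes>\<^sub>M borel)"
    by measurable
  also have "(\<lambda>p. bump (snd p) * \<phi> (stopped_path I (fst p) i (max 0 (min (r + \<delta> * snd p) b)))) =
      (\<lambda>(\<omega>, v). bump v * \<phi> (\<omega> (min (t + ereal (\<delta> * v)) (Sup I)) $ i))"
  proof (rule ext, clarify)
    fix \<omega> :: "'d path" and v
    show "bump (snd (\<omega>, v)) * \<phi> (stopped_path I (fst (\<omega>, v)) i (max 0 (min (r + \<delta> * snd (\<omega>, v)) b))) =
        bump v * \<phi> (\<omega> (min (t + ereal (\<delta> * v)) (Sup I)) $ i)"
    proof (cases "1 \<le> v \<and> v \<le> 2")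
      case True
      then have "max 0 (min (r + \<delta> * v) b) = r + \<delta> * v" using \<delta> r by (simp add: mult.commute b_def)
      then show ?thesis by (simp add: stopped_path_def r)
    qed (auto simp: bump_zero)
  qed
  finally show ?thesis .
qed

lemma measurable_average:
  assumes "0 < \<delta>" "t \<in> I"
    and "\<And>s. s \<in> I \<Longrightarrow> s \<le> t + ereal (2 * \<delta>) \<Longrightarrow> (\<lambda>\<omega>. \<omega> s $ i) \<in> borel_measurable N"
  shows "average I i \<phi> \<delta> t \<in> borel_measurable N"
proof -
  have "(\<lambda>(\<omega>, v). bump v * \<phi> (\<omega> (min (t + ereal (\<delta> * v)) (Sup I)) $ i)) \<in> borel_measurable (N \<Otimes>\<^sub>M lborel)"
    using measurable_average_integrand[OF assms] by simp
  from lborel.borel_measurable_lebesgue_integral[OF this]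
  show ?thesis unfolding average_def[abs_def] .
qed

end

context
  fixes I :: "ereal set" and \<phi> :: "real \<Rightarrow> real" and B :: real
  assumes I: "time_domain I" and \<phi>: "continuous_on UNIV \<phi>" and B: "\<And>x. \<bar>\<phi> x\<bar> \<le> B"
begin

lemma abs_average_le: "\<bar>average I i \<phi> \<delta> t \<omega>\<bar> \<le> B"
proof -
  have "\<bar>average I i \<phi> \<delta> t \<omega>\<bar> \<le> (\<integral>v. bump v * \<bar>\<phi> (\<omega> (min (t + ereal (\<delta> * v)) (Sup I)) $ i)\<bar> \<partial>lborel)"
    unfolding average_def by (rule order_trans[OF integral_abs_bound]) (simp add: abs_mult bump_nonneg)
  also have "\<dots> \<le> B"
    by (rule integral_bump_le) (use B order_trans[OF abs_ge_zero B] in auto)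
  finally show ?thesis .
qed

lemma average_tendsto:
  assumes \<omega>: "\<omega> \<in> skorokhod_space I" and t: "t \<in> I"
  shows "(\<lambda>m. average I i \<phi> (inverse (real (Suc m))) t \<omega>) \<longlonglongrightarrow> \<phi> (\<omega> t $ i)"
proof (cases "t = Sup I")
  case True
  then show ?thesis by (simp add: average_Sup del: of_nat_Suc)
next
  case False
  have "(\<lambda>m. \<integral>v. bump v * \<phi> (\<omega> (min (t + ereal (inverse (real (Suc m)) * v)) (Sup I)) $ i) \<partial>lborel) \<longlonglongrightarrow>
      (\<integral>v. bump v * \<phi> (\<omega> t $ i) \<partial>lborel)"
  proof (rule integral_dominated_convergence)
    show "integrable lborel (\<lambda>v. B * bump v)" using integrable_bump by simp
    fix m
    have "(\<lambda>(\<omega>, v). bump v * \<phi> (\<omega> (min (t + ereal (inverse (real (Suc m)) * v)) (Sup I)) $ i)) \<in>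
        borel_measurable (path_algebra I \<Otimes>\<^sub>M borel)"
      by (rule measurable_average_integrand[OF I space_path_algebra \<phi> B])
        (use t measurable_coordinate_path in \<open>auto simp del: of_nat_Suc\<close>)
    from measurable_compose[OF measurable_Pair1' this, of \<omega>] \<omega>
    show "(\<lambda>v. bump v * \<phi> (\<omega> (min (t + ereal (inverse (real (Suc m)) * v)) (Sup I)) $ i)) \<in> borel_measurable lborel"
      by simp
    show "AE v in lborel. norm (bump v * \<phi> (\<omega> (min (t + ereal (inverse (real (Suc m)) * v)) (Sup I)) $ i)) \<le> B * bump v"
      using mult_right_mono[OF B bump_nonneg] by (intro AE_I2) (simp add: abs_mult bump_nonneg mult.commute)
  next
    obtain r where r: "t = ereal r" "0 \<le> r"
      using time_domain_nonneg[OF I t] time_domain_le_Sup[OF I t] False by (cases t) auto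
    show "AE v in lborel. (\<lambda>m. bump v * \<phi> (\<omega> (min (t + ereal (inverse (real (Suc m)) * v)) (Sup I)) $ i)) \<longlonglongrightarrow>
        bump v * \<phi> (\<omega> t $ i)"
    proof (intro AE_I2)
      fix v :: real
      show "(\<lambda>m. bump v * \<phi> (\<omega> (min (t + ereal (inverse (real (Suc m)) * v)) (Sup I)) $ i)) \<longlonglongrightarrow> bump v * \<phi> (\<omega> t $ i)"
      proof (cases "1 \<le> v")
        case True
        have "(\<lambda>m. r + inverse (real (Suc m)) * v) \<longlonglongrightarrow> r + 0 * v"
          by (intro tendsto_intros LIMSEQ_inverse_real_of_nat)
        then have "filterlim (\<lambda>m. r + inverse (real (Suc m)) * v) (at_right r) sequentially"
          using True by (auto simp: filterlim_at simp del: of_nat_Suc)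
        then have "(\<lambda>m. stopped_path I \<omega> i (r + inverse (real (Suc m)) * v)) \<longlonglongrightarrow> stopped_path I \<omega> i r"
          by (rule filterlim_compose[OF stopped_path_right_continuous[OF I \<omega> r(2)]])
        then have "(\<lambda>m. \<omega> (min (t + ereal (inverse (real (Suc m)) * v)) (Sup I)) $ i) \<longlonglongrightarrow> \<omega> t $ i"
          using stopped_path_eq[of r I \<omega> i] t r by (simp add: stopped_path_def del: of_nat_Suc)
        moreover have "isCont \<phi> (\<omega> t $ i)" using \<phi> by (simp add: continuous_on_eq_continuous_at)
        ultimately show ?thesis by (intro tendsto_mult tendsto_const isCont_tendsto_compose[where g = \<phi>])
      qed (simp add: bump_zero)
    qed
  qed simp
  then show ?thesis by (simp add: average_def integral_bump)
qed

text \<open>Substitution of \<open>s\<close> for \<open>t + \<delta> * v\<close>. The factor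
  \<open>exp s\<close> cancels the weight of the Meyer-Zheng functional; it does not spoil
  boundedness, since the bump vanishes outside a bounded window.\<close>

lemma average_eq_MZ_functional:
  assumes t: "0 \<le> t" "ereal (t + 2 * \<delta>) < Sup I" and \<delta>: "0 < \<delta>"
  shows "average I i \<phi> \<delta> (ereal t) \<omega> =
    MZ_functional I i (\<lambda>(s, x). bump ((s - t) / \<delta>) / \<delta> * exp s * \<phi> x) \<omega>"
proof -
  have "(\<integral>s. indicator {s. ereal s \<in> I} s *\<^sub>R (bump ((s - t) / \<delta>) / \<delta> * exp s * \<phi> (\<omega> (ereal s) $ i) * exp (- s)) \<partial>lborel) =
      \<delta> * (\<integral>v. indicator {s. ereal s \<in> I} (t + \<delta> * v) *\<^sub>R (bump ((t + \<delta> * v - t) / \<delta>) / \<delta> * exp (t + \<delta> * v) *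
        \<phi> (\<omega> (ereal (t + \<delta> * v)) $ i) * exp (- (t + \<delta> * v))) \<partial>lborel)"
    using \<delta> lborel_integral_real_affine[of \<delta> "\<lambda>s. indicator {s. ereal s \<in> I} s *\<^sub>R (bump ((s - t) / \<delta>) / \<delta> *
      exp s * \<phi> (\<omega> (ereal s) $ i) * exp (- s))" t] by (simp only: real_scaleR_def abs_of_pos)
  also have "\<dots> = (\<integral>v. \<delta> * (indicator {s. ereal s \<in> I} (t + \<delta> * v) *\<^sub>R (bump ((t + \<delta> * v - t) / \<delta>) / \<delta> * exp (t + \<delta> * v) *
        \<phi> (\<omega> (ereal (t + \<delta> * v)) $ i) * exp (- (t + \<delta> * v)))) \<partial>lborel)" by (rule integral_mult_right_zero[symmetric])
  also have "\<dots> = average I i \<phi> \<delta> (ereal t) \<omega>"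
    unfolding average_def
  proof (rule Bochner_Integration.integral_cong[OF refl])
    fix v
    show "\<delta> * (indicator {s. ereal s \<in> I} (t + \<delta> * v) *\<^sub>R (bump ((t + \<delta> * v - t) / \<delta>) / \<delta> * exp (t + \<delta> * v) *
        \<phi> (\<omega> (ereal (t + \<delta> * v)) $ i) * exp (- (t + \<delta> * v)))) =
      bump v * \<phi> (\<omega> (min (ereal t + ereal (\<delta> * v)) (Sup I)) $ i)"
    proof (cases "1 \<le> v \<and> v \<le> 2")
      case True
      then have "ereal (t + \<delta> * v) \<le> ereal (t + 2 * \<delta>)" using \<delta> by simp
      then have lt: "ereal (t + \<delta> * v) < Sup I" using t(2) by (rule le_less_trans)
      moreover have "0 \<le> ereal (t + \<delta> * v)" using t \<delta> True by simp
      ultimately have "ereal (t + \<delta> * v) \<in> I" by (intro time_domain_less[OF I])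
      moreover have "min (ereal t + ereal (\<delta> * v)) (Sup I) = ereal (t + \<delta> * v)" using lt by simp
      ultimately show ?thesis using \<delta> by (simp add: mult_exp_exp)
    qed (use \<delta> in \<open>auto simp: bump_zero\<close>)
  qed
  finally show ?thesis unfolding MZ_functional_def set_lebesgue_integral_def by simp
qed

lemma continuous_map_average:
  assumes top: "topspace \<D> = skorokhod_space I"
    and stronger: "\<And>U. openin (MZ_topology I) U \<Longrightarrow> openin \<D> U"
    and adm: "admissible I \<delta> t"
  shows "continuous_map \<D> euclideanreal (average I i \<phi> \<delta> t :: ('d::finite) path \<Rightarrow> real)"
  unfolding continuous_map_def
proof (intro conjI allI impI)
  fix U :: "real set" assume "openin euclideanreal U"
  then have U: "open U" by simp
  show "openin \<D> {\<omega> \<in> topspace \<D>. average I i \<phi> \<delta> t \<omega> \<in> U}"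
    unfolding top
  proof (rule stronger)
    have \<delta>: "0 < \<delta>" "0 \<le> t" using adm by (auto simp: admissible_def)
    show "openin (MZ_topology I) {\<omega> \<in> skorokhod_space I. average I i \<phi> \<delta> t \<omega> \<in> U}"
    proof (cases "t = Sup I \<and> Sup I \<in> I")
      case True
      let ?V = "{x :: real ^ 'd. \<phi> (x $ i) \<in> U}"
      have "open ?V"
      proof -
        have "continuous_on UNIV (\<lambda>x :: real ^ 'd. \<phi> (x $ i))"
          by (rule continuous_on_compose2[OF \<phi>]) (auto intro!: continuous_intros)
        from open_vimage[OF U this] show ?thesis by (simp add: vimage_def)
      qed
      moreover have "{\<omega> \<in> skorokhod_space I. average I i \<phi> \<delta> t \<omega> \<in> U} = {\<omega> \<in> skorokhod_space I. \<omega> (Sup I) \<in> ?V}"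
        using True by (simp add: average_Sup \<delta>)
      ultimately show ?thesis unfolding MZ_topology_def using True
        by (intro topology_generated_by_Basis UnI2) blast
    next
      case False
      then have t2: "t + ereal (2 * \<delta>) < Sup I" using adm by (auto simp: admissible_def)
      then obtain r where r: "t = ereal r" using \<delta> by (cases t) auto
      let ?f = "\<lambda>(s, x). bump ((s - r) / \<delta>) / \<delta> * exp s * \<phi> x"
      have "{\<omega> \<in> skorokhod_space I. average I i \<phi> \<delta> t \<omega> \<in> U} = {\<omega> \<in> skorokhod_space I. MZ_functional I i ?f \<omega> \<in> U}"
        using average_eq_MZ_functional[of r \<delta> i] t2 \<delta> by (simp add: r)
      moreover have "continuous_on ({t. ereal t \<in> I} \<times> UNIV) ?f"
        unfolding case_prod_beta using \<delta>
        by (intro continuous_intros continuous_on_compose2[OF continuous_bump] continuous_on_compose2[OF \<phi>]) auto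
      moreover have "bounded (?f ` ({t. ereal t \<in> I} \<times> UNIV))"
      proof (rule boundedI)
        fix y assume "y \<in> ?f ` ({t. ereal t \<in> I} \<times> UNIV)"
        then obtain s x where y: "y = bump ((s - r) / \<delta>) / \<delta> * exp s * \<phi> x" by auto
        have "bump ((s - r) / \<delta>) * exp s \<le> 6 * exp (r + 2 * \<delta>)"
        proof (cases "s \<le> r + 2 * \<delta>")
          case True
          then show ?thesis by (intro mult_mono bump_le) (auto simp: bump_nonneg)
        next
          case False
          then have "2 \<le> (s - r) / \<delta>" using \<delta> by (simp add: pos_le_divide_eq)
          then show ?thesis by (simp add: bump_zero)
        qed
        then have "bump ((s - r) / \<delta>) * exp s / \<delta> * \<bar>\<phi> x\<bar> \<le> 6 * exp (r + 2 * \<delta>) / \<delta> * B"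
          using \<delta> by (intro mult_mono[OF divide_right_mono B]) auto
        then show "norm y \<le> 6 * exp (r + 2 * \<delta>) / \<delta> * B"
          using \<delta> by (simp add: y abs_mult bump_nonneg)
      qed
      ultimately show ?thesis unfolding MZ_topology_def using U
        by (intro topology_generated_by_Basis UnI1) blast
    qed
  qed
qed auto

end

section \<open>Averages under a quasimartingale measure\<close>

lemma measurable_average_raw:
  assumes I: "time_domain I" and \<phi>: "continuous_on UNIV \<phi>" "\<And>x. \<bar>\<phi> x\<bar> \<le> B"
    and t: "0 < \<delta>" "t \<in> I" and u: "\<And>s. s \<in> I \<Longrightarrow> s \<le> t + ereal (2 * \<delta>) \<Longrightarrow> s \<le> u"
  shows "average I i \<phi> \<delta> t \<in> borel_measurable (raw_filtration I u :: ('d::finite) path measure)"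
  by (rule measurable_average[OF I space_raw_filtration \<phi> t measurable_coordinate[OF _ u]])

context bounded_quasimartingale
begin

text \<open>Fubini, with \<open>K * B * bump v\<close> as dominating function. It reduces
  expectations involving an average to expectations at a fixed shift \<open>v\<close>.\<close>

lemma integral_average:
  assumes \<phi>: "continuous_on UNIV \<phi>" "\<And>x. \<bar>\<phi> x\<bar> \<le> B" and t: "0 < \<delta>" "t \<in> I"
    and h: "h \<in> borel_measurable Q" "\<And>\<omega>. \<bar>h \<omega>\<bar> \<le> K"
  shows "integrable Q (\<lambda>\<omega>. h \<omega> * average I i \<phi> \<delta> t \<omega>)"
    and "integrable lborel (\<lambda>v. bump v * (\<integral>\<omega>. h \<omega> * \<phi> (\<omega> (min (t + ereal (\<delta> * v)) (Sup I)) $ i) \<partial>Q))"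
    and "(\<integral>\<omega>. h \<omega> * average I i \<phi> \<delta> t \<omega> \<partial>Q) =
      (\<integral>v. bump v * (\<integral>\<omega>. h \<omega> * \<phi> (\<omega> (min (t + ereal (\<delta> * v)) (Sup I)) $ i) \<partial>Q) \<partial>lborel)"
proof -
  interpret pair_sigma_finite Q lborel by unfold_locales
  let ?Y = "\<lambda>\<omega> v. \<phi> (\<omega> (min (t + ereal (\<delta> * v)) (Sup I)) $ i)"
  let ?F = "\<lambda>\<omega> v. h \<omega> * (bump v * ?Y \<omega> v)"
  have mY: "(\<lambda>(\<omega>, v). bump v * ?Y \<omega> v) \<in> borel_measurable (Q \<Otimes>\<^sub>M lborel)"
    using measurable_average_integrand[OF time_domain space_Q \<phi> t coordinate_measurable] by simp
  have mF: "case_prod ?F \<in> borel_measurable (Q \<Otimes>\<^sub>M lborel)"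
    using borel_measurable_times[OF measurable_compose[OF measurable_fst h(1)] mY] by (simp add: case_prod_beta)
  have bF: "\<bar>?F \<omega> v\<bar> \<le> K * B * bump v" for \<omega> v
  proof -
    have "\<bar>h \<omega>\<bar> * (bump v * \<bar>?Y \<omega> v\<bar>) \<le> K * (bump v * B)"
      using h(2) \<phi>(2) order_trans[OF abs_ge_zero h(2)] by (intro mult_mono) (auto simp: bump_nonneg)
    then show ?thesis by (simp add: abs_mult bump_nonneg mult_ac)
  qed
  have "integrable (Q \<Otimes>\<^sub>M lborel) (\<lambda>(\<omega>, v). K * B * bump v)"
    by (rule Fubini_integrable) (use integrable_bump in \<open>auto simp: case_prod_beta\<close>)
  then have int: "integrable (Q \<Otimes>\<^sub>M lborel) (case_prod ?F)"
    by (rule Bochner_Integration.integrable_bound[OF _ mF])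
      (use bF order_trans[OF _ abs_ge_self] in \<open>auto intro!: AE_I2\<close>)
  have F1: "(\<integral>v. ?F \<omega> v \<partial>lborel) = h \<omega> * average I i \<phi> \<delta> t \<omega>" for \<omega> by (simp add: average_def)
  have F2: "(\<integral>\<omega>. ?F \<omega> v \<partial>Q) = bump v * (\<integral>\<omega>. h \<omega> * ?Y \<omega> v \<partial>Q)" for v
    by (simp add: mult.left_commute)
  show "integrable Q (\<lambda>\<omega>. h \<omega> * average I i \<phi> \<delta> t \<omega>)" using integrable_fst[OF int] unfolding F1 .
  show "integrable lborel (\<lambda>v. bump v * (\<integral>\<omega>. h \<omega> * ?Y \<omega> v \<partial>Q))" using integrable_snd[OF int] unfolding F2 .
  show "(\<integral>\<omega>. h \<omega> * average I i \<phi> \<delta> t \<omega> \<partial>Q) = (\<integral>v. bump v * (\<integral>\<omega>. h \<omega> * ?Y \<omega> v \<partial>Q) \<partial>lborel)"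
    using Fubini_integral[OF int] unfolding F1 F2 by simp
qed

lemma average_L1:
  assumes t: "0 < \<delta>" "t \<in> I" and c: "0 \<le> c"
  shows "(\<integral>\<omega>. average I i (\<lambda>x. min \<bar>x\<bar> c) \<delta> t \<omega> \<partial>Q) \<le> C"
proof -
  have \<phi>: "continuous_on UNIV (\<lambda>x::real. min \<bar>x\<bar> c)" "\<And>x::real. \<bar>(min \<bar>x\<bar> c)\<bar> \<le> c"
    using c by (auto intro!: continuous_intros)
  have "(\<integral>\<omega>. average I i (\<lambda>x. min \<bar>x\<bar> c) \<delta> t \<omega> \<partial>Q) =
      (\<integral>v. bump v * (\<integral>\<omega>. min \<bar>\<omega> (min (t + ereal (\<delta> * v)) (Sup I)) $ i\<bar> c \<partial>Q) \<partial>lborel)"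
    using integral_average(3)[OF \<phi> t, of "\<lambda>_. 1" 1] by simp
  also have "\<dots> \<le> C"
  proof (rule integral_bump_le[OF _ C_nonneg])
    fix v :: real assume v: "1 \<le> v" "v \<le> 2"
    let ?t = "min (t + ereal (\<delta> * v)) (Sup I)"
    have t': "?t \<in> I" by (rule shifted_time[OF time_domain t(2)]) (use t v in auto)
    have "(\<integral>\<omega>. min \<bar>\<omega> ?t $ i\<bar> c \<partial>Q) \<le> (\<integral>\<omega>. \<bar>\<omega> ?t $ i\<bar> \<partial>Q)"
    proof (rule integral_mono)
      show "integrable Q (\<lambda>\<omega>. min \<bar>\<omega> ?t $ i\<bar> c)"
        using c coordinate_measurable[OF t'] by (intro integrable_const_bound[of _ c]) auto
    qed (use coordinate_integrable[OF t'] in auto)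
    also have "\<dots> \<le> C" by (rule coordinate_L1[OF t'])
    finally show "(\<integral>\<omega>. min \<bar>\<omega> ?t $ i\<bar> c \<partial>Q) \<le> C" .
  qed
  finally show ?thesis .
qed

text \<open>For each shift \<open>v\<close> in \<open>[1, 2]\<close> the shifted times form a grid,
  and a weight known by \<open>s k + \<delta>\<close> is known at the later time
  \<open>s k + \<delta> * v\<close>, so the estimate for clipped increments applies. Averaging over
  \<open>v\<close> keeps the constant.\<close>

lemma average_bound:
  assumes s: "time_grid I n s" and \<delta>: "0 < \<delta>" and c: "0 \<le> c"
    and h: "\<And>k. k < n \<Longrightarrow> h k \<in> borel_measurable (raw_filtration I (min (s k + ereal \<delta>) (Sup I)))"
    and h1: "\<And>k \<omega>. \<bar>h k \<omega>\<bar> \<le> 1"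
  shows "(\<integral>\<omega>. (\<Sum>k<n. h k \<omega> * (average I i (clip c) \<delta> (s (Suc k)) \<omega> - average I i (clip c) \<delta> (s k) \<omega>)) \<partial>Q) \<le> 14 * C"
proof -
  have sI: "s k \<in> I" if "k \<le> n" for k using s that by (simp add: time_grid_def)
  have \<phi>: "continuous_on UNIV (clip c)" "\<And>x. \<bar>clip c x\<bar> \<le> c"
    using abs_clip_le[OF c] by (auto simp: clip_def[abs_def] intro!: continuous_intros)
  have hQ: "h k \<in> borel_measurable Q" if "k < n" for k
    by (rule measurable_sub_sigma_algebra[OF h[OF that]]) (simp add: space_Q, unfold sets_Q, rule raw_le_path_algebra)
  let ?A = "\<lambda>k \<omega>. average I i (clip c) \<delta> (s k) \<omega>"
  let ?s = "\<lambda>v k. min (s k + ereal (\<delta> * v)) (Sup I)"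
  let ?Y = "\<lambda>k v \<omega>. clip c (\<omega> (?s v k) $ i)"
  have A: "integrable Q (\<lambda>\<omega>. h k \<omega> * ?A l \<omega>)"
    "integrable lborel (\<lambda>v. bump v * (\<integral>\<omega>. h k \<omega> * ?Y l v \<omega> \<partial>Q))"
    "(\<integral>\<omega>. h k \<omega> * ?A l \<omega> \<partial>Q) = (\<integral>v. bump v * (\<integral>\<omega>. h k \<omega> * ?Y l v \<omega> \<partial>Q) \<partial>lborel)" if "k < n" "l \<le> n" for k l
    using integral_average[OF \<phi> \<delta> sI[OF that(2)] hQ[OF that(1)] h1] by auto
  have "(\<integral>\<omega>. (\<Sum>k<n. h k \<omega> * (?A (Suc k) \<omega> - ?A k \<omega>)) \<partial>Q) =
      (\<Sum>k<n. (\<integral>\<omega>. h k \<omega> * ?A (Suc k) \<omega> \<partial>Q) - (\<integral>\<omega>. h k \<omega> * ?A k \<omega> \<partial>Q))"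
    using A(1) by (subst Bochner_Integration.integral_sum) (auto simp: right_diff_distrib intro!: sum.cong)
  also have "\<dots> = (\<Sum>k<n. (\<integral>v. bump v * (\<integral>\<omega>. h k \<omega> * ?Y (Suc k) v \<omega> \<partial>Q) - bump v * (\<integral>\<omega>. h k \<omega> * ?Y k v \<omega> \<partial>Q) \<partial>lborel))"
    using A(2,3) by (intro sum.cong refl) (simp add: Suc_le_eq)
  also have "\<dots> = (\<integral>v. (\<Sum>k<n. bump v * (\<integral>\<omega>. h k \<omega> * ?Y (Suc k) v \<omega> \<partial>Q) - bump v * (\<integral>\<omega>. h k \<omega> * ?Y k v \<omega> \<partial>Q)) \<partial>lborel)"
    using A(2) by (subst Bochner_Integration.integral_sum) (auto simp: Suc_le_eq)
  also have "\<dots> = (\<integral>v. bump v * (\<Sum>k<n. (\<integral>\<omega>. h k \<omega> * ?Y (Suc k) v \<omega> \<partial>Q) - (\<integral>\<omega>. h k \<omega> * ?Y k v \<omega> \<partial>Q)) \<partial>lborel)"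
    by (simp add: sum_distrib_left right_diff_distrib)
  also have "\<dots> \<le> 14 * C"
  proof (rule integral_bump_le)
    fix v :: real assume v: "1 \<le> v" "v \<le> 2"
    have sv: "?s v k \<in> I" if "k \<le> n" for k
      by (rule shifted_time[OF time_domain sI[OF that]]) (use \<delta> v in auto)
    have grid: "time_grid I n (?s v)"
      unfolding time_grid_def
    proof (intro conjI allI impI)
      fix k assume "k < n"
      then have "s k \<le> s (Suc k)" using s by (simp add: time_grid_def)
      then show "?s v k \<le> ?s v (Suc k)" by (intro min.mono add_right_mono order_refl)
    qed (rule sv)
    have int: "integrable Q (\<lambda>\<omega>. h k \<omega> * ?Y l v \<omega>)" if "k < n" "l \<le> n" for k l
    proof (rule integrable_mult_bounded[OF _ hQ[OF that(1)] h1])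
      show "integrable Q (?Y l v)"
        using \<phi>(2) measurable_compose[OF coordinate_measurable[OF sv[OF that(2)]] measurable_clip]
        by (intro integrable_const_bound[of _ c]) auto
    qed
    have "(\<Sum>k<n. (\<integral>\<omega>. h k \<omega> * ?Y (Suc k) v \<omega> \<partial>Q) - (\<integral>\<omega>. h k \<omega> * ?Y k v \<omega> \<partial>Q)) =
        (\<integral>\<omega>. (\<Sum>k<n. h k \<omega> * (?Y (Suc k) v \<omega> - ?Y k v \<omega>)) \<partial>Q)"
      using int by (subst Bochner_Integration.integral_sum) (auto simp: right_diff_distrib Suc_le_eq intro!: sum.cong)
    also have "\<dots> \<le> 14 * C"
    proof (rule clip_bound[OF grid _ h1 c])
      fix k assume k: "k < n"
      have "\<delta> * 1 \<le> \<delta> * v" using \<delta> v by (intro mult_left_mono) auto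
      then have "min (s k + ereal \<delta>) (Sup I) \<le> ?s v k" by (intro min.mono add_left_mono) auto
      then have "sets (raw_filtration I (min (s k + ereal \<delta>) (Sup I)) :: 'd path measure) \<subseteq> sets (right_filtration I (?s v k))"
        by (rule order_trans[OF raw_filtration_mono raw_le_right_filtration])
      then show "h k \<in> borel_measurable (right_filtration I (?s v k))"
        by (intro measurable_sub_sigma_algebra[OF h[OF k]]) simp_all
    qed
    finally show "(\<Sum>k<n. (\<integral>\<omega>. h k \<omega> * ?Y (Suc k) v \<omega> \<partial>Q) - (\<integral>\<omega>. h k \<omega> * ?Y k v \<omega> \<partial>Q)) \<le> 14 * C" .
  qed (use C_nonneg in simp)
  finally show ?thesis .
qed

end

section \<open>Approximation in L1 by a vector lattice of functions\<close>

context prob_space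
begin

definition L1_closure :: "('a \<Rightarrow> real) set \<Rightarrow> ('a \<Rightarrow> real) set" where
  "L1_closure H = {f. integrable M f \<and> (\<forall>\<epsilon>>0. \<exists>h\<in>H. (\<integral>x. \<bar>f x - h x\<bar> \<partial>M) < \<epsilon>)}"

definition L1_events :: "('a \<Rightarrow> real) set \<Rightarrow> 'a set set" where
  "L1_events H = {A \<in> events. indicator A \<in> L1_closure H}"

context
  fixes H :: "('a \<Rightarrow> real) set"
  assumes H_integrable: "\<And>h. h \<in> H \<Longrightarrow> integrable M h" and H_const: "\<And>a. (\<lambda>_. a) \<in> H"
    and H_add: "\<And>h k. h \<in> H \<Longrightarrow> k \<in> H \<Longrightarrow> (\<lambda>x. h x + k x) \<in> H"
    and H_scale: "\<And>a h. h \<in> H \<Longrightarrow> (\<lambda>x. a * h x) \<in> H"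
    and H_max: "\<And>h k. h \<in> H \<Longrightarrow> k \<in> H \<Longrightarrow> (\<lambda>x. max (h x) (k x)) \<in> H"
begin

lemma L1_closure_integrable: "f \<in> L1_closure H \<Longrightarrow> integrable M f"
  by (simp add: L1_closure_def)

lemma L1_closureI:
  assumes "integrable M f" "\<And>\<epsilon>. 0 < \<epsilon> \<Longrightarrow> \<exists>g\<in>L1_closure H. (\<integral>x. \<bar>f x - g x\<bar> \<partial>M) < \<epsilon>"
  shows "f \<in> L1_closure H"
proof -
  have "\<exists>h\<in>H. (\<integral>x. \<bar>f x - h x\<bar> \<partial>M) < \<epsilon>" if \<epsilon>: "0 < \<epsilon>" for \<epsilon>
  proof -
    obtain g where g: "g \<in> L1_closure H" "(\<integral>x. \<bar>f x - g x\<bar> \<partial>M) < \<epsilon> / 2" using assms(2)[of "\<epsilon> / 2"] \<epsilon> by auto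
    have "0 < \<epsilon> / 2" using \<epsilon> by simp
    with g(1) obtain h where h: "h \<in> H" "(\<integral>x. \<bar>g x - h x\<bar> \<partial>M) < \<epsilon> / 2"
      unfolding L1_closure_def by blast
    have int: "integrable M (\<lambda>x. \<bar>f x - g x\<bar>)" "integrable M (\<lambda>x. \<bar>g x - h x\<bar>)"
      using assms(1) L1_closure_integrable[OF g(1)] H_integrable[OF h(1)] by auto
    have "(\<integral>x. \<bar>f x - h x\<bar> \<partial>M) \<le> (\<integral>x. \<bar>f x - g x\<bar> + \<bar>g x - h x\<bar> \<partial>M)"
      using assms(1) H_integrable[OF h(1)] int by (intro integral_mono) auto
    also have "\<dots> = (\<integral>x. \<bar>f x - g x\<bar> \<partial>M) + (\<integral>x. \<bar>g x - h x\<bar> \<partial>M)" using int by simp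
    finally show ?thesis using g h by (intro bexI[of _ h]) auto
  qed
  then show ?thesis using assms(1) by (simp add: L1_closure_def)
qed

lemma L1_closure_base: "h \<in> H \<Longrightarrow> h \<in> L1_closure H"
  using H_integrable by (auto simp: L1_closure_def intro!: bexI[of _ h])

lemma L1_closure_limit:
  assumes s: "\<And>k :: nat. s k \<in> L1_closure H" and lim: "\<And>x. x \<in> space M \<Longrightarrow> (\<lambda>k. s k x) \<longlonglongrightarrow> f x"
    and w: "integrable M w" "\<And>k x. x \<in> space M \<Longrightarrow> \<bar>s k x\<bar> \<le> w x"
  shows "f \<in> L1_closure H"
proof -
  have sm: "s k \<in> borel_measurable M" for k using L1_closure_integrable[OF s[of k]] by simp
  have fm: "f \<in> borel_measurable M" by (rule borel_measurable_LIMSEQ_real[OF lim sm])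
  have f: "integrable M f"
    by (rule integrable_dominated_convergence[OF fm sm w(1)]) (use lim w in \<open>auto intro!: AE_I2\<close>)
  have fw: "\<bar>f x\<bar> \<le> w x" if "x \<in> space M" for x
    by (rule LIMSEQ_le_const2[OF tendsto_rabs[OF lim[OF that]]]) (use w that in auto)
  have "(\<lambda>k. \<integral>x. \<bar>f x - s k x\<bar> \<partial>M) \<longlonglongrightarrow> (\<integral>x. 0 \<partial>M)"
  proof (rule integral_dominated_convergence)
    show "integrable M (\<lambda>x. 2 * w x)" using w(1) by simp
    show "AE x in M. (\<lambda>k. \<bar>f x - s k x\<bar>) \<longlonglongrightarrow> 0"
    proof (intro AE_I2)
      fix x assume "x \<in> space M"
      from tendsto_diff[OF tendsto_const lim[OF this], of "f x"]
      show "(\<lambda>k. \<bar>f x - s k x\<bar>) \<longlonglongrightarrow> 0" by (intro tendsto_rabs_zero) simp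
    qed
    show "AE x in M. norm \<bar>f x - s k x\<bar> \<le> 2 * w x" for k
      using fw w(2)[of _ k] by (intro AE_I2) (smt (verit) real_norm_def)
  qed (use fm sm in auto)
  then have lim0: "(\<lambda>k. \<integral>x. \<bar>f x - s k x\<bar> \<partial>M) \<longlonglongrightarrow> 0" by simp
  show ?thesis
  proof (rule L1_closureI[OF f])
    fix \<epsilon> :: real assume "0 < \<epsilon>"
    from order_tendstoD(2)[OF lim0 this] obtain k where "(\<integral>x. \<bar>f x - s k x\<bar> \<partial>M) < \<epsilon>"
      by (auto simp: eventually_sequentially)
    then show "\<exists>g\<in>L1_closure H. (\<integral>x. \<bar>f x - g x\<bar> \<partial>M) < \<epsilon>" using s by blast
  qed
qed

lemma L1_closure_cong: "(\<And>x. x \<in> space M \<Longrightarrow> f x = g x) \<Longrightarrow> f \<in> L1_closure H \<Longrightarrow> g \<in> L1_closure H"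
  by (rule L1_closure_limit[of "\<lambda>_. f" _ "\<lambda>x. \<bar>f x\<bar>"]) (auto dest: L1_closure_integrable)

text \<open>One Lipschitz estimate serves both addition and maximum.\<close>

lemma L1_closure_binary:
  assumes f: "f \<in> L1_closure H" "g \<in> L1_closure H"
    and op: "\<And>h k. h \<in> H \<Longrightarrow> k \<in> H \<Longrightarrow> (\<lambda>x. op (h x) (k x)) \<in> H"
    and lip: "\<And>a b c d :: real. \<bar>op a b - op c d\<bar> \<le> \<bar>a - c\<bar> + \<bar>b - d\<bar>"
    and m: "(\<lambda>x. op (f x) (g x)) \<in> borel_measurable M"
  shows "(\<lambda>x. op (f x) (g x)) \<in> L1_closure H"
proof -
  note int = L1_closure_integrable[OF f(1)] L1_closure_integrable[OF f(2)]
  have "integrable M (\<lambda>x. \<bar>f x\<bar> + \<bar>g x\<bar> + \<bar>op 0 0\<bar>)" using int by simp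
  then have i: "integrable M (\<lambda>x. op (f x) (g x))"
  proof (rule Bochner_Integration.integrable_bound[OF _ m])
    have "\<bar>op (f x) (g x)\<bar> \<le> \<bar>f x\<bar> + \<bar>g x\<bar> + \<bar>op 0 0\<bar>" for x using lip[of "f x" "g x" 0 0] by linarith
    then show "AE x in M. norm (op (f x) (g x)) \<le> norm (\<bar>f x\<bar> + \<bar>g x\<bar> + \<bar>op 0 0\<bar>)"
      by (intro AE_I2) simp
  qed
  show ?thesis
  proof (rule L1_closureI[OF i])
    fix \<epsilon> :: real assume "0 < \<epsilon>"
    then have "0 < \<epsilon> / 2" by simp
    then obtain h k where hk: "h \<in> H" "(\<integral>x. \<bar>f x - h x\<bar> \<partial>M) < \<epsilon> / 2" "k \<in> H" "(\<integral>x. \<bar>g x - k x\<bar> \<partial>M) < \<epsilon> / 2"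
      using f unfolding L1_closure_def by blast
    have ii: "integrable M (\<lambda>x. \<bar>f x - h x\<bar>)" "integrable M (\<lambda>x. \<bar>g x - k x\<bar>)"
      using int H_integrable hk by auto
    have "(\<integral>x. \<bar>op (f x) (g x) - op (h x) (k x)\<bar> \<partial>M) \<le> (\<integral>x. \<bar>f x - h x\<bar> + \<bar>g x - k x\<bar> \<partial>M)"
      using ii i H_integrable[OF op[OF hk(1,3)]] lip by (intro integral_mono) auto
    also have "\<dots> < \<epsilon>" using ii hk by simp
    finally show "\<exists>g'\<in>L1_closure H. (\<integral>x. \<bar>op (f x) (g x) - g' x\<bar> \<partial>M) < \<epsilon>"
      by (rule bexI[OF _ L1_closure_base[OF op[OF hk(1,3)]]])
  qed
qed

lemma L1_closure_add: "f \<in> L1_closure H \<Longrightarrow> g \<in> L1_closure H \<Longrightarrow> (\<lambda>x. f x + g x) \<in> L1_closure H"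
  by (rule L1_closure_binary[where op = "(+)"])
    (auto intro: H_add borel_measurable_add dest!: L1_closure_integrable borel_measurable_integrable)

lemma L1_closure_max: "f \<in> L1_closure H \<Longrightarrow> g \<in> L1_closure H \<Longrightarrow> (\<lambda>x. max (f x) (g x)) \<in> L1_closure H"
  by (rule L1_closure_binary[where op = max])
    (auto intro: H_max borel_measurable_max dest!: L1_closure_integrable borel_measurable_integrable)

lemma L1_closure_scale:
  assumes f: "f \<in> L1_closure H" shows "(\<lambda>x. a * f x) \<in> L1_closure H"
proof (cases "a = 0")
  case True
  then show ?thesis using L1_closure_base[OF H_const[of 0]] by simp
next
  case False
  note int = L1_closure_integrable[OF f]
  show ?thesis
  proof (rule L1_closureI)
    fix \<epsilon> :: real assume "0 < \<epsilon>"
    then have "0 < \<epsilon> / \<bar>a\<bar>" using False by simp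
    then obtain h where h: "h \<in> H" "(\<integral>x. \<bar>f x - h x\<bar> \<partial>M) < \<epsilon> / \<bar>a\<bar>" using f unfolding L1_closure_def by blast
    have "(\<integral>x. \<bar>a * f x - a * h x\<bar> \<partial>M) = \<bar>a\<bar> * (\<integral>x. \<bar>f x - h x\<bar> \<partial>M)"
      by (simp add: right_diff_distrib[symmetric] abs_mult)
    also have "\<dots> < \<epsilon>" using h(2) False by (simp add: pos_less_divide_eq mult.commute)
    finally show "\<exists>g\<in>L1_closure H. (\<integral>x. \<bar>a * f x - g x\<bar> \<partial>M) < \<epsilon>"
      by (rule bexI[OF _ L1_closure_base[OF H_scale[OF h(1)]]])
  qed (use int in simp)
qed

text \<open>Complements come from linearity, finite unions from the maximum, and countable unions
  from dominated convergence. Thus approximability has to be checked only on a generating class of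
  events.\<close>

lemma sigma_algebra_L1_events: "sigma_algebra (space M) (L1_events H)"
  unfolding sigma_algebra_iff2
proof (intro conjI ballI allI impI)
  show "L1_events H \<subseteq> Pow (space M)" using sets.sets_into_space by (auto simp: L1_events_def)
  have z: "(\<lambda>_. 0) \<in> L1_closure H" by (rule L1_closure_base[OF H_const])
  then have "indicator {} \<in> L1_closure H" by (rule L1_closure_cong[rotated]) simp
  then show "{} \<in> L1_events H" by (simp add: L1_events_def)
  show "space M - A \<in> L1_events H" if A: "A \<in> L1_events H" for A
  proof -
    have "(\<lambda>x. 1 + - 1 * indicator A x) \<in> L1_closure H"
      using A by (intro L1_closure_add L1_closure_scale L1_closure_base[OF H_const]) (simp add: L1_events_def)
    then have "indicator (space M - A) \<in> L1_closure H"
      by (rule L1_closure_cong[rotated]) (auto simp: indicator_def)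
    then show ?thesis using A by (auto simp: L1_events_def)
  qed
  fix A :: "nat \<Rightarrow> 'a set" assume A: "range A \<subseteq> L1_events H"
  have fin: "indicator (\<Union>i<n. A i) \<in> L1_closure H" for n
  proof (induction n)
    case 0
    from z show ?case by (rule L1_closure_cong[rotated]) simp
  next
    case (Suc n)
    have "A n \<in> L1_events H" using A by auto
    then have "(\<lambda>x. max (indicator (\<Union>i<n. A i) x) (indicator (A n) x)) \<in> L1_closure H"
      by (intro L1_closure_max Suc.IH) (simp add: L1_events_def)
    then show ?case
      by (rule L1_closure_cong[rotated]) (auto simp: indicator_def lessThan_Suc)
  qed
  have "indicator (\<Union>i. A i) \<in> L1_closure H"
    by (rule L1_closure_limit[OF fin LIMSEQ_indicator_UN, of "\<lambda>_. 1"]) (auto simp: indicator_def)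
  moreover have "(\<Union>i. A i) \<in> events" using A by (intro sets.countable_UN) (auto simp: L1_events_def)
  ultimately show "(\<Union>i. A i) \<in> L1_events H" by (simp add: L1_events_def)
qed

text \<open>Approximability extends from indicators to integrable functions by the standard
  induction, carried out on the sub-\<sigma>-algebra.\<close>

lemma L1_closure_measurable:
  assumes N: "space N = space M" "sets N \<subseteq> L1_events H" and f: "f \<in> borel_measurable N" "integrable M f"
  shows "f \<in> L1_closure H"
proof -
  have sub: "subalgebra M N" using N by (auto simp: subalgebra_def L1_events_def)
  have "integrable (restr_to_subalg M N) f" by (rule integrable_in_subalg[OF sub f])
  then show ?thesis
  proof (induction rule: integrable_induct)
    case (base A c)
    then have "indicator A \<in> L1_closure H" using N sets_restr_to_subalg[OF sub] by (auto simp: L1_events_def)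
    from L1_closure_scale[OF this, of c] show ?case by (simp add: mult.commute)
  next
    case (add f g)
    then show ?case by (intro L1_closure_add)
  next
    case (lim f s)
    have "integrable M f" by (rule integrable_from_subalg[OF sub lim(4)])
    then show ?case
      by (intro L1_closure_limit[of s f "\<lambda>x. 2 * \<bar>f x\<bar>"]) (use lim in \<open>auto simp: space_restr_to_subalg\<close>)
  qed
qed

lemma bounded_L1_approximation:
  assumes f: "f \<in> L1_closure H" and f1: "\<And>x. \<bar>f x\<bar> \<le> 1"
  shows "\<exists>h :: nat \<Rightarrow> 'a \<Rightarrow> real. (\<forall>m. h m \<in> H) \<and> (\<forall>m x. \<bar>h m x\<bar> \<le> 1) \<and>
    (\<lambda>m. \<integral>x. \<bar>f x - h m x\<bar> \<partial>M) \<longlonglongrightarrow> 0"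
proof -
  have "\<exists>h\<in>H. (\<forall>x. \<bar>h x\<bar> \<le> 1) \<and> (\<integral>x. \<bar>f x - h x\<bar> \<partial>M) < inverse (real (Suc m))" for m
  proof -
    have "0 < inverse (real (Suc m))" by simp
    then obtain h where h: "h \<in> H" "(\<integral>x. \<bar>f x - h x\<bar> \<partial>M) < inverse (real (Suc m))"
      using f unfolding L1_closure_def by blast
    \<comment> \<open>Truncation to \<open>[- 1, 1]\<close>, written with maxima and scalar
      multiples because \<open>H\<close> is closed under these. It brings \<open>h\<close> no
      further from \<open>f\<close>, whose values already lie in \<open>[- 1, 1]\<close>.\<close>
    let ?h = "\<lambda>x. max (- 1) (- 1 * max (- 1 * h x) (- 1))"
    have hH: "?h \<in> H" by (intro H_max H_scale H_const h(1))
    have "(\<integral>x. \<bar>f x - ?h x\<bar> \<partial>M) \<le> (\<integral>x. \<bar>f x - h x\<bar> \<partial>M)"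
    proof (rule integral_mono)
      show "integrable M (\<lambda>x. \<bar>f x - ?h x\<bar>)" "integrable M (\<lambda>x. \<bar>f x - h x\<bar>)"
        using L1_closure_integrable[OF f] H_integrable[OF hH] H_integrable[OF h(1)]
        by (auto simp del: mult_minus1 intro!: integrable_abs Bochner_Integration.integrable_diff)
      show "\<bar>f x - ?h x\<bar> \<le> \<bar>f x - h x\<bar>" for x using f1[of x] by (auto simp: max_def abs_if)
    qed
    then show ?thesis using h(2) hH by (intro bexI[of _ ?h]) (auto simp: max_def abs_if)
  qed
  then obtain h where h: "\<And>m. h m \<in> H" "\<And>m x. \<bar>h m x\<bar> \<le> 1"
    "\<And>m. (\<integral>x. \<bar>f x - h m x\<bar> \<partial>M) < inverse (real (Suc m))" by metis
  have "(\<lambda>m. \<integral>x. \<bar>f x - h m x\<bar> \<partial>M) \<longlonglongrightarrow> 0"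
    by (rule tendsto_sandwich[OF _ _ tendsto_const LIMSEQ_inverse_real_of_nat])
      (use h(3) in \<open>auto intro!: always_eventually less_imp_le simp del: of_nat_Suc\<close>)
  then show ?thesis using h(1,2) by blast
qed

end

end

section \<open>The limit measure\<close>

lemma raw_filtration_le:
  fixes N :: "('d::finite) path measure"
  assumes N: "space N = skorokhod_space I"
    and c: "\<And>s i. s \<in> I \<Longrightarrow> s \<le> t \<Longrightarrow> (\<lambda>\<omega>. \<omega> s $ i) \<in> borel_measurable N"
  shows "sets (raw_filtration I t) \<subseteq> sets N"
  unfolding sets_raw_filtration
proof (rule sets.sigma_sets_subset[of _ N, unfolded N], clarify)
  fix s and A :: "(real ^ 'd) set" assume s: "s \<in> I" "s \<le> t" and A: "A \<in> sets borel"
  have "(\<lambda>\<omega>. \<omega> s) \<in> borel_measurable N"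
  proof (rule borel_measurable_euclidean_space[THEN iffD2], rule ballI)
    fix b :: "real ^ 'd" assume "b \<in> Basis"
    then have "\<exists>k. b = axis k 1" unfolding Basis_vec_def Basis_real_def by blast
    then obtain k where "b = axis k 1" by (rule exE)
    moreover have "x \<bullet> axis k 1 = x $ k" for x :: "real ^ 'd" by (simp add: inner_axis)
    ultimately show "(\<lambda>\<omega>. \<omega> s \<bullet> b) \<in> borel_measurable N" using c[OF s, of k] by (simp only:)
  qed
  from measurable_sets[OF this A] have "(\<lambda>\<omega>. \<omega> s) -` A \<inter> skorokhod_space I \<in> sets N" by (simp add: N)
  also have "(\<lambda>\<omega>. \<omega> s) -` A \<inter> skorokhod_space I = {\<omega> \<in> skorokhod_space I. \<omega> s \<in> A}" by auto
  finally show "{\<omega> \<in> skorokhod_space I. \<omega> s \<in> A} \<in> sets N" .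
qed

lemma eventually_shift_less:
  assumes "0 \<le> t" "t < b"
  shows "\<forall>\<^sub>F m in sequentially. t + ereal (2 * inverse (real (Suc m))) < b"
proof -
  obtain r where r: "t = ereal r" using assms by (cases t) auto
  have "(\<lambda>m. r + 2 * inverse (real (Suc m))) \<longlonglongrightarrow> r + 2 * 0"
    by (intro tendsto_intros LIMSEQ_inverse_real_of_nat)
  then have "(\<lambda>m. ereal (r + 2 * inverse (real (Suc m)))) \<longlonglongrightarrow> ereal r" by simp
  from order_tendstoD(2)[OF this, of b] assms show ?thesis by (simp add: r del: of_nat_Suc)
qed

lemma eventually_admissible:
  assumes I: "time_domain I" and t: "t \<in> I"
  shows "\<forall>\<^sub>F m in sequentially. admissible I (inverse (real (Suc m))) t"
proof (cases "t = Sup I")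
  case True
  then show ?thesis using t time_domain_nonneg[OF I t] by (simp add: admissible_def del: of_nat_Suc)
next
  case False
  then have "t < Sup I" using time_domain_le_Sup[OF I t] by simp
  from eventually_shift_less[OF time_domain_nonneg[OF I t] this] show ?thesis
    by (rule eventually_mono) (use time_domain_nonneg[OF I t] in \<open>simp add: admissible_def del: of_nat_Suc\<close>)
qed

lemma continuous_clip: "continuous_on UNIV (clip c)"
  unfolding clip_def by (intro continuous_intros)

lemma clip_tendsto: "(\<lambda>m. clip (real m) x) \<longlonglongrightarrow> x"
proof (rule tendsto_eventually)
  obtain N where "\<bar>x\<bar> \<le> real N" using real_arch_simple by blast
  then show "\<forall>\<^sub>F m in sequentially. clip (real m) x = x"
    by (intro eventually_sequentiallyI[of N]) (auto simp: clip_def)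
qed

lemma abs_clip_le_abs: "0 \<le> c \<Longrightarrow> \<bar>clip c x\<bar> \<le> \<bar>x\<bar>"
  by (auto simp: clip_def)

locale quasimartingale_limit = prob_space Q for Q :: "('d::finite) path measure" +
  fixes I :: "ereal set" and C :: real and \<D> :: "'d path topology" and Qs :: "nat \<Rightarrow> 'd path measure"
  assumes time_domain: "time_domain I" and sets_Q: "sets Q = sets (path_algebra I)"
    and top: "topspace \<D> = skorokhod_space I"
    and stronger: "\<And>U. openin (MZ_topology I) U \<Longrightarrow> openin \<D> U"
    and Qs: "\<And>n. bounded_quasimartingale (Qs n) I C"
    and weak_limit: "\<And>f. bounded_continuous \<D> f \<Longrightarrow> (\<lambda>n. \<integral>\<omega>. f \<omega> \<partial>Qs n) \<longlonglongrightarrow> (\<integral>\<omega>. f \<omega> \<partial>Q)"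
begin

lemma space_Q: "space Q = skorokhod_space I"
  using sets_eq_imp_space_eq[OF sets_Q] by simp

lemma C_nonneg: "0 \<le> C"
  using bounded_quasimartingale.C_nonneg[OF Qs] .

lemma coordinate_measurable: "t \<in> I \<Longrightarrow> (\<lambda>\<omega>. \<omega> t $ i) \<in> borel_measurable Q"
  by (rule measurable_if_sets_eq[OF measurable_coordinate_path sets_Q])

lemma raw_measurable: "f \<in> measurable (raw_filtration I t) M \<Longrightarrow> f \<in> measurable Q M"
  by (erule measurable_sub_sigma_algebra) (simp add: space_Q, unfold sets_Q, rule raw_le_path_algebra)

lemma right_measurable: "f \<in> measurable (right_filtration I t) M \<Longrightarrow> f \<in> measurable Q M"
  by (erule measurable_sub_sigma_algebra) (simp add: space_Q, unfold sets_Q, rule right_le_path_algebra)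

lemma expectation_le_limit:
  assumes "bounded_continuous \<D> f" "\<And>n. (\<integral>\<omega>. f \<omega> \<partial>Qs n) \<le> a" shows "expectation f \<le> a"
  by (rule LIMSEQ_le_const2[OF weak_limit[OF assms(1)]]) (use assms(2) in auto)

lemma bounded_continuous_average:
  assumes \<phi>: "continuous_on UNIV \<phi>" "\<And>x. \<bar>\<phi> x\<bar> \<le> B" and adm: "admissible I \<delta> t"
  shows "bounded_continuous \<D> (average I i \<phi> \<delta> t)"
proof
  show "continuous_map \<D> euclideanreal (average I i \<phi> \<delta> t)"
    by (rule continuous_map_average[OF time_domain \<phi> top stronger adm])
  show "bounded (average I i \<phi> \<delta> t ` topspace \<D>)"
    by (rule boundedI[of _ B]) (use abs_average_le[OF time_domain \<phi>] in auto)
qed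

lemma measurable_average_Q:
  assumes "continuous_on UNIV \<phi>" "\<And>x. \<bar>\<phi> x\<bar> \<le> B" "0 < \<delta>" "t \<in> I"
  shows "average I i \<phi> \<delta> t \<in> borel_measurable Q"
  by (rule measurable_average[OF time_domain space_Q assms coordinate_measurable])

text \<open>Weights that survive both sides of the limit: continuity lets them pass through weak
  convergence, and measurability for the raw filtration, which involves no null sets, keeps them
  admissible under every \<open>Qs n\<close>.\<close>

definition test_space :: "ereal \<Rightarrow> ('d path \<Rightarrow> real) set" where
  "test_space u = {h. bounded_continuous \<D> h \<and> h \<in> borel_measurable (raw_filtration I u)}"

lemma
  shows test_space_integrable: "h \<in> test_space u \<Longrightarrow> integrable Q h"
    and test_space_const: "(\<lambda>_. a) \<in> test_space u"
    and test_space_add: "h \<in> test_space u \<Longrightarrow> k \<in> test_space u \<Longrightarrow> (\<lambda>x. h x + k x) \<in> test_space u"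
    and test_space_scale: "h \<in> test_space u \<Longrightarrow> (\<lambda>x. a * h x) \<in> test_space u"
    and test_space_max: "h \<in> test_space u \<Longrightarrow> k \<in> test_space u \<Longrightarrow> (\<lambda>x. max (h x) (k x)) \<in> test_space u"
proof -
  have bd: "\<exists>b. \<forall>x\<in>skorokhod_space I. \<bar>h x\<bar> \<le> b" if "h \<in> test_space u" for h
  proof -
    have "bounded_continuous \<D> h" using that unfolding test_space_def by blast
    then obtain b where "\<And>x. x \<in> topspace \<D> \<Longrightarrow> \<bar>h x\<bar> \<le> b" by (rule bounded_continuousE) blast
    then show ?thesis unfolding top by blast
  qed
  have bdI: "bounded (h ` topspace \<D>)" if "\<And>x. x \<in> skorokhod_space I \<Longrightarrow> \<bar>h x\<bar> \<le> b"
    for h :: "'d path \<Rightarrow> real" and b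
    by (rule boundedI[of _ b]) (use that top in auto)
  show "integrable Q h" if h: "h \<in> test_space u" for h
  proof -
    obtain b where "\<And>x. x \<in> skorokhod_space I \<Longrightarrow> \<bar>h x\<bar> \<le> b" using bd[OF h] by blast
    then show ?thesis using h raw_measurable
      by (intro integrable_const_bound[of _ b]) (auto simp: test_space_def space_Q)
  qed
  show "(\<lambda>_. a) \<in> test_space u" using bdI[of "\<lambda>_. a" "\<bar>a\<bar>"] by (simp add: test_space_def)
  show "(\<lambda>x. a * h x) \<in> test_space u" if h: "h \<in> test_space u" for h
  proof -
    obtain b where b: "\<And>x. x \<in> skorokhod_space I \<Longrightarrow> \<bar>h x\<bar> \<le> b" using bd[OF h] by blast
    have "\<bar>a * h x\<bar> \<le> \<bar>a\<bar> * b" if "x \<in> skorokhod_space I" for x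
      using b[OF that] by (simp add: abs_mult mult_left_mono)
    from bdI[OF this] h show ?thesis by (auto simp: test_space_def intro: continuous_map_real_mult_left)
  qed
  fix h k assume h: "h \<in> test_space u" and k: "k \<in> test_space u"
  obtain b where b: "\<And>x. x \<in> skorokhod_space I \<Longrightarrow> \<bar>h x\<bar> \<le> b" using bd[OF h] by blast
  obtain b' where b': "\<And>x. x \<in> skorokhod_space I \<Longrightarrow> \<bar>k x\<bar> \<le> b'" using bd[OF k] by blast
  have "\<bar>h x + k x\<bar> \<le> b + b'" if "x \<in> skorokhod_space I" for x
    using b[OF that] b'[OF that] by linarith
  from bdI[OF this] h k show "(\<lambda>x. h x + k x) \<in> test_space u"
    by (auto simp: test_space_def intro: continuous_map_add)
  have "\<bar>max (h x) (k x)\<bar> \<le> b + b'" if "x \<in> skorokhod_space I" for x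
    using b[OF that] b'[OF that] by linarith
  from bdI[OF this] h k show "(\<lambda>x. max (h x) (k x)) \<in> test_space u"
    by (auto simp: test_space_def intro: continuous_map_real_max)
qed

lemmas test_space_closed = test_space_integrable test_space_const test_space_add test_space_scale test_space_max

text \<open>Averages over windows inside \<open>(t, u)\<close> belong to the test space and converge
  boundedly to the transformed coordinate. The strict inequality \<open>t < u\<close> provides the
  room for the window.\<close>

lemma coordinate_L1_closure:
  assumes \<phi>: "continuous_on UNIV \<phi>" "\<And>x. \<bar>\<phi> x\<bar> \<le> B" and t: "t \<in> I" "t < u" "u \<le> Sup I"
  shows "(\<lambda>\<omega>. \<phi> (\<omega> t $ i)) \<in> L1_closure (test_space u)"
proof -
  from eventually_shift_less[OF time_domain_nonneg[OF time_domain t(1)] t(2)]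
  obtain m0 where m0: "\<And>m. m0 \<le> m \<Longrightarrow> t + ereal (2 * inverse (real (Suc m))) < u"
    unfolding eventually_sequentially by blast
  define \<delta> where "\<delta> m = inverse (real (Suc (m + m0)))" for m
  show ?thesis
  proof (rule L1_closure_limit[OF test_space_closed])
    fix m
    have lt: "t + ereal (2 * \<delta> m) < u" unfolding \<delta>_def by (rule m0) simp
    have "average I i \<phi> (\<delta> m) t \<in> borel_measurable (raw_filtration I u)"
    proof (rule measurable_average_raw[OF time_domain \<phi>])
      show "0 < \<delta> m" by (simp add: \<delta>_def)
      show "s \<le> u" if "s \<le> t + ereal (2 * \<delta> m)" for s using that lt by (meson le_less_trans less_imp_le)
    qed (rule t(1))
    moreover have "admissible I (\<delta> m) t"
      using lt t(3) time_domain_nonneg[OF time_domain t(1)]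
      by (auto simp: admissible_def \<delta>_def simp del: of_nat_Suc)
    ultimately show "average I i \<phi> (\<delta> m) t \<in> L1_closure (test_space u)"
      using bounded_continuous_average[OF \<phi>]
      by (intro L1_closure_base[OF test_space_closed]) (auto simp: test_space_def)
  next
    fix \<omega> assume "\<omega> \<in> space Q"
    then have "(\<lambda>m. average I i \<phi> (inverse (real (Suc m))) t \<omega>) \<longlonglongrightarrow> \<phi> (\<omega> t $ i)"
      unfolding space_Q by (rule average_tendsto[OF time_domain \<phi> _ t(1)])
    then show "(\<lambda>m. average I i \<phi> (\<delta> m) t \<omega>) \<longlonglongrightarrow> \<phi> (\<omega> t $ i)"
      unfolding \<delta>_def by (rule LIMSEQ_ignore_initial_segment)
  qed (use abs_average_le[OF time_domain \<phi>] in auto)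
qed

lemma indicator_greater_L1_closure:
  assumes t: "t \<in> I" "t < u" "u \<le> Sup I"
  shows "indicator {\<omega> \<in> space Q. y < \<omega> t $ i} \<in> L1_closure (test_space u)"
proof (rule L1_closure_limit[OF test_space_closed, where w = "\<lambda>_. 1"])
  show "(\<lambda>\<omega>. min 1 (real j * max 0 (\<omega> t $ i - y))) \<in> L1_closure (test_space u)" for j
    by (rule coordinate_L1_closure[OF _ _ t, of "\<lambda>x. min 1 (real j * max 0 (x - y))" 1])
      (auto intro!: continuous_intros)
  fix \<omega> assume \<omega>: "\<omega> \<in> space Q"
  show "(\<lambda>j. min 1 (real j * max 0 (\<omega> t $ i - y))) \<longlonglongrightarrow> indicator {\<omega> \<in> space Q. y < \<omega> t $ i} \<omega>"
  proof (cases "y < \<omega> t $ i")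
    case True
    then obtain N where N: "1 < real N * (\<omega> t $ i - y)" using reals_Archimedean3[of "\<omega> t $ i - y"] by auto
    have "1 \<le> real j * (\<omega> t $ i - y)" if "N \<le> j" for j
    proof -
      have "real N * (\<omega> t $ i - y) \<le> real j * (\<omega> t $ i - y)" using that True by (intro mult_right_mono) auto
      then show ?thesis using N by linarith
    qed
    then show ?thesis using True \<omega>
      by (intro tendsto_eventually eventually_sequentiallyI[of N]) (auto simp: min_def)
  qed (use \<omega> in simp)
qed (auto intro: order_trans[of _ 0])

text \<open>The right-continuous filtration at \<open>t\<close> sits inside the raw one at some time
  before \<open>u\<close>, and coordinates up to that time are approximable by test functions at
  \<open>u\<close>. Right-continuity thus costs an arbitrarily small delay, which the averages
  provide.\<close>

lemma right_filtration_L1_events: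
  assumes t: "0 \<le> t" "t < u" "u \<le> Sup I"
  shows "sets (right_filtration I t) \<subseteq> L1_events (test_space u)"
proof -
  define G where "G = sigma (space Q) (L1_events (test_space u))"
  have sa: "sigma_algebra (space Q) (L1_events (test_space u))"
    by (rule sigma_algebra_L1_events[OF test_space_closed])
  have "L1_events (test_space u) \<subseteq> Pow (space Q)"
    using sa unfolding sigma_algebra_iff2 by blast
  then have G: "sets G = L1_events (test_space u)" "space G = space Q"
    unfolding G_def using sigma_algebra.sigma_sets_eq[OF sa] by auto
  have c: "(\<lambda>\<omega>. \<omega> s $ i) \<in> borel_measurable G" if s: "s \<in> I" "s < u" for s i
  proof (rule borel_measurableI_greater)
    fix y
    have "{\<omega> \<in> space Q. y < \<omega> s $ i} \<in> events" using coordinate_measurable[OF s(1)] by measurable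
    then show "{\<omega> \<in> space G. y < \<omega> s $ i} \<in> sets G"
      unfolding G using indicator_greater_L1_closure[OF s t(3)] by (simp add: L1_events_def)
  qed
  from eventually_happens'[OF sequentially_bot eventually_shift_less[OF t(1,2)]]
  obtain m where m: "t + ereal (2 * inverse (real (Suc m))) < u" by (rule exE)
  let ?v = "t + ereal (2 * inverse (real (Suc m)))"
  have "sets (right_filtration I t) \<subseteq> sets (raw_filtration I ?v)"
    by (rule right_le_raw_filtration) simp
  also have "\<dots> \<subseteq> sets G"
  proof (rule raw_filtration_le)
    show "(\<lambda>\<omega>. \<omega> s $ i) \<in> borel_measurable G" if "s \<in> I" "s \<le> ?v" for s i
      using that(2) m by (intro c[OF that(1)]) (rule le_less_trans)
  qed (simp add: G space_Q)
  finally show ?thesis unfolding G .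
qed

text \<open>The truncated modulus \<open>min \<bar>x\<bar> c\<close> is averaged so that the bound C
  passes to the limit; then the window shrinks by dominated convergence and \<open>c\<close> grows
  by monotone convergence.\<close>

lemma limit_coordinate:
  assumes t: "t \<in> I"
  shows "integrable Q (\<lambda>\<omega>. \<omega> t $ i)" and "expectation (\<lambda>\<omega>. \<bar>\<omega> t $ i\<bar>) \<le> C"
proof -
  have trunc: "expectation (\<lambda>\<omega>. min \<bar>\<omega> t $ i\<bar> c) \<le> C" if c: "0 \<le> c" for c
  proof -
    have \<phi>: "continuous_on UNIV (\<lambda>x::real. min \<bar>x\<bar> c)" "\<And>x::real. \<bar>(min \<bar>x\<bar> c)\<bar> \<le> c"
      using c by (auto intro!: continuous_intros)
    have le: "expectation (average I i (\<lambda>x. min \<bar>x\<bar> c) \<delta> t) \<le> C" if "admissible I \<delta> t" for \<delta>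
      by (rule expectation_le_limit[OF bounded_continuous_average[OF \<phi> that]])
        (rule bounded_quasimartingale.average_L1[OF Qs _ t c], use that in \<open>simp add: admissible_def\<close>)
    have "(\<lambda>m. expectation (average I i (\<lambda>x. min \<bar>x\<bar> c) (inverse (real (Suc m))) t)) \<longlonglongrightarrow>
        expectation (\<lambda>\<omega>. min \<bar>\<omega> t $ i\<bar> c)"
    proof (rule integral_dominated_convergence[where w = "\<lambda>_. c"])
      show "AE \<omega> in Q. (\<lambda>m. average I i (\<lambda>x. min \<bar>x\<bar> c) (inverse (real (Suc m))) t \<omega>) \<longlonglongrightarrow> min \<bar>\<omega> t $ i\<bar> c"
        by (intro AE_I2 average_tendsto[OF time_domain \<phi> _ t]) (simp add: space_Q)
      show "AE \<omega> in Q. norm (average I i (\<lambda>x. min \<bar>x\<bar> c) (inverse (real (Suc m))) t \<omega>) \<le> c" for m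
        using abs_average_le[OF time_domain \<phi>] by (intro AE_I2) simp
      show "average I i (\<lambda>x. min \<bar>x\<bar> c) (inverse (real (Suc m))) t \<in> borel_measurable Q" for m
        by (rule measurable_average_Q[OF \<phi> _ t]) simp
    qed (use coordinate_measurable[OF t] in auto)
    then show ?thesis
      by (rule tendsto_upperbound)
        (use eventually_mono[OF eventually_admissible[OF time_domain t] le] in auto)
  qed
  let ?f = "\<lambda>n \<omega>. min \<bar>\<omega> t $ i\<bar> (real n)"
  have int: "integrable Q (?f n)" for n
    using coordinate_measurable[OF t] by (intro integrable_const_bound[of _ "real n"]) auto
  have inc: "incseq (\<lambda>n. expectation (?f n))"
    by (intro incseq_SucI integral_mono int) auto
  obtain L where L: "(\<lambda>n. expectation (?f n)) \<longlonglongrightarrow> L" "L \<le> C"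
  proof -
    obtain L where L: "(\<lambda>n. expectation (?f n)) \<longlonglongrightarrow> L"
      by (rule incseq_convergent[OF inc, of C]) (use trunc in auto)
    moreover have "L \<le> C" by (rule LIMSEQ_le_const2[OF L]) (use trunc in auto)
    ultimately show ?thesis by (rule that)
  qed
  have lim: "(\<lambda>n. ?f n \<omega>) \<longlonglongrightarrow> \<bar>\<omega> t $ i\<bar>" for \<omega> :: "'d path"
  proof (rule tendsto_eventually)
    obtain N where "\<bar>\<omega> t $ i\<bar> \<le> real N" using real_arch_simple by blast
    then show "\<forall>\<^sub>F n in sequentially. ?f n \<omega> = \<bar>\<omega> t $ i\<bar>"
      by (intro eventually_sequentiallyI[of N]) auto
  qed
  have m: "(\<lambda>\<omega>. \<bar>\<omega> t $ i\<bar>) \<in> borel_measurable Q" using coordinate_measurable[OF t] by simp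
  have mono: "AE \<omega> in Q. mono (\<lambda>n. ?f n \<omega>)" by (intro AE_I2 monoI) auto
  have "has_bochner_integral Q (\<lambda>\<omega>. \<bar>\<omega> t $ i\<bar>) L"
    by (rule has_bochner_integral_monotone_convergence[OF int mono _ L(1) m]) (use lim in auto)
  then show "integrable Q (\<lambda>\<omega>. \<omega> t $ i)" "expectation (\<lambda>\<omega>. \<bar>\<omega> t $ i\<bar>) \<le> C"
    using L(2) integrable_abs_cancel[OF _ coordinate_measurable[OF t]] by (auto simp: has_bochner_integral_iff)
qed

end

lemma abs_weighted_sum_le:
  fixes h a :: "nat \<Rightarrow> real"
  assumes "\<And>k. \<bar>h k\<bar> \<le> 1" "\<And>k. \<bar>a k\<bar> \<le> w k"
  shows "\<bar>\<Sum>k<n. h k * (a (Suc k) - a k)\<bar> \<le> (\<Sum>k<n. w (Suc k) + w k)"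
proof (rule order_trans[OF sum_abs sum_mono])
  fix k
  have "\<bar>a (Suc k) - a k\<bar> \<le> w (Suc k) + w k" using assms(2)[of k] assms(2)[of "Suc k"] by linarith
  then show "\<bar>h k * (a (Suc k) - a k)\<bar> \<le> w (Suc k) + w k"
    unfolding abs_mult using mult_mono[OF assms(1)[of k], of "\<bar>a (Suc k) - a k\<bar>"] by fastforce
qed

context quasimartingale_limit
begin

text \<open>With continuous weights and admissible averages the whole sum is a bounded continuous
  functional, so the bound for the approximating measures carries over.\<close>

lemma bound_test_weights:
  assumes s: "time_grid I n s" and adm: "\<And>k. k \<le> n \<Longrightarrow> admissible I \<delta> (s k)" and c: "0 \<le> c"
    and h: "\<And>k. k < n \<Longrightarrow> h k \<in> test_space (min (s k + ereal \<delta>) (Sup I))" and h1: "\<And>k \<omega>. \<bar>h k \<omega>\<bar> \<le> 1"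
  shows "expectation (\<lambda>\<omega>. \<Sum>k<n. h k \<omega> * (average I i (clip c) \<delta> (s (Suc k)) \<omega> - average I i (clip c) \<delta> (s k) \<omega>)) \<le> 14 * C"
proof (rule expectation_le_limit)
  note \<phi> = continuous_clip[of c] abs_clip_le[OF c]
  let ?A = "\<lambda>k. average I i (clip c) \<delta> (s k)"
  have A: "continuous_map \<D> euclideanreal (?A k)" if "k \<le> n" for k
    using bounded_continuous_average[OF \<phi> adm[OF that]] by blast
  have A1: "\<bar>?A k \<omega>\<bar> \<le> c" for k \<omega> by (rule abs_average_le[OF time_domain \<phi>])
  show "bounded_continuous \<D> (\<lambda>\<omega>. \<Sum>k<n. h k \<omega> * (?A (Suc k) \<omega> - ?A k \<omega>))"
  proof
    show "continuous_map \<D> euclideanreal (\<lambda>\<omega>. \<Sum>k<n. h k \<omega> * (?A (Suc k) \<omega> - ?A k \<omega>))"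
      using h A by (intro continuous_map_sum continuous_map_real_mult continuous_map_diff) (auto simp: test_space_def)
    show "bounded ((\<lambda>\<omega>. \<Sum>k<n. h k \<omega> * (?A (Suc k) \<omega> - ?A k \<omega>)) ` topspace \<D>)"
    proof (rule boundedI, clarify)
      fix \<omega>
      have "\<bar>\<Sum>k<n. h k \<omega> * (?A (Suc k) \<omega> - ?A k \<omega>)\<bar> \<le> (\<Sum>k<n. c + c)"
        by (rule abs_weighted_sum_le[OF h1 A1])
      then show "norm (\<Sum>k<n. h k \<omega> * (?A (Suc k) \<omega> - ?A k \<omega>)) \<le> (\<Sum>k<n. c + c)" by simp
    qed
  qed
  fix m
  show "(\<integral>\<omega>. (\<Sum>k<n. h k \<omega> * (?A (Suc k) \<omega> - ?A k \<omega>)) \<partial>Qs m) \<le> 14 * C"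
    by (rule bounded_quasimartingale.average_bound[OF Qs s _ c _ h1])
      (use adm[of 0] h in \<open>auto simp: admissible_def test_space_def\<close>)
qed

text \<open>Each weight is approximated in L1 by test weights available at
  \<open>s k + \<delta>\<close>. Increments of averages are at most \<open>2 * c\<close>, so the
  error is controlled by the L1 distances. At a grid time equal to the right end there is no room
  for a delay; there the weight is assumed to vanish.\<close>

lemma bound_average:
  assumes s: "time_grid I n s" and adm: "\<And>k. k \<le> n \<Longrightarrow> admissible I \<delta> (s k)" and c: "0 \<le> c"
    and h: "\<And>k. k < n \<Longrightarrow> h k \<in> borel_measurable (right_filtration I (s k))" and h1: "\<And>k \<omega>. \<bar>h k \<omega>\<bar> \<le> 1"
    and h0: "\<And>k. k < n \<Longrightarrow> s k = Sup I \<Longrightarrow> h k = (\<lambda>_. 0)"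
  shows "expectation (\<lambda>\<omega>. \<Sum>k<n. h k \<omega> * (average I i (clip c) \<delta> (s (Suc k)) \<omega> - average I i (clip c) \<delta> (s k) \<omega>)) \<le> 14 * C"
proof -
  note \<phi> = continuous_clip[of c] abs_clip_le[OF c]
  have \<delta>: "0 < \<delta>" using adm[of 0] by (simp add: admissible_def)
  have sI: "s k \<in> I" if "k \<le> n" for k using s that by (simp add: time_grid_def)
  let ?u = "\<lambda>k. min (s k + ereal \<delta>) (Sup I)"
  let ?D = "\<lambda>k \<omega>. average I i (clip c) \<delta> (s (Suc k)) \<omega> - average I i (clip c) \<delta> (s k) \<omega>"
  have D1: "\<bar>?D k \<omega>\<bar> \<le> 2 * c" for k \<omega>
    using abs_average_le[OF time_domain \<phi>, of i \<delta> "s (Suc k)" \<omega>] abs_average_le[OF time_domain \<phi>, of i \<delta> "s k" \<omega>] by linarith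
  have Dm: "?D k \<in> borel_measurable Q" if "k < n" for k
    using that by (intro borel_measurable_diff measurable_average_Q[OF \<phi> \<delta>] sI) auto
  have hm: "h k \<in> borel_measurable Q" if "k < n" for k by (rule right_measurable[OF h[OF that]])
  have hint: "integrable Q (h k)" if "k < n" for k
    using h1 by (intro integrable_const_bound[of _ 1] hm[OF that]) auto
  have "\<exists>g. (\<forall>m. g m \<in> test_space (?u k)) \<and> (\<forall>m \<omega>. \<bar>g m \<omega>\<bar> \<le> 1) \<and>
      (\<lambda>m. \<integral>\<omega>. \<bar>h k \<omega> - g m \<omega>\<bar> \<partial>Q) \<longlonglongrightarrow> 0" if k: "k < n" for k
  proof (cases "s k = Sup I")
    case True
    then show ?thesis using h0[OF k] test_space_const by (intro exI[of _ "\<lambda>_ _. 0"]) simp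
  next
    case False
    have s0: "0 \<le> s k" using k by (intro time_domain_nonneg[OF time_domain] sI) simp
    have "s k < Sup I" using False time_domain_le_Sup[OF time_domain sI[of k]] k by simp
    moreover from this have "s k < s k + ereal \<delta>" using s0 \<delta> by (cases "s k") auto
    ultimately have u: "s k < ?u k" by simp
    have "h k \<in> L1_closure (test_space (?u k))"
      by (rule L1_closure_measurable[OF test_space_closed _ right_filtration_L1_events[OF s0 u] h[OF k] hint[OF k]])
        (simp_all add: space_Q)
    note L = this
    show ?thesis
      by (rule bounded_L1_approximation[where H = "test_space (?u k)" and f = "h k"])
        (assumption | rule test_space_closed L h1)+
  qed
  then have "\<forall>k. \<exists>g. k < n \<longrightarrow> (\<forall>m. g m \<in> test_space (?u k)) \<and> (\<forall>m \<omega>. \<bar>g m \<omega>\<bar> \<le> 1) \<and>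
      (\<lambda>m. \<integral>\<omega>. \<bar>h k \<omega> - g m \<omega>\<bar> \<partial>Q) \<longlonglongrightarrow> 0" by blast
  from choice[OF this] obtain g where
    "\<forall>k. k < n \<longrightarrow> (\<forall>m. g k m \<in> test_space (?u k)) \<and> (\<forall>m \<omega>. \<bar>g k m \<omega>\<bar> \<le> 1) \<and>
      (\<lambda>m. \<integral>\<omega>. \<bar>h k \<omega> - g k m \<omega>\<bar> \<partial>Q) \<longlonglongrightarrow> 0" by (rule exE)
  then have g: "\<And>k m. k < n \<Longrightarrow> g k m \<in> test_space (?u k)" "\<And>k m \<omega>. k < n \<Longrightarrow> \<bar>g k m \<omega>\<bar> \<le> 1"
    "\<And>k. k < n \<Longrightarrow> (\<lambda>m. \<integral>\<omega>. \<bar>h k \<omega> - g k m \<omega>\<bar> \<partial>Q) \<longlonglongrightarrow> 0" by blast+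
  have gint: "integrable Q (g k m)" if "k < n" for k m by (rule test_space_integrable[OF g(1)[OF that]])
  have mult_int: "integrable Q (\<lambda>\<omega>. f \<omega> * ?D k \<omega>)" if "k < n" "integrable Q f" for k f
  proof (rule Bochner_Integration.integrable_bound[of Q "\<lambda>\<omega>. 2 * c * f \<omega>"])
    show "AE \<omega> in Q. norm (f \<omega> * ?D k \<omega>) \<le> norm (2 * c * f \<omega>)"
    proof (intro AE_I2)
      fix \<omega> show "norm (f \<omega> * ?D k \<omega>) \<le> norm (2 * c * f \<omega>)"
        using mult_right_mono[OF D1[of k \<omega>], of "\<bar>f \<omega>\<bar>"] c by (simp add: abs_mult mult.commute)
    qed
  qed (use that Dm in auto)
  have bd: "expectation (\<lambda>\<omega>. \<Sum>k<n. h k \<omega> * ?D k \<omega>) \<le> 14 * C + (\<Sum>k<n. 2 * c * (\<integral>\<omega>. \<bar>h k \<omega> - g k m \<omega>\<bar> \<partial>Q))" for m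
  proof -
    define g' where "g' k = (if k < n then g k m else (\<lambda>_. 0))" for k
    have "expectation (\<lambda>\<omega>. \<Sum>k<n. h k \<omega> * ?D k \<omega>) \<le>
        expectation (\<lambda>\<omega>. (\<Sum>k<n. g' k \<omega> * ?D k \<omega>) + (\<Sum>k<n. 2 * c * \<bar>h k \<omega> - g k m \<omega>\<bar>))"
    proof (rule integral_mono)
      show "integrable Q (\<lambda>\<omega>. \<Sum>k<n. h k \<omega> * ?D k \<omega>)" using mult_int hint by auto
      show "integrable Q (\<lambda>\<omega>. (\<Sum>k<n. g' k \<omega> * ?D k \<omega>) + (\<Sum>k<n. 2 * c * \<bar>h k \<omega> - g k m \<omega>\<bar>))"
        by (intro Bochner_Integration.integrable_add Bochner_Integration.integrable_sum mult_int
            integrable_mult_right integrable_abs Bochner_Integration.integrable_diff hint gint)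
          (auto simp: g'_def gint)
      fix \<omega>
      have "h k \<omega> * ?D k \<omega> \<le> g' k \<omega> * ?D k \<omega> + 2 * c * \<bar>h k \<omega> - g k m \<omega>\<bar>" if "k < n" for k
      proof -
        have "(h k \<omega> - g k m \<omega>) * ?D k \<omega> \<le> \<bar>h k \<omega> - g k m \<omega>\<bar> * \<bar>?D k \<omega>\<bar>"
          unfolding abs_mult[symmetric] by (rule abs_ge_self)
        also have "\<dots> \<le> \<bar>h k \<omega> - g k m \<omega>\<bar> * (2 * c)" by (intro mult_left_mono D1) simp
        finally show ?thesis using that by (simp add: g'_def algebra_simps)
      qed
      then show "(\<Sum>k<n. h k \<omega> * ?D k \<omega>) \<le> (\<Sum>k<n. g' k \<omega> * ?D k \<omega>) + (\<Sum>k<n. 2 * c * \<bar>h k \<omega> - g k m \<omega>\<bar>)"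
        unfolding sum.distrib[symmetric] by (intro sum_mono) simp
    qed
    also have "\<dots> = expectation (\<lambda>\<omega>. \<Sum>k<n. g' k \<omega> * ?D k \<omega>) + expectation (\<lambda>\<omega>. \<Sum>k<n. 2 * c * \<bar>h k \<omega> - g k m \<omega>\<bar>)"
      by (rule Bochner_Integration.integral_add; intro Bochner_Integration.integrable_sum mult_int
            integrable_mult_right integrable_abs Bochner_Integration.integrable_diff hint gint)
          (auto simp: g'_def gint)
    also have "expectation (\<lambda>\<omega>. \<Sum>k<n. 2 * c * \<bar>h k \<omega> - g k m \<omega>\<bar>) = (\<Sum>k<n. 2 * c * (\<integral>\<omega>. \<bar>h k \<omega> - g k m \<omega>\<bar> \<partial>Q))"
      using hint gint by (subst Bochner_Integration.integral_sum) auto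
    also have "expectation (\<lambda>\<omega>. \<Sum>k<n. g' k \<omega> * ?D k \<omega>) \<le> 14 * C"
      by (rule bound_test_weights[OF s adm c]) (use g in \<open>auto simp: g'_def\<close>)
    finally show ?thesis by simp
  qed
  have "(\<lambda>m. 14 * C + (\<Sum>k<n. 2 * c * (\<integral>\<omega>. \<bar>h k \<omega> - g k m \<omega>\<bar> \<partial>Q))) \<longlonglongrightarrow> 14 * C + (\<Sum>k<n. 2 * c * 0)"
    by (intro tendsto_add tendsto_const tendsto_sum tendsto_mult g(3)) simp
  from LIMSEQ_le_const[OF this] bd show ?thesis by simp
qed

text \<open>As the window shrinks, all of the finitely many grid times become admissible and the
  averages converge boundedly to the clipped coordinates.\<close>

lemma bound_clipped:
  assumes s: "time_grid I n s" and c: "0 \<le> c"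
    and h: "\<And>k. k < n \<Longrightarrow> h k \<in> borel_measurable (right_filtration I (s k))" and h1: "\<And>k \<omega>. \<bar>h k \<omega>\<bar> \<le> 1"
    and h0: "\<And>k. k < n \<Longrightarrow> s k = Sup I \<Longrightarrow> h k = (\<lambda>_. 0)"
  shows "expectation (\<lambda>\<omega>. \<Sum>k<n. h k \<omega> * (clip c (\<omega> (s (Suc k)) $ i) - clip c (\<omega> (s k) $ i))) \<le> 14 * C"
proof -
  note \<phi> = continuous_clip[of c] abs_clip_le[OF c]
  have sI: "s k \<in> I" if "k \<le> n" for k using s that by (simp add: time_grid_def)
  let ?\<delta> = "\<lambda>m. inverse (real (Suc m))"
  let ?A = "\<lambda>m k \<omega>. average I i (clip c) (?\<delta> m) (s k) \<omega>"
  have ev: "\<forall>\<^sub>F m in sequentially. \<forall>k\<in>{..n}. admissible I (?\<delta> m) (s k)"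
    by (intro eventually_ball_finite ballI eventually_admissible[OF time_domain] sI) auto
  have hm: "h k \<in> borel_measurable Q" if "k < n" for k by (rule right_measurable[OF h[OF that]])
  have "(\<lambda>m. expectation (\<lambda>\<omega>. \<Sum>k<n. h k \<omega> * (?A m (Suc k) \<omega> - ?A m k \<omega>))) \<longlonglongrightarrow>
      expectation (\<lambda>\<omega>. \<Sum>k<n. h k \<omega> * (clip c (\<omega> (s (Suc k)) $ i) - clip c (\<omega> (s k) $ i)))"
  proof (rule integral_dominated_convergence[where w = "\<lambda>_. \<Sum>k<n. c + c"])
    have "clip c \<circ> (\<lambda>\<omega>. \<omega> (s k) $ i) \<in> borel_measurable Q" if "k \<le> n" for k
      using coordinate_measurable[OF sI[OF that]] measurable_clip by (rule measurable_comp)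
    then show "(\<lambda>\<omega>. \<Sum>k<n. h k \<omega> * (clip c (\<omega> (s (Suc k)) $ i) - clip c (\<omega> (s k) $ i))) \<in> borel_measurable Q"
      by (intro borel_measurable_sum borel_measurable_times borel_measurable_diff hm) (auto simp: comp_def)
    show "(\<lambda>\<omega>. \<Sum>k<n. h k \<omega> * (?A m (Suc k) \<omega> - ?A m k \<omega>)) \<in> borel_measurable Q" for m
      by (intro borel_measurable_sum borel_measurable_times borel_measurable_diff hm measurable_average_Q[OF \<phi>] sI)
        auto
    show "AE \<omega> in Q. (\<lambda>m. \<Sum>k<n. h k \<omega> * (?A m (Suc k) \<omega> - ?A m k \<omega>)) \<longlonglongrightarrow>
        (\<Sum>k<n. h k \<omega> * (clip c (\<omega> (s (Suc k)) $ i) - clip c (\<omega> (s k) $ i)))"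
      by (intro AE_I2 tendsto_sum tendsto_mult tendsto_const tendsto_diff average_tendsto[OF time_domain \<phi>] sI)
        (auto simp: space_Q)
    show "AE \<omega> in Q. norm (\<Sum>k<n. h k \<omega> * (?A m (Suc k) \<omega> - ?A m k \<omega>)) \<le> (\<Sum>k<n. c + c)" for m
    proof (intro AE_I2)
      fix \<omega>
      have "\<bar>\<Sum>k<n. h k \<omega> * (?A m (Suc k) \<omega> - ?A m k \<omega>)\<bar> \<le> (\<Sum>k<n. c + c)"
        by (rule abs_weighted_sum_le[OF h1 abs_average_le[OF time_domain \<phi>]])
      then show "norm (\<Sum>k<n. h k \<omega> * (?A m (Suc k) \<omega> - ?A m k \<omega>)) \<le> (\<Sum>k<n. c + c)" by simp
    qed
  qed simp
  then show ?thesis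
  proof (rule tendsto_upperbound)
    show "\<forall>\<^sub>F m in sequentially. expectation (\<lambda>\<omega>. \<Sum>k<n. h k \<omega> * (?A m (Suc k) \<omega> - ?A m k \<omega>)) \<le> 14 * C"
      using ev by (rule eventually_mono) (rule bound_average[OF s _ c h h1 h0]; simp)
  qed simp
qed

text \<open>After the right end nothing moves, so a weight at such a grid time multiplies a zero
  increment and may be replaced by 0. The clipping level then tends to infinity, dominated by the
  absolute values of the coordinates.\<close>

lemma bound_increments:
  assumes s: "time_grid I n s"
    and h: "\<And>k. k < n \<Longrightarrow> h k \<in> borel_measurable (right_filtration I (s k))" and h1: "\<And>k \<omega>. \<bar>h k \<omega>\<bar> \<le> 1"
  shows "expectation (\<lambda>\<omega>. \<Sum>k<n. h k \<omega> * (\<omega> (s (Suc k)) $ i - \<omega> (s k) $ i)) \<le> 14 * C"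
proof -
  have sI: "s k \<in> I" if "k \<le> n" for k using s that by (simp add: time_grid_def)
  define g where "g k = (if s k = Sup I then (\<lambda>_. 0) else h k)" for k
  have g: "g k \<in> borel_measurable (right_filtration I (s k))" if "k < n" for k using h[OF that] by (simp add: g_def)
  have g1: "\<bar>g k \<omega>\<bar> \<le> 1" for k \<omega> using h1 by (simp add: g_def)
  have gm: "g k \<in> borel_measurable Q" if "k < n" for k by (rule right_measurable[OF g[OF that]])
  have last: "s (Suc k) = s k" if "k < n" "s k = Sup I" for k
    using s that time_domain_le_Sup[OF time_domain sI[of "Suc k"]] by (auto simp: time_grid_def intro: antisym)
  let ?X = "\<lambda>k (\<omega> :: 'd path). \<omega> (s k) $ i"
  have X: "integrable Q (?X k)" if "k \<le> n" for k by (rule limit_coordinate(1)[OF sI[OF that]])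
  have "(\<lambda>m. expectation (\<lambda>\<omega>. \<Sum>k<n. g k \<omega> * (clip (real m) (?X (Suc k) \<omega>) - clip (real m) (?X k \<omega>)))) \<longlonglongrightarrow>
      expectation (\<lambda>\<omega>. \<Sum>k<n. g k \<omega> * (?X (Suc k) \<omega> - ?X k \<omega>))"
  proof (rule integral_dominated_convergence[where w = "\<lambda>\<omega>. \<Sum>k<n. \<bar>?X (Suc k) \<omega>\<bar> + \<bar>?X k \<omega>\<bar>"])
    have Xm: "?X k \<in> borel_measurable Q" if "k \<le> n" for k using X[OF that] by simp
    show "(\<lambda>\<omega>. \<Sum>k<n. g k \<omega> * (?X (Suc k) \<omega> - ?X k \<omega>)) \<in> borel_measurable Q"
      by (intro borel_measurable_sum borel_measurable_times borel_measurable_diff gm Xm) auto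
    have "(\<lambda>\<omega>. clip (real m) (?X k \<omega>)) \<in> borel_measurable Q" if "k \<le> n" for k m
      by (rule measurable_compose[OF Xm[OF that] measurable_clip])
    then show "(\<lambda>\<omega>. \<Sum>k<n. g k \<omega> * (clip (real m) (?X (Suc k) \<omega>) - clip (real m) (?X k \<omega>))) \<in> borel_measurable Q" for m
      by (intro borel_measurable_sum borel_measurable_times borel_measurable_diff gm) auto
    show "integrable Q (\<lambda>\<omega>. \<Sum>k<n. \<bar>?X (Suc k) \<omega>\<bar> + \<bar>?X k \<omega>\<bar>)"
      by (intro Bochner_Integration.integrable_sum Bochner_Integration.integrable_add integrable_abs X) auto
    show "AE \<omega> in Q. (\<lambda>m. \<Sum>k<n. g k \<omega> * (clip (real m) (?X (Suc k) \<omega>) - clip (real m) (?X k \<omega>))) \<longlonglongrightarrow>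
        (\<Sum>k<n. g k \<omega> * (?X (Suc k) \<omega> - ?X k \<omega>))"
      by (intro AE_I2 tendsto_sum tendsto_mult tendsto_const tendsto_diff clip_tendsto)
    show "AE \<omega> in Q. norm (\<Sum>k<n. g k \<omega> * (clip (real m) (?X (Suc k) \<omega>) - clip (real m) (?X k \<omega>))) \<le>
        (\<Sum>k<n. \<bar>?X (Suc k) \<omega>\<bar> + \<bar>?X k \<omega>\<bar>)" for m
    proof (intro AE_I2)
      fix \<omega> :: "'d path"
      have "\<bar>\<Sum>k<n. g k \<omega> * (clip (real m) (?X (Suc k) \<omega>) - clip (real m) (?X k \<omega>))\<bar> \<le>
          (\<Sum>k<n. \<bar>?X (Suc k) \<omega>\<bar> + \<bar>?X k \<omega>\<bar>)"
        by (rule abs_weighted_sum_le[OF g1 abs_clip_le_abs]) simp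
      then show "norm (\<Sum>k<n. g k \<omega> * (clip (real m) (?X (Suc k) \<omega>) - clip (real m) (?X k \<omega>))) \<le>
          (\<Sum>k<n. \<bar>?X (Suc k) \<omega>\<bar> + \<bar>?X k \<omega>\<bar>)" by simp
    qed
  qed
  then have "expectation (\<lambda>\<omega>. \<Sum>k<n. g k \<omega> * (?X (Suc k) \<omega> - ?X k \<omega>)) \<le> 14 * C"
    by (rule LIMSEQ_le_const2) (intro exI allI impI bound_clipped[OF s _ g g1], auto simp: g_def)
  also have "(\<lambda>\<omega>. \<Sum>k<n. g k \<omega> * (?X (Suc k) \<omega> - ?X k \<omega>)) = (\<lambda>\<omega>. \<Sum>k<n. h k \<omega> * (?X (Suc k) \<omega> - ?X k \<omega>))"
    using last by (intro ext sum.cong) (auto simp: g_def)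
  finally show ?thesis .
qed

text \<open>Weights are bounded by 1 only almost surely, and clipping makes the bound hold
  everywhere. Stopping at \<open>t\<close> turns the grid times into
  \<open>min (\<tau> i k) t\<close>; a weight from a time after \<open>t\<close> need not be
  measurable at the stopped time, but from \<open>t\<close> on the increments are zero and the
  weights are set to 0. Each coordinate costs C for the initial term and 14 C for the
  increments.\<close>

lemma elementary_integral_bound:
  assumes H: "H \<in> elementary_integrands I Q" and t: "t \<in> I"
  shows "expectation (elementary_integral H t) \<le> 15 * C * real CARD('d)"
proof -
  obtain n \<tau> J where HJ: "H = (n, \<tau>, J)" by (cases H)
  have \<tau>: "\<tau> i 0 = 0" "\<And>k. k < n \<Longrightarrow> \<tau> i k \<le> \<tau> i (Suc k)" "\<And>k. k \<le> n \<Longrightarrow> \<tau> i k \<in> I"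
    and J: "\<And>k. k \<le> n \<Longrightarrow> J i (\<tau> i k) \<in> borel_measurable (right_filtration I (\<tau> i k))"
      "\<And>k. k \<le> n \<Longrightarrow> AE \<omega> in Q. \<bar>J i (\<tau> i k) \<omega>\<bar> \<le> 1" for i
    using H unfolding HJ elementary_integrands_def by auto
  define s where "s i k = min (\<tau> i k) t" for i k
  define h where "h i k = (if \<tau> i k < t then (\<lambda>\<omega>. clip 1 (J i (\<tau> i k) \<omega>)) else (\<lambda>_. 0))" for i k
  have grid: "time_grid I n (s i)" for i
    unfolding time_grid_def s_def
  proof (intro conjI allI impI)
    show "min (\<tau> i k) t \<le> min (\<tau> i (Suc k)) t" if "k < n" for k by (intro min.mono \<tau>(2) that order_refl)
  qed (use \<tau> t in \<open>auto simp: min_def\<close>)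
  have h: "h i k \<in> borel_measurable (right_filtration I (s i k))" if "k < n" for i k
  proof (cases "\<tau> i k < t")
    case True
    then have "s i k = \<tau> i k" by (simp add: s_def)
    then show ?thesis using measurable_compose[OF J(1)[of k i] measurable_clip[of 1]] that True by (simp add: h_def)
  qed (simp add: h_def)
  have h1: "\<bar>h i k \<omega>\<bar> \<le> 1" for i k \<omega> using abs_clip_le[of 1] by (simp add: h_def)
  have zero: "0 \<in> I" by (rule time_domain_zero[OF time_domain])
  let ?f = "\<lambda>i \<omega>. clip 1 (J i 0 \<omega>) * \<omega> 0 $ i"
  let ?S = "\<lambda>i \<omega>. \<Sum>k<n. h i k \<omega> * (\<omega> (s i (Suc k)) $ i - \<omega> (s i k) $ i)"
  have J0: "(\<lambda>\<omega>. clip 1 (J i 0 \<omega>)) \<in> borel_measurable Q" for i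
    using right_measurable[OF measurable_compose[OF J(1)[of 0 i] measurable_clip[of 1]]] \<tau>(1)[of i] by simp
  have bounded_mult: "integrable Q (\<lambda>\<omega>. f \<omega> * X \<omega>)"
    if "f \<in> borel_measurable Q" "\<And>\<omega>. \<bar>f \<omega>\<bar> \<le> 1" "integrable Q X" for f X :: "'d path \<Rightarrow> real"
  proof (rule Bochner_Integration.integrable_bound[OF that(3)])
    show "AE \<omega> in Q. norm (f \<omega> * X \<omega>) \<le> norm (X \<omega>)"
      using mult_right_mono[OF that(2) abs_ge_zero] by (intro AE_I2) (simp add: abs_mult)
  qed (use that in auto)
  have f_int: "integrable Q (?f i)" for i
    by (rule bounded_mult[OF J0 abs_clip_le limit_coordinate(1)[OF zero]]) simp
  have s_in: "s i k \<in> I" if "k \<le> n" for i k using grid[of i] that by (simp add: time_grid_def)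
  have S_int: "integrable Q (?S i)" for i
    by (intro Bochner_Integration.integrable_sum bounded_mult right_measurable[OF h] h1
        Bochner_Integration.integrable_diff limit_coordinate(1) s_in) auto
  have EI: "elementary_integral H t \<omega> = (\<Sum>i\<in>UNIV. J i 0 \<omega> * \<omega> 0 $ i +
      (\<Sum>k<n. J i (\<tau> i k) \<omega> * (\<omega> (s i (Suc k)) $ i - \<omega> (s i k) $ i)))" for \<omega>
    unfolding HJ by (simp add: sum.atLeast1_atMost_eq s_def)
  have Jm: "J i (\<tau> i k) \<in> borel_measurable Q" if "k \<le> n" for i k by (rule right_measurable[OF J(1)[OF that]])
  have J0m: "J i 0 \<in> borel_measurable Q" for i using Jm[of 0 i] \<tau>(1)[of i] by simp
  have EI_m: "elementary_integral H t \<in> borel_measurable Q"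
    unfolding EI[abs_def]
    by (intro borel_measurable_sum borel_measurable_add borel_measurable_times borel_measurable_diff
        Jm J0m coordinate_measurable zero s_in) auto
  have "AE \<omega> in Q. elementary_integral H t \<omega> = (\<Sum>i\<in>UNIV. ?f i \<omega> + ?S i \<omega>)"
  proof -
    have "AE \<omega> in Q. \<forall>i\<in>UNIV. \<forall>k\<in>{..n}. \<bar>J i (\<tau> i k) \<omega>\<bar> \<le> 1"
      using J(2) by (intro AE_finite_allI) auto
    then show ?thesis
    proof (rule AE_mp, intro AE_I2 impI)
      fix \<omega> :: "'d path" assume *: "\<forall>i\<in>UNIV. \<forall>k\<in>{..n}. \<bar>J i (\<tau> i k) \<omega>\<bar> \<le> 1"
      have cJ: "clip 1 (J i (\<tau> i k) \<omega>) = J i (\<tau> i k) \<omega>" if "k \<le> n" for i k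
      proof -
        have "\<bar>J i (\<tau> i k) \<omega>\<bar> \<le> 1" using * that by blast
        then show ?thesis by (auto simp: clip_def)
      qed
      have "J i (\<tau> i k) \<omega> * (\<omega> (s i (Suc k)) $ i - \<omega> (s i k) $ i) =
          h i k \<omega> * (\<omega> (s i (Suc k)) $ i - \<omega> (s i k) $ i)" if "k < n" for i k
      proof (cases "\<tau> i k < t")
        case False
        then have "s i (Suc k) = s i k" using \<tau>(2)[OF that, of i] by (auto simp: s_def min_def)
        then show ?thesis by simp
      qed (use cJ[of k i] that in \<open>simp add: h_def\<close>)
      note increments = this
      have "J i 0 \<omega> * \<omega> 0 $ i = ?f i \<omega>" for i using cJ[of 0 i] \<tau>(1)[of i] by simp
      then show "elementary_integral H t \<omega> = (\<Sum>i\<in>UNIV. ?f i \<omega> + ?S i \<omega>)"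
        unfolding EI by (intro sum.cong arg_cong2[where f = "(+)"] increments) auto
    qed
  qed
  then have "expectation (elementary_integral H t) = expectation (\<lambda>\<omega>. \<Sum>i\<in>UNIV. ?f i \<omega> + ?S i \<omega>)"
    by (intro integral_cong_AE EI_m) (use f_int S_int in auto)
  also have "\<dots> = (\<Sum>i\<in>UNIV. expectation (?f i) + expectation (?S i))"
    using f_int S_int by (subst Bochner_Integration.integral_sum) auto
  also have "\<dots> \<le> (\<Sum>i\<in>(UNIV :: 'd set). C + 14 * C)"
  proof (intro sum_mono add_mono)
    fix i
    have "expectation (?f i) \<le> expectation (\<lambda>\<omega>. \<bar>\<omega> 0 $ i\<bar>)"
    proof (rule integral_mono[OF f_int])
      show "integrable Q (\<lambda>\<omega>. \<bar>\<omega> 0 $ i\<bar>)" using limit_coordinate(1)[OF zero] by simp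
      show "?f i \<omega> \<le> \<bar>\<omega> 0 $ i\<bar>" for \<omega> :: "'d path"
        using mult_right_mono[OF abs_clip_le[of 1 "J i 0 \<omega>"] abs_ge_zero[of "\<omega> 0 $ i"]]
          abs_ge_self[of "?f i \<omega>"] by (simp add: abs_mult)
    qed
    then show "expectation (?f i) \<le> C" using limit_coordinate(2)[OF zero, of i] by simp
    show "expectation (?S i) \<le> 14 * C" by (rule bound_increments[OF grid h h1])
  qed
  finally show ?thesis by (simp add: mult.commute)
qed

lemma quasimartingale: "quasimartingale_measure I Q"
proof -
  have "UB_constant I Q (15 * C * real CARD('d))"
    unfolding UB_constant_def
  proof (intro conjI ballI)
    show "0 \<le> 15 * C * real CARD('d)" using C_nonneg by simp
    fix t assume t: "t \<in> I"
    show "(\<integral>\<^sup>+\<omega>. ennreal (l1norm (\<omega> t)) \<partial>Q) \<le> ennreal (15 * C * real CARD('d))"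
    proof -
      have int: "integrable Q (\<lambda>\<omega>. l1norm (\<omega> t))"
        unfolding l1norm_def using limit_coordinate(1)[OF t] by auto
      have "(\<integral>\<omega>. l1norm (\<omega> t) \<partial>Q) = (\<Sum>i\<in>UNIV. \<integral>\<omega>. \<bar>\<omega> t $ i\<bar> \<partial>Q)"
        unfolding l1norm_def using limit_coordinate(1)[OF t] by (subst Bochner_Integration.integral_sum) auto
      also have "\<dots> \<le> (\<Sum>i\<in>(UNIV :: 'd set). C)" by (intro sum_mono limit_coordinate(2)[OF t])
      also have "\<dots> \<le> 15 * C * real CARD('d)" using C_nonneg by (simp add: mult.commute mult_right_mono)
      finally show ?thesis
        using int by (subst nn_integral_eq_integral) (auto simp: l1norm_def sum_nonneg intro!: ennreal_leI)
    qed
  qed (rule elementary_integral_bound)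
  then show ?thesis unfolding quasimartingale_measure_def
    using prob_space_axioms sets_Q UB_constant_imp_UB by blast
qed

end

section \<open>Borel sets of the path space\<close>

text \<open>Strictly increasing and continuous with values in \<open>[1 / 4, 3 / 4]\<close>:
  averages of squashed coordinates lie in \<open>[0, 1)\<close>, as the coding requires, and in the
  limit of short windows still determine the coordinates.\<close>

definition squash :: "real \<Rightarrow> real" where
  "squash x = 1 / 2 + arctan x / (2 * pi)"

lemma squash_bounds: "1 / 4 \<le> squash x" "squash x \<le> 3 / 4"
proof -
  have "- (1 / 4) = - (pi / 2) / (2 * pi)" "1 / 4 = (pi / 2) / (2 * pi)" by simp_all
  moreover have "- (pi / 2) / (2 * pi) \<le> arctan x / (2 * pi)"
    using arctan_lbound[of x] by (intro divide_right_mono) auto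
  moreover have "arctan x / (2 * pi) \<le> (pi / 2) / (2 * pi)"
    using arctan_ubound[of x] by (intro divide_right_mono) auto
  ultimately show "1 / 4 \<le> squash x" "squash x \<le> 3 / 4" unfolding squash_def by linarith+
qed

lemma abs_squash_le: "\<bar>squash x\<bar> \<le> 3 / 4"
  using squash_bounds[of x] by simp

lemma continuous_squash: "continuous_on UNIV squash"
  unfolding squash_def by (intro continuous_intros) simp_all

lemma squash_less_iff: "squash x < squash y \<longleftrightarrow> x < y"
  by (simp add: squash_def divide_strict_right_mono divide_less_cancel arctan_less_iff)

lemma squash_eq_iff: "squash x = squash y \<longleftrightarrow> x = y"
  using squash_less_iff[of x y] squash_less_iff[of y x] by (cases x y rule: linorder_cases) auto

text \<open>Averages at dense times with windows shrinking in \<open>m\<close>. Inadmissible pairs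
  of a time and a window receive the continuous constant 0; for every dense time there are only
  finitely many such \<open>m\<close>, so the limit in \<open>m\<close> recovers the squashed
  coordinate.\<close>

definition path_coordinate :: "ereal set \<Rightarrow> nat \<Rightarrow> ('d::finite) path \<Rightarrow> real" where
  "path_coordinate I n \<omega> = (case from_nat n of (i :: 'd, k :: nat, m :: nat) \<Rightarrow>
     if admissible I (inverse (real (Suc m))) (dense_times I k)
     then average I i squash (inverse (real (Suc m))) (dense_times I k) \<omega> else 0)"

lemma path_coordinate_range:
  assumes "time_domain I" shows "0 \<le> path_coordinate I n \<omega>" "path_coordinate I n \<omega> < 1"
proof -
  have "0 \<le> squash x" for x using squash_bounds[of x] by simp
  then have 0: "0 \<le> average I i squash \<delta> t \<omega>" for i \<delta> t
    unfolding average_def by (intro integral_nonneg_AE AE_I2 mult_nonneg_nonneg bump_nonneg)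
  have 1: "average I i squash \<delta> t \<omega> < 1" for i \<delta> t
    using abs_average_le[OF assms continuous_squash abs_squash_le, of i \<delta> t \<omega>] by simp
  show "0 \<le> path_coordinate I n \<omega>" "path_coordinate I n \<omega> < 1"
    using 0 1 by (auto simp: path_coordinate_def split: prod.split)
qed

lemma continuous_map_path_coordinate:
  fixes \<D> :: "('d::finite) path topology"
  assumes I: "time_domain I" and top: "topspace \<D> = skorokhod_space I"
    and stronger: "\<And>U. openin (MZ_topology I) U \<Longrightarrow> openin \<D> U"
  shows "continuous_map \<D> euclideanreal (path_coordinate I n)"
proof -
  obtain i :: 'd and k m :: nat where ikm: "from_nat n = (i, k, m)" by (cases "from_nat n :: 'd \<times> nat \<times> nat") 
  show ?thesis
  proof (cases "admissible I (inverse (real (Suc m))) (dense_times I k)")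
    case True
    then show ?thesis
      using continuous_map_average[OF I continuous_squash abs_squash_le top stronger True, of i]
      by (simp add: path_coordinate_def[abs_def] ikm)
  next
    case False
    then have "path_coordinate I n = (\<lambda>_ :: 'd path. 0)" by (intro ext) (simp add: path_coordinate_def ikm)
    then show ?thesis by simp
  qed
qed

lemma path_coordinate_tendsto:
  assumes I: "time_domain I" and \<omega>: "\<omega> \<in> skorokhod_space I"
  shows "(\<lambda>m. path_coordinate I (to_nat (i, k, m)) \<omega>) \<longlonglongrightarrow> squash (\<omega> (dense_times I k) $ i)"
proof (rule Lim_transform_eventually)
  show "(\<lambda>m. average I i squash (inverse (real (Suc m))) (dense_times I k) \<omega>) \<longlonglongrightarrow> squash (\<omega> (dense_times I k) $ i)"
    by (rule average_tendsto[OF I continuous_squash abs_squash_le \<omega> dense_times_in[OF I]])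
  show "\<forall>\<^sub>F m in sequentially. average I i squash (inverse (real (Suc m))) (dense_times I k) \<omega> =
      path_coordinate I (to_nat (i, k, m)) \<omega>"
    using eventually_admissible[OF I dense_times_in[OF I, of k]]
    by (rule eventually_mono) (simp add: path_coordinate_def)
qed

lemma path_coordinate_separates:
  fixes \<omega> \<omega>' :: "('d::finite) path"
  assumes I: "time_domain I" and \<omega>: "\<omega> \<in> skorokhod_space I" "\<omega>' \<in> skorokhod_space I"
    and eq: "\<And>n. path_coordinate I n \<omega> = path_coordinate I n \<omega>'"
  shows "\<omega> = \<omega>'"
proof (rule extensionalityI[of _ I])
  show "\<omega> \<in> extensional I" "\<omega>' \<in> extensional I" using \<omega> by (auto simp: skorokhod_space_def)
  have dense: "\<omega> (dense_times I k) $ i = \<omega>' (dense_times I k) $ i" for i k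
    using LIMSEQ_unique[OF path_coordinate_tendsto[OF I \<omega>(1), of i k, unfolded eq]
        path_coordinate_tendsto[OF I \<omega>(2), of i k]] by (simp only: squash_eq_iff)
  fix t assume t: "t \<in> I"
  obtain k :: "nat \<Rightarrow> nat" where k: "\<And>\<omega> :: 'd path. \<And>i. \<omega> \<in> skorokhod_space I \<Longrightarrow> (\<lambda>n. \<omega> (dense_times I (k n)) $ i) \<longlonglongrightarrow> \<omega> t $ i"
    by (rule dense_times_limit[OF I t]) blast
  have "\<omega> t $ i = \<omega>' t $ i" for i
    by (rule LIMSEQ_unique[OF k[OF \<omega>(1), of i, unfolded dense] k[OF \<omega>(2), of i]])
  then show "\<omega> t = \<omega>' t" by (simp add: vec_eq_iff)
qed

text \<open>Limits of the path coordinates recover the squashed values first at dense times, then at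
  all times by right-continuity; strict monotonicity of \<open>squash\<close> removes the
  squashing.\<close>

lemma path_algebra_le_coordinates:
  assumes I: "time_domain I"
  shows "sets (path_algebra I :: ('d::finite) path measure) \<subseteq>
    sets (vimage_algebra (skorokhod_space I) (\<lambda>\<omega> n. path_coordinate I n \<omega>) (PiM UNIV (\<lambda>_. borel)))"
proof -
  define V :: "'d path measure" where
    "V = vimage_algebra (skorokhod_space I) (\<lambda>\<omega> n. path_coordinate I n \<omega>) (PiM UNIV (\<lambda>_. borel))"
  have V: "space V = skorokhod_space I" by (simp add: V_def)
  have "(\<lambda>\<omega> n. path_coordinate I n \<omega>) \<in> measurable V (PiM UNIV (\<lambda>_. borel))"
    unfolding V_def by (rule measurable_vimage_algebra1) (simp add: space_PiM)
  from measurable_compose[OF this measurable_component_singleton]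
  have g: "path_coordinate I n \<in> borel_measurable V" for n by simp
  have d: "(\<lambda>\<omega>. squash (\<omega> (dense_times I k) $ i)) \<in> borel_measurable V" for k i
    by (rule borel_measurable_LIMSEQ_real[OF path_coordinate_tendsto[OF I] g]) (simp add: V)
  have c: "(\<lambda>\<omega>. \<omega> t $ i) \<in> borel_measurable V" if t: "t \<in> I" for t i
  proof -
    obtain k :: "nat \<Rightarrow> nat" where k: "\<And>\<omega> :: 'd path. \<And>i. \<omega> \<in> skorokhod_space I \<Longrightarrow> (\<lambda>n. \<omega> (dense_times I (k n)) $ i) \<longlonglongrightarrow> \<omega> t $ i"
      by (rule dense_times_limit[OF I t]) blast
    have "isCont squash x" for x using continuous_squash by (simp add: continuous_on_eq_continuous_at)
    then have lim: "(\<lambda>n. squash (\<omega> (dense_times I (k n)) $ i)) \<longlonglongrightarrow> squash (\<omega> t $ i)" if "\<omega> \<in> space V" for \<omega>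
      using k[of \<omega> i] that unfolding V by (intro isCont_tendsto_compose[where g = squash])
    have m: "(\<lambda>\<omega>. squash (\<omega> t $ i)) \<in> borel_measurable V"
      by (rule borel_measurable_LIMSEQ_real[where u = "\<lambda>n \<omega>. squash (\<omega> (dense_times I (k n)) $ i)"])
        (rule lim, assumption, rule d)
    show ?thesis
    proof (rule borel_measurableI_greater)
      fix y
      have "{\<omega> \<in> space V. squash y < squash (\<omega> t $ i)} \<in> sets V" using m by measurable
      then show "{\<omega> \<in> space V. y < \<omega> t $ i} \<in> sets V" unfolding squash_less_iff .
    qed
  qed
  have "sigma_sets (skorokhod_space I) (\<Union>t\<in>I. sets (raw_filtration I t)) \<subseteq> sets V"
  proof (rule sets.sigma_sets_subset[of _ V, unfolded V], rule UN_least)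
    show "sets (raw_filtration I t) \<subseteq> sets V" for t by (rule raw_filtration_le[OF V c])
  qed
  then show ?thesis unfolding V_def[symmetric] sets_path_algebra .
qed

text \<open>
  A probability measure on the path \<open>\<sigma>\<close>-algebra, extended by \<open>0\<close>, cannot be additive on a set outside
  that \<open>\<sigma>\<close>-algebra and its complement. So if there are more Borel sets, no limit exists at all.
\<close>

lemma sequential_closure_empty:
  assumes A: "A \<in> sets (borel_algebra X)" and Q: "\<And>Q. Q \<in> \<Q> \<Longrightarrow> prob_space Q \<and> space Q = topspace X \<and> A \<notin> sets Q"
  shows "sequential_closure (weak_star X) (measure ` \<Q>) = {}"
proof (rule ccontr)
  assume "sequential_closure (weak_star X) (measure ` \<Q>) \<noteq> {}"
  then obtain x s where s: "\<And>n. s n \<in> measure ` \<Q>" and lim: "limitin (weak_star X) s x sequentially"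
    unfolding sequential_closure_def by blast
  have "\<forall>\<^sub>F n in sequentially. s n \<in> topspace (weak_star X)"
    using lim unfolding limitin_def by blast
  then have "\<exists>n. s n \<in> topspace (weak_star X)" by (rule eventually_happens'[OF sequentially_bot])
  then obtain Q where "Q \<in> \<Q>" and mQ: "measure Q \<in> signed_measures (borel_algebra X)"
    using s unfolding topspace_weak_star by (metis imageE)
  then have P: "prob_space Q" "space Q = topspace X" "A \<notin> sets Q" using Q by auto
  interpret prob_space Q by (rule P(1))
  have sub: "A \<subseteq> topspace X" using sets.sets_into_space[OF A] by simp
  have "topspace X \<in> sets (borel_algebra X)" using sets.top[of "borel_algebra X"] by simp
  from signed_measures_Diff[OF mQ this A sub]
  have "measure Q (topspace X - A) = measure Q (topspace X) - measure Q A" .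
  moreover have "topspace X - A \<notin> sets Q"
  proof
    assume "topspace X - A \<in> sets Q"
    from sets.compl_sets[OF this] have "A \<in> sets Q" using sub P(2) by (simp add: double_diff)
    then show False using P(3) by simp
  qed
  moreover have "measure Q (topspace X) = 1" using prob_space P(2) by simp
  ultimately show False using P(3) by (simp add: measure_notin_sets)
qed

theorem corollary3p3:
  fixes I :: "ereal set"
    and \<D> :: "('d::finite) path topology"
    and \<Q> :: "'d path measure set"
  assumes "time_domain I"
    and "topspace \<D> = skorokhod_space I"
    and "Hausdorff_space \<D>" and "regular_space \<D>"
    and weaker: "\<And>U. openin \<D> U \<Longrightarrow> openin (S_topology I) U"
    and stronger: "\<And>U. openin (MZ_topology I) U \<Longrightarrow> openin \<D> U"
    and "\<And>Q. Q \<in> \<Q> \<Longrightarrow> quasimartingale_measure I Q"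
    and "UB I \<Q>"
  shows "compactin (weak_star \<D>) (sequential_closure (weak_star \<D>) (measure ` \<Q>)) \<and>
    sequentially_compactin (weak_star \<D>) (sequential_closure (weak_star \<D>) (measure ` \<Q>)) \<and>
    sequential_closure (weak_star \<D>) (measure ` \<Q>) \<subseteq> measure ` {Q. quasimartingale_measure I Q}"
proof -
  note I = assms(1) and top = assms(2) and \<Q> = assms(7) and UB = assms(8)
  obtain C where C: "\<And>Q. Q \<in> \<Q> \<Longrightarrow> UB_constant I Q C" by (rule UB_imp_UB_constant[OF I UB]) blast
  have bq: "bounded_quasimartingale Q I C" if "Q \<in> \<Q>" for Q
    using \<Q>[OF that] C[OF that] I
    by (simp add: bounded_quasimartingale_def bounded_quasimartingale_axioms_def quasimartingale_measure_def)
  note g_cont = continuous_map_path_coordinate[OF I top stronger]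
  let ?V = "vimage_algebra (skorokhod_space I) (\<lambda>\<omega> n. path_coordinate I n \<omega>) (PiM UNIV (\<lambda>_. borel)) :: 'd path measure"
  have V_le: "sets ?V \<subseteq> sets (borel_algebra \<D>)"
  proof -
    have "(\<lambda>\<omega> n. path_coordinate I n \<omega>) \<in> measurable (borel_algebra \<D>) (PiM UNIV (\<lambda>_. borel))"
      by (rule measurable_PiM_single') (auto intro: borel_measurable_continuous_map[OF g_cont] simp: space_PiM)
    then show ?thesis by (simp add: measurable_iff_sets top)
  qed
  \<comment> \<open>The path \<sigma>-algebra is always contained in the one generated by the
    coordinates, and that in the Borel \<sigma>-algebra. If the Borel sets are contained in the path
    \<sigma>-algebra, all three coincide and the coordinates may be used for Borel measurability;
    otherwise the closure is empty.\<close>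
  show ?thesis
  proof (cases "sets (borel_algebra \<D>) \<subseteq> sets (path_algebra I)")
    case False
    then obtain A where A: "A \<in> sets (borel_algebra \<D>)" "A \<notin> sets (path_algebra I)" by blast
    have "sequential_closure (weak_star \<D>) (measure ` \<Q>) = {}"
    proof (rule sequential_closure_empty[OF A(1)])
      fix Q assume "Q \<in> \<Q>"
      then interpret bounded_quasimartingale Q I C by (rule bq)
      show "prob_space Q \<and> space Q = topspace \<D> \<and> A \<notin> sets Q"
        using A(2) prob_space_axioms space_Q sets_Q top by simp
    qed
    then show ?thesis by (simp add: sequentially_compactin_def)
  next
    case True
    have borel: "sets (borel_algebra \<D>) = sets ?V" "sets (borel_algebra \<D>) = sets (path_algebra I)"
      using True V_le path_algebra_le_coordinates[OF I, where 'd = 'd] by blast+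
    obtain c :: "nat \<Rightarrow> real" and N :: "nat \<Rightarrow> nat \<Rightarrow> nat" where
      cN: "\<And>Q :: 'd path measure. \<And>I j. bounded_quasimartingale Q I C \<Longrightarrow> tame_paths I (c j) (N j) \<in> sets Q \<Longrightarrow>
        1 - inverse (real (Suc j)) \<le> measure Q (tame_paths I (c j) (N j))"
      by (rule uniform_tightness) blast
    interpret tight_family \<D> "path_coordinate I" "\<lambda>j. tame_paths I (c j) (N j)" "\<lambda>j. inverse (real (Suc j))"
    proof
      show "continuous_map \<D> euclideanreal (path_coordinate I k)" for k by (rule g_cont)
      show "x = y" if "x \<in> topspace \<D>" "y \<in> topspace \<D>" "\<And>k. path_coordinate I k x = path_coordinate I k y" for x y
        using that unfolding top by (rule path_coordinate_separates[OF I])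
      show "sequentially_compactin \<D> (tame_paths I (c m) (N m))" for m
        by (rule sequentially_compactin_tame_paths[OF I top weaker])
      show "(\<lambda>j. inverse (real (Suc j))) \<longlonglongrightarrow> 0" by (rule LIMSEQ_inverse_real_of_nat)
    qed (use path_coordinate_range[OF I] borel top in auto)
    have sub: "\<Q> \<subseteq> tight_probabilities"
    proof
      fix Q assume Q: "Q \<in> \<Q>"
      interpret bounded_quasimartingale Q I C by (rule bq[OF Q])
      have "tame_paths I (c m) (N m) \<in> sets Q" for m using K_sets[of m] unfolding borel(2) sets_Q .
      then show "Q \<in> tight_probabilities"
        using cN[OF bq[OF Q]] prob_space_axioms sets_Q borel(2) by (simp add: tight_probabilities_def del: of_nat_Suc)
    qed
    have "\<mu> \<in> measure ` {Q. quasimartingale_measure I Q}"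
      if \<mu>: "\<mu> \<in> sequential_closure (weak_star \<D>) (measure ` \<Q>)" for \<mu>
    proof -
      from weak_star_compactness(3)[OF sub \<mu>] obtain Q Qs where Q: "prob_space Q" "sets Q = sets (borel_algebra \<D>)"
        "\<mu> = measure Q" and Qs: "\<And>n. Qs n \<in> \<Q>"
        "\<And>f. bounded_continuous \<D> f \<Longrightarrow> (\<lambda>n. \<integral>x. f x \<partial>Qs n) \<longlonglongrightarrow> (\<integral>x. f x \<partial>Q)" by blast
      have "quasimartingale_limit Q I C \<D> Qs"
        unfolding quasimartingale_limit_def quasimartingale_limit_axioms_def
        using Q(1,2) I borel(2) top stronger bq[OF Qs(1)] Qs(2) by blast
      then have "quasimartingale_measure I Q" by (rule quasimartingale_limit.quasimartingale)
      then show ?thesis using Q(3) by blast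
    qed
    then show ?thesis using weak_star_compactness(1,2)[OF sub] by blast
  qed
qed

end
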